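(* Let $\Omega\subset\mathbb{R}^n$ be a bounded open set, $V=H^1_0(\Omega)$ with dual $V'$, and $g\in L^2(\Omega)$. Let $T>0$, $f\in L^2(0,T;V')$ and $u_0\in L^2(\Omega)$. Let $a:\mathbb{R}\to\mathbb{R}$ be a continuous function for which there exist constants $m,M$ with $0<m\le a(\epsilon)\le M$ for all $\epsilon\in\mathbb{R}$. Then for every fixed $r\in[0,\mathrm{diam}(\Omega)]$ there exists a function $u$ such that $$u\in L^2(0,T;V),\qquad u_t\in L^2(0,T;V'),\qquad u(0,\cdot)=u_0\ \text{ in }\Omega,$$ and, for all $\phi\in H^1_0(\Omega)$, $$\frac{d}{dt}(u,\phi)+\int_\Omega a(l_r(u(t)))\,\nabla u\cdot\nabla\phi\,dx=\langle f,\phi\rangle\qquad\text{in } \mathcal{D}'(0,T).$$ Moreover, if $a$ is locally Lipschitz, i.e. for every $c$ there exists $\gamma_c$ such that $|a(\epsilon)-a(\epsilon')|\le\gamma_c|\epsilon-\epsilon'|$ for all $\epsilon,\epsilon'\in[-c,c]$, then the function $u$ with these properties is unique.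
   Context: For $r\ge 0$ and $v\in L^2(\Omega)$, $l_r(v)$ is the function on $\Omega$ given by $l_r(v)(x)=\int_{\Omega\cap B(x,r)}g(y)v(y)\,dy$, where $B(x,r)$ is the closed ball of $\mathbb{R}^n$ with center $x$ and radius $r$; for a time-dependent $u$, $l_r(u(t))(x)=\int_{\Omega\cap B(x,r)}g(y)u(t,y)\,dy$. $(\cdot,\cdot)$ is the $L^2(\Omega)$ scalar product and $\langle\cdot,\cdot\rangle$ the duality bracket between $V'$ and $V$. The initial condition makes sense because $u\in L^2(0,T;V)$ and $u_t\in L^2(0,T;V')$ imply $u\in C([0,T];L^2(\Omega))$. *)

theory Defs
  imports "HOL-Analysis.Analysis"
begin

text \<open>
  Elements of \<open>L\<^sup>2(\<Omega>)\<close> and of the Sobolev spaces are represented by functions on the whole space,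
  of which only the restriction to \<open>\<Omega>\<close> matters. Nothing is quotiented, so the norms below are
  seminorms, and equality of elements is equality almost everywhere on \<open>\<Omega>\<close>.
\<close>

definition L2_space :: "'a::euclidean_space set \<Rightarrow> ('a \<Rightarrow> real) set" where
  "L2_space \<Omega> = {v. v \<in> borel_measurable (lebesgue_on \<Omega>) \<and>
                    integrable (lebesgue_on \<Omega>) (\<lambda>x. (v x)\<^sup>2)}"

definition L2_inner :: "'a::euclidean_space set \<Rightarrow> ('a \<Rightarrow> real) \<Rightarrow> ('a \<Rightarrow> real) \<Rightarrow> real" where
  "L2_inner \<Omega> v w = (LINT x|lebesgue_on \<Omega>. v x * w x)"

definition L2_norm :: "'a::euclidean_space set \<Rightarrow> ('a \<Rightarrow> real) \<Rightarrow> real" where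
  "L2_norm \<Omega> v = sqrt (L2_inner \<Omega> v v)"

primrec Ck :: "nat \<Rightarrow> ('a::euclidean_space \<Rightarrow> real) \<Rightarrow> bool" where
  "Ck 0 \<psi> \<longleftrightarrow> continuous_on UNIV \<psi>"
| "Ck (Suc k) \<psi> \<longleftrightarrow> (\<forall>x. \<psi> differentiable (at x)) \<and>
                   (\<forall>b\<in>Basis. Ck k (\<lambda>x. frechet_derivative \<psi> (at x) b))"

definition test_functions :: "'a::euclidean_space set \<Rightarrow> ('a \<Rightarrow> real) set" where
  "test_functions \<Omega> = {\<psi>. (\<forall>k. Ck k \<psi>) \<and>
      compact (closure {x. \<psi> x \<noteq> 0}) \<and> closure {x. \<psi> x \<noteq> 0} \<subseteq> \<Omega>}"

definition weak_gradient ::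
  "'a::euclidean_space set \<Rightarrow> ('a \<Rightarrow> real) \<Rightarrow> ('a \<Rightarrow> 'a) \<Rightarrow> bool" where
  "weak_gradient \<Omega> v G \<longleftrightarrow>
     (\<forall>b\<in>Basis. (\<lambda>x. G x \<bullet> b) \<in> L2_space \<Omega>) \<and>
     (\<forall>\<psi>\<in>test_functions \<Omega>. \<forall>b\<in>Basis.
        (LINT x|lebesgue_on \<Omega>. v x * frechet_derivative \<psi> (at x) b) =
        - (LINT x|lebesgue_on \<Omega>. (G x \<bullet> b) * \<psi> x))"

definition H1_space :: "'a::euclidean_space set \<Rightarrow> ('a \<Rightarrow> real) set" where
  "H1_space \<Omega> = {v \<in> L2_space \<Omega>. \<exists>G. weak_gradient \<Omega> v G}"

text \<open>The weak gradient is unique only up to a null set; an arbitrary representative is chosen.\<close>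

definition grad :: "'a::euclidean_space set \<Rightarrow> ('a \<Rightarrow> real) \<Rightarrow> 'a \<Rightarrow> 'a" where
  "grad \<Omega> v = (SOME G. weak_gradient \<Omega> v G)"

definition H1_norm :: "'a::euclidean_space set \<Rightarrow> ('a \<Rightarrow> real) \<Rightarrow> real" where
  "H1_norm \<Omega> v = sqrt ((LINT x|lebesgue_on \<Omega>. (v x)\<^sup>2) +
                       (LINT x|lebesgue_on \<Omega>. (norm (grad \<Omega> v x))\<^sup>2))"

definition H10_space :: "'a::euclidean_space set \<Rightarrow> ('a \<Rightarrow> real) set" where
  "H10_space \<Omega> = {v \<in> H1_space \<Omega>.
      \<forall>e>0. \<exists>\<psi>\<in>test_functions \<Omega>. H1_norm \<Omega> (\<lambda>x. v x - \<psi> x) < e}"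

text \<open>
  The dual of \<open>V\<close>: a functional is applied to representatives; boundedness forces equal values on
  functions agreeing almost everywhere. Its values outside \<open>V\<close> are irrelevant.
  The bracket of \<open>F\<close> and \<open>\<phi>\<close> is the application \<open>F \<phi>\<close>.
\<close>

definition H10_dual :: "'a::euclidean_space set \<Rightarrow> (('a \<Rightarrow> real) \<Rightarrow> real) set" where
  "H10_dual \<Omega> = {F.
      (\<forall>v\<in>H10_space \<Omega>. \<forall>w\<in>H10_space \<Omega>. F (\<lambda>x. v x + w x) = F v + F w) \<and>
      (\<forall>c. \<forall>v\<in>H10_space \<Omega>. F (\<lambda>x. c * v x) = c * F v) \<and>
      (\<exists>C. \<forall>v\<in>H10_space \<Omega>. \<bar>F v\<bar> \<le> C * H1_norm \<Omega> v)}"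

definition H10_dual_norm :: "'a::euclidean_space set \<Rightarrow> (('a \<Rightarrow> real) \<Rightarrow> real) \<Rightarrow> real" where
  "H10_dual_norm \<Omega> F = Sup {\<bar>F v\<bar> | v. v \<in> H10_space \<Omega> \<and> H1_norm \<Omega> v \<le> 1}"

text \<open>
  The Bochner space \<open>L\<^sup>2(0,T;X)\<close> for a space \<open>X\<close> of real functions with seminorm \<open>N\<close>: strongly
  measurable functions (almost everywhere limits of simple functions) with square integrable norm.
  Only almost every \<open>u t\<close> is required to lie in \<open>X\<close>. The type \<open>'b\<close> is the space itself for
  \<open>X = V\<close>, and a function type for \<open>X = V'\<close>.
\<close>

definition bochner_L2 ::
  "real \<Rightarrow> ('b \<Rightarrow> real) set \<Rightarrow> (('b \<Rightarrow> real) \<Rightarrow> real) \<Rightarrow> (real \<Rightarrow> 'b \<Rightarrow> real) set" where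
  "bochner_L2 T X N = {u.
      (AE t in lebesgue_on {0<..<T}. u t \<in> X) \<and>
      (\<exists>s. (\<forall>k. simple_function (lebesgue_on {0<..<T}) (s k) \<and> s k ` {0<..<T} \<subseteq> X) \<and>
           (AE t in lebesgue_on {0<..<T}. (\<lambda>k. N (\<lambda>z. s k t z - u t z)) \<longlonglongrightarrow> 0)) \<and>
      integrable (lebesgue_on {0<..<T}) (\<lambda>t. (N (u t))\<^sup>2)}"

abbreviation L2_V :: "real \<Rightarrow> 'a::euclidean_space set \<Rightarrow> (real \<Rightarrow> 'a \<Rightarrow> real) set" where
  "L2_V T \<Omega> \<equiv> bochner_L2 T (H10_space \<Omega>) (H1_norm \<Omega>)"

abbreviation L2_V' :: "real \<Rightarrow> 'a::euclidean_space set \<Rightarrow> (real \<Rightarrow> ('a \<Rightarrow> real) \<Rightarrow> real) set" where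
  "L2_V' T \<Omega> \<equiv> bochner_L2 T (H10_dual \<Omega>) (H10_dual_norm \<Omega>)"

text \<open>
  Distributions on \<open>(0,T)\<close> are functionals on \<open>test_functions {0<..<T}\<close>: \<open>regular_distr T h\<close> is the one
  given by a locally integrable function \<open>h\<close>, and \<open>distr_deriv\<close> is the distributional derivative.
\<close>

definition regular_distr :: "real \<Rightarrow> (real \<Rightarrow> real) \<Rightarrow> (real \<Rightarrow> real) \<Rightarrow> real" where
  "regular_distr T h \<psi> = (LINT t|lebesgue_on {0<..<T}. h t * \<psi> t)"

definition distr_deriv :: "((real \<Rightarrow> real) \<Rightarrow> real) \<Rightarrow> (real \<Rightarrow> real) \<Rightarrow> real" where
  "distr_deriv D \<psi> = - D (deriv \<psi>)"

text \<open>
  \<open>u\<^sub>t = w\<close> as \<open>V'\<close>-valued distributions, where \<open>V\<close> is embedded in \<open>V'\<close> through the \<open>L\<^sup>2\<close> scalar product.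
  The two Bochner integrals to be compared are elements of \<open>V'\<close>, i.e. equal iff they agree at
  every \<open>\<phi>\<close>, and evaluation at \<open>\<phi>\<close> commutes with the integral.
\<close>

definition weak_time_deriv ::
  "real \<Rightarrow> 'a::euclidean_space set \<Rightarrow> (real \<Rightarrow> 'a \<Rightarrow> real) \<Rightarrow>
   (real \<Rightarrow> ('a \<Rightarrow> real) \<Rightarrow> real) \<Rightarrow> bool" where
  "weak_time_deriv T \<Omega> u w \<longleftrightarrow>
     (\<forall>\<psi>\<in>test_functions {0<..<T}. \<forall>\<phi>\<in>H10_space \<Omega>.
        distr_deriv (regular_distr T (\<lambda>t. L2_inner \<Omega> (u t) \<phi>)) \<psi> =
        regular_distr T (\<lambda>t. w t \<phi>) \<psi>)"

definition C_L2 :: "real \<Rightarrow> 'a::euclidean_space set \<Rightarrow> (real \<Rightarrow> 'a \<Rightarrow> real) set" where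
  "C_L2 T \<Omega> = {w. \<forall>t\<in>{0..T}. w t \<in> L2_space \<Omega> \<and>
      ((\<lambda>s. L2_norm \<Omega> (\<lambda>x. w s x - w t x)) \<longlongrightarrow> 0) (at t within {0..T})}"

text \<open>
  As \<open>u\<close> is determined only for almost every \<open>t\<close>, the initial condition refers to its representative
  in \<open>C([0,T];L\<^sup>2(\<Omega>))\<close>.
\<close>

definition initial_value ::
  "real \<Rightarrow> 'a::euclidean_space set \<Rightarrow> (real \<Rightarrow> 'a \<Rightarrow> real) \<Rightarrow> ('a \<Rightarrow> real) \<Rightarrow> bool" where
  "initial_value T \<Omega> u u0 \<longleftrightarrow>
     (\<exists>w\<in>C_L2 T \<Omega>.
        (AE t in lebesgue_on {0<..<T}. AE x in lebesgue_on \<Omega>. w t x = u t x) \<and>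
        (AE x in lebesgue_on \<Omega>. w 0 x = u0 x))"

definition l_op ::
  "'a::euclidean_space set \<Rightarrow> ('a \<Rightarrow> real) \<Rightarrow> real \<Rightarrow> ('a \<Rightarrow> real) \<Rightarrow> 'a \<Rightarrow> real" where
  "l_op \<Omega> g r v x = (LINT y:\<Omega> \<inter> cball x r|lebesgue. g y * v y)"

text \<open>
  In the equation all three functions of \<open>t\<close> are automatically integrable on \<open>(0,T)\<close> when
  \<open>u\<close> and \<open>f\<close> lie in the respective Bochner spaces and \<open>a\<close> is continuous and bounded.
\<close>

definition is_solution ::
  "'a::euclidean_space set \<Rightarrow> real \<Rightarrow> (real \<Rightarrow> real) \<Rightarrow> ('a \<Rightarrow> real) \<Rightarrow> real \<Rightarrow>
   (real \<Rightarrow> ('a \<Rightarrow> real) \<Rightarrow> real) \<Rightarrow> ('a \<Rightarrow> real) \<Rightarrow> (real \<Rightarrow> 'a \<Rightarrow> real) \<Rightarrow> bool" where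
  "is_solution \<Omega> T a g r f u0 u \<longleftrightarrow>
     u \<in> L2_V T \<Omega> \<and>
     (\<exists>w\<in>L2_V' T \<Omega>. weak_time_deriv T \<Omega> u w) \<and>
     initial_value T \<Omega> u u0 \<and>
     (\<forall>\<phi>\<in>H10_space \<Omega>. \<forall>\<psi>\<in>test_functions {0<..<T}.
        distr_deriv (regular_distr T (\<lambda>t. L2_inner \<Omega> (u t) \<phi>)) \<psi> +
        regular_distr T (\<lambda>t. LINT x|lebesgue_on \<Omega>.
            a (l_op \<Omega> g r (u t) x) * (grad \<Omega> (u t) x \<bullet> grad \<Omega> \<phi> x)) \<psi> =
        regular_distr T (\<lambda>t. f t \<phi>) \<psi>)"

end

theory Submission
  imports Defs "HOL-Library.Function_Algebras" "HOL-Complex_Analysis.Great_Picard"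
begin

text \<open>
  Existence is proved by time discretization with a lagged coefficient: on each time step a linear elliptic
  problem with coefficient \<open>a(l\<^sub>r(u))\<close>, \<open>u\<close> taken from the previous step, is solved by the Riesz theorem. As
  \<open>l\<^sub>r(u(t))(x)\<close> is the scalar product of \<open>u(t)\<close> with a function depending continuously on \<open>x\<close>, the
  approximations of \<open>l\<^sub>r(u)\<close> are asymptotically equicontinuous in \<open>(t,x)\<close> and converge pointwise along a
  subsequence; no compact embedding is needed. With the limit of the coefficients frozen the
  equation is linear, hence satisfied in the limit by convex combinations of the approximations, and these
  can be chosen to converge strongly in \<open>L\<^sup>2(0,T;V)\<close>.

  Continuity in time and uniqueness rest on the energy identity for functions with
  derivative in \<open>L\<^sup>2(0,T;V')\<close>, obtained by regularizing with the resolvents of the operator of \<open>V\<close>. For two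
  solutions \<open>u\<close> and \<open>v\<close> the coefficients differ by at most a constant times the \<open>L\<^sup>2\<close> norm of \<open>u(t) - v(t)\<close>,
  uniformly in \<open>x\<close>, and the Gronwall lemma applies.
\<close>

section \<open>Semi-inner product spaces\<close>

text \<open>The obstacle is the product of the coefficient with the gradient: the a priori bounds
  control gradients only weakly, so the coefficient has to converge strongly, here pointwise and
  boundedly. Lagging it by one step leaves each elliptic problem linear with a symmetric form, which
  is why the Riesz theorem suffices. The price is the difference of two consecutive time values; it
  tends to zero weakly in \<open>L2_space\<close>, and a scalar product with a fixed function
  notices no more than that.

  Since nothing is quotiented, the Hilbert space arguments are made for semi-inner products on
  subspaces of function spaces, and limits are determined up to null elements only. This is why
  functions receive a pointwise vector space structure.

  Resolvents regularize up to both ends of the time interval: they map functionals on V boundedly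
  into V, so a path that is merely continuous as a functional on V becomes a continuous path in V,
  and their self-adjointness supplies the product rule.\<close>

instantiation "fun" :: (type, scaleR) scaleR
begin

definition "c *\<^sub>R f = (\<lambda>x. c *\<^sub>R f x)"

instance ..

end

lemma scaleR_fun_apply [simp]: "(c *\<^sub>R f) x = c *\<^sub>R f x"
  by (simp add: scaleR_fun_def)

lemma minus_fun_apply [simp]: "((f :: 'a \<Rightarrow> 'b::ab_group_add) - g) x = f x - g x"
  by (simp add: fun_diff_def)

instance "fun" :: (type, real_vector) real_vector
  by standard (auto simp: fun_eq_iff scaleR_add_right scaleR_add_left)

text \<open>The vectors form a subset \<open>X\<close> of a larger type because the spaces in
  question are sets of functions. \<open>ip x x = 0\<close> does not force \<open>x = 0\<close>:
  functions equal almost everywhere stay distinct.\<close>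

locale semi_inner =
  fixes X :: "'v::real_vector set" and ip :: "'v \<Rightarrow> 'v \<Rightarrow> real"
  assumes subspace: "subspace X"
    and add_left: "\<And>x y z. \<lbrakk>x \<in> X; y \<in> X; z \<in> X\<rbrakk> \<Longrightarrow> ip (x + y) z = ip x z + ip y z"
    and scale_left: "\<And>c x z. \<lbrakk>x \<in> X; z \<in> X\<rbrakk> \<Longrightarrow> ip (c *\<^sub>R x) z = c * ip x z"
    and sym: "\<And>x y. \<lbrakk>x \<in> X; y \<in> X\<rbrakk> \<Longrightarrow> ip x y = ip y x"
    and pos: "\<And>x. x \<in> X \<Longrightarrow> 0 \<le> ip x x"
begin

definition nrm :: "'v \<Rightarrow> real" where "nrm x = sqrt (ip x x)"

lemma mem_add [simp]: "x \<in> X \<Longrightarrow> y \<in> X \<Longrightarrow> x + y \<in> X"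
  and mem_diff [simp]: "x \<in> X \<Longrightarrow> y \<in> X \<Longrightarrow> x - y \<in> X"
  and mem_scale [simp]: "x \<in> X \<Longrightarrow> c *\<^sub>R x \<in> X"
  and mem_zero [simp]: "0 \<in> X"
  using subspace by (auto simp: subspace_add subspace_diff subspace_scale subspace_0)

lemma add_right: "\<lbrakk>x \<in> X; y \<in> X; z \<in> X\<rbrakk> \<Longrightarrow> ip z (x + y) = ip z x + ip z y"
  by (metis add_left mem_add sym)

lemma scale_right: "\<lbrakk>x \<in> X; z \<in> X\<rbrakk> \<Longrightarrow> ip z (c *\<^sub>R x) = c * ip z x"
  by (metis scale_left mem_scale sym)

lemma diff_left: "\<lbrakk>x \<in> X; y \<in> X; z \<in> X\<rbrakk> \<Longrightarrow> ip (x - y) z = ip x z - ip y z"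
  by (metis add_diff_cancel add_left diff_add_cancel mem_diff)

lemma diff_right: "\<lbrakk>x \<in> X; y \<in> X; z \<in> X\<rbrakk> \<Longrightarrow> ip z (x - y) = ip z x - ip z y"
  by (metis diff_left mem_diff sym)

lemmas ip_simps = add_left add_right scale_left scale_right diff_left diff_right

lemma nrm_ge_0 [simp]: "x \<in> X \<Longrightarrow> 0 \<le> nrm x"
  by (simp add: nrm_def pos)

lemma nrm_sq: "x \<in> X \<Longrightarrow> (nrm x)\<^sup>2 = ip x x"
  by (simp add: nrm_def pos)

lemma nrm_0 [simp]: "nrm 0 = 0"
  using scale_left[of 0 0 0] by (simp add: nrm_def)

lemma Cauchy_Schwarz:
  assumes x: "x \<in> X" and y: "y \<in> X" shows "\<bar>ip x y\<bar> \<le> nrm x * nrm y"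
proof -
  have q: "0 \<le> ip x x + 2 * t * ip x y + t\<^sup>2 * ip y y" for t
    using pos[of "x + t *\<^sub>R y"] x y sym[of x y]
    by (simp add: ip_simps power2_eq_square algebra_simps)
  have "(ip x y)\<^sup>2 \<le> ip x x * ip y y"
  proof (cases "ip y y = 0")
    case True
    have "ip x y = 0"
    proof (rule ccontr)
      assume "ip x y \<noteq> 0"
      \<comment> \<open>The quadratic in \<open>q\<close> is affine in \<open>t\<close> here, and at
        the chosen \<open>t\<close> its value is -1.\<close>
      then show False
        using q[of "- (ip x x + 1) / (2 * ip x y)"] True by (simp add: field_simps)
    qed
    then show ?thesis using True by simp
  next
    case False
    then have "ip y y > 0" using pos[OF y] by simp
    then show ?thesis
      using q[of "- ip x y / ip y y"] by (simp add: field_simps power2_eq_square)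
  qed
  then show ?thesis
    by (metis nrm_def real_sqrt_abs real_sqrt_le_mono real_sqrt_mult)
qed

lemma nrm_triangle: "\<lbrakk>x \<in> X; y \<in> X\<rbrakk> \<Longrightarrow> nrm (x + y) \<le> nrm x + nrm y"
proof -
  assume xy: "x \<in> X" "y \<in> X"
  have "(nrm (x + y))\<^sup>2 = (nrm x)\<^sup>2 + 2 * ip x y + (nrm y)\<^sup>2"
    using xy sym[of x y] by (simp add: nrm_sq ip_simps)
  also have "\<dots> \<le> (nrm x + nrm y)\<^sup>2"
    using Cauchy_Schwarz[OF xy] by (simp add: power2_sum)
  finally show ?thesis
    using xy by (meson add_nonneg_nonneg nrm_ge_0 power2_le_imp_le)
qed

lemma nrm_scale:
  assumes "x \<in> X" shows "nrm (c *\<^sub>R x) = \<bar>c\<bar> * nrm x"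
proof -
  have "ip (c *\<^sub>R x) (c *\<^sub>R x) = c\<^sup>2 * ip x x"
    using assms by (simp add: scale_left scale_right power2_eq_square)
  then show ?thesis by (simp add: nrm_def real_sqrt_mult)
qed

lemma nrm_diff_commute: "\<lbrakk>x \<in> X; y \<in> X\<rbrakk> \<Longrightarrow> nrm (x - y) = nrm (y - x)"
  using nrm_scale[of "x - y" "-1"] by simp

lemma nrm_triangle_diff: "\<lbrakk>x \<in> X; y \<in> X; z \<in> X\<rbrakk> \<Longrightarrow> nrm (x - z) \<le> nrm (x - y) + nrm (y - z)"
  using nrm_triangle[of "x - y" "y - z"] by simp

lemma nrm_diff_le: "\<lbrakk>x \<in> X; y \<in> X\<rbrakk> \<Longrightarrow> nrm (x - y) \<le> nrm x + nrm y"
  using nrm_triangle[of x "- y"] nrm_scale[of y "-1"] mem_scale[of y "-1"] by simp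

lemma nrm_triangle_sub: "\<lbrakk>x \<in> X; y \<in> X\<rbrakk> \<Longrightarrow> \<bar>nrm x - nrm y\<bar> \<le> nrm (x - y)"
  using nrm_triangle[of "x - y" y] nrm_triangle[of "y - x" x] nrm_diff_commute[of x y] by simp

lemma parallelogram:
  "\<lbrakk>x \<in> X; y \<in> X\<rbrakk> \<Longrightarrow> (nrm (x - y))\<^sup>2 = 2 * (nrm x)\<^sup>2 + 2 * (nrm y)\<^sup>2 - 4 * (nrm ((1/2) *\<^sub>R (x + y)))\<^sup>2"
  using sym[of x y] by (simp add: nrm_sq ip_simps field_simps)

lemma ip_zero_of_nrm: "\<lbrakk>x \<in> X; y \<in> X; nrm x = 0\<rbrakk> \<Longrightarrow> ip x y = 0"
  using Cauchy_Schwarz[of x y] by simp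

lemma nrm_le_add: "\<lbrakk>x \<in> X; y \<in> X\<rbrakk> \<Longrightarrow> nrm x \<le> nrm (x - y) + nrm y"
  using nrm_triangle[of "x - y" y] by simp

lemma tendsto_ip_left:
  assumes "(\<lambda>n. nrm (s n - x)) \<longlonglongrightarrow> 0" "\<And>n. s n \<in> X" "x \<in> X" "y \<in> X"
  shows "(\<lambda>n. ip (s n) y) \<longlonglongrightarrow> ip x y"
proof -
  have 0: "(\<lambda>n. nrm (s n - x) * nrm y) \<longlonglongrightarrow> 0"
    using tendsto_mult_left_zero[OF assms(1)] .
  have 1: "norm (ip (s n) y - ip x y) \<le> norm (nrm (s n - x) * nrm y) * 1" for n
    using Cauchy_Schwarz[of "s n - x" y] assms by (simp add: diff_left)
  have "(\<lambda>n. ip (s n) y - ip x y) \<longlonglongrightarrow> 0"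
    by (rule tendsto_0_le[OF 0, where K=1]) (use 1 in \<open>auto intro!: always_eventually\<close>)
  then show ?thesis by (simp add: LIM_zero_iff)
qed

lemma tendsto_nrm:
  assumes "(\<lambda>n. nrm (s n - x)) \<longlonglongrightarrow> 0" "\<And>n. s n \<in> X" "x \<in> X"
  shows "(\<lambda>n. nrm (s n)) \<longlonglongrightarrow> nrm x"
proof -
  have "(\<lambda>n. nrm (s n) - nrm x) \<longlonglongrightarrow> 0"
    by (rule tendsto_0_le[where K=1, OF assms(1)])
      (use assms nrm_triangle_sub in \<open>auto intro!: always_eventually\<close>)
  then show ?thesis by (simp add: LIM_zero_iff)
qed

lemma convex_X: "convex X"
  using subspace by (rule subspace_imp_convex)

lemma hull_tail_mem:
  fixes xs :: "nat \<Rightarrow> 'v"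
  assumes "\<And>k. xs k \<in> X" "v \<in> convex hull (xs ` {n..})" shows "v \<in> X"
proof -
  have "convex hull (xs ` {n..}) \<subseteq> X"
    by (rule hull_minimal) (use assms(1) convex_X in auto)
  then show ?thesis using assms(2) by blast
qed

lemma hull_bounded:
  assumes "\<And>x. x \<in> S \<Longrightarrow> x \<in> X \<and> nrm x \<le> C" "v \<in> convex hull S" shows "nrm v \<le> C"
proof -
  have "convex {x \<in> X. nrm x \<le> C}"
  proof (rule convexI)
    fix x y and u v :: real
    assume xy: "x \<in> {x \<in> X. nrm x \<le> C}" "y \<in> {x \<in> X. nrm x \<le> C}" "0 \<le> u" "0 \<le> v" "u + v = 1"
    have "nrm (u *\<^sub>R x + v *\<^sub>R y) \<le> u * nrm x + v * nrm y"
      using nrm_triangle[of "u *\<^sub>R x" "v *\<^sub>R y"] xy by (simp add: nrm_scale)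
    also have "\<dots> \<le> C"
      by (rule convex_bound_le) (use xy in auto)
    finally show "u *\<^sub>R x + v *\<^sub>R y \<in> {x \<in> X. nrm x \<le> C}" using xy by simp
  qed
  then have "convex hull S \<subseteq> {x \<in> X. nrm x \<le> C}"
    by (intro hull_minimal) (use assms(1) in auto)
  then show ?thesis using assms(2) by auto
qed

text \<open>The strip of all points of \<open>X\<close> at which \<open>p\<close> is within
  \<open>e\<close> of \<open>l\<close> is convex and contains a tail of the sequence, hence also the
  hulls of the later tails. Linearity of \<open>p\<close> is asked on \<open>X\<close> only, which
  admits functionals built from integrals and from evaluation at one time.\<close>

lemma convex_combination_limit:
  fixes xs :: "nat \<Rightarrow> 'v"
  assumes xs: "\<And>k. xs k \<in> X"
    and lin: "\<And>x y. \<lbrakk>x \<in> X; y \<in> X\<rbrakk> \<Longrightarrow> p (x + y) = p x + p y"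
      "\<And>c x. x \<in> X \<Longrightarrow> p (c *\<^sub>R x) = c * p x"
    and lim: "(\<lambda>k. p (xs k)) \<longlonglongrightarrow> (l::real)"
    and v: "\<And>n. v n \<in> convex hull (xs ` {n..})"
  shows "(\<lambda>n. p (v n)) \<longlonglongrightarrow> l"
proof (rule LIMSEQ_I)
  fix e :: real assume "e > 0"
  then obtain N where N: "\<And>n. n \<ge> N \<Longrightarrow> \<bar>p (xs n) - l\<bar> < e"
    using LIMSEQ_D[OF lim] by auto
  have cv: "convex {x \<in> X. p x \<in> ball l e}"
  proof (rule convexI)
    fix x y and u v :: real
    assume xy: "x \<in> {x \<in> X. p x \<in> ball l e}" "y \<in> {x \<in> X. p x \<in> ball l e}" "0 \<le> u" "0 \<le> v" "u + v = 1"
    have "u *\<^sub>R p x + v *\<^sub>R p y \<in> ball l e"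
      by (rule convexD[OF convex_ball]) (use xy in auto)
    then show "u *\<^sub>R x + v *\<^sub>R y \<in> {x \<in> X. p x \<in> ball l e}" using xy by (simp add: lin)
  qed
  have "norm (p (v n) - l) < e" if "n \<ge> N" for n
  proof -
    have "convex hull (xs ` {n..}) \<subseteq> {x \<in> X. p x \<in> ball l e}"
      by (rule hull_minimal) (use N that xs cv in \<open>auto simp: dist_real_def abs_minus_commute\<close>)
    then show ?thesis using v[of n] by (auto simp: dist_real_def abs_minus_commute)
  qed
  then show "\<exists>N. \<forall>n\<ge>N. norm (p (v n) - l) < e" by blast
qed

text \<open>
  A Banach--Saks/Mazur argument without completeness: nearly minimal elements of the convex hulls
  of the tails form a Cauchy sequence, by the parallelogram law.
\<close>

lemma mazur_Cauchy:
  fixes xs :: "nat \<Rightarrow> 'v"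
  assumes xs: "\<And>k. xs k \<in> X" and bd: "\<And>k. nrm (xs k) \<le> C"
  obtains v where "\<And>n. v n \<in> convex hull (xs ` {n..})"
    and "\<And>e. e > 0 \<Longrightarrow> \<exists>N. \<forall>m\<ge>N. \<forall>n\<ge>N. nrm (v m - v n) < e"
proof -
  define K where "K n = convex hull (xs ` {n..})" for n
  define d where "d n = Inf (nrm ` K n)" for n
  have KX: "K n \<subseteq> X" for n
    using hull_tail_mem[OF xs] by (auto simp: K_def)
  have Kne: "xs n \<in> K n" for n
    unfolding K_def by (rule hull_inc) auto
  have bdd: "bdd_below (nrm ` K n)" for n
    by (rule bdd_belowI[of _ 0]) (auto dest!: subsetD[OF KX])
  have Kmono: "K m \<subseteq> K n" if "n \<le> m" for m n
    unfolding K_def by (rule hull_mono) (use that in auto)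
  have dmono: "d n \<le> d m" if "n \<le> m" for m n
    unfolding d_def by (rule cInf_superset_mono) (use Kne bdd Kmono[OF that] in auto)
  have d0: "0 \<le> d n" for n
    unfolding d_def by (rule cInf_greatest) (use Kne in \<open>auto dest!: subsetD[OF KX]\<close>)
  have dC: "d n \<le> C" for n
    unfolding d_def by (rule cInf_lower2[of "nrm (xs n)"]) (use Kne bd bdd in auto)
  have "\<exists>y\<in>K n. nrm y < d n + 1 / real (Suc n)" for n
    using cInf_lessD[of "nrm ` K n" "d n + 1 / real (Suc n)"] Kne by (auto simp: d_def)
  then obtain v where vK: "\<And>n. v n \<in> K n" and vd: "\<And>n. nrm (v n) < d n + 1 / real (Suc n)"
    by metis
  have vX: "v n \<in> X" for n using vK KX by blast
  have "convergent d"
    using Bseq_mono_convergent[of d] dmono BseqI'[of d C] d0 dC by auto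
  then have lim: "d \<longlonglongrightarrow> lim d" by (simp add: convergent_LIMSEQ_iff)
  have inv: "(\<lambda>n. 1 / real (Suc n)) \<longlonglongrightarrow> 0"
    using LIMSEQ_inverse_real_of_nat unfolding inverse_eq_divide .
  have E: "(\<lambda>n. (d n + 1 / real (Suc n))\<^sup>2) \<longlonglongrightarrow> (lim d)\<^sup>2"
    using tendsto_power[OF tendsto_add[OF lim inv], of 2] by simp
  have main: "\<exists>N. \<forall>m\<ge>N. \<forall>n\<ge>N. nrm (v m - v n) < e" if "e > 0" for e
  proof -
    \<comment> \<open>The parallelogram law below has weights 2, 2 and 4, so three errors of this
      size add up to the square of e.\<close>
    have "e\<^sup>2 / 8 > 0" using that by simp
    then obtain N1 where N1: "\<And>n. n \<ge> N1 \<Longrightarrow> \<bar>(d n + 1 / real (Suc n))\<^sup>2 - (lim d)\<^sup>2\<bar> < e\<^sup>2 / 8"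
      using LIMSEQ_D[OF E] unfolding real_norm_def by blast
    obtain N2 where N2: "\<And>n. n \<ge> N2 \<Longrightarrow> \<bar>(d n)\<^sup>2 - (lim d)\<^sup>2\<bar> < e\<^sup>2 / 8"
      using LIMSEQ_D[OF tendsto_power[OF lim, of 2]] \<open>e\<^sup>2 / 8 > 0\<close> unfolding real_norm_def by blast
    have "nrm (v m - v n) < e" if mn: "m \<ge> max N1 N2" "n \<ge> max N1 N2" for m n
    proof -
      \<comment> \<open>Both points lie in the hull of the larger tail, so their midpoint does too
        and has norm at least \<open>d k\<close>.\<close>
      define k where "k = min m n"
      have "(1/2) *\<^sub>R (v m + v n) \<in> K k"
        using convexD[OF convex_convex_hull[of "xs ` {k..}"], of "v m" "v n" "1/2" "1/2"]
          vK[of m] vK[of n] Kmono[of k m] Kmono[of k n]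
        by (auto simp: K_def k_def scaleR_add_right)
      then have "d k \<le> nrm ((1/2) *\<^sub>R (v m + v n))"
        unfolding d_def by (intro cInf_lower bdd) auto
      then have 1: "(d k)\<^sup>2 \<le> (nrm ((1/2) *\<^sub>R (v m + v n)))\<^sup>2"
        by (rule power_mono[OF _ d0])
      have 2: "(nrm (v j))\<^sup>2 \<le> (d j + 1 / real (Suc j))\<^sup>2" for j
        by (rule power_mono) (use vd[of j] vX nrm_ge_0 in \<open>auto intro: less_imp_le\<close>)
      have k: "k \<ge> N2" using mn by (auto simp: k_def)
      have "(nrm (v m - v n))\<^sup>2 < e\<^sup>2"
        using parallelogram[OF vX vX, of m n] 1 2[of m] 2[of n] N1[of m] N1[of n] N2[OF k] mn
        unfolding abs_less_iff by simp
      then show ?thesis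
        by (rule power_less_imp_less_base) (use that \<open>e > 0\<close> in auto)
    qed
    then show ?thesis by blast
  qed
  show ?thesis
    by (rule that[of v]) (use vK main in \<open>auto simp: K_def\<close>)
qed

end

section \<open>Complete spaces: weak limits, the Riesz theorem, equivalent forms\<close>

locale semi_hilbert = semi_inner X ip for X :: "'v::real_vector set" and ip +
  assumes complete: "\<And>s. \<lbrakk>\<And>n. s n \<in> X; \<And>e. e > 0 \<Longrightarrow> \<exists>N. \<forall>m\<ge>N. \<forall>n\<ge>N. nrm (s m - s n) < e\<rbrakk>
    \<Longrightarrow> \<exists>x\<in>X. (\<lambda>n. nrm (s n - x)) \<longlonglongrightarrow> 0"
begin

text \<open>The strong limit of the Cauchy convex combinations is the candidate. No subsequence is
  extracted; the conclusion concerns just those \<open>\<phi>\<close> for which the scalar products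
  converge along the given sequence.\<close>

lemma weak_limit:
  fixes xs :: "nat \<Rightarrow> 'v"
  assumes xs: "\<And>k. xs k \<in> X" and bd: "\<And>k. nrm (xs k) \<le> C"
  obtains x where "x \<in> X" "\<And>\<phi> l. \<lbrakk>\<phi> \<in> X; (\<lambda>k. ip (xs k) \<phi>) \<longlonglongrightarrow> l\<rbrakk> \<Longrightarrow> ip x \<phi> = l"
proof -
  obtain v where v: "\<And>n. v n \<in> convex hull (xs ` {n..})"
    and c: "\<And>e. e > 0 \<Longrightarrow> \<exists>N. \<forall>m\<ge>N. \<forall>n\<ge>N. nrm (v m - v n) < e"
    by (rule mazur_Cauchy[OF xs bd], rule that)
  have vX: "v n \<in> X" for n using hull_tail_mem[OF xs v] .
  obtain x where x: "x \<in> X" "(\<lambda>n. nrm (v n - x)) \<longlonglongrightarrow> 0"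
    using complete[of v, OF vX c] by auto
  show ?thesis
  proof (rule that[OF x(1)])
    fix \<phi> l assume \<phi>: "\<phi> \<in> X" and l: "(\<lambda>k. ip (xs k) \<phi>) \<longlonglongrightarrow> l"
    have "(\<lambda>n. ip (v n) \<phi>) \<longlonglongrightarrow> l"
      by (rule convex_combination_limit[where p="\<lambda>x. ip x \<phi>", OF xs _ _ l v]) (use \<phi> in \<open>auto simp: ip_simps\<close>)
    moreover have "(\<lambda>n. ip (v n) \<phi>) \<longlonglongrightarrow> ip x \<phi>"
      by (rule tendsto_ip_left[OF x(2) vX x(1) \<phi>])
    ultimately show "ip x \<phi> = l" by (rule LIMSEQ_unique[symmetric])
  qed
qed

text \<open>The representing vector minimizes the functional \<open>J\<close>. A minimizing sequence
  is Cauchy by the parallelogram law, and the vanishing of the first variation at the minimum is the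
  claim.\<close>

theorem Riesz:
  assumes lin: "\<And>x y. \<lbrakk>x \<in> X; y \<in> X\<rbrakk> \<Longrightarrow> F (x + y) = F x + F y"
      "\<And>c x. x \<in> X \<Longrightarrow> F (c *\<^sub>R x) = c * F x"
    and bd: "\<And>x. x \<in> X \<Longrightarrow> \<bar>F x\<bar> \<le> C * nrm x"
  obtains u where "u \<in> X" "\<And>x. x \<in> X \<Longrightarrow> ip u x = F x"
proof -
  define J where "J x = (nrm x)\<^sup>2 - 2 * F x" for x
  define d where "d = Inf (J ` X)"
  have "- C\<^sup>2 \<le> J x" if "x \<in> X" for x
  proof -
    have "0 \<le> (nrm x - C)\<^sup>2" by simp
    then show ?thesis using bd[OF that] unfolding J_def by (simp add: power2_diff abs_le_iff algebra_simps)
  qed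
  then have bdd: "bdd_below (J ` X)" by (intro bdd_belowI[of _ "- C\<^sup>2"]) auto
  have dle: "d \<le> J x" if "x \<in> X" for x unfolding d_def by (rule cInf_lower[OF _ bdd]) (use that in auto)
  have "\<exists>y\<in>X. J y < d + 1 / real (Suc n)" for n
  proof -
    have "J ` X \<noteq> {}" using mem_zero by blast
    then show ?thesis
      using cInf_lessD[of "J ` X" "d + 1 / real (Suc n)"] by (auto simp: d_def)
  qed
  then obtain s where sX: "\<And>n. s n \<in> X" and sJ: "\<And>n. J (s n) < d + 1 / real (Suc n)"
    by metis
  \<comment> \<open>The linear part of \<open>J\<close> cancels in the parallelogram law, and
    \<open>J\<close> at the midpoint is at least \<open>d\<close>.\<close>
  have par: "(nrm (x - y))\<^sup>2 \<le> 2 * (J x - d) + 2 * (J y - d)" if "x \<in> X" "y \<in> X" for x y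
    using parallelogram[OF that] dle[of "(1/2) *\<^sub>R (x + y)"] that
    by (simp add: J_def lin algebra_simps)
  have "\<exists>N. \<forall>m\<ge>N. \<forall>n\<ge>N. nrm (s m - s n) < e" if "e > 0" for e
  proof -
    have "e\<^sup>2 / 4 > 0" using that by simp
    then obtain N where N: "1 / real (Suc N) < e\<^sup>2 / 4"
      using nat_approx_posE by blast
    have "nrm (s m - s n) < e" if "m \<ge> N" "n \<ge> N" for m n
    proof -
      have le: "1 / real (Suc k) \<le> 1 / real (Suc N)" if "k \<ge> N" for k
        using that by (simp add: frac_le)
      have Js: "J (s k) - d < e\<^sup>2 / 4" if "k \<ge> N" for k
        using sJ[of k] N le[OF that] by linarith
      have "(nrm (s m - s n))\<^sup>2 < e\<^sup>2"
        using par[OF sX sX, of m n] Js[OF \<open>m \<ge> N\<close>] Js[OF \<open>n \<ge> N\<close>] by argo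
      then show ?thesis by (rule power_less_imp_less_base) (use \<open>e > 0\<close> in auto)
    qed
    then show ?thesis by blast
  qed
  then obtain u where u: "u \<in> X" "(\<lambda>n. nrm (s n - u)) \<longlonglongrightarrow> 0"
    using complete[of s, OF sX] by auto
  have "(\<lambda>n. F (s n) - F u) \<longlonglongrightarrow> 0"
  proof (rule tendsto_0_le[where K=C, OF u(2)], intro always_eventually allI)
    fix n
    have "F (s n) - F u = F (s n - u)" using lin(1)[of "s n - u" u] sX u by simp
    then show "norm (F (s n) - F u) \<le> norm (nrm (s n - u)) * C"
      using bd[of "s n - u"] sX u by (simp add: mult.commute)
  qed
  then have "(\<lambda>n. F (s n)) \<longlonglongrightarrow> F u" by (simp add: LIM_zero_iff)
  then have "(\<lambda>n. J (s n)) \<longlonglongrightarrow> J u"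
    unfolding J_def by (intro tendsto_intros tendsto_nrm[OF u(2) sX u(1)])
  moreover have "(\<lambda>n. d + 1 / real (Suc n)) \<longlonglongrightarrow> d + 0"
    using LIMSEQ_inverse_real_of_nat by (intro tendsto_intros) (simp add: inverse_eq_divide)
  ultimately have Ju: "J u \<le> d"
    by (intro tendsto_le[OF _ \<open>(\<lambda>n. d + 1 / real (Suc n)) \<longlonglongrightarrow> d + 0\<close>[simplified] \<open>(\<lambda>n. J (s n)) \<longlonglongrightarrow> J u\<close>])
      (use sJ in \<open>auto intro!: always_eventually less_imp_le\<close>)
  have "ip u x = F x" if x: "x \<in> X" for x
  proof -
    have q: "0 \<le> 2 * t * (ip u x - F x) + t\<^sup>2 * ip x x" for t
    proof -
      have "J (u + t *\<^sub>R x) = J u + (2 * t * (ip u x - F x) + t\<^sup>2 * ip x x)"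
        using u(1) x sym[of u x] unfolding J_def by (simp add: nrm_sq lin ip_simps) (simp add: algebra_simps power2_eq_square)
      then show ?thesis
        using dle[of "u + t *\<^sub>R x"] Ju u(1) x by simp
    qed
    define b where "b = ip u x - F x"
    have c: "0 < ip x x + 1" using pos[OF x] by simp
    \<comment> \<open>The optimal step would be \<open>b / ip x x\<close>; adding 1 keeps the
      denominator positive for null vectors and still gives a negative value unless
      \<open>b = 0\<close>.\<close>
    define r where "r = b / (ip x x + 1)"
    have b: "b = r * (ip x x + 1)" using c by (simp add: r_def)
    have "0 \<le> 2 * (- r) * b + (- r)\<^sup>2 * ip x x"
      using q[of "- r"] by (simp add: b_def)
    also have "\<dots> = - (r\<^sup>2 * (ip x x + 2))"
      unfolding b by (simp add: algebra_simps power2_eq_square)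
    finally have "r\<^sup>2 * (ip x x + 2) \<le> 0" by simp
    then have "b = 0" using c pos[OF x] by (simp add: mult_le_0_iff b)
    then show ?thesis by (simp add: b_def)
  qed
  with u(1) show ?thesis by (rule that)
qed

text \<open>Completeness passes to an equivalent norm, so that the Riesz theorem becomes available
  for the resolvent form and for the elliptic form of one time step.\<close>

lemma equivalent_form:
  assumes b: "semi_inner X b"
    and c: "0 < c" "\<And>x. x \<in> X \<Longrightarrow> c * ip x x \<le> b x x" "\<And>x. x \<in> X \<Longrightarrow> b x x \<le> C * ip x x"
  shows "semi_hilbert X b"
proof -
  interpret b: semi_inner X b by fact
  have up: "b.nrm x \<le> sqrt C * nrm x" if "x \<in> X" for x
    unfolding b.nrm_def nrm_def real_sqrt_mult[symmetric] by (rule real_sqrt_le_mono) (rule c(3)[OF that])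
  have lo: "sqrt c * nrm x \<le> b.nrm x" if "x \<in> X" for x
    unfolding b.nrm_def nrm_def real_sqrt_mult[symmetric] by (rule real_sqrt_le_mono) (rule c(2)[OF that])
  show ?thesis
  proof
    fix s :: "nat \<Rightarrow> 'v" assume s: "\<And>n. s n \<in> X" and cau: "\<And>e. e > 0 \<Longrightarrow> \<exists>N. \<forall>m\<ge>N. \<forall>n\<ge>N. b.nrm (s m - s n) < e"
    have "\<exists>N. \<forall>m\<ge>N. \<forall>n\<ge>N. nrm (s m - s n) < e" if "e > 0" for e
    proof -
      have "sqrt c * e > 0" using that c(1) by simp
      then obtain N where N: "\<And>m n. m\<ge>N \<Longrightarrow> n\<ge>N \<Longrightarrow> b.nrm (s m - s n) < sqrt c * e"
        using cau by blast
      have "nrm (s m - s n) < e" if "m\<ge>N" "n\<ge>N" for m n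
      proof -
        have "sqrt c * nrm (s m - s n) < sqrt c * e"
          using lo[of "s m - s n"] N[OF that] s by (meson le_less_trans mem_diff)
        then show ?thesis using c(1) by simp
      qed
      then show ?thesis by blast
    qed
    then obtain x where x: "x \<in> X" "(\<lambda>n. nrm (s n - x)) \<longlonglongrightarrow> 0"
      using complete[of s, OF s] by blast
    have "(\<lambda>n. b.nrm (s n - x)) \<longlonglongrightarrow> 0"
      by (rule tendsto_0_le[where K="sqrt C", OF x(2)])
        (use up s x b.nrm_ge_0 in \<open>auto intro!: always_eventually simp: mult.commute\<close>)
    with x(1) show "\<exists>x\<in>X. (\<lambda>n. b.nrm (s n - x)) \<longlonglongrightarrow> 0" by blast
  qed
qed

end

section \<open>Integrals over time and Gelfand triples\<close>

text \<open>Convergence off a null set is enough because the Lebesgue measure is complete; the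
  functions are extended by zero to the whole space, where measurability is invariant under changes
  on null sets.\<close>

lemma measurable_AE_limit:
  fixes h :: "'a::euclidean_space \<Rightarrow> real"
  assumes S: "S \<in> sets lebesgue" and f: "\<And>n. f n \<in> borel_measurable (lebesgue_on S)"
    and lim: "AE x in lebesgue_on S. (\<lambda>n. f n x) \<longlonglongrightarrow> h x"
  shows "h \<in> borel_measurable (lebesgue_on S)"
proof -
  define l where "l x = lim (\<lambda>n. f n x)" for x
  have l: "l \<in> borel_measurable (lebesgue_on S)"
    unfolding l_def by (rule borel_measurable_lim_metric) (rule f)
  have "AE x in lebesgue_on S. l x = h x"
    using lim by eventually_elim (simp add: l_def limI)
  then have eq: "AE x in lebesgue. (if x \<in> S then l x else 0) = (if x \<in> S then h x else 0)"
    using S by (simp add: AE_restrict_space_iff)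
  have "(\<lambda>x. if x \<in> S then l x else 0) \<in> borel_measurable lebesgue"
    using borel_measurable_if_lebesgue_on[of S UNIV l] S l by (simp add: lebesgue_on_UNIV_eq)
  from borel_measurable_AE[OF this eq]
  have "(\<lambda>x. if x \<in> S then h x else 0) \<in> borel_measurable lebesgue" .
  then show ?thesis
    using borel_measurable_if_lebesgue_on[of S UNIV h] S by (simp add: lebesgue_on_UNIV_eq)
qed

lemma measurable_AE_eq:
  fixes h :: "'a::euclidean_space \<Rightarrow> real"
  assumes "S \<in> sets lebesgue" "f \<in> borel_measurable (lebesgue_on S)"
    "AE x in lebesgue_on S. f x = h x"
  shows "h \<in> borel_measurable (lebesgue_on S)"
proof (rule measurable_AE_limit[OF assms(1)])
  show "AE x in lebesgue_on S. (\<lambda>n. f x) \<longlonglongrightarrow> h x"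
    using assms(3) by eventually_elim simp
qed fact

section \<open>Integrals over subintervals of (0,T)\<close>

abbreviation MT :: "real \<Rightarrow> real measure" where "MT T \<equiv> lebesgue_on {0<..<T}"

text \<open>The interval is encoded in the integrand, so that every integral over time refers to the
  one measure \<open>MT T\<close>. Half-open intervals make adjacent pieces add up exactly.\<close>

definition iint :: "real \<Rightarrow> (real \<Rightarrow> real) \<Rightarrow> real \<Rightarrow> real \<Rightarrow> real" where
  "iint T b s t = (LINT \<sigma>|MT T. (if s < \<sigma> \<and> \<sigma> \<le> t then b \<sigma> else 0))"

lemma finite_measure_MT: "finite_measure (MT T)"
  by (rule finite_measure_lebesgue_on) simp

lemma measurable_ident_MT [measurable]: "(\<lambda>x. x) \<in> borel_measurable (MT T)"
  using id_borel_measurable_lebesgue_on unfolding id_def .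

lemma pred_cut [measurable]: "Measurable.pred (MT T) (\<lambda>\<sigma>. s < \<sigma> \<and> \<sigma> \<le> t)"
  by measurable

lemma integrable_cut [simp]:
  fixes b :: "real \<Rightarrow> real"
  assumes "integrable (MT T) b"
  shows "integrable (MT T) (\<lambda>\<sigma>. if s < \<sigma> \<and> \<sigma> \<le> t then b \<sigma> else 0)"
proof (rule Bochner_Integration.integrable_bound[OF assms])
  have [measurable]: "b \<in> borel_measurable (MT T)" using assms by auto
  show "(\<lambda>\<sigma>. if s < \<sigma> \<and> \<sigma> \<le> t then b \<sigma> else 0) \<in> borel_measurable (MT T)" by measurable
qed auto

lemma iint_split:
  assumes "integrable (MT T) b" "s \<le> t" "t \<le> r"
  shows "iint T b s r = iint T b s t + iint T b t r"
proof -
  have "(\<lambda>\<sigma>. if s < \<sigma> \<and> \<sigma> \<le> r then b \<sigma> else 0) =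
    (\<lambda>\<sigma>. (if s < \<sigma> \<and> \<sigma> \<le> t then b \<sigma> else 0) + (if t < \<sigma> \<and> \<sigma> \<le> r then b \<sigma> else 0))"
    using assms by auto
  then show ?thesis using assms by (simp add: iint_def)
qed

lemma iint_refl [simp]: "iint T b s s = 0"
proof -
  have "(\<lambda>\<sigma>. if s < \<sigma> \<and> \<sigma> \<le> s then b \<sigma> else 0) = (\<lambda>\<sigma>. 0)" by auto
  then show ?thesis by (simp add: iint_def)
qed

lemma iint_full: "iint T b 0 T = (LINT \<sigma>|MT T. b \<sigma>)"
  unfolding iint_def by (rule Bochner_Integration.integral_cong) auto

lemma iint_add:
  assumes "integrable (MT T) b" "integrable (MT T) c"
  shows "iint T (\<lambda>\<sigma>. b \<sigma> + c \<sigma>) s t = iint T b s t + iint T c s t"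
proof -
  have "(\<lambda>\<sigma>. if s < \<sigma> \<and> \<sigma> \<le> t then b \<sigma> + c \<sigma> else 0) =
    (\<lambda>\<sigma>. (if s < \<sigma> \<and> \<sigma> \<le> t then b \<sigma> else 0) + (if s < \<sigma> \<and> \<sigma> \<le> t then c \<sigma> else 0))"
    by auto
  then show ?thesis using assms by (simp add: iint_def)
qed

lemma iint_cmult: "iint T (\<lambda>\<sigma>. k * b \<sigma>) s t = k * iint T b s t"
proof -
  have "(\<lambda>\<sigma>. if s < \<sigma> \<and> \<sigma> \<le> t then k * b \<sigma> else 0) =
    (\<lambda>\<sigma>. k * (if s < \<sigma> \<and> \<sigma> \<le> t then b \<sigma> else 0))"
    by auto
  then show ?thesis by (simp add: iint_def)
qed

lemma iint_diff:
  assumes "integrable (MT T) b" "integrable (MT T) c"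
  shows "iint T (\<lambda>\<sigma>. b \<sigma> - c \<sigma>) s t = iint T b s t - iint T c s t"
  using iint_add[of T b "\<lambda>\<sigma>. (-1) * c \<sigma>" s t] iint_cmult[of T "-1" c s t] assms by simp

lemma iint_mono_AE:
  assumes "integrable (MT T) b" "integrable (MT T) c"
    and "AE \<sigma> in MT T. s < \<sigma> \<and> \<sigma> \<le> t \<longrightarrow> b \<sigma> \<le> c \<sigma>"
  shows "iint T b s t \<le> iint T c s t"
  unfolding iint_def by (rule integral_mono_AE) (use assms in \<open>auto elim!: eventually_mono\<close>)

lemma iint_cong_AE:
  assumes "AE \<sigma> in MT T. s < \<sigma> \<and> \<sigma> \<le> t \<longrightarrow> b \<sigma> = c \<sigma>"
    "b \<in> borel_measurable (MT T)" "c \<in> borel_measurable (MT T)"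
  shows "iint T b s t = iint T c s t"
  unfolding iint_def by (rule integral_cong_AE) (use assms in \<open>auto elim!: eventually_mono\<close>)

lemma iint_nonneg: "(\<And>\<sigma>. \<sigma> \<in> {0<..<T} \<Longrightarrow> 0 \<le> b \<sigma>) \<Longrightarrow> 0 \<le> iint T b s t"
  unfolding iint_def by (rule Bochner_Integration.integral_nonneg) auto

lemma iint_abs_le:
  assumes "integrable (MT T) b" "integrable (MT T) c"
    and "AE \<sigma> in MT T. s < \<sigma> \<and> \<sigma> \<le> t \<longrightarrow> \<bar>b \<sigma>\<bar> \<le> c \<sigma>"
  shows "\<bar>iint T b s t\<bar> \<le> iint T c s t"
proof -
  have "iint T b s t \<le> iint T c s t" "iint T (\<lambda>\<sigma>. (-1) * b \<sigma>) s t \<le> iint T c s t"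
    by (rule iint_mono_AE; use assms in \<open>auto elim: eventually_mono\<close>)+
  then show ?thesis unfolding iint_cmult by simp
qed

lemma iint_mono_interval:
  assumes "integrable (MT T) b" "\<And>\<sigma>. \<sigma> \<in> {0<..<T} \<Longrightarrow> 0 \<le> b \<sigma>" "s' \<le> s" "t \<le> t'"
  shows "iint T b s t \<le> iint T b s' t'"
  unfolding iint_def by (rule integral_mono) (use assms in auto)

lemma tendsto_iint:
  assumes b: "\<And>n. b n \<in> borel_measurable (MT T)" "c \<in> borel_measurable (MT T)"
    and w: "integrable (MT T) w" and bd: "\<And>n. AE \<sigma> in MT T. \<bar>b n \<sigma>\<bar> \<le> w \<sigma>"
    and lim: "AE \<sigma> in MT T. (\<lambda>n. b n \<sigma>) \<longlonglongrightarrow> c \<sigma>"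
  shows "(\<lambda>n. iint T (b n) s t) \<longlonglongrightarrow> iint T c s t"
  unfolding iint_def
proof (rule integral_dominated_convergence[where w=w])
  have [measurable]: "b n \<in> borel_measurable (MT T)" "c \<in> borel_measurable (MT T)" for n by fact+
  show "(\<lambda>\<sigma>. if s < \<sigma> \<and> \<sigma> \<le> t then c \<sigma> else 0) \<in> borel_measurable (MT T)" by measurable
  show "(\<lambda>\<sigma>. if s < \<sigma> \<and> \<sigma> \<le> t then b n \<sigma> else 0) \<in> borel_measurable (MT T)" for n by measurable
  show "AE \<sigma> in MT T. (\<lambda>n. if s < \<sigma> \<and> \<sigma> \<le> t then b n \<sigma> else 0) \<longlonglongrightarrow> (if s < \<sigma> \<and> \<sigma> \<le> t then c \<sigma> else 0)"
    using lim by eventually_elim auto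
  show "AE \<sigma> in MT T. norm (if s < \<sigma> \<and> \<sigma> \<le> t then b n \<sigma> else 0) \<le> w \<sigma>" for n
    using bd[of n] by eventually_elim auto
qed fact

lemma AE_neq_MT: "AE \<sigma> in MT T. \<sigma> \<noteq> (t::real)"
proof -
  have "AE \<sigma> in lebesgue. \<sigma> \<noteq> t"
    by (rule AE_I'[of "{t}"]) (auto simp: negligible_iff_null_sets[symmetric])
  then have "AE \<sigma> in lebesgue. \<sigma> \<in> {0<..<T} \<longrightarrow> \<sigma> \<noteq> t" by (rule eventually_mono) simp
  then show ?thesis by (simp add: AE_restrict_space_iff)
qed

text \<open>As the upper limit varies, the cut-off integrand converges at each point other than the
  limiting endpoint, which is a null set.\<close>

lemma iint_continuous:
  assumes b: "integrable (MT T) b"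
  shows "continuous_on UNIV (\<lambda>t. iint T b s t)"
proof (rule continuous_on_sequentiallyI)
  fix u and a :: real assume u: "u \<longlonglongrightarrow> a"
  have [measurable]: "b \<in> borel_measurable (MT T)" using b by auto
  show "(\<lambda>n. iint T b s (u n)) \<longlonglongrightarrow> iint T b s a"
    unfolding iint_def
  proof (rule integral_dominated_convergence[where w="\<lambda>\<sigma>. \<bar>b \<sigma>\<bar>"])
    show "AE \<sigma> in MT T. (\<lambda>n. if s < \<sigma> \<and> \<sigma> \<le> u n then b \<sigma> else 0) \<longlonglongrightarrow> (if s < \<sigma> \<and> \<sigma> \<le> a then b \<sigma> else 0)"
      using AE_neq_MT[of a T]
    proof eventually_elim
      case (elim \<sigma>)
      have "\<forall>\<^sub>F n in sequentially. (\<sigma> \<le> u n) = (\<sigma> \<le> a)"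
      proof (cases "\<sigma> < a")
        case True
        from order_tendstoD(1)[OF u True] show ?thesis
          by eventually_elim (use True in auto)
      next
        case False
        then have "a < \<sigma>" using elim by auto
        from order_tendstoD(2)[OF u this] show ?thesis
          by eventually_elim (use \<open>a < \<sigma>\<close> in auto)
      qed
      then have "\<forall>\<^sub>F n in sequentially. (if s < \<sigma> \<and> \<sigma> \<le> u n then b \<sigma> else 0) = (if s < \<sigma> \<and> \<sigma> \<le> a then b \<sigma> else 0)"
        by eventually_elim auto
      then show ?case by (rule tendsto_eventually)
    qed
  qed (use b in \<open>auto simp: integrable_abs_iff\<close>)
qed

lemma sum_telescope_le:
  fixes f :: "nat \<Rightarrow> real"
  assumes "\<And>i. i < N \<Longrightarrow> \<bar>f (Suc i) - f i\<bar> \<le> c"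
  shows "\<bar>f N - f 0\<bar> \<le> real N * c"
  using assms
proof (induction N)
  case (Suc N)
  then have "\<bar>f N - f 0\<bar> \<le> real N * c" "\<bar>f (Suc N) - f N\<bar> \<le> c" by auto
  then show ?case by (simp add: algebra_simps)
qed simp

text \<open>The range of \<open>b\<close>, and not the time interval, is divided into N equal parts.
  Each part contributes an error of order 1/N^2, so N of them contribute 1/N.\<close>

lemma constant_of_quadratic_modulus:
  fixes b \<Phi> :: "real \<Rightarrow> real"
  assumes st: "s \<le> t" and b: "continuous_on {s..t} b"
    and q: "\<And>x y. \<lbrakk>x \<in> {s..t}; y \<in> {s..t}\<rbrakk> \<Longrightarrow> \<bar>\<Phi> y - \<Phi> x\<bar> \<le> C * (b y - b x)\<^sup>2"
  shows "\<Phi> t = \<Phi> s"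
proof -
  define D where "D = b t - b s"
  have "\<bar>\<Phi> t - \<Phi> s\<bar> \<le> C * D\<^sup>2 / real N" if N: "N > 0" for N :: nat
  proof -
    have "\<exists>x\<in>{s..t}. b x = b s + (real i / real N) * D" if "i \<le> N" for i
    proof -
      have "connected (b ` {s..t})"
        by (rule connected_continuous_image[OF b]) auto
      then have conv: "convex (b ` {s..t})" by (simp add: is_interval_convex is_interval_connected_1)
      have "(1 - real i / real N) *\<^sub>R b s + (real i / real N) *\<^sub>R b t \<in> b ` {s..t}"
        by (rule convexD_alt[OF conv]) (use st that N in auto)
      moreover have "(1 - real i / real N) *\<^sub>R b s + (real i / real N) *\<^sub>R b t = b s + (real i / real N) * D"
        by (simp add: D_def left_diff_distrib right_diff_distrib)
      ultimately show ?thesis by (metis imageE)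
    qed
    then obtain x where x: "\<And>i. i \<le> N \<Longrightarrow> x i \<in> {s..t} \<and> b (x i) = b s + (real i / real N) * D"
      by metis
    have "\<bar>\<Phi> (x (Suc i)) - \<Phi> (x i)\<bar> \<le> C * (D / real N)\<^sup>2" if "i < N" for i
    proof -
      have "b (x (Suc i)) - b (x i) = D / real N"
        using x[of i] x[of "Suc i"] that N by (simp add: field_simps)
      then show ?thesis using q[of "x i" "x (Suc i)"] x[of i] x[of "Suc i"] that by simp
    qed
    from sum_telescope_le[of N "\<lambda>i. \<Phi> (x i)", OF this]
    have "\<bar>\<Phi> (x N) - \<Phi> (x 0)\<bar> \<le> real N * (C * (D / real N)\<^sup>2)" .
    \<comment> \<open>\<open>x N\<close> need not be \<open>t\<close>, but \<open>b\<close> agrees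
      at the two points, and then the modulus gives equality. The same holds at the other
      end.\<close>
    moreover have "\<Phi> (x N) = \<Phi> t"
      using q[of "x N" t] x[of N] st N by (simp add: D_def)
    moreover have "\<Phi> (x 0) = \<Phi> s"
      using q[of "x 0" s] x[of 0] st by simp
    ultimately show ?thesis using N by (simp add: power2_eq_square field_simps)
  qed
  from this[of "Suc n" for n] have le: "\<bar>\<Phi> t - \<Phi> s\<bar> \<le> C * D\<^sup>2 * (1 / real (Suc n))" for n
    by simp
  have "(\<lambda>n. C * D\<^sup>2 * (1 / real (Suc n))) \<longlonglongrightarrow> C * D\<^sup>2 * 0"
    using LIMSEQ_inverse_real_of_nat unfolding inverse_eq_divide by (intro tendsto_intros)
  then have "\<bar>\<Phi> t - \<Phi> s\<bar> \<le> C * D\<^sup>2 * 0"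
    by (rule LIMSEQ_le_const) (use le in auto)
  then show ?thesis by simp
qed

text \<open>\<open>separating\<close> expresses density of \<open>V\<close> in \<open>H\<close>
  through orthogonality. \<open>null_V\<close> says that an element of \<open>V\<close> that is null
  in \<open>H\<close> is null in \<open>V\<close>, that is, the embedding is injective after passing
  to quotients.\<close>

locale gelfand = H: semi_hilbert H ipH + V: semi_hilbert V ipV
  for H V :: "'v::real_vector set" and ipH ipV :: "'v \<Rightarrow> 'v \<Rightarrow> real" +
  assumes V_sub: "V \<subseteq> H"
    and ip_le: "\<And>v. v \<in> V \<Longrightarrow> ipH v v \<le> ipV v v"
    and separating: "\<And>h. \<lbrakk>h \<in> H; \<And>\<phi>. \<phi> \<in> V \<Longrightarrow> ipH h \<phi> = 0\<rbrakk> \<Longrightarrow> ipH h h = 0"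
    and null_V: "\<And>v. \<lbrakk>v \<in> V; ipH v v = 0\<rbrakk> \<Longrightarrow> ipV v v = 0"
begin

lemma VH [simp]: "v \<in> V \<Longrightarrow> v \<in> H"
  using V_sub by blast

lemma nrm_le: "v \<in> V \<Longrightarrow> H.nrm v \<le> V.nrm v"
  unfolding H.nrm_def V.nrm_def by (intro real_sqrt_le_mono ip_le)

text \<open>
  \<open>res e h y\<close> says that \<open>y\<close> is the resolvent \<open>(1 + e A)\<^bsup>-1\<^esup> h\<close> of the operator \<open>A\<close> associated with the form \<open>ipV\<close>.
\<close>

definition res :: "real \<Rightarrow> 'v \<Rightarrow> 'v \<Rightarrow> bool" where
  "res e h y \<longleftrightarrow> y \<in> V \<and> (\<forall>\<phi>\<in>V. ipH y \<phi> + e * ipV y \<phi> = ipH h \<phi>)"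

lemma resD: "res e h y \<Longrightarrow> \<phi> \<in> V \<Longrightarrow> ipH y \<phi> + e * ipV y \<phi> = ipH h \<phi>"
  and resV: "res e h y \<Longrightarrow> y \<in> V"
  by (auto simp: res_def)

text \<open>Riesz theorem for the form \<open>ipH + e * ipV\<close>, which is equivalent to
  \<open>ipV\<close> with constants \<open>e\<close> and \<open>1 + e\<close>.\<close>

lemma res_exists:
  assumes e: "e > 0" and h: "h \<in> H" shows "\<exists>y. res e h y"
proof -
  have "semi_inner V (\<lambda>x y. ipH x y + e * ipV x y)"
    by unfold_locales (use e V.subspace in \<open>auto simp: H.ip_simps V.ip_simps algebra_simps
        H.sym V.sym intro!: add_nonneg_nonneg mult_nonneg_nonneg H.pos V.pos\<close>)
  then have "semi_hilbert V (\<lambda>x y. ipH x y + e * ipV x y)"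
    by (rule V.equivalent_form[where c=e and C="1 + e"])
      (use e in \<open>auto intro: H.pos simp: algebra_simps ip_le\<close>)
  then interpret B: semi_hilbert V "\<lambda>x y. ipH x y + e * ipV x y" .
  have "H.nrm x \<le> B.nrm x" if "x \<in> V" for x
    unfolding H.nrm_def B.nrm_def by (rule real_sqrt_le_mono) (use e that V.pos in auto)
  then have "\<bar>ipH h x\<bar> \<le> H.nrm h * B.nrm x" if "x \<in> V" for x
    using H.Cauchy_Schwarz[OF h, of x] that by (meson H.nrm_ge_0 VH h mult_left_mono order_trans)
  then obtain u where "u \<in> V" "\<And>x. x \<in> V \<Longrightarrow> ipH u x + e * ipV u x = ipH h x"
    by (rule B.Riesz[of "ipH h" "H.nrm h", rotated 2]) (use h in \<open>auto simp: H.ip_simps\<close>)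
  then show ?thesis by (auto simp: res_def)
qed

lemma res_diff:
  "\<lbrakk>res e h y; res e h' y'; h \<in> H; h' \<in> H\<rbrakk> \<Longrightarrow> res e (h - h') (y - y')"
proof -
  assume r: "res e h y" "res e h' y'" and h: "h \<in> H" "h' \<in> H"
  have V: "y \<in> V" "y' \<in> V" using r resV by auto
  have "ipH (y - y') \<phi> + e * ipV (y - y') \<phi> = ipH (h - h') \<phi>" if "\<phi> \<in> V" for \<phi>
    using resD[OF r(1) that] resD[OF r(2) that] V h that
    by (simp add: H.diff_left V.diff_left right_diff_distrib)
  then show ?thesis using V by (simp add: res_def)
qed

text \<open>Self-adjointness of the resolvent: both sides equal the symmetric form
  \<open>ipH + e * ipV\<close> at the pair \<open>y\<close>, \<open>y'\<close>.\<close>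

lemma res_sym:
  assumes "res e h y" "res e h' y'" "h \<in> H" "h' \<in> H" shows "ipH h y' = ipH h' y"
  using resD[OF assms(1), of y'] resD[OF assms(2), of y] resV[OF assms(1)] resV[OF assms(2)]
    H.sym[of y y'] V.sym[of y y'] by simp

text \<open>Testing with \<open>y\<close> itself. The right-hand side is measured only as a
  functional on \<open>V\<close>, while the solution is measured in \<open>V\<close>; this gain is
  what turns a path with a derivative in the dual into a path in \<open>V\<close>.\<close>

lemma res_dual_bound:
  assumes e: "e > 0" and r: "res e h y" and bd: "\<And>\<phi>. \<phi> \<in> V \<Longrightarrow> \<bar>ipH h \<phi>\<bar> \<le> c * V.nrm \<phi>"
    and c: "0 \<le> c"
  shows "V.nrm y \<le> c / e"
proof (cases "V.nrm y = 0")
  case False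
  have y: "y \<in> V" using resV[OF r] .
  then have pos: "V.nrm y > 0" using False V.nrm_ge_0[OF y] by linarith
  have "e * (V.nrm y)\<^sup>2 \<le> c * V.nrm y"
    using resD[OF r y] bd[OF y] H.pos[of y] y by (simp add: V.nrm_sq)
  then have "e * V.nrm y \<le> c" using pos by (simp add: power2_eq_square)
  then show ?thesis using e by (simp add: field_simps)
qed (use e c in simp)

lemma res_H_le:
  assumes e: "e > 0" and r: "res e h y" and h: "h \<in> H"
  shows "H.nrm y \<le> H.nrm h" "e * (V.nrm y)\<^sup>2 \<le> (H.nrm h)\<^sup>2"
proof -
  have y: "y \<in> V" using resV[OF r] .
  have eq: "(H.nrm y)\<^sup>2 + e * (V.nrm y)\<^sup>2 \<le> H.nrm h * H.nrm y"
    using resD[OF r y] H.Cauchy_Schwarz[OF h, of y] y by (simp add: V.nrm_sq H.nrm_sq)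
  have 0: "0 \<le> H.nrm y" "0 \<le> H.nrm h" "0 \<le> e * (V.nrm y)\<^sup>2" using y h e by auto
  show 1: "H.nrm y \<le> H.nrm h"
  proof (cases "H.nrm y = 0")
    case False
    then have "H.nrm y > 0" using 0 by simp
    moreover have "H.nrm y * H.nrm y \<le> H.nrm h * H.nrm y" using eq 0 by (simp add: power2_eq_square)
    ultimately show ?thesis by (simp only: mult_le_cancel_right_pos)
  qed (use 0 in simp)
  have "H.nrm h * H.nrm y \<le> (H.nrm h)\<^sup>2"
    using 1 0 by (simp add: power2_eq_square mult_left_mono)
  then show "e * (V.nrm y)\<^sup>2 \<le> (H.nrm h)\<^sup>2" using eq 0
    by (smt (verit) zero_le_power2)
qed

text \<open>Testing with \<open>v - y\<close> shows that \<open>ipV y (v - y)\<close> is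
  nonnegative, so the resolvent is also a contraction in \<open>V\<close>.\<close>

lemma res_V_le:
  assumes e: "e > 0" and r: "res e v y" and v: "v \<in> V"
  shows "V.nrm y \<le> V.nrm v" "ipH (v - y) (v - y) = e * ipV y (v - y)"
proof -
  have y: "y \<in> V" using resV[OF r] .
  show eq: "ipH (v - y) (v - y) = e * ipV y (v - y)"
    using resD[OF r, of "v - y"] y v by (simp add: H.diff_left)
  have "0 \<le> ipH (v - y) (v - y)" using y v by (simp add: H.pos)
  then have "0 \<le> ipV y (v - y)" unfolding eq using e by (simp add: zero_le_mult_iff)
  then have "V.nrm y * V.nrm y \<le> V.nrm v * V.nrm y"
    using V.Cauchy_Schwarz[of y v] y v by (simp add: V.diff_right V.nrm_sq[symmetric] power2_eq_square mult.commute)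
  then show "V.nrm y \<le> V.nrm v"
    using V.nrm_ge_0[OF y] V.nrm_ge_0[OF v] by (cases "V.nrm y = 0") auto
qed

text \<open>
  As \<open>e\<close> decreases the resolvents increase in the sense of spectral calculus; these two
  inequalities make them Cauchy.
\<close>

lemma res_monotone:
  assumes e: "0 < e" "e \<le> d" and x: "res e h x" and y: "res d h y" and h: "h \<in> H"
  shows "(H.nrm (x - y))\<^sup>2 \<le> (H.nrm (h - y))\<^sup>2 - (H.nrm (h - x))\<^sup>2"
    and "(V.nrm (x - y))\<^sup>2 \<le> (V.nrm x)\<^sup>2 - (V.nrm y)\<^sup>2"
proof -
  have xV: "x \<in> V" and yV: "y \<in> V" using resV x y by auto
  define D where "D = x - y"
  have DV: "D \<in> V" using xV yV by (simp add: D_def)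
  have Y: "y = x - D" by (simp add: D_def)
  have ex: "ipH x D + e * ipV x D = ipH h D" using resD[OF x DV] .
  have ey: "ipH x D - ipH D D + d * (ipV x D - ipV D D) = ipH h D"
    using resD[OF y DV] unfolding Y using xV DV by (simp add: H.ip_simps V.ip_simps)
  \<comment> \<open>Difference of the two resolvent equations, both tested with
    \<open>D\<close>.\<close>
  have key: "(d - e) * ipV x D = ipH D D + d * ipV D D"
    using ex ey by (simp add: algebra_simps)
  have posD: "0 \<le> ipH D D" "0 \<le> ipV D D" using DV H.pos V.pos by auto
  have geD: "ipV D D \<le> ipV x D"
  \<comment> \<open>For equal parameters \<open>key\<close> carries no information on
    \<open>ipV x D\<close>, but it forces \<open>D\<close> to be null.\<close>
  proof (cases "e = d")
    case True
    then have "ipH D D + d * ipV D D = 0" using key by simp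
    then have "ipV D D = 0" using posD e by (smt (verit) mult_nonneg_nonneg mult_eq_0_iff)
    then have "ipV x D = 0" using V.ip_zero_of_nrm[of D x] DV xV V.sym[of x D] by (simp add: V.nrm_def)
    then show ?thesis using \<open>ipV D D = 0\<close> by simp
  next
    case False
    then have "0 < d - e" using e by simp
    have "(d - e) * ipV D D \<le> d * ipV D D" using posD e by (simp add: mult_right_mono)
    also have "\<dots> \<le> (d - e) * ipV x D" using key posD by simp
    finally show ?thesis using \<open>0 < d - e\<close> by simp
  qed
  have "(V.nrm x)\<^sup>2 - (V.nrm y)\<^sup>2 = 2 * ipV x D - ipV D D"
    unfolding Y using xV DV V.sym[of x D] by (simp add: V.nrm_sq V.ip_simps)
  then show "(V.nrm (x - y))\<^sup>2 \<le> (V.nrm x)\<^sup>2 - (V.nrm y)\<^sup>2"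
    using geD DV by (simp add: D_def[symmetric] V.nrm_sq)
  have "ipH (h - x) D = e * ipV x D" using ex xV DV h by (simp add: H.ip_simps)
  then have "0 \<le> ipH (h - x) D" using geD posD e by simp
  moreover have "(H.nrm (h - y))\<^sup>2 - (H.nrm (h - x))\<^sup>2 = 2 * ipH (h - x) D + ipH D D"
  proof -
    have "h - y = (h - x) + D" by (simp add: D_def)
    then have "(H.nrm (h - y))\<^sup>2 = (H.nrm ((h - x) + D))\<^sup>2" by (simp only:)
    then show ?thesis
      using xV DV h H.sym[of "h - x" D] H.nrm_sq[of "h - x"] H.nrm_sq[of "(h - x) + D"]
      by (simp add: H.add_left H.add_right)
  qed
  ultimately show "(H.nrm (x - y))\<^sup>2 \<le> (H.nrm (h - y))\<^sup>2 - (H.nrm (h - x))\<^sup>2"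
    using DV by (simp add: D_def[symmetric] H.nrm_sq)
qed

end

lemma (in semi_inner) Cauchy_of_monotone:
  assumes s: "\<And>n::nat. s n \<in> X" and c: "convergent c"
    and le: "\<And>m n. n \<le> m \<Longrightarrow> (nrm (s m - s n))\<^sup>2 \<le> \<bar>c m - c n :: real\<bar>" and e: "e > 0"
  shows "\<exists>N. \<forall>m\<ge>N. \<forall>n\<ge>N. nrm (s m - s n) < e"
proof -
  have "Cauchy c" using c by (simp add: convergent_Cauchy)
  then obtain N where N: "\<And>m n. m \<ge> N \<Longrightarrow> n \<ge> N \<Longrightarrow> \<bar>c m - c n\<bar> < e\<^sup>2"
    using CauchyD[of c "e\<^sup>2"] e by (auto)
  have *: "nrm (s m - s n) < e" if "m \<ge> N" "n \<ge> N" "n \<le> m" for m n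
  proof -
    have "(nrm (s m - s n))\<^sup>2 < e\<^sup>2" using le[OF that(3)] N[OF that(1,2)] by linarith
    then show ?thesis by (rule power_less_imp_less_base) (use e in auto)
  qed
  have "nrm (s m - s n) < e" if "m \<ge> N" "n \<ge> N" for m n
    using *[of m n] *[of n m] that nrm_diff_commute[OF s s, of m n] by (cases "n \<le> m") auto
  then show ?thesis by blast
qed

context gelfand begin

lemma inv_Suc: "(\<lambda>n. 1 / real (Suc n)) \<longlonglongrightarrow> 0" "0 < 1 / real (Suc n)"
  "n \<le> m \<Longrightarrow> 1 / real (Suc m) \<le> 1 / real (Suc n)"
  using LIMSEQ_inverse_real_of_nat unfolding inverse_eq_divide by (auto simp: frac_le)

text \<open>The distances to \<open>h\<close> decrease with the parameter, and
  \<open>res_monotone\<close> converts this into the Cauchy property. The limit is identified by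
  testing with elements of \<open>V\<close>, where the resolvent equation leaves an error of order
  \<open>sqrt (1 / Suc n)\<close>, and by \<open>separating\<close>.\<close>

lemma res_tendsto_H:
  assumes r: "\<And>n. res (1 / real (Suc n)) h (y n)" and h: "h \<in> H"
  shows "(\<lambda>n. H.nrm (y n - h)) \<longlonglongrightarrow> 0"
proof -
  have yV: "y n \<in> V" for n using resV r by blast
  define c where "c n = (H.nrm (h - y n))\<^sup>2" for n
  have mono: "(H.nrm (y m - y n))\<^sup>2 \<le> c n - c m" if "n \<le> m" for m n
    unfolding c_def by (rule res_monotone(1)[OF inv_Suc(2) inv_Suc(3)[OF that] r r h])
  have dec: "c m \<le> c n" if "n \<le> m" for m n
    using mono[OF that] zero_le_power2[of "H.nrm (y m - y n)"] by linarith
  have "decseq c" using dec by (auto simp: decseq_def)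
  moreover have "Bseq c" by (rule BseqI'[of c "c 0"]) (use dec[of 0] in \<open>auto simp: c_def\<close>)
  ultimately have "convergent c"
    by (intro Bseq_monoseq_convergent decseq_imp_monoseq)
  then have cau: "\<And>e. e > 0 \<Longrightarrow> \<exists>N. \<forall>m\<ge>N. \<forall>n\<ge>N. H.nrm (y m - y n) < e"
    by (rule H.Cauchy_of_monotone[of y c, rotated]) (use yV mono in \<open>force+\<close>)
  obtain z where z: "z \<in> H" "(\<lambda>n. H.nrm (y n - z)) \<longlonglongrightarrow> 0"
    using H.complete[of y] yV cau by auto
  have "ipH (z - h) \<phi> = 0" if \<phi>: "\<phi> \<in> V" for \<phi>
  proof -
    have 1: "(\<lambda>n. ipH (y n) \<phi>) \<longlonglongrightarrow> ipH z \<phi>"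
      by (rule H.tendsto_ip_left[OF z(2)]) (use yV z \<phi> in auto)
    have bound: "\<bar>ipH (y n) \<phi> - ipH h \<phi>\<bar> \<le> sqrt (1 / real (Suc n)) * (H.nrm h * V.nrm \<phi>)" for n
    proof -
      define d where "d = 1 / real (Suc n)"
      have d: "d > 0" by (simp add: d_def)
      have "ipH (y n) \<phi> - ipH h \<phi> = - d * ipV (y n) \<phi>"
        using resD[OF r \<phi>, of n] by (simp add: d_def)
      then have "\<bar>ipH (y n) \<phi> - ipH h \<phi>\<bar> \<le> d * (V.nrm (y n) * V.nrm \<phi>)"
        using V.Cauchy_Schwarz[OF yV \<phi>, of n] d by (simp add: abs_mult)
      \<comment> \<open>One factor \<open>sqrt d\<close> is spent on the energy bound of
        \<open>res_H_le\<close>, the other one remains as the rate.\<close>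
      also have "\<dots> = sqrt d * (sqrt d * V.nrm (y n)) * V.nrm \<phi>" using d by simp
      also have "sqrt d * V.nrm (y n) \<le> H.nrm h"
      proof (rule power2_le_imp_le)
        show "(sqrt d * V.nrm (y n))\<^sup>2 \<le> (H.nrm h)\<^sup>2"
          using res_H_le(2)[OF _ r h, of n] d by (simp add: power_mult_distrib d_def)
      qed (use h in simp)
      finally show ?thesis using d yV \<phi> by (simp add: d_def mult_left_mono mult_right_mono mult.assoc)
    qed
    have "(\<lambda>n. sqrt (1 / real (Suc n)) * (H.nrm h * V.nrm \<phi>)) \<longlonglongrightarrow> sqrt 0 * (H.nrm h * V.nrm \<phi>)"
      by (intro tendsto_intros inv_Suc(1))
    then have "(\<lambda>n. sqrt (1 / real (Suc n)) * (H.nrm h * V.nrm \<phi>)) \<longlonglongrightarrow> 0" by simp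
    then have "(\<lambda>n. ipH (y n) \<phi> - ipH h \<phi>) \<longlonglongrightarrow> 0"
    proof (rule tendsto_0_le[where K=1], intro always_eventually allI)
      fix n
      show "norm (ipH (y n) \<phi> - ipH h \<phi>) \<le> norm (sqrt (1 / real (Suc n)) * (H.nrm h * V.nrm \<phi>)) * 1"
        using bound[of n] unfolding real_norm_def by linarith
    qed
    then have "(\<lambda>n. ipH (y n) \<phi>) \<longlonglongrightarrow> ipH h \<phi>" by (simp add: LIM_zero_iff)
    with 1 have "ipH z \<phi> = ipH h \<phi>" by (rule LIMSEQ_unique)
    then show ?thesis using z h \<phi> by (simp add: H.ip_simps)
  qed
  then have "ipH (z - h) (z - h) = 0" using separating[of "z - h"] z h by auto
  then have zh: "H.nrm (z - h) = 0" by (simp add: H.nrm_def)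
  have "H.nrm (y n - h) \<le> H.nrm (y n - z)" for n
    using H.nrm_triangle_diff[of "y n" z h] yV z h zh by simp
  then show ?thesis
    by (intro tendsto_sandwich[OF _ _ tendsto_const z(2)]) (use yV h in \<open>auto intro!: always_eventually\<close>)
qed

text \<open>For data in \<open>V\<close> the norms in \<open>V\<close> increase and stay below that
  of \<open>v\<close>. The limit in \<open>V\<close> agrees with \<open>v\<close> up to an
  \<open>H\<close>-null element, and \<open>null_V\<close> makes this null in
  \<open>V\<close>.\<close>

lemma res_tendsto_V:
  assumes r: "\<And>n. res (1 / real (Suc n)) v (y n)" and v: "v \<in> V"
  shows "(\<lambda>n. V.nrm (y n - v)) \<longlonglongrightarrow> 0"
proof -
  have yV: "y n \<in> V" for n using resV r by blast
  define c where "c n = (V.nrm (y n))\<^sup>2" for n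
  have mono: "(V.nrm (y m - y n))\<^sup>2 \<le> c m - c n" if "n \<le> m" for m n
    unfolding c_def by (rule res_monotone(2)[OF inv_Suc(2) inv_Suc(3)[OF that] r r VH[OF v]])
  have inc: "c n \<le> c m" if "n \<le> m" for m n
    using mono[OF that] zero_le_power2[of "V.nrm (y m - y n)"] by linarith
  have bd: "c n \<le> (V.nrm v)\<^sup>2" for n
    unfolding c_def using res_V_le(1)[OF inv_Suc(2) r v, of n] yV by (simp add: power_mono)
  have "incseq c" using inc by (auto simp: incseq_def)
  moreover have "Bseq c" by (rule BseqI'[of c "(V.nrm v)\<^sup>2"]) (use bd in \<open>auto simp: c_def\<close>)
  ultimately have "convergent c"
    by (intro Bseq_monoseq_convergent incseq_imp_monoseq)
  then have cau: "\<And>e. e > 0 \<Longrightarrow> \<exists>N. \<forall>m\<ge>N. \<forall>n\<ge>N. V.nrm (y m - y n) < e"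
    by (rule V.Cauchy_of_monotone[of y c, rotated]) (use yV mono in \<open>force+\<close>)
  obtain z where z: "z \<in> V" "(\<lambda>n. V.nrm (y n - z)) \<longlonglongrightarrow> 0"
    using V.complete[of y] yV cau by auto
  have "(\<lambda>n. H.nrm (y n - z) + H.nrm (y n - v)) \<longlonglongrightarrow> 0 + 0"
  proof (rule tendsto_add)
    show "(\<lambda>n. H.nrm (y n - z)) \<longlonglongrightarrow> 0"
      by (rule tendsto_sandwich[OF _ _ tendsto_const z(2)])
        (use yV z nrm_le in \<open>auto intro!: always_eventually\<close>)
    show "(\<lambda>n. H.nrm (y n - v)) \<longlonglongrightarrow> 0" by (rule res_tendsto_H[OF r]) (use v in simp)
  qed
  moreover have "H.nrm (z - v) \<le> H.nrm (y n - z) + H.nrm (y n - v)" for n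
    using H.nrm_triangle_diff[of z "y n" v] yV z v H.nrm_diff_commute[of z "y n"] by simp
  ultimately have "H.nrm (z - v) \<le> 0 + 0"
    by (intro LIMSEQ_le_const) auto
  then have "H.nrm (z - v) = 0" using H.nrm_ge_0[of "z - v"] z v by (simp add: order_antisym)
  then have "ipH (z - v) (z - v) = 0" using H.nrm_sq[of "z - v"] z v by simp
  then have "ipV (z - v) (z - v) = 0" using null_V z v by simp
  then have zv: "V.nrm (z - v) = 0" by (simp add: V.nrm_def)
  have "V.nrm (y n - v) \<le> V.nrm (y n - z)" for n
    using V.nrm_triangle_diff[of "y n" z v] yV z v zv by simp
  then show ?thesis
    by (intro tendsto_sandwich[OF _ _ tendsto_const z(2)]) (use yV v in \<open>auto intro!: always_eventually\<close>)
qed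

end

section \<open>The energy identity\<close>

text \<open>\<open>w\<close> is a path in \<open>H\<close>, defined at every time, with derivative
  \<open>B\<close> in the dual of \<open>V\<close>, stated in integrated form by
  \<open>path\<close>; \<open>u\<close> is its version with values in \<open>V\<close>, available at
  almost every time. \<open>\<beta>\<close> dominates the dual norm of \<open>B\<close>.\<close>

locale gelfand_path = gelfand H V ipH ipV
  for H V :: "'v::real_vector set" and ipH ipV +
  fixes T :: real and w u :: "real \<Rightarrow> 'v" and B :: "real \<Rightarrow> 'v \<Rightarrow> real" and \<beta> :: "real \<Rightarrow> real"
  assumes T: "T > 0"
    and wH: "\<And>t. t \<in> {0..T} \<Longrightarrow> w t \<in> H"
    and uV: "AE t in MT T. u t \<in> V \<and> ipH (w t - u t) (w t - u t) = 0"
    and B_linear: "AE t in MT T. \<forall>x\<in>V. \<forall>y\<in>V. B t (x + y) = B t x + B t y \<and> B t (x - y) = B t x - B t y"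
    and B_bound: "AE t in MT T. \<forall>x\<in>V. \<bar>B t x\<bar> \<le> \<beta> t * V.nrm x"
    and B_measurable: "\<And>\<phi>. \<phi> \<in> V \<Longrightarrow> (\<lambda>t. B t \<phi>) \<in> borel_measurable (MT T)"
    and \<beta>: "integrable (MT T) \<beta>" and \<beta>_nonneg: "\<And>t. t \<in> {0<..<T} \<Longrightarrow> 0 \<le> \<beta> t"
    and \<beta>u: "integrable (MT T) (\<lambda>t. \<beta> t * V.nrm (u t))"
    and path: "\<And>s t \<phi>. \<lbrakk>0 \<le> s; s \<le> t; t \<le> T; \<phi> \<in> V\<rbrakk> \<Longrightarrow> ipH (w t - w s) \<phi> = iint T (\<lambda>\<sigma>. B \<sigma> \<phi>) s t"
begin

definition b :: "real \<Rightarrow> real" where "b t = iint T \<beta> 0 t"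

lemma b_diff: "\<lbrakk>0 \<le> s; s \<le> t\<rbrakk> \<Longrightarrow> b t - b s = iint T \<beta> s t"
  unfolding b_def using iint_split[OF \<beta>, of 0 s t] by simp

lemma b_mono: "\<lbrakk>0 \<le> s; s \<le> t\<rbrakk> \<Longrightarrow> b s \<le> b t"
  using b_diff[of s t] iint_nonneg[of T \<beta> s t] \<beta>_nonneg by simp

lemma b_cont: "continuous_on S b"
  unfolding b_def using iint_continuous[OF \<beta>] by (rule continuous_on_subset) auto

lemma B_integrable:
  assumes "\<phi> \<in> V" shows "integrable (MT T) (\<lambda>t. B t \<phi>)"
proof (rule Bochner_Integration.integrable_bound[of _ "\<lambda>t. \<beta> t * V.nrm \<phi>"])
  show "AE t in MT T. norm (B t \<phi>) \<le> norm (\<beta> t * V.nrm \<phi>)"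
    using B_bound
  proof eventually_elim
    case (elim t)
    then have "\<bar>B t \<phi>\<bar> \<le> \<beta> t * V.nrm \<phi>" using assms by blast
    then show ?case unfolding real_norm_def by linarith
  qed
qed (use \<beta> B_measurable assms in auto)

lemma path_bound:
  assumes "0 \<le> s" "s \<le> t" "t \<le> T" "\<phi> \<in> V"
  shows "\<bar>ipH (w t - w s) \<phi>\<bar> \<le> (b t - b s) * V.nrm \<phi>"
proof -
  have "\<bar>iint T (\<lambda>\<sigma>. B \<sigma> \<phi>) s t\<bar> \<le> iint T (\<lambda>\<sigma>. V.nrm \<phi> * \<beta> \<sigma>) s t"
  proof (rule iint_abs_le)
    show "AE \<sigma> in MT T. s < \<sigma> \<and> \<sigma> \<le> t \<longrightarrow> \<bar>B \<sigma> \<phi>\<bar> \<le> V.nrm \<phi> * \<beta> \<sigma>"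
      using B_bound by eventually_elim (use assms in \<open>auto simp: mult.commute\<close>)
  qed (use \<beta> B_integrable assms in auto)
  also have "\<dots> = (b t - b s) * V.nrm \<phi>"
    unfolding iint_cmult using b_diff[of s t] assms by simp
  finally show ?thesis using path[OF assms] by simp
qed

lemma path_bound':
  assumes "s \<in> {0..T}" "t \<in> {0..T}" "\<phi> \<in> V"
  shows "\<bar>ipH (w t - w s) \<phi>\<bar> \<le> \<bar>b t - b s\<bar> * V.nrm \<phi>"
proof (cases "s \<le> t")
  case True
  then show ?thesis using path_bound[of s t \<phi>] b_mono[of s t] assms by simp
next
  case False
  have "ipH (w t - w s) \<phi> = - ipH (w s - w t) \<phi>"
    using wH assms by (simp add: H.diff_left)
  then show ?thesis using path_bound[of t s \<phi>] b_mono[of t s] assms False by simp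
qed

context
  fixes e :: real and y :: "real \<Rightarrow> 'v"
  assumes e: "e > 0" and y: "\<And>t. t \<in> {0..T} \<Longrightarrow> res e (w t) (y t)"
begin

lemma yV: "t \<in> {0..T} \<Longrightarrow> y t \<in> V"
  using y resV by blast

text \<open>Increments of \<open>w\<close>, seen as functionals on \<open>V\<close>, are bounded by
  increments of \<open>b\<close>, and \<open>res_dual_bound\<close> transfers this to the norm of
  \<open>V\<close> at the cost of \<open>1 / e\<close>.\<close>

lemma y_modulus:
  assumes "s \<in> {0..T}" "t \<in> {0..T}"
  shows "V.nrm (y t - y s) \<le> \<bar>b t - b s\<bar> / e"
  by (rule res_dual_bound[OF e res_diff[OF y y]]) (use assms wH path_bound' in auto)

text \<open>\<open>B\<close> is known to be measurable only at a fixed argument. Freezing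
  \<open>y\<close> at countably many grid times reduces to that case, and continuity of
  \<open>y\<close> in \<open>V\<close> recovers the moving argument.\<close>

lemma B_y_measurable: "(\<lambda>t. B t (y t)) \<in> borel_measurable (MT T)"
proof -
  \<comment> \<open>All fractions with denominator \<open>Suc n\<close> occur as grid times; the
    value 0 outside the time interval keeps the argument in \<open>V\<close>.\<close>
  define Y where "Y r = (if r \<in> {0..T} then y r else 0)" for r
  define r where "r n t = real_of_int \<lfloor>real (Suc n) * t\<rfloor> / real (Suc n)" for n t
  have YV: "Y r \<in> V" for r by (simp add: Y_def yV)
  have meas: "(\<lambda>t. B t (Y (r n t))) \<in> borel_measurable (MT T)" for n
    unfolding r_def
  proof (rule measurable_compose_countable[where f="\<lambda>i t. B t (Y (real_of_int i / real (Suc n)))"])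
    show "(\<lambda>t. \<lfloor>real (Suc n) * t\<rfloor>) \<in> measurable (MT T) (count_space UNIV)"
      by measurable
  qed (rule B_measurable[OF YV])
  show ?thesis
  proof (rule measurable_AE_limit[OF _ meas])
    have "AE t in MT T. t \<in> {0<..<T}" by (rule AE_I2) simp
    with B_bound B_linear show "AE t in MT T. (\<lambda>n. B t (Y (r n t))) \<longlonglongrightarrow> B t (y t)"
    proof eventually_elim
      case (elim t)
      have r: "r n t \<in> {0..T}" "\<bar>r n t - t\<bar> \<le> 1 / real (Suc n)" for n
      proof -
        have "real_of_int \<lfloor>real (Suc n) * t\<rfloor> \<le> real (Suc n) * t" "real (Suc n) * t < real_of_int \<lfloor>real (Suc n) * t\<rfloor> + 1"
          by linarith+
        then have "r n t \<le> t" "t \<le> r n t + 1 / real (Suc n)"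
          unfolding r_def by (auto simp: field_simps)
        moreover have "0 \<le> r n t" unfolding r_def using elim by auto
        ultimately show "r n t \<in> {0..T}" "\<bar>r n t - t\<bar> \<le> 1 / real (Suc n)"
          using elim by auto
      qed
      have "(\<lambda>n. r n t - t) \<longlonglongrightarrow> 0"
        by (rule tendsto_0_le[OF inv_Suc(1), where K=1]) (use r(2) in auto)
      then have "(\<lambda>n. r n t) \<longlonglongrightarrow> t" by (simp add: LIM_zero_iff)
      then have "(\<lambda>n. b (r n t)) \<longlonglongrightarrow> b t"
        using b_cont[of UNIV] by (auto simp: continuous_on_eq_continuous_at intro: isCont_tendsto_compose)
      then have 0: "(\<lambda>n. b (r n t) - b t) \<longlonglongrightarrow> 0" by (simp add: LIM_zero_iff)
      have "norm (B t (Y (r n t)) - B t (y t)) \<le> norm (b (r n t) - b t) * (\<beta> t / e)" for n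
      proof -
        have yr: "Y (r n t) = y (r n t)" "y (r n t) \<in> V" "y t \<in> V"
          using r(1) elim by (auto simp: Y_def yV)
        have "\<bar>B t (Y (r n t)) - B t (y t)\<bar> = \<bar>B t (y (r n t) - y t)\<bar>"
          using elim yr by simp
        also have "\<dots> \<le> \<beta> t * V.nrm (y (r n t) - y t)"
          using elim V.mem_diff[OF yr(2,3)] by blast
        also have "\<dots> \<le> \<beta> t * (\<bar>b (r n t) - b t\<bar> / e)"
          by (intro mult_left_mono y_modulus) (use r elim \<beta>_nonneg[of t] in auto)
        finally show ?thesis by (simp add: mult_ac)
      qed
      then have "(\<lambda>n. B t (Y (r n t)) - B t (y t)) \<longlonglongrightarrow> 0"
        by (intro tendsto_0_le[OF 0, where K="\<beta> t / e"] always_eventually allI)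
      then show ?case by (simp add: LIM_zero_iff)
    qed
  qed simp
qed

lemma B_y_integrable: "integrable (MT T) (\<lambda>t. B t (y t))"
proof (rule Bochner_Integration.integrable_bound[OF _ B_y_measurable])
  define K where "K = V.nrm (y 0) + \<bar>b T - b 0\<bar> / e"
  show "integrable (MT T) (\<lambda>t. \<beta> t * K)" using \<beta> by simp
  have "AE t in MT T. t \<in> {0<..<T}" by (rule AE_I2) simp
  with B_bound show "AE t in MT T. norm (B t (y t)) \<le> norm (\<beta> t * K)"
  proof eventually_elim
    case (elim t)
    have yt: "y t \<in> V" "y 0 \<in> V" using elim T yV by auto
    have "V.nrm (y t) \<le> V.nrm (y t - y 0) + V.nrm (y 0)" by (rule V.nrm_le_add[OF yt])
    also have "V.nrm (y t - y 0) \<le> \<bar>b t - b 0\<bar> / e" by (rule y_modulus) (use elim T in auto)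
    also have "\<dots> \<le> \<bar>b T - b 0\<bar> / e"
      by (rule divide_right_mono) (use b_mono[of 0 t] b_mono[of t T] elim e in auto)
    finally have "V.nrm (y t) \<le> K" by (simp add: K_def)
    then have "\<bar>B t (y t)\<bar> \<le> \<beta> t * K"
      using elim yt \<beta>_nonneg[of t] by (meson mult_left_mono order_trans greaterThanLessThan_iff)
    then show ?case by simp
  qed
qed

text \<open>
  The error of the product rule on a subinterval is quadratic in the increment of the continuous function \<open>b\<close>,
  so it disappears under refinement.
\<close>

lemma regularized_identity:
  assumes st: "0 \<le> s" "s \<le> t" "t \<le> T"
  shows "ipH (w t) (y t) - ipH (w s) (y s) = 2 * iint T (\<lambda>\<sigma>. B \<sigma> (y \<sigma>)) s t"
proof -
  define \<Phi> where "\<Phi> t = ipH (w t) (y t) - 2 * iint T (\<lambda>\<sigma>. B \<sigma> (y \<sigma>)) 0 t" for t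
  have mono: "\<bar>\<Phi> t - \<Phi> s\<bar> \<le> (2 / e) * (b t - b s)\<^sup>2" if st: "0 \<le> s" "s \<le> t" "t \<le> T" for s t
  proof -
    have V: "y s \<in> V" "y t \<in> V" using yV that by auto
    have wst: "w s \<in> H" "w t \<in> H" using wH that by auto
    \<comment> \<open>By self-adjointness the mixed terms cancel, so the increment of the quadratic
      form is the increment of \<open>w\<close> paired with \<open>y t + y s\<close>.\<close>
    have "ipH (w t) (y s) = ipH (w s) (y t)"
      by (rule res_sym[OF y y]) (use wst that in auto)
    then have "ipH (w t) (y t) - ipH (w s) (y s) = ipH (w t - w s) (y t + y s)"
      using V wst by (simp add: H.add_right H.diff_left)
    also have "\<dots> = iint T (\<lambda>\<sigma>. B \<sigma> (y t + y s)) s t" by (rule path) (use that V in auto)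
    finally have "\<Phi> t - \<Phi> s = iint T (\<lambda>\<sigma>. B \<sigma> (y t + y s)) s t - 2 * iint T (\<lambda>\<sigma>. B \<sigma> (y \<sigma>)) s t"
      using iint_split[OF B_y_integrable, of 0 s t] st by (simp add: \<Phi>_def)
    also have "\<dots> = iint T (\<lambda>\<sigma>. B \<sigma> (y t + y s) - 2 * B \<sigma> (y \<sigma>)) s t"
      using B_y_integrable B_integrable V by (simp add: iint_diff iint_cmult)
    finally have eq: "\<Phi> t - \<Phi> s = iint T (\<lambda>\<sigma>. B \<sigma> (y t + y s) - 2 * B \<sigma> (y \<sigma>)) s t" .
    have "\<bar>\<Phi> t - \<Phi> s\<bar> \<le> iint T (\<lambda>\<sigma>. (2 * (b t - b s) / e) * \<beta> \<sigma>) s t"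
      unfolding eq
    proof (rule iint_abs_le)
      have "AE t in MT T. t \<in> {0<..<T}" by (rule AE_I2) simp
      with B_bound B_linear
      show "AE \<sigma> in MT T. s < \<sigma> \<and> \<sigma> \<le> t \<longrightarrow> \<bar>B \<sigma> (y t + y s) - 2 * B \<sigma> (y \<sigma>)\<bar> \<le> (2 * (b t - b s) / e) * \<beta> \<sigma>"
      proof eventually_elim
        case (elim \<sigma>)
        show ?case
        proof
          assume \<sigma>: "s < \<sigma> \<and> \<sigma> \<le> t"
          have V\<sigma>: "y \<sigma> \<in> V" using elim yV by auto
          have le: "V.nrm (y t - y \<sigma>) \<le> (b t - b s) / e" "V.nrm (y s - y \<sigma>) \<le> (b t - b s) / e"
          proof -
            have "\<bar>b t - b \<sigma>\<bar> \<le> b t - b s" "\<bar>b s - b \<sigma>\<bar> \<le> b t - b s"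
              using b_mono[of s \<sigma>] b_mono[of \<sigma> t] \<sigma> st by auto
            then show "V.nrm (y t - y \<sigma>) \<le> (b t - b s) / e" "V.nrm (y s - y \<sigma>) \<le> (b t - b s) / e"
              using order_trans[OF y_modulus[of \<sigma> t] divide_right_mono]
                order_trans[OF y_modulus[of \<sigma> s] divide_right_mono] \<sigma> st e by auto
          qed
          \<comment> \<open>Replacing the two end values by the value at an intermediate time
            produces two increments of \<open>y\<close>, each at most
            \<open>(b t - b s) / e\<close>.\<close>
          have "B \<sigma> (y t + y s) - 2 * B \<sigma> (y \<sigma>) = B \<sigma> (y t - y \<sigma>) + B \<sigma> (y s - y \<sigma>)"
            using elim V V\<sigma> by simp
          then have "\<bar>B \<sigma> (y t + y s) - 2 * B \<sigma> (y \<sigma>)\<bar> \<le> \<beta> \<sigma> * V.nrm (y t - y \<sigma>) + \<beta> \<sigma> * V.nrm (y s - y \<sigma>)"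
            using elim V V\<sigma> V.mem_diff by (smt (verit, best))
          also have "\<dots> \<le> \<beta> \<sigma> * ((b t - b s) / e) + \<beta> \<sigma> * ((b t - b s) / e)"
            by (intro add_mono mult_left_mono le) (use elim \<beta>_nonneg in auto)
          finally show "\<bar>B \<sigma> (y t + y s) - 2 * B \<sigma> (y \<sigma>)\<bar> \<le> (2 * (b t - b s) / e) * \<beta> \<sigma>"
            by (simp add: mult_ac)
        qed
      qed
    qed (use \<beta> B_y_integrable B_integrable V in auto)
    also have "\<dots> = (2 * (b t - b s) / e) * (b t - b s)"
      unfolding iint_cmult using b_diff[of s t] st by simp
    also have "\<dots> = (2 / e) * (b t - b s)\<^sup>2"
      by (simp add: power2_eq_square field_simps)
    finally show ?thesis .
  qed
  have "\<Phi> t = \<Phi> s"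
  proof (rule constant_of_quadratic_modulus[OF st(2) b_cont, of _ "2 / e"])
    fix p q assume "p \<in> {s..t}" "q \<in> {s..t}"
    then show "\<bar>\<Phi> q - \<Phi> p\<bar> \<le> (2 / e) * (b q - b p)\<^sup>2"
      using mono[of p q] mono[of q p] st power2_commute[of "b p" "b q"] abs_minus_commute[of "\<Phi> p" "\<Phi> q"]
      by (cases "p \<le> q") auto
  qed
  then show ?thesis
    using iint_split[OF B_y_integrable, of 0 s t] st by (simp add: \<Phi>_def)
qed

end

text \<open>At almost every time the resolvents of \<open>w t\<close> are also those of
  \<open>u t\<close>, which lies in \<open>V\<close>; hence they converge in \<open>V\<close> and
  are bounded by \<open>V.nrm (u t)\<close>, and dominated convergence applies under the integral.
  The boundary terms need only convergence in \<open>H\<close>, which holds at every time.\<close>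

lemma B_u_integrable: "integrable (MT T) (\<lambda>t. B t (u t))"
  and energy_identity: "\<lbrakk>0 \<le> s; s \<le> t; t \<le> T\<rbrakk> \<Longrightarrow>
    ipH (w t) (w t) - ipH (w s) (w s) = 2 * iint T (\<lambda>\<sigma>. B \<sigma> (u \<sigma>)) s t"
proof -
  define y where "y n t = (SOME z. res (1 / real (Suc n)) (w t) z)" for n :: nat and t
  have y: "res (1 / real (Suc n)) (w t) (y n t)" if "t \<in> {0..T}" for n t
    unfolding y_def by (rule someI_ex, rule res_exists[OF inv_Suc(2)]) (use wH that in auto)
  have meas: "(\<lambda>t. B t (y n t)) \<in> borel_measurable (MT T)" for n
    by (rule B_y_measurable[OF inv_Suc(2) y])
  have main: "AE t in MT T. (\<lambda>n. B t (y n t)) \<longlonglongrightarrow> B t (u t) \<and> (\<forall>n. \<bar>B t (y n t)\<bar> \<le> \<beta> t * V.nrm (u t))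
    \<and> \<bar>B t (u t)\<bar> \<le> \<beta> t * V.nrm (u t)"
  proof -
    have "AE t in MT T. t \<in> {0<..<T}" by (rule AE_I2) simp
    with B_bound B_linear uV show ?thesis
    proof eventually_elim
      case (elim t)
      have t: "t \<in> {0..T}" and ut: "u t \<in> V" and b0: "0 \<le> \<beta> t" using elim \<beta>_nonneg by auto
      have wt: "w t \<in> H" using wH t by auto
      have 0: "H.nrm (w t - u t) = 0" using elim by (simp add: H.nrm_def)
      have r: "res (1 / real (Suc n)) (u t) (y n t)" for n
      proof -
        have "ipH (u t) \<phi> = ipH (w t) \<phi>" if "\<phi> \<in> V" for \<phi>
          using H.ip_zero_of_nrm[OF _ _ 0, of \<phi>] wt ut that by (simp add: H.diff_left)
        then show ?thesis using y[OF t, of n] by (simp add: res_def)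
      qed
      have yV: "y n t \<in> V" for n using resV[OF r] .
      have lim: "(\<lambda>n. V.nrm (y n t - u t)) \<longlonglongrightarrow> 0" by (rule res_tendsto_V[OF r ut])
      have "norm (B t (y n t) - B t (u t)) \<le> norm (V.nrm (y n t - u t)) * \<beta> t" for n
      proof -
        have "\<bar>B t (y n t) - B t (u t)\<bar> = \<bar>B t (y n t - u t)\<bar>" using elim yV ut by simp
        also have "\<dots> \<le> \<beta> t * V.nrm (y n t - u t)"
          using elim V.mem_diff[OF yV ut] by blast
        also have "\<dots> \<le> norm (V.nrm (y n t - u t)) * \<beta> t"
          using b0 by (simp add: mult.commute mult_left_mono)
        finally show ?thesis by simp
      qed
      then have "(\<lambda>n. B t (y n t) - B t (u t)) \<longlonglongrightarrow> 0"
        by (intro tendsto_0_le[OF lim, where K="\<beta> t"] always_eventually allI)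
      moreover have "\<bar>B t (y n t)\<bar> \<le> \<beta> t * V.nrm (u t)" for n
      proof -
        have "\<bar>B t (y n t)\<bar> \<le> \<beta> t * V.nrm (y n t)" using elim yV by simp
        also have "\<dots> \<le> \<beta> t * V.nrm (u t)"
          by (intro mult_left_mono res_V_le(1)[OF inv_Suc(2) r ut] b0)
        finally show ?thesis .
      qed
      moreover have "\<bar>B t (u t)\<bar> \<le> \<beta> t * V.nrm (u t)" using elim ut by simp
      ultimately show ?case by (simp add: LIM_zero_iff)
    qed
  qed
  have meas_u: "(\<lambda>t. B t (u t)) \<in> borel_measurable (MT T)"
    by (rule measurable_AE_limit[OF _ meas]) (use main in \<open>auto elim: eventually_mono\<close>)
  show "integrable (MT T) (\<lambda>t. B t (u t))"
    by (rule Bochner_Integration.integrable_bound[OF \<beta>u meas_u], use main in eventually_elim) auto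
  assume st: "0 \<le> s" "s \<le> t" "t \<le> T"
  have "(\<lambda>n. iint T (\<lambda>\<sigma>. B \<sigma> (y n \<sigma>)) s t) \<longlonglongrightarrow> iint T (\<lambda>\<sigma>. B \<sigma> (u \<sigma>)) s t"
    by (rule tendsto_iint[OF meas meas_u \<beta>u]) (use main in \<open>auto elim: eventually_mono\<close>)
  then have "(\<lambda>n. 2 * iint T (\<lambda>\<sigma>. B \<sigma> (y n \<sigma>)) s t) \<longlonglongrightarrow> 2 * iint T (\<lambda>\<sigma>. B \<sigma> (u \<sigma>)) s t"
    by (intro tendsto_intros)
  moreover have "2 * iint T (\<lambda>\<sigma>. B \<sigma> (y n \<sigma>)) s t = ipH (w t) (y n t) - ipH (w s) (y n s)" for n
    by (rule regularized_identity[symmetric, OF inv_Suc(2) y]) (use st in auto)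
  moreover have "(\<lambda>n. ipH (w t) (y n t)) \<longlonglongrightarrow> ipH (w t) (w t)" if "t \<in> {0..T}" for t
  proof -
    have yV: "y n t \<in> V" for n using resV[OF y[OF that]] .
    have "(\<lambda>n. ipH (y n t) (w t)) \<longlonglongrightarrow> ipH (w t) (w t)"
      by (rule H.tendsto_ip_left[OF res_tendsto_H[OF y]]) (use that wH yV in auto)
    then show ?thesis using H.sym yV wH[OF that] by (simp add: H.sym)
  qed
  then have "(\<lambda>n. ipH (w t) (y n t) - ipH (w s) (y n s)) \<longlonglongrightarrow> ipH (w t) (w t) - ipH (w s) (w s)"
    using st by (intro tendsto_diff) auto
  ultimately show "ipH (w t) (w t) - ipH (w s) (w s) = 2 * iint T (\<lambda>\<sigma>. B \<sigma> (u \<sigma>)) s t"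
    using LIMSEQ_unique by auto
qed

lemma energy_continuous: "continuous_on {0..T} (\<lambda>t. ipH (w t) (w t))"
proof -
  have "continuous_on {0..T} (\<lambda>t. ipH (w 0) (w 0) + 2 * iint T (\<lambda>\<sigma>. B \<sigma> (u \<sigma>)) 0 t)"
    by (intro continuous_intros continuous_on_subset[OF iint_continuous[OF B_u_integrable]]) auto
  then show ?thesis
    by (rule continuous_on_eq) (use energy_identity[of 0] in force)
qed

lemma path_bounded: obtains K where "K > 0" "\<And>t. t \<in> {0..T} \<Longrightarrow> H.nrm (w t) \<le> K"
proof -
  have "bounded ((\<lambda>t. ipH (w t) (w t)) ` {0..T})"
    by (intro compact_imp_bounded compact_continuous_image energy_continuous) simp
  then obtain K where K: "K > 0" "\<And>t. t \<in> {0..T} \<Longrightarrow> \<bar>ipH (w t) (w t)\<bar> \<le> K"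
    by (auto simp: bounded_pos)
  have "H.nrm (w t) \<le> sqrt K" if "t \<in> {0..T}" for t
    unfolding H.nrm_def using K(2)[OF that] by auto
  then show ?thesis using that[of "sqrt K"] K(1) by auto
qed

text \<open>Weak continuity, from the modulus \<open>b\<close> on the dense subspace
  \<open>V\<close> and boundedness in \<open>H\<close>, together with continuity of the norm, from
  the energy identity, gives strong continuity.\<close>

theorem path_continuous:
  assumes t: "t \<in> {0..T}"
  shows "((\<lambda>s. H.nrm (w s - w t)) \<longlongrightarrow> 0) (at t within {0..T})"
proof -
  obtain K where K: "K > 0" "\<And>t. t \<in> {0..T} \<Longrightarrow> H.nrm (w t) \<le> K"
    by (rule path_bounded, rule that)
  have wt: "w t \<in> H" using wH t by auto
  have weak: "((\<lambda>s. ipH (w s - w t) (w t)) \<longlongrightarrow> 0) (at t within {0..T})"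
  proof (rule tendstoI)
    fix e :: real assume e: "e > 0"
    obtain y where y: "\<And>n. res (1 / real (Suc n)) (w t) (y n)"
      using res_exists[OF inv_Suc(2) wt] by metis
    have "\<forall>\<^sub>F n in sequentially. H.nrm (y n - w t) < e / (4 * K)"
      by (rule order_tendstoD(2)[OF res_tendsto_H[OF y wt]]) (use e K in auto)
    then obtain n where n: "H.nrm (y n - w t) < e / (4 * K)"
      by (auto simp: eventually_sequentially)
    define \<phi> where "\<phi> = y n"
    have \<phi>: "\<phi> \<in> V" using resV[OF y] by (simp add: \<phi>_def)
    have "((\<lambda>s. \<bar>b s - b t\<bar> * V.nrm \<phi>) \<longlongrightarrow> \<bar>b t - b t\<bar> * V.nrm \<phi>) (at t within {0..T})"
      using b_cont[of "{0..T}"] t by (intro tendsto_intros) (auto simp: continuous_on_def)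
    then have "\<forall>\<^sub>F s in at t within {0..T}. \<bar>b s - b t\<bar> * V.nrm \<phi> < e / 2"
      by (rule order_tendstoD(2)) (use e in simp)
    moreover have "\<forall>\<^sub>F s in at t within {0..T}. s \<in> {0..T}"
      by (simp add: eventually_at_filter)
    ultimately show "\<forall>\<^sub>F s in at t within {0..T}. dist (ipH (w s - w t) (w t)) 0 < e"
    proof eventually_elim
      case (elim s)
      have ws: "w s \<in> H" using wH elim by auto
      have "ipH (w s - w t) (w t) = ipH (w s - w t) \<phi> - ipH (w s - w t) (\<phi> - w t)"
        using ws wt \<phi> by (simp add: H.diff_right)
      moreover have "\<bar>ipH (w s - w t) \<phi>\<bar> < e / 2"
        using path_bound'[OF t _ \<phi>, of s] elim by auto
      moreover have "\<bar>ipH (w s - w t) (\<phi> - w t)\<bar> \<le> (2 * K) * (e / (4 * K))"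
      proof -
        have "\<bar>ipH (w s - w t) (\<phi> - w t)\<bar> \<le> H.nrm (w s - w t) * H.nrm (\<phi> - w t)"
          by (rule H.Cauchy_Schwarz) (use ws wt \<phi> in auto)
        also have "\<dots> \<le> (2 * K) * (e / (4 * K))"
          using H.nrm_diff_le[OF ws wt] K(2)[OF t] K(2)[of s] elim n ws wt \<phi> K(1)
          by (intro mult_mono) (auto simp: \<phi>_def[symmetric])
        finally show ?thesis .
      qed
      ultimately show ?case using K(1) by (auto simp: dist_real_def)
    qed
  qed
  have "((\<lambda>s. ipH (w s) (w s) - ipH (w t) (w t) - 2 * ipH (w s - w t) (w t)) \<longlongrightarrow>
      ipH (w t) (w t) - ipH (w t) (w t) - 2 * 0) (at t within {0..T})"
    using energy_continuous t by (intro tendsto_intros weak) (auto simp: continuous_on_def)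
  then have "((\<lambda>s. ipH (w s) (w s) - ipH (w t) (w t) - 2 * ipH (w s - w t) (w t)) \<longlongrightarrow> 0) (at t within {0..T})"
    by simp
  moreover have "\<forall>\<^sub>F s in at t within {0..T}.
      ipH (w s) (w s) - ipH (w t) (w t) - 2 * ipH (w s - w t) (w t) = ipH (w s - w t) (w s - w t)"
    unfolding eventually_at_filter
    by (rule always_eventually) (use wH wt H.sym in \<open>auto simp: H.diff_left H.diff_right\<close>)
  ultimately have "((\<lambda>s. ipH (w s - w t) (w s - w t)) \<longlongrightarrow> 0) (at t within {0..T})"
    by (simp add: tendsto_cong)
  then have "((\<lambda>s. sqrt (ipH (w s - w t) (w s - w t))) \<longlongrightarrow> sqrt 0) (at t within {0..T})"
    by (intro tendsto_intros)
  then show ?thesis by (simp add: H.nrm_def)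
qed

end

section \<open>Square integrable functions\<close>

text \<open>Used for squares: an almost everywhere limit of functions bounded in L2 is again in L2,
  with the same bound and without a dominating function.\<close>

lemma Fatou_bound:
  fixes f :: "nat \<Rightarrow> 'a \<Rightarrow> real"
  assumes f: "\<And>n. integrable M (f n)" "\<And>n. AE x in M. 0 \<le> f n x" "\<And>n. (LINT x|M. f n x) \<le> C"
    and h: "h \<in> borel_measurable M" and lim: "AE x in M. (\<lambda>n. f n x) \<longlonglongrightarrow> h x"
  shows "integrable M h" "(LINT x|M. h x) \<le> C"
proof -
  have C: "0 \<le> C"
    using integral_nonneg_AE[OF f(2)[of 0]] f(3)[of 0] by linarith
  have "AE x in M. \<forall>n. 0 \<le> f n x" using f(2) by (simp add: AE_all_countable)
  with lim have h0: "AE x in M. 0 \<le> h x"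
    by eventually_elim (auto intro: LIMSEQ_le_const)
  have "(\<integral>\<^sup>+x. ennreal (h x) \<partial>M) = (\<integral>\<^sup>+x. liminf (\<lambda>n. ennreal (f n x)) \<partial>M)"
  proof (rule nn_integral_cong_AE)
    show "AE x in M. ennreal (h x) = liminf (\<lambda>n. ennreal (f n x))"
      using lim
    proof eventually_elim
      case (elim x)
      then have "(\<lambda>n. ennreal (f n x)) \<longlonglongrightarrow> ennreal (h x)" by (intro tendsto_intros)
      then show ?case by (simp add: lim_imp_Liminf)
    qed
  qed
  also have "\<dots> \<le> liminf (\<lambda>n. \<integral>\<^sup>+x. ennreal (f n x) \<partial>M)"
    by (rule nn_integral_liminf) (use f(1) in auto)
  also have "\<dots> \<le> ennreal C"
  proof (rule Liminf_le)
    show "\<forall>\<^sub>F n in sequentially. (\<integral>\<^sup>+x. ennreal (f n x) \<partial>M) \<le> ennreal C"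
      using f by (auto simp: nn_integral_eq_integral intro!: always_eventually ennreal_leI)
  qed simp
  finally have le: "(\<integral>\<^sup>+x. ennreal (h x) \<partial>M) \<le> ennreal C" .
  show int: "integrable M h"
    by (rule integrableI_nonneg[OF h h0]) (use le in \<open>simp add: le_less_trans\<close>)
  have "ennreal (LINT x|M. h x) \<le> ennreal C"
    using le nn_integral_eq_integral[OF int h0] by simp
  then show "(LINT x|M. h x) \<le> C" using C by (simp add: ennreal_le_iff)
qed

text \<open>With weights \<open>4^k\<close> the squares still have a finite total integral, so at
  almost every point they are bounded by some \<open>S\<close>, and then the k-th term is at most
  \<open>sqrt S / 2^k\<close>. The rate 1/8 is chosen to leave room for these weights.\<close>

lemma AE_summable_of_fast:
  fixes \<delta> :: "nat \<Rightarrow> 'a \<Rightarrow> real"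
  assumes int: "\<And>k. integrable M (\<lambda>x. (\<delta> k x)\<^sup>2)" and le: "\<And>k. (LINT x|M. (\<delta> k x)\<^sup>2) \<le> (1/8)^k"
  shows "AE x in M. summable (\<lambda>k. \<bar>\<delta> k x\<bar>)"
proof -
  have "(\<integral>\<^sup>+x. (\<Sum>k. ennreal (4^k * (\<delta> k x)\<^sup>2)) \<partial>M) = (\<Sum>k. \<integral>\<^sup>+x. ennreal (4^k * (\<delta> k x)\<^sup>2) \<partial>M)"
  proof (rule nn_integral_suminf)
    fix k
    have [measurable]: "(\<lambda>x. (\<delta> k x)\<^sup>2) \<in> borel_measurable M" using int by auto
    show "(\<lambda>x. ennreal (4^k * (\<delta> k x)\<^sup>2)) \<in> borel_measurable M" by measurable
  qed
  also have "\<dots> \<le> (\<Sum>k. ennreal ((1/2)^k))"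
  proof (rule suminf_le)
    fix k
    have "(\<integral>\<^sup>+x. ennreal (4^k * (\<delta> k x)\<^sup>2) \<partial>M) = ennreal (4^k * (LINT x|M. (\<delta> k x)\<^sup>2))"
      using int[of k] by (subst nn_integral_eq_integral) auto
    also have "\<dots> \<le> ennreal (4^k * (1/8)^k)"
      by (intro ennreal_leI mult_left_mono le) auto
    also have "4^k * (1/8)^k = ((1/2)^k :: real)" by (simp flip: power_mult_distrib)
    finally show "(\<integral>\<^sup>+x. ennreal (4^k * (\<delta> k x)\<^sup>2) \<partial>M) \<le> ennreal ((1/2)^k)" .
  qed auto
  also have "\<dots> = ennreal (\<Sum>k. (1/2)^k)"
    by (rule suminf_ennreal2) (auto simp: summable_geometric)
  finally have fin: "(\<integral>\<^sup>+x. (\<Sum>k. ennreal (4^k * (\<delta> k x)\<^sup>2)) \<partial>M) \<noteq> \<infinity>"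
    by (auto simp: top_unique)
  have "AE x in M. (\<Sum>k. ennreal (4^k * (\<delta> k x)\<^sup>2)) \<noteq> \<infinity>"
  proof (rule nn_integral_PInf_AE[OF _ fin])
    have [measurable]: "(\<lambda>x. (\<delta> k x)\<^sup>2) \<in> borel_measurable M" for k using int by auto
    show "(\<lambda>x. \<Sum>k. ennreal (4^k * (\<delta> k x)\<^sup>2)) \<in> borel_measurable M" by measurable
  qed
  then show ?thesis
  proof eventually_elim
    case (elim x)
    then have "summable (\<lambda>k. 4^k * (\<delta> k x)\<^sup>2)"
      by (intro summable_suminf_not_top) auto
    then have "Bseq (\<lambda>k. 4^k * (\<delta> k x)\<^sup>2)"
      by (intro convergent_imp_Bseq) (auto simp: convergent_def dest: summable_LIMSEQ_zero)
    then obtain S where S: "S > 0" "\<And>k. \<bar>4^k * (\<delta> k x)\<^sup>2\<bar> \<le> S"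
      by (auto simp: Bseq_def)
    have B: "\<bar>\<delta> k x\<bar> \<le> sqrt S * (1/2)^k" for k
    proof -
      have "(2^k * \<bar>\<delta> k x\<bar>)\<^sup>2 \<le> (sqrt S)\<^sup>2"
      proof -
        have "(2^k)\<^sup>2 = (4::real)^k" by (simp add: power2_eq_square flip: power_mult_distrib)
        then show ?thesis using S(2)[of k] S(1) by (simp add: power_mult_distrib)
      qed
      then have "2^k * \<bar>\<delta> k x\<bar> \<le> sqrt S"
        by (rule power2_le_imp_le) (use S in auto)
      then show ?thesis by (simp add: field_simps)
    qed
    have "summable (\<lambda>k. sqrt S * (1/2)^k)"
      by (rule summable_mult, rule summable_geometric) simp
    then show ?case
      by (rule summable_comparison_test'[where N=0]) (use B in simp)
  qed
qed

lemma fast_subsequence: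
  fixes d :: "nat \<Rightarrow> nat \<Rightarrow> real"
  assumes "\<And>e. e > 0 \<Longrightarrow> \<exists>N. \<forall>m\<ge>N. \<forall>n\<ge>N. d m n < e"
  obtains r :: "nat \<Rightarrow> nat" where "strict_mono r" "\<And>k m n. \<lbrakk>m \<ge> r k; n \<ge> r k\<rbrakk> \<Longrightarrow> d m n < (1/8)^k"
proof -
  have "\<exists>N. \<forall>m\<ge>N. \<forall>n\<ge>N. d m n < (1/8)^k" for k by (rule assms) simp
  then obtain N where N: "\<And>k m n. \<lbrakk>m \<ge> N k; n \<ge> N k\<rbrakk> \<Longrightarrow> d m n < (1/8)^k" by metis
  define r where "r k = (\<Sum>i\<le>k. Suc (N i))" for k
  have "strict_mono r" by (rule strict_mono_Suc_iff[THEN iffD2]) (simp add: r_def)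
  moreover have "N k \<le> r k" for k
    unfolding r_def by (rule order_trans[OF _ member_le_sum[of k]]) auto
  ultimately show ?thesis using that[of r] N by (meson order_trans)
qed

lemma summable_imp_Cauchy_sum:
  fixes s :: "nat \<Rightarrow> real"
  assumes "summable (\<lambda>k. \<bar>s (Suc k) - s k\<bar>)" shows "convergent s"
proof -
  have "summable (\<lambda>k. s (Suc k) - s k)" using assms by (rule summable_rabs_cancel)
  then have "convergent (\<lambda>n. \<Sum>k<n. s (Suc k) - s k)" by (simp add: summable_iff_convergent)
  then have "convergent (\<lambda>n. s n - s 0)" by (simp add: sum_lessThan_telescope)
  then have "convergent (\<lambda>n. (s n - s 0) + s 0)" by (intro convergent_add convergent_const)
  then show ?thesis by simp
qed

lemma L2_measurable: "v \<in> L2_space \<Omega> \<Longrightarrow> v \<in> borel_measurable (lebesgue_on \<Omega>)"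
  and L2_square_integrable: "v \<in> L2_space \<Omega> \<Longrightarrow> integrable (lebesgue_on \<Omega>) (\<lambda>x. (v x)\<^sup>2)"
  by (auto simp: L2_space_def)

lemma L2_mult_integrable:
  assumes "v \<in> L2_space \<Omega>" "w \<in> L2_space \<Omega>"
  shows "integrable (lebesgue_on \<Omega>) (\<lambda>x. v x * w x)"
proof (rule Bochner_Integration.integrable_bound)
  show "integrable (lebesgue_on \<Omega>) (\<lambda>x. (v x)\<^sup>2 + (w x)\<^sup>2)"
    by (intro Bochner_Integration.integrable_add L2_square_integrable assms)
  have "\<bar>v x * w x\<bar> \<le> (v x)\<^sup>2 + (w x)\<^sup>2" for x
  proof -
    have "0 \<le> \<bar>v x\<bar> * \<bar>w x\<bar>" by simp
    then show ?thesis
      using sum_squares_bound[of "\<bar>v x\<bar>" "\<bar>w x\<bar>"] unfolding abs_mult power2_abs by linarith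
  qed
  then show "AE x in lebesgue_on \<Omega>. norm (v x * w x) \<le> norm ((v x)\<^sup>2 + (w x)\<^sup>2)"
    by (auto intro!: always_eventually)
qed (intro borel_measurable_times L2_measurable assms)

lemma L2_subspace: "subspace (L2_space \<Omega>)"
proof (rule subspaceI)
  fix v w assume vw: "v \<in> L2_space \<Omega>" "w \<in> L2_space \<Omega>"
  have [measurable]: "v \<in> borel_measurable (lebesgue_on \<Omega>)" "w \<in> borel_measurable (lebesgue_on \<Omega>)"
    using vw L2_measurable by auto
  have "(\<lambda>x. (v x + w x)\<^sup>2) = (\<lambda>x. (v x)\<^sup>2 + (w x)\<^sup>2 + 2 * (v x * w x))"
    by (auto simp: power2_sum)
  then show "v + w \<in> L2_space \<Omega>"
    using L2_mult_integrable[OF vw] vw[THEN L2_square_integrable] by (simp add: L2_space_def plus_fun_def)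
next
  fix c :: real and v assume v: "v \<in> L2_space \<Omega>"
  then show "c *\<^sub>R v \<in> L2_space \<Omega>"
    by (auto simp: L2_space_def scaleR_fun_def power_mult_distrib)
qed (auto simp: L2_space_def zero_fun_def)

lemma L2_semi_inner: "semi_inner (L2_space \<Omega>) (L2_inner \<Omega>)"
proof
  fix x y z assume "x \<in> L2_space \<Omega>" "y \<in> L2_space \<Omega>" "z \<in> L2_space \<Omega>"
  then show "L2_inner \<Omega> (x + y) z = L2_inner \<Omega> x z + L2_inner \<Omega> y z"
    by (simp add: L2_inner_def distrib_right L2_mult_integrable)
qed (auto simp: L2_inner_def L2_subspace mult.commute mult.left_commute mult.assoc)

lemma L2_nrm: "semi_inner.nrm (L2_inner \<Omega>) = L2_norm \<Omega>"
  by (rule ext) (simp add: semi_inner.nrm_def[OF L2_semi_inner] L2_norm_def)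

text \<open>Riesz-Fischer: a rapidly converging subsequence has an almost everywhere limit, and the
  Fatou bound shows that the whole sequence tends to it in norm.\<close>

lemma L2_hilbert:
  assumes \<Omega>: "\<Omega> \<in> sets lebesgue"
  shows "semi_hilbert (L2_space \<Omega>) (L2_inner \<Omega>)"
proof -
  interpret semi_inner "L2_space \<Omega>" "L2_inner \<Omega>" by (rule L2_semi_inner)
  have sq: "(nrm x)\<^sup>2 = (LINT t|lebesgue_on \<Omega>. (x t)\<^sup>2)" if "x \<in> L2_space \<Omega>" for x
    using nrm_sq[OF that] by (simp add: L2_inner_def power2_eq_square)
  show ?thesis
  proof
    fix s :: "nat \<Rightarrow> 'a \<Rightarrow> real"
    assume s: "\<And>n. s n \<in> L2_space \<Omega>"
      and cau: "\<And>e. e > 0 \<Longrightarrow> \<exists>N. \<forall>m\<ge>N. \<forall>n\<ge>N. nrm (s m - s n) < e"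
    have "\<exists>N. \<forall>m\<ge>N. \<forall>n\<ge>N. (nrm (s m - s n))\<^sup>2 < e" if e: "e > 0" for e
    proof -
      obtain N where N: "\<And>m n. m \<ge> N \<Longrightarrow> n \<ge> N \<Longrightarrow> nrm (s m - s n) < sqrt e"
        using cau[of "sqrt e"] e by auto
      have "(nrm (s m - s n))\<^sup>2 < e" if "m \<ge> N" "n \<ge> N" for m n
      proof -
        have "(nrm (s m - s n))\<^sup>2 < (sqrt e)\<^sup>2"
          by (rule power_strict_mono[OF N[OF that]]) (use s in auto)
        then show ?thesis using \<open>e > 0\<close> by simp
      qed
      then show ?thesis by blast
    qed
    note C = this
    obtain r where r: "strict_mono r"
      and fast: "\<And>k m n. \<lbrakk>m \<ge> r k; n \<ge> r k\<rbrakk> \<Longrightarrow> (nrm (s m - s n))\<^sup>2 < (1/8)^k"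
      by (rule fast_subsequence[of "\<lambda>m n. (nrm (s m - s n))\<^sup>2"], erule C, rule that)
    define l where "l x = lim (\<lambda>k. s (r k) x)" for x
    have meas: "s n \<in> borel_measurable (lebesgue_on \<Omega>)" for n using s L2_measurable by auto
    have lm [measurable]: "l \<in> borel_measurable (lebesgue_on \<Omega>)"
      unfolding l_def by (rule borel_measurable_lim_metric) (rule meas)
    have "AE x in lebesgue_on \<Omega>. summable (\<lambda>k. \<bar>(s (r (Suc k)) - s (r k)) x\<bar>)"
    proof (rule AE_summable_of_fast)
      fix k
      show "integrable (lebesgue_on \<Omega>) (\<lambda>x. ((s (r (Suc k)) - s (r k)) x)\<^sup>2)"
        by (rule L2_square_integrable[OF mem_diff[OF s s]])
      have "r k \<le> r (Suc k)" using r by (simp add: strict_mono_less_eq)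
      then show "(LINT x|lebesgue_on \<Omega>. ((s (r (Suc k)) - s (r k)) x)\<^sup>2) \<le> (1/8)^k"
        using fast[of k "r (Suc k)" "r k"] sq[of "s (r (Suc k)) - s (r k)"] s by simp
    qed
    then have lim: "AE x in lebesgue_on \<Omega>. (\<lambda>k. s (r k) x) \<longlonglongrightarrow> l x"
      unfolding l_def
      by eventually_elim (auto dest!: summable_imp_Cauchy_sum[of "\<lambda>k. s (r k) _"] simp: convergent_LIMSEQ_iff)
    \<comment> \<open>Fatou along the subsequence with \<open>m\<close> fixed; starting it at
      \<open>r j\<close> keeps all the distances below \<open>(1/8)^j\<close>.\<close>
    have key: "integrable (lebesgue_on \<Omega>) (\<lambda>x. (s m x - l x)\<^sup>2) \<and> (LINT x|lebesgue_on \<Omega>. (s m x - l x)\<^sup>2) \<le> (1/8)^j"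
      if "m \<ge> r j" for m j
    proof -
      have le: "(LINT x|lebesgue_on \<Omega>. ((s m - s (r (k + j))) x)\<^sup>2) \<le> (1/8)^j" for k
      proof -
        have "r j \<le> r (k + j)" using r by (simp add: strict_mono_less_eq)
        then show ?thesis using fast[of j m "r (k + j)"] that sq[of "s m - s (r (k + j))"] s by simp
      qed
      have *: "AE x in lebesgue_on \<Omega>. (\<lambda>k. ((s m - s (r (k + j))) x)\<^sup>2) \<longlonglongrightarrow> (s m x - l x)\<^sup>2"
        using lim
      proof eventually_elim
        case (elim x)
        show ?case
          using LIMSEQ_ignore_initial_segment[OF elim, of j] by (auto intro!: tendsto_intros)
      qed
      have sm [measurable]: "s m \<in> borel_measurable (lebesgue_on \<Omega>)" by (rule meas)
      have i: "integrable (lebesgue_on \<Omega>) (\<lambda>x. ((s m - s (r (k + j))) x)\<^sup>2)" for k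
        by (rule L2_square_integrable[OF mem_diff[OF s s]])
      show ?thesis
        by (intro conjI Fatou_bound[OF i _ le _ *]) auto
    qed
    have "s (r 0) - l \<in> L2_space \<Omega>"
      using key[of 0 "r 0"] meas[of "r 0"] by (auto simp: L2_space_def fun_diff_def)
    then have "s (r 0) - (s (r 0) - l) \<in> L2_space \<Omega>" using s mem_diff by blast
    then have lL: "l \<in> L2_space \<Omega>" by simp
    have "(\<lambda>n. nrm (s n - l)) \<longlonglongrightarrow> 0"
    proof (rule LIMSEQ_I)
      fix e :: real assume e: "e > 0"
      have "(\<lambda>j. (1/8::real)^j) \<longlonglongrightarrow> 0" by (rule LIMSEQ_power_zero) simp
      then have "\<forall>\<^sub>F j in sequentially. (1/8::real)^j < e\<^sup>2"
        by (rule order_tendstoD) (use e in simp)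
      then obtain j where j: "(1/8::real)^j < e\<^sup>2" by (auto simp: eventually_sequentially)
      have "norm (nrm (s n - l) - 0) < e" if "n \<ge> r j" for n
      proof -
        have "(nrm (s n - l))\<^sup>2 < e\<^sup>2"
          using key[OF that] sq[of "s n - l"] s lL j by simp
        then have "nrm (s n - l) < e" by (rule power_less_imp_less_base) (use e in auto)
        then show ?thesis using s lL by simp
      qed
      then show "\<exists>N. \<forall>n\<ge>N. norm (nrm (s n - l) - 0) < e" by blast
    qed
    with lL show "\<exists>x\<in>L2_space \<Omega>. (\<lambda>n. nrm (s n - x)) \<longlonglongrightarrow> 0" by blast
  qed
qed

lemma L2_null_iff:
  assumes "v \<in> L2_space \<Omega>"
  shows "L2_inner \<Omega> v v = 0 \<longleftrightarrow> (AE x in lebesgue_on \<Omega>. v x = 0)"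
  using integral_nonneg_eq_0_iff_AE[of "lebesgue_on \<Omega>" "\<lambda>x. v x * v x"] L2_mult_integrable[OF assms assms]
  by (simp add: L2_inner_def)

section \<open>Test functions\<close>

lemma Ck_SucI:
  assumes "\<And>x. (\<psi> has_derivative D x) (at x)" "\<And>b. b \<in> Basis \<Longrightarrow> Ck k (\<lambda>x. D x b)"
  shows "Ck (Suc k) \<psi>"
proof -
  have "frechet_derivative \<psi> (at x) = D x" for x
    using frechet_derivative_at[OF assms(1)] by simp
  then show ?thesis using assms by (auto simp: differentiable_def)
qed

lemma Ck_SucE:
  assumes "Ck (Suc k) \<psi>"
  obtains D where "\<And>x. (\<psi> has_derivative D x) (at x)" "\<And>b. b \<in> Basis \<Longrightarrow> Ck k (\<lambda>x. D x b)"
    "\<And>x. frechet_derivative \<psi> (at x) = D x"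
  using assms by (intro that[of "\<lambda>x. frechet_derivative \<psi> (at x)"]) (auto simp: frechet_derivative_works)

lemma Ck_Suc_D: "Ck (Suc k) \<psi> \<Longrightarrow> Ck k \<psi>"
proof (induction k arbitrary: \<psi>)
  case 0
  then show ?case
    by (auto intro: continuous_at_imp_continuous_on differentiable_imp_continuous_within)
next
  case (Suc k)
  then show ?case by (metis Ck.simps(2))
qed

lemma Ck_imp_continuous: "Ck k \<psi> \<Longrightarrow> continuous_on UNIV \<psi>"
  by (induction k) (auto intro: continuous_at_imp_continuous_on differentiable_imp_continuous_within)

lemma Ck_const: "Ck k (\<lambda>x. c)"
proof (induction k arbitrary: c)
  case (Suc k)
  show ?case by (rule Ck_SucI[of _ "\<lambda>x h. 0"]) (auto intro!: Suc)
qed simp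

lemma Ck_add: "Ck k \<phi> \<Longrightarrow> Ck k \<psi> \<Longrightarrow> Ck k (\<lambda>x. \<phi> x + \<psi> x)"
proof (induction k arbitrary: \<phi> \<psi>)
  case (Suc k)
  obtain D where D: "\<And>x. (\<phi> has_derivative D x) (at x)" "\<And>b. b \<in> Basis \<Longrightarrow> Ck k (\<lambda>x. D x b)"
    using Ck_SucE[OF Suc.prems(1)] by metis
  obtain E where E: "\<And>x. (\<psi> has_derivative E x) (at x)" "\<And>b. b \<in> Basis \<Longrightarrow> Ck k (\<lambda>x. E x b)"
    using Ck_SucE[OF Suc.prems(2)] by metis
  show ?case
    by (rule Ck_SucI[of _ "\<lambda>x h. D x h + E x h"]) (auto intro!: D E Suc.IH has_derivative_add)
qed (auto intro: continuous_on_add)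

lemma Ck_mult: "Ck k \<phi> \<Longrightarrow> Ck k \<psi> \<Longrightarrow> Ck k (\<lambda>x. \<phi> x * \<psi> x)"
proof (induction k arbitrary: \<phi> \<psi>)
  case (Suc k)
  obtain D where D: "\<And>x. (\<phi> has_derivative D x) (at x)" "\<And>b. b \<in> Basis \<Longrightarrow> Ck k (\<lambda>x. D x b)"
    using Ck_SucE[OF Suc.prems(1)] by metis
  obtain E where E: "\<And>x. (\<psi> has_derivative E x) (at x)" "\<And>b. b \<in> Basis \<Longrightarrow> Ck k (\<lambda>x. E x b)"
    using Ck_SucE[OF Suc.prems(2)] by metis
  show ?case
  proof (rule Ck_SucI)
    show "((\<lambda>x. \<phi> x * \<psi> x) has_derivative (\<lambda>h. \<phi> x * E x h + D x h * \<psi> x)) (at x)" for x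
      by (rule has_derivative_mult[OF D(1) E(1)])
    show "Ck k (\<lambda>x. \<phi> x * E x b + D x b * \<psi> x)" if "b \<in> Basis" for b
      by (intro Ck_add Suc.IH D(2) E(2) that Ck_Suc_D[OF Suc.prems(1)] Ck_Suc_D[OF Suc.prems(2)])
  qed
qed (auto intro: continuous_on_mult)

lemma Ck_cmult: "Ck k \<phi> \<Longrightarrow> Ck k (\<lambda>x. c * \<phi> x)"
  by (intro Ck_mult Ck_const)

lemma Ck_prod: "(\<And>i. i \<in> I \<Longrightarrow> Ck k (f i)) \<Longrightarrow> Ck k (\<lambda>x. \<Prod>i\<in>I. f i x)"
  by (induction I rule: infinite_finite_induct) (auto intro: Ck_const Ck_mult)

lemma Ck_real_SucI:
  fixes F F' :: "real \<Rightarrow> real"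
  assumes "\<And>y. (F has_real_derivative F' y) (at y)" "Ck k F'"
  shows "Ck (Suc k) F"
  by (rule Ck_SucI[of _ "\<lambda>x h. F' x * h"]) (use assms in \<open>auto simp: has_field_derivative_def\<close>)

lemma Ck_real_SucE:
  fixes F :: "real \<Rightarrow> real"
  assumes "Ck (Suc k) F"
  obtains F' where "\<And>y. (F has_real_derivative F' y) (at y)" "Ck k F'" "deriv F = F'"
proof -
  obtain D where D: "\<And>x. (F has_derivative D x) (at x)" "\<And>b. b \<in> Basis \<Longrightarrow> Ck k (\<lambda>x. D x b)"
    using Ck_SucE[OF assms] by metis
  have der: "(F has_real_derivative D y 1) (at y)" for y
  proof -
    have "D y h = D y 1 * h" for h
      using linear_scale[OF has_derivative_linear[OF D(1)], of y h 1] by simp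
    then have "D y = (*) (D y 1)" by (rule ext)
    then show ?thesis using D(1)[of y] by (simp add: has_field_derivative_def)
  qed
  show ?thesis
  proof (rule that[of "\<lambda>y. D y 1"])
    show "Ck k (\<lambda>y. D y 1)" by (rule D(2)) simp
    show "deriv F = (\<lambda>y. D y 1)" using DERIV_imp_deriv[OF der] by (rule ext)
  qed (rule der)
qed

lemma Ck_affine_comp:
  fixes F :: "real \<Rightarrow> real" and v :: "'a::euclidean_space"
  shows "Ck k F \<Longrightarrow> Ck k (\<lambda>x. F (x \<bullet> v + c))"
proof (induction k arbitrary: F)
  case 0
  then show ?case
    by (auto intro!: continuous_on_compose2[of UNIV F] continuous_intros)
next
  case (Suc k)
  obtain F' where F': "\<And>y. (F has_real_derivative F' y) (at y)" "Ck k F'"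
    using Ck_real_SucE[OF Suc.prems] by metis
  show ?case
  proof (rule Ck_SucI)
    show "((\<lambda>x. F (x \<bullet> v + c)) has_derivative (\<lambda>h. F' (x \<bullet> v + c) * (h \<bullet> v))) (at x)" for x
    proof -
      have "((\<lambda>x. x \<bullet> v + c) has_derivative (\<lambda>h. h \<bullet> v)) (at x)"
        by (auto intro!: derivative_eq_intros)
      from has_derivative_compose[OF this F'(1)[unfolded has_field_derivative_def]]
      show ?thesis .
    qed
    show "Ck k (\<lambda>x. F' (x \<bullet> v + c) * (b \<bullet> v))" for b
      by (intro Ck_mult Ck_const Suc.IH F')
  qed
qed

section \<open>Smooth bumps on boxes\<close>

definition bump_exp :: "real poly \<Rightarrow> real \<Rightarrow> real" where
  "bump_exp p x = (if x > 0 then poly p (1 / x) * exp (- 1 / x) else 0)"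

lemma poly_exp_tendsto_0: "((\<lambda>y. poly p y * exp (- y)) \<longlongrightarrow> (0::real)) at_top"
proof -
  have "((\<lambda>y. \<Sum>i\<le>degree p. coeff p i * (y ^ i / exp y)) \<longlongrightarrow> (\<Sum>i\<le>degree p. coeff p i * 0)) at_top"
    by (intro tendsto_intros tendsto_power_div_exp_0)
  then show ?thesis
    by (simp add: poly_altdef sum_distrib_right exp_minus divide_inverse mult.assoc)
qed

text \<open>Functions of the form p(1/x) exp(-1/x), continued by zero, are closed under
  differentiation: with y = 1/x the new polynomial is y^2 (p - p'). This makes smoothness an
  induction. At the origin the difference quotient is y p(y) exp(-y) with y tending to
  infinity.\<close>

lemma bump_exp_deriv:
  "(bump_exp p has_real_derivative bump_exp ([:0, 0, 1:] * (p - pderiv p)) x) (at x)"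
proof -
  let ?q = "[:0, 0, 1:] * (p - pderiv p)"
  consider "x > 0" | "x < 0" | "x = 0" by linarith
  then show ?thesis
  proof cases
    case 1
    have "((\<lambda>x. poly p (1 / x) * exp (- 1 / x)) has_real_derivative bump_exp ?q x) (at x)"
      using 1 by (auto intro!: derivative_eq_intros DERIV_chain'[OF _ poly_DERIV]
          simp: bump_exp_def field_simps power2_eq_square)
    moreover have "\<forall>\<^sub>F y in nhds x. y > 0" using 1 by (rule eventually_nhds_in_open[of "{0<..}" x, simplified])
    then have "\<forall>\<^sub>F y in nhds x. poly p (1 / y) * exp (- 1 / y) = bump_exp p y"
      by eventually_elim (simp add: bump_exp_def)
    ultimately show ?thesis
      by (subst (asm) DERIV_cong_ev[OF refl _ refl]) auto
  next
    case 2
    have "((\<lambda>x. 0) has_real_derivative bump_exp ?q x) (at x)"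
      using 2 by (simp add: bump_exp_def)
    moreover have "\<forall>\<^sub>F y in nhds x. y < 0" using 2 by (rule eventually_nhds_in_open[of "{..<0}" x, simplified])
    then have "\<forall>\<^sub>F y in nhds x. 0 = bump_exp p y"
      by eventually_elim (simp add: bump_exp_def)
    ultimately show ?thesis
      by (subst (asm) DERIV_cong_ev[OF refl _ refl]) auto
  next
    case 3
    have "((\<lambda>h. (bump_exp p (0 + h) - bump_exp p 0) / h) \<longlongrightarrow> 0) (at 0)"
    proof (rule filterlim_split_at)
      have "\<forall>\<^sub>F h in at_left (0::real). 0 = (bump_exp p (0 + h) - bump_exp p 0) / h"
        by (auto simp: eventually_at_filter bump_exp_def)
      then show "((\<lambda>h. (bump_exp p (0 + h) - bump_exp p 0) / h) \<longlongrightarrow> 0) (at_left 0)"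
        by (rule Lim_transform_eventually[OF tendsto_const])
      have "((\<lambda>h. poly ([:0, 1:] * p) (inverse h) * exp (- inverse h)) \<longlongrightarrow> 0) (at_right 0)"
        by (rule filterlim_compose[OF poly_exp_tendsto_0 filterlim_inverse_at_top_right])
      moreover have "\<forall>\<^sub>F h in at_right (0::real).
          poly ([:0, 1:] * p) (inverse h) * exp (- inverse h) = (bump_exp p (0 + h) - bump_exp p 0) / h"
        by (auto simp: eventually_at_filter bump_exp_def inverse_eq_divide)
      ultimately show "((\<lambda>h. (bump_exp p (0 + h) - bump_exp p 0) / h) \<longlongrightarrow> 0) (at_right 0)"
        by (rule Lim_transform_eventually)
    qed
    then show ?thesis using 3 by (simp add: DERIV_def bump_exp_def)
  qed
qed

lemma bump_exp_Ck: "Ck k (bump_exp p)"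
proof (induction k arbitrary: p)
  case 0
  then show ?case
    using bump_exp_deriv[of p] by (auto intro!: continuous_at_imp_continuous_on DERIV_isCont)
next
  case (Suc k)
  show ?case by (rule Ck_real_SucI[OF bump_exp_deriv Suc])
qed

abbreviation smooth_step :: "real \<Rightarrow> real" where "smooth_step \<equiv> bump_exp 1"

lemma smooth_step: "smooth_step x = (if x > 0 then exp (- 1 / x) else 0)"
  by (simp add: bump_exp_def)

text \<open>\<open>n\<close> is a steepness: for growing \<open>n\<close> the bumps tend to the
  indicator of the open box. The arguments are written in the affine form that
  \<open>Ck_affine_comp\<close> accepts.\<close>

definition box_bump :: "'a::euclidean_space \<Rightarrow> 'a \<Rightarrow> nat \<Rightarrow> 'a \<Rightarrow> real" where
  "box_bump a b n x = (\<Prod>i\<in>Basis. smooth_step (x \<bullet> (real n *\<^sub>R i) + - real n * (a \<bullet> i)) *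
    smooth_step (x \<bullet> (- real n *\<^sub>R i) + real n * (b \<bullet> i)))"

lemma box_bump_Ck: "Ck k (box_bump a b n)"
  unfolding box_bump_def by (intro Ck_prod Ck_mult Ck_affine_comp bump_exp_Ck)

lemma smooth_step_range: "0 \<le> smooth_step x" "smooth_step x \<le> 1"
  by (auto simp: smooth_step)

lemma box_bump_range: "0 \<le> box_bump a b n x" "box_bump a b n x \<le> 1"
  unfolding box_bump_def
  by (auto intro!: prod_nonneg prod_le_1 mult_nonneg_nonneg mult_le_one smooth_step_range)

lemma box_bump_pos_iff: "n > 0 \<Longrightarrow> box_bump a b n x \<noteq> 0 \<longleftrightarrow> x \<in> box a b"
proof -
  assume n: "n > 0"
  have nz: "smooth_step y \<noteq> 0 \<longleftrightarrow> y > 0" for y by (simp add: smooth_step)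
  have eq: "x \<bullet> (real n *\<^sub>R i) + - real n * (a \<bullet> i) = real n * (x \<bullet> i - a \<bullet> i)"
    "x \<bullet> (- real n *\<^sub>R i) + real n * (b \<bullet> i) = real n * (b \<bullet> i - x \<bullet> i)" for i
    by (simp_all add: right_diff_distrib)
  have "box_bump a b n x \<noteq> 0 \<longleftrightarrow> (\<forall>i\<in>Basis. smooth_step (real n * (x \<bullet> i - a \<bullet> i)) \<noteq> 0 \<and>
      smooth_step (real n * (b \<bullet> i - x \<bullet> i)) \<noteq> 0)"
    unfolding box_bump_def eq by (simp add: prod_zero_iff)
  then show ?thesis using n unfolding nz by (simp add: mem_box zero_less_mult_iff)
qed

lemma box_bump_tendsto: "(\<lambda>n. box_bump a b (Suc n) x) \<longlonglongrightarrow> indicator (box a b) x"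
proof (cases "x \<in> box a b")
  case True
  have step: "(\<lambda>n. smooth_step (real (Suc n) * c)) \<longlonglongrightarrow> 1" if "c > 0" for c
  proof -
    have "(\<lambda>n. exp (- 1 / c * (1 / real (Suc n)))) \<longlonglongrightarrow> exp (- 1 / c * 0)"
      using LIMSEQ_inverse_real_of_nat unfolding inverse_eq_divide by (intro tendsto_intros)
    then show ?thesis using that by (simp add: smooth_step mult.commute del: of_nat_Suc)
  qed
  have "(\<lambda>n. box_bump a b (Suc n) x) \<longlonglongrightarrow> (\<Prod>i\<in>(Basis::'a set). 1 * 1)"
    unfolding box_bump_def
  proof (rule tendsto_prod, rule tendsto_mult)
    fix i :: 'a assume i: "i \<in> Basis"
    have "(\<lambda>n. smooth_step (real (Suc n) * (x \<bullet> i - a \<bullet> i))) \<longlonglongrightarrow> 1"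
      "(\<lambda>n. smooth_step (real (Suc n) * (b \<bullet> i - x \<bullet> i))) \<longlonglongrightarrow> 1"
      using True i by (intro step; simp add: mem_box)+
    then show "(\<lambda>n. smooth_step (x \<bullet> (real (Suc n) *\<^sub>R i) + - real (Suc n) * (a \<bullet> i))) \<longlonglongrightarrow> 1"
      "(\<lambda>n. smooth_step (x \<bullet> (- real (Suc n) *\<^sub>R i) + real (Suc n) * (b \<bullet> i))) \<longlonglongrightarrow> 1"
      by (simp_all add: right_diff_distrib del: of_nat_Suc)
  qed
  then show ?thesis using True by simp
next
  case False
  then have "box_bump a b (Suc n) x = 0" for n using box_bump_pos_iff[of "Suc n" a b x] by auto
  then show ?thesis using False by simp
qed

section \<open>Test functions and integration by parts\<close>

lemma test_functionsI:
  assumes "\<And>k. Ck k \<psi>" "\<And>x. \<psi> x \<noteq> 0 \<Longrightarrow> x \<in> K" "compact K" "K \<subseteq> \<Omega>"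
  shows "\<psi> \<in> test_functions \<Omega>"
proof -
  have "closure {x. \<psi> x \<noteq> 0} \<subseteq> K"
    using assms by (intro closure_minimal compact_imp_closed) auto
  moreover have "compact (closure {x. \<psi> x \<noteq> 0})"
    using calculation assms(3) by (metis closed_closure compact_Int_closed inf.absorb_iff2)
  ultimately show ?thesis using assms by (auto simp: test_functions_def)
qed

lemma box_bump_test: "cbox a b \<subseteq> \<Omega> \<Longrightarrow> box_bump a b (Suc n) \<in> test_functions \<Omega>"
  using box_bump_pos_iff[of "Suc n" a b]
  by (intro test_functionsI[of _ "cbox a b"]) (auto intro: box_bump_Ck subsetD[OF box_subset_cbox])

lemma mem_support: "\<psi> x \<noteq> 0 \<Longrightarrow> x \<in> closure {x. \<psi> x \<noteq> 0}"
  by (rule subsetD[OF closure_subset]) simp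

lemma test_functions_add:
  assumes "\<phi> \<in> test_functions \<Omega>" "\<psi> \<in> test_functions \<Omega>"
  shows "(\<lambda>x. \<phi> x + \<psi> x) \<in> test_functions \<Omega>"
proof (rule test_functionsI)
  show "x \<in> closure {x. \<phi> x \<noteq> 0} \<union> closure {x. \<psi> x \<noteq> 0}" if "\<phi> x + \<psi> x \<noteq> 0" for x
  proof -
    have "\<phi> x \<noteq> 0 \<or> \<psi> x \<noteq> 0" using that by auto
    then show ?thesis using mem_support[of \<phi> x] mem_support[of \<psi> x] by blast
  qed
qed (use assms in \<open>auto simp: test_functions_def intro: Ck_add\<close>)

lemma test_functions_cmult:
  assumes "\<phi> \<in> test_functions \<Omega>"
  shows "(\<lambda>x. c * \<phi> x) \<in> test_functions \<Omega>"
  by (rule test_functionsI[of _ "closure {x. \<phi> x \<noteq> 0}"])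
    (use assms mem_support[of \<phi>] in \<open>auto simp: test_functions_def intro: Ck_cmult\<close>)

lemma test_functions_zero: "(\<lambda>x. 0) \<in> test_functions \<Omega>"
  by (rule test_functionsI[of _ "{}"]) (auto intro: Ck_const)

lemma test_functionsD:
  assumes "\<psi> \<in> test_functions \<Omega>"
  shows "Ck k \<psi>" "continuous_on UNIV \<psi>" "(\<psi> has_derivative frechet_derivative \<psi> (at x)) (at x)"
    "b \<in> Basis \<Longrightarrow> continuous_on UNIV (\<lambda>x. frechet_derivative \<psi> (at x) b)"
    "x \<notin> \<Omega> \<Longrightarrow> \<psi> x = 0"
proof -
  have C: "Ck k \<psi>" for k using assms by (simp add: test_functions_def)
  show "Ck k \<psi>" by (rule C)
  show "continuous_on UNIV \<psi>" using C[of 0] by simp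
  show "(\<psi> has_derivative frechet_derivative \<psi> (at x)) (at x)"
    using C[of "Suc 0"] by (simp add: frechet_derivative_works)
  show "b \<in> Basis \<Longrightarrow> continuous_on UNIV (\<lambda>x. frechet_derivative \<psi> (at x) b)"
    using C[of "Suc 0"] by simp
  show "x \<notin> \<Omega> \<Longrightarrow> \<psi> x = 0"
    using assms closure_subset[of "{x. \<psi> x \<noteq> 0}"] by (auto simp: test_functions_def)
qed

text \<open>
  By translation invariance the difference quotients of \<open>h\<close> have integral zero.
\<close>

lemma integral_frechet_derivative_zero:
  fixes h :: "'a::euclidean_space \<Rightarrow> real"
  assumes D: "\<And>x. (h has_derivative D x) (at x)" and b: "b \<in> Basis"
    and cont: "continuous_on UNIV (\<lambda>x. D x b)" and K: "bounded K" "\<And>x. x \<notin> K \<Longrightarrow> h x = 0"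
  shows "(LINT x|lborel. D x b) = 0"
proof -
  obtain R where R: "\<And>x. h x \<noteq> 0 \<Longrightarrow> norm x \<le> R"
    using K bounded_iff by metis
  have hc: "continuous_on UNIV h"
    using D by (auto intro!: continuous_at_imp_continuous_on has_derivative_continuous)
  \<comment> \<open>The difference quotients live in the ball of radius R + 1, and the intermediate
    point of the mean value theorem is at most one unit away.\<close>
  obtain C where C: "C > 0" "\<And>x. x \<in> cball 0 (R + 2) \<Longrightarrow> \<bar>D x b\<bar> \<le> C"
  proof -
    have "bounded ((\<lambda>x. D x b) ` cball 0 (R + 2))"
      by (intro compact_imp_bounded compact_continuous_image continuous_on_subset[OF cont]) auto
    then show ?thesis using that by (auto simp: bounded_pos)
  qed
  define s where "s n = 1 / real (Suc n)" for n
  have s: "0 < s n" "s n \<le> 1" for n by (auto simp: s_def)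
  define q where "q n x = (h (x + s n *\<^sub>R b) - h x) / s n" for n x
  have hint: "integrable lborel h"
  proof -
    have "integrable lborel (\<lambda>x. indicator (cball 0 R) x *\<^sub>R h x)"
      by (rule borel_integrable_compact) (auto intro: continuous_on_subset[OF hc])
    moreover have "(\<lambda>x. indicator (cball 0 R) x *\<^sub>R h x) = h"
      using R by (auto simp: fun_eq_iff indicator_def)
    ultimately show ?thesis by simp
  qed
  have hm [measurable]: "h \<in> borel_measurable borel" using hc by (rule borel_measurable_continuous_onI)
  have Dm: "(\<lambda>x. D x b) \<in> borel_measurable borel" using cont by (rule borel_measurable_continuous_onI)
  have shift: "integrable lborel (\<lambda>x. h (x + c)) \<and> (LINT x|lborel. h (x + c)) = (LINT x|lborel. h x)" for c
  proof -
    have "(\<lambda>x. x + c) = (+) c" by (rule ext, rule add.commute)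
    then have e: "distr lborel borel (\<lambda>x. x + c) = lborel" using lborel_distr_plus[of c] by simp
    have "integral\<^sup>L (distr lborel borel (\<lambda>x. x + c)) h = (LINT x|lborel. h (x + c))"
      by (rule integral_distr) auto
    moreover have "integrable (distr lborel borel (\<lambda>x. x + c)) h = integrable lborel (\<lambda>x. h (x + c))"
      by (rule integrable_distr_eq) auto
    ultimately show ?thesis using hint unfolding e by simp
  qed
  have int0: "(LINT x|lborel. q n x) = 0" for n
    unfolding q_def using shift[of "s n *\<^sub>R b"] hint by simp
  have lim: "(\<lambda>n. LINT x|lborel. q n x) \<longlonglongrightarrow> (LINT x|lborel. D x b)"
  proof (rule integral_dominated_convergence[where w="\<lambda>x. C * indicator (cball 0 (R + 1)) x"])
    show "(\<lambda>x. D x b) \<in> borel_measurable lborel" using Dm by simp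
    show "q n \<in> borel_measurable lborel" for n
      unfolding q_def by measurable
    have "emeasure lborel (cball (0::'a) (R + 1)) < \<infinity>" by (rule emeasure_compact_finite) auto
    then show "integrable lborel (\<lambda>x::'a. C * indicator (cball 0 (R + 1)) x)"
      by (auto intro!: integrable_real_indicator)
    show "AE x in lborel. (\<lambda>n. q n x) \<longlonglongrightarrow> D x b"
    proof (rule AE_I2)
      fix x
      have "((\<lambda>t. h (x + t *\<^sub>R b)) has_derivative (\<lambda>t. D x (t *\<^sub>R b))) (at 0)"
      proof -
        have "((\<lambda>t. x + t *\<^sub>R b) has_derivative (\<lambda>t. t *\<^sub>R b)) (at 0)"
          by (auto intro!: derivative_eq_intros)
        from has_derivative_compose[OF this, of h "D x"] D[of x] show ?thesis by simp
      qed
      moreover have "(\<lambda>t. D x (t *\<^sub>R b)) = (*) (D x b)"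
        using has_derivative_linear[OF D[of x]] by (auto simp: fun_eq_iff linear_scale)
      ultimately have "((\<lambda>t. h (x + t *\<^sub>R b)) has_real_derivative D x b) (at 0)"
        by (simp add: has_field_derivative_def)
      then have "((\<lambda>t. (h (x + t *\<^sub>R b) - h x) / t) \<longlongrightarrow> D x b) (at 0)"
        by (simp add: DERIV_def)
      moreover have "filterlim s (at 0) sequentially"
      proof -
        have "s \<longlonglongrightarrow> 0"
          using LIMSEQ_inverse_real_of_nat unfolding inverse_eq_divide s_def .
        moreover have "\<forall>\<^sub>F n in sequentially. s n \<noteq> 0"
          using s(1) by (intro always_eventually allI) (metis less_irrefl)
        ultimately show ?thesis by (simp add: filterlim_at)
      qed
      ultimately show "(\<lambda>n. q n x) \<longlonglongrightarrow> D x b"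
        unfolding q_def by (rule filterlim_compose)
    qed
    show "AE x in lborel. norm (q n x) \<le> C * indicator (cball 0 (R + 1)) x" for n
    proof (rule AE_I2)
      fix x
      have nb: "norm (s n *\<^sub>R b) \<le> 1" using b s[of n] by simp
      show "norm (q n x) \<le> C * indicator (cball 0 (R + 1)) x"
      proof (cases "norm x \<le> R + 1")
        case False
        have "h x = 0" using R False by force
        moreover have "norm (x + s n *\<^sub>R b) > R"
          using norm_diff_ineq[of x "s n *\<^sub>R b"] nb False by linarith
        then have "h (x + s n *\<^sub>R b) = 0" using R by force
        ultimately show ?thesis using C by (simp add: q_def indicator_def)
      next
        case True
        have der: "((\<lambda>t. h (x + t *\<^sub>R b)) has_real_derivative D (x + t *\<^sub>R b) b) (at t)" for t
        proof -
          have "((\<lambda>t. x + t *\<^sub>R b) has_derivative (\<lambda>t. t *\<^sub>R b)) (at t)"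
            by (auto intro!: derivative_eq_intros)
          from has_derivative_compose[OF this D]
          have "((\<lambda>t. h (x + t *\<^sub>R b)) has_derivative (\<lambda>r. D (x + t *\<^sub>R b) (r *\<^sub>R b))) (at t)" .
          moreover have "(\<lambda>r. D (x + t *\<^sub>R b) (r *\<^sub>R b)) = (*) (D (x + t *\<^sub>R b) b)"
            using has_derivative_linear[OF D[of "x + t *\<^sub>R b"]] by (auto simp: fun_eq_iff linear_scale)
          ultimately show ?thesis by (simp add: has_field_derivative_def)
        qed
        obtain z where z: "0 < z" "z < s n"
          "h (x + s n *\<^sub>R b) - h (x + 0 *\<^sub>R b) = (s n - 0) * D (x + z *\<^sub>R b) b"
          using MVT2[OF s(1)[of n], of "\<lambda>t. h (x + t *\<^sub>R b)" "\<lambda>t. D (x + t *\<^sub>R b) b"] der by blast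
        have "norm (x + z *\<^sub>R b) \<le> R + 2"
          using norm_triangle_ineq[of x "z *\<^sub>R b"] True b z s(2)[of n] by simp
        then have "\<bar>D (x + z *\<^sub>R b) b\<bar> \<le> C" using C by simp
        moreover have "q n x = D (x + z *\<^sub>R b) b" using z s(1)[of n] by (simp add: q_def)
        ultimately show ?thesis using True by simp
      qed
    qed
  qed
  then have "(\<lambda>n. 0::real) \<longlonglongrightarrow> (LINT x|lborel. D x b)" by (simp add: int0)
  then show ?thesis using LIMSEQ_unique tendsto_const by blast
qed

lemma lebesgue_on_eq_lborel:
  assumes "\<Omega> \<in> sets borel" "h \<in> borel_measurable borel" "\<And>x. x \<notin> \<Omega> \<Longrightarrow> h x = (0::real)"
  shows "(LINT x|lebesgue_on \<Omega>. h x) = (LINT x|lborel. h x)"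
proof -
  have "(LINT x|lebesgue_on \<Omega>. h x) = (LINT x|lebesgue. indicator \<Omega> x *\<^sub>R h x)"
    using assms(1) by (intro integral_restrict_space) auto
  also have "(\<lambda>x. indicator \<Omega> x *\<^sub>R h x) = h" using assms(3) by (auto simp: indicator_def fun_eq_iff)
  also have "(LINT x|lebesgue. h x) = (LINT x|lborel. h x)"
    by (rule integral_completion) (use assms in simp)
  finally show ?thesis .
qed

lemma continuous_L2:
  fixes h :: "'a::euclidean_space \<Rightarrow> real"
  assumes "open \<Omega>" "bounded \<Omega>" and h: "continuous_on UNIV h" shows "h \<in> L2_space \<Omega>"
proof -
  have \<Omega>: "\<Omega> \<in> lmeasurable" using assms by (intro bounded_set_imp_lmeasurable) auto
  have m [measurable]: "h \<in> borel_measurable (lebesgue_on \<Omega>)"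
    using continuous_imp_measurable_on_sets_lebesgue[OF continuous_on_subset[OF h]] \<Omega> by auto
  have "bounded (h ` closure \<Omega>)"
    using assms by (intro compact_imp_bounded compact_continuous_image continuous_on_subset[OF h]) auto
  then obtain C where C: "C > 0" "\<And>x. x \<in> closure \<Omega> \<Longrightarrow> \<bar>h x\<bar> \<le> C"
    by (auto simp: bounded_pos)
  interpret finite_measure "lebesgue_on \<Omega>" using \<Omega> by (rule finite_measure_lebesgue_on)
  have "integrable (lebesgue_on \<Omega>) (\<lambda>x. (h x)\<^sup>2)"
  proof (rule integrable_const_bound[where B="C\<^sup>2"])
    show "AE x in lebesgue_on \<Omega>. norm ((h x)\<^sup>2) \<le> C\<^sup>2"
    proof (rule AE_I2)
      fix x assume "x \<in> space (lebesgue_on \<Omega>)"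
      then have "\<bar>h x\<bar> \<le> C" using C closure_subset by auto
      then show "norm ((h x)\<^sup>2) \<le> C\<^sup>2" using C(1) by (simp add: abs_le_square_iff[symmetric])
    qed
  qed measurable
  then show ?thesis using m by (simp add: L2_space_def)
qed

text \<open>The product of the two functions has compact support, so its derivative integrates to
  zero. This gives test functions a weak gradient, namely the classical one.\<close>

lemma test_functions_parts:
  fixes \<phi> \<psi> :: "'a::euclidean_space \<Rightarrow> real"
  assumes \<Omega>: "open \<Omega>" "bounded \<Omega>" and \<phi>: "\<phi> \<in> test_functions \<Omega>" and \<psi>: "\<psi> \<in> test_functions \<Omega>"
    and b: "b \<in> Basis"
  shows "(LINT x|lebesgue_on \<Omega>. \<phi> x * frechet_derivative \<psi> (at x) b) =
    - (LINT x|lebesgue_on \<Omega>. frechet_derivative \<phi> (at x) b * \<psi> x)"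
proof -
  let ?D = "\<lambda>x h. \<phi> x * frechet_derivative \<psi> (at x) h + frechet_derivative \<phi> (at x) h * \<psi> x"
  note T\<phi> = test_functionsD[OF \<phi>] and T\<psi> = test_functionsD[OF \<psi>]
  have cont: "continuous_on UNIV (\<lambda>x. ?D x b)"
    by (intro continuous_intros T\<phi>(2) T\<psi>(2) T\<phi>(4)[OF b] T\<psi>(4)[OF b])
  have "(LINT x|lborel. ?D x b) = 0"
    by (rule integral_frechet_derivative_zero[of "\<lambda>x. \<phi> x * \<psi> x" ?D b \<Omega>, OF _ b cont \<Omega>(2)])
      (use T\<phi> T\<psi> in \<open>auto intro!: has_derivative_mult\<close>)
  moreover have "(LINT x|lebesgue_on \<Omega>. ?D x b) = (LINT x|lborel. ?D x b)"
    by (rule lebesgue_on_eq_lborel)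
      (use \<Omega> T\<phi>(5) T\<psi>(5) borel_measurable_continuous_onI[OF cont] in auto)
  moreover have "integrable (lebesgue_on \<Omega>) (\<lambda>x. \<phi> x * frechet_derivative \<psi> (at x) b)"
    "integrable (lebesgue_on \<Omega>) (\<lambda>x. frechet_derivative \<phi> (at x) b * \<psi> x)"
    by (intro L2_mult_integrable continuous_L2 \<Omega> T\<phi>(2) T\<psi>(2) T\<phi>(4)[OF b] T\<psi>(4)[OF b])+
  ultimately show ?thesis by simp
qed

text \<open>Boxes form an intersection-stable generator of the Borel sets, so by a Dynkin argument
  the integrals over all Borel subsets of \<open>box c d\<close> vanish, in particular those over
  the sets where \<open>h\<close> is positive or negative.\<close>

lemma AE_zero_of_box_integrals:
  fixes h :: "'a::euclidean_space \<Rightarrow> real"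
  assumes h: "integrable lborel h" and hm: "h \<in> borel_measurable borel"
    and zero: "\<And>a b. box a b \<subseteq> box c d \<Longrightarrow> (LINT x|lborel. h x * indicator (box a b) x) = 0"
  shows "AE x in lborel. x \<in> box c d \<longrightarrow> h x = 0"
proof -
  let ?I = "\<lambda>E. (LINT x|lborel. h x * indicator (E \<inter> box c d) x)"
  have int: "integrable lborel (\<lambda>x. h x * indicator E x)" if "E \<in> sets borel" for E
    using integrable_mult_indicator[of E lborel h] that h by (simp add: mult.commute)
  have "?I E = 0" if "E \<in> sets borel" for E
  proof -
    have 1: "E \<in> sigma_sets UNIV (range (\<lambda>(a, b). box a b :: 'a set))"
      using that by (simp add: borel_eq_box)
    have 2: "Int_stable (range (\<lambda>(a, b). box a b :: 'a set))"
      by (auto simp: Int_stable_def box_Int_box)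
    have 3: "range (\<lambda>(a, b). box a b :: 'a set) \<subseteq> Pow UNIV" by simp
    from 2 3 1 show ?thesis
    proof (induction rule: sigma_sets_induct_disjoint)
      case (basic A)
      then obtain a b where ab: "A = box a b" by auto
      obtain p q where pq: "box a b \<inter> box c d = box p q" using box_Int_box[of a b c d] by blast
      then have "box p q \<subseteq> box c d" by blast
      then show ?case using zero[of p q] by (simp add: ab pq)
    next
      case empty show ?case by simp
    next
      case (compl A)
      then have A: "A \<in> sets borel" by (simp add: borel_eq_box)
      have "(\<lambda>x. h x * indicator ((UNIV - A) \<inter> box c d) x) =
        (\<lambda>x. h x * indicator (box c d) x - h x * indicator (A \<inter> box c d) x)"
        by (auto simp: indicator_def fun_eq_iff)
      then have "?I (UNIV - A) = (LINT x|lborel. h x * indicator (box c d) x) - ?I A"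
        using int[of "box c d"] int[of "A \<inter> box c d"] A by simp
      then show ?case using compl zero[of c d] by simp
    next
      case (union A)
      then have A: "A i \<in> sets borel" for i by (auto simp: borel_eq_box)
      have "(LINT x:(\<Union>i. A i \<inter> box c d)|lborel. h x) = (\<Sum>i. (LINT x:A i \<inter> box c d|lborel. h x))"
      proof (rule lebesgue_integral_countable_add)
        show "\<And>i j. i \<noteq> j \<Longrightarrow> (A i \<inter> box c d) \<inter> (A j \<inter> box c d) = {}"
          using union(1) by (auto simp: disjoint_family_on_def)
        show "set_integrable lborel (\<Union>i. A i \<inter> box c d) h"
          unfolding set_integrable_def by (rule integrable_mult_indicator) (use A h in auto)
      qed (use A in auto)
      moreover have S: "(LINT x:E|lborel. h x) = (LINT x|lborel. h x * indicator E x)" for E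
        by (simp add: set_lebesgue_integral_def mult.commute)
      moreover have "(\<Union>i. A i \<inter> box c d) = (\<Union>i. A i) \<inter> box c d" by blast
      ultimately show ?case using union(3) unfolding S by simp
    qed
  qed
  note zero' = this
  have sign: "AE x in lborel. r * h x * indicator ({x. r * h x > 0} \<inter> box c d) x = 0" for r :: real
  proof -
    let ?E = "{x. r * h x > 0}"
    have E: "?E \<in> sets borel" using hm by measurable
    have eq: "(\<lambda>x. r * h x * indicator (?E \<inter> box c d) x) = (\<lambda>x. r * (h x * indicator (?E \<inter> box c d) x))"
      by (simp add: mult.assoc)
    have 1: "integrable lborel (\<lambda>x. r * h x * indicator (?E \<inter> box c d) x)"
      unfolding eq by (rule integrable_mult_right[OF int]) (use E in auto)
    have 2: "AE x in lborel. 0 \<le> r * h x * indicator (?E \<inter> box c d) x"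
      by (intro always_eventually allI) (simp add: indicator_def)
    have "(LINT x|lborel. r * h x * indicator (?E \<inter> box c d) x) = 0"
      unfolding eq using zero'[OF E] by simp
    then show ?thesis by (simp only: integral_nonneg_eq_0_iff_AE[OF 1 2])
  qed
  have pos: "AE x in lborel. 1 * h x * indicator ({x. 1 * h x > 0} \<inter> box c d) x = 0"
    by (rule sign)
  have neg: "AE x in lborel. (-1) * h x * indicator ({x. (-1) * h x > 0} \<inter> box c d) x = 0"
    by (rule sign)
  from pos neg show ?thesis
    by eventually_elim (auto simp: indicator_def split: if_splits)
qed

text \<open>Indicators of boxes are bounded pointwise limits of test functions, so the integral of
  \<open>h\<close> vanishes over each box whose closure lies in \<open>\<Omega>\<close>. Countably
  many such closed boxes fill \<open>\<Omega>\<close>, and their boundaries are null sets.\<close>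

theorem fundamental_lemma:
  fixes h :: "'a::euclidean_space \<Rightarrow> real"
  assumes \<Omega>: "open \<Omega>" and h: "integrable (lebesgue_on \<Omega>) h"
    and zero: "\<And>\<psi>. \<psi> \<in> test_functions \<Omega> \<Longrightarrow> (LINT x|lebesgue_on \<Omega>. h x * \<psi> x) = 0"
  shows "AE x in lebesgue_on \<Omega>. h x = 0"
proof -
  have \<Omega>s: "\<Omega> \<in> sets lebesgue" using \<Omega> by auto
  \<comment> \<open>\<open>h\<close> is measurable for the completed measure only; the Borel
    representative \<open>k\<close> of its extension by zero is what the Dynkin argument can
    handle.\<close>
  define h0 where "h0 x = indicator \<Omega> x *\<^sub>R h x" for x
  have h0: "integrable lebesgue h0"
    unfolding h0_def using h \<Omega>s by (subst (asm) integrable_restrict_space) auto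
  then obtain k where k: "k \<in> borel_measurable lborel" "AE x in lborel. h0 x = k x"
    using completion_ex_borel_measurable_real[of h0 lborel] by auto
  have k_leb: "AE x in lebesgue. h0 x = k x" using k(2) by (rule AE_completion)
  have km: "k \<in> borel_measurable lebesgue" using k(1) by (rule measurable_completion)
  have kint: "integrable lborel k"
    using integrable_cong_AE_imp[OF h0 km] k_leb integrable_completion[OF k(1)] by (simp add: eq_commute)
  have box: "AE x in lborel. x \<in> box c d \<longrightarrow> k x = 0" if cd: "cbox c d \<subseteq> \<Omega>" for c d
  proof (cases "box c d = {}")
    case False
    show ?thesis
    proof (rule AE_zero_of_box_integrals[OF kint])
      fix a b assume ab: "box a b \<subseteq> box c d"
      show "(LINT x|lborel. k x * indicator (box a b) x) = 0"
      proof (cases "box a b = {}")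
        case ne: False
        have "closure (box a b) \<subseteq> closure (box c d)" using ab by (rule closure_mono)
        then have sub: "cbox a b \<subseteq> \<Omega>" using ne False cd by simp
        have bm: "box_bump a b (Suc n) \<in> borel_measurable borel" for n
          using Ck_imp_continuous[OF box_bump_Ck] by (rule borel_measurable_continuous_onI)
        have bm_leb: "box_bump a b (Suc n) \<in> borel_measurable lebesgue" for n
          by (rule measurable_completion) (use bm in simp)
        have "(\<lambda>n. LINT x|lborel. k x * box_bump a b (Suc n) x) \<longlonglongrightarrow> (LINT x|lborel. k x * indicator (box a b) x)"
        proof (rule integral_dominated_convergence[where w="\<lambda>x. \<bar>k x\<bar>"])
          show "AE x in lborel. norm (k x * box_bump a b (Suc n) x) \<le> \<bar>k x\<bar>" for n
            using box_bump_range[of a b "Suc n"] by (auto intro!: always_eventually simp: abs_mult mult_left_le)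
          show "AE x in lborel. (\<lambda>n. k x * box_bump a b (Suc n) x) \<longlonglongrightarrow> k x * indicator (box a b) x"
            by (intro always_eventually allI tendsto_mult tendsto_const box_bump_tendsto)
        qed (use k(1) kint bm in \<open>auto intro!: borel_measurable_times\<close>)
        moreover have "(LINT x|lborel. k x * box_bump a b (Suc n) x) = 0" for n
        proof -
          have "(LINT x|lborel. k x * box_bump a b (Suc n) x) = (LINT x|lebesgue. k x * box_bump a b (Suc n) x)"
            by (rule integral_completion[symmetric]) (use k(1) bm in auto)
          also have "\<dots> = (LINT x|lebesgue. h0 x * box_bump a b (Suc n) x)"
          proof (rule integral_cong_AE)
            show "AE x in lebesgue. k x * box_bump a b (Suc n) x = h0 x * box_bump a b (Suc n) x"
              using k_leb by eventually_elim simp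
          qed (use km h0 bm_leb in \<open>auto intro!: borel_measurable_times\<close>)
          also have "\<dots> = (LINT x|lebesgue. indicator \<Omega> x *\<^sub>R (h x * box_bump a b (Suc n) x))"
            by (simp add: h0_def mult.assoc)
          also have "\<dots> = (LINT x|lebesgue_on \<Omega>. h x * box_bump a b (Suc n) x)"
            using \<Omega>s by (subst integral_restrict_space) auto
          also have "\<dots> = 0" by (rule zero[OF box_bump_test[OF sub]])
          finally show ?thesis .
        qed
        ultimately have "(\<lambda>n. 0::real) \<longlonglongrightarrow> (LINT x|lborel. k x * indicator (box a b) x)" by simp
        then show ?thesis using LIMSEQ_unique tendsto_const by blast
      qed simp
    qed (use k in auto)
  qed simp
  obtain \<D> where \<D>: "countable \<D>" "\<D> \<subseteq> Pow \<Omega>" "\<And>X. X \<in> \<D> \<Longrightarrow> \<exists>a b. X = cbox a b" "\<Union>\<D> = \<Omega>"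
    using open_countable_Union_open_cbox[OF \<Omega>] by metis
  have "AE x in lebesgue. \<forall>X\<in>\<D>. x \<in> X \<longrightarrow> k x = 0"
  proof (subst AE_ball_countable[OF \<D>(1)], intro ballI)
    fix X assume X: "X \<in> \<D>"
    then obtain a b where ab: "X = cbox a b" using \<D>(3) by blast
    have "AE x in lebesgue. x \<in> box a b \<longrightarrow> k x = 0"
      by (rule AE_completion, rule box) (use X ab \<D>(2) in auto)
    moreover have "AE x in lebesgue. x \<notin> cbox a b - box a b"
      by (rule AE_not_in) (use negligible_frontier_interval[of a b] in \<open>simp add: negligible_iff_null_sets\<close>)
    ultimately show "AE x in lebesgue. x \<in> X \<longrightarrow> k x = 0"
      by eventually_elim (auto simp: ab)
  qed
  with k_leb have "AE x in lebesgue. x \<in> \<Omega> \<longrightarrow> h x = 0"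
  proof eventually_elim
    case (elim x)
    show ?case
    proof
      assume x: "x \<in> \<Omega>"
      then have "k x = 0" using elim \<D>(4) by blast
      then show "h x = 0" using elim x by (simp add: h0_def)
    qed
  qed
  then show ?thesis using \<Omega>s by (simp add: AE_restrict_space_iff)
qed

section \<open>Sobolev spaces and elliptic forms\<close>

locale bounded_domain =
  fixes \<Omega> :: "'a::euclidean_space set"
  assumes open_domain: "open \<Omega>" and bounded_domain: "bounded \<Omega>"
begin

abbreviation "M\<Omega> \<equiv> lebesgue_on \<Omega>"

lemma lmeasurable_domain: "\<Omega> \<in> lmeasurable"
  using open_domain bounded_domain by (intro bounded_set_imp_lmeasurable) auto

lemma sets_domain [simp]: "\<Omega> \<in> sets lebesgue"
  using lmeasurable_domain by auto

end

text \<open>The rewrite lets all inherited facts speak of \<open>L2_norm\<close>, the norm of the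
  problem statement, in place of \<open>nrm\<close>.\<close>

sublocale bounded_domain \<subseteq> L2: semi_hilbert "L2_space \<Omega>" "L2_inner \<Omega>"
  rewrites "semi_inner.nrm (L2_inner \<Omega>) = L2_norm \<Omega>"
  using L2_hilbert[OF sets_domain] by (auto simp: L2_nrm)

context bounded_domain begin

lemma L2_const: "(\<lambda>x. c) \<in> L2_space \<Omega>"
  using open_domain bounded_domain by (intro continuous_L2) auto

lemma L2_integrable: "v \<in> L2_space \<Omega> \<Longrightarrow> integrable M\<Omega> v"
  using L2_mult_integrable[OF _ L2_const[of 1], of v] by simp

lemma L2_norm_sq: "v \<in> L2_space \<Omega> \<Longrightarrow> (L2_norm \<Omega> v)\<^sup>2 = (LINT x|M\<Omega>. (v x)\<^sup>2)"
  using L2.nrm_sq by (simp add: L2_inner_def power2_eq_square)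

lemma L2_eqI_test:
  assumes "h \<in> L2_space \<Omega>" "\<And>\<psi>. \<psi> \<in> test_functions \<Omega> \<Longrightarrow> (LINT x|M\<Omega>. h x * \<psi> x) = 0"
  shows "AE x in M\<Omega>. h x = 0"
  by (rule fundamental_lemma[OF open_domain L2_integrable[OF assms(1)] assms(2)])

lemma test_L2:
  assumes "\<psi> \<in> test_functions \<Omega>"
  shows "\<psi> \<in> L2_space \<Omega>" "b \<in> Basis \<Longrightarrow> (\<lambda>x. frechet_derivative \<psi> (at x) b) \<in> L2_space \<Omega>"
  using test_functionsD[OF assms] open_domain bounded_domain by (auto intro!: continuous_L2)

section \<open>Weak gradients and the space \<open>H1_space\<close>\<close>

lemma weak_gradientD:
  assumes "weak_gradient \<Omega> v G"
  shows "b \<in> Basis \<Longrightarrow> (\<lambda>x. G x \<bullet> b) \<in> L2_space \<Omega>"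
    "\<lbrakk>\<psi> \<in> test_functions \<Omega>; b \<in> Basis\<rbrakk> \<Longrightarrow>
      (LINT x|M\<Omega>. v x * frechet_derivative \<psi> (at x) b) = - (LINT x|M\<Omega>. (G x \<bullet> b) * \<psi> x)"
  using assms by (auto simp: weak_gradient_def)

text \<open>The fundamental lemma, applied to each coordinate. It makes the arbitrary choice in
  \<open>grad\<close> harmless, but identities for \<open>grad\<close> hold only almost
  everywhere.\<close>

lemma weak_gradient_unique:
  assumes "weak_gradient \<Omega> v G" "weak_gradient \<Omega> v K"
  shows "AE x in M\<Omega>. G x = K x"
proof -
  have "AE x in M\<Omega>. G x \<bullet> b - K x \<bullet> b = 0" if b: "b \<in> Basis" for b
  proof (rule L2_eqI_test)
    note G = weak_gradientD(1)[OF assms(1) b] and K = weak_gradientD(1)[OF assms(2) b]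
    show "(\<lambda>x. G x \<bullet> b - K x \<bullet> b) \<in> L2_space \<Omega>"
      using L2.mem_diff[OF G K] by (simp add: fun_diff_def)
    fix \<psi> assume \<psi>: "\<psi> \<in> test_functions \<Omega>"
    show "(LINT x|M\<Omega>. (G x \<bullet> b - K x \<bullet> b) * \<psi> x) = 0"
      using weak_gradientD(2)[OF assms(1) \<psi> b] weak_gradientD(2)[OF assms(2) \<psi> b]
        L2_mult_integrable[OF G test_L2(1)[OF \<psi>]] L2_mult_integrable[OF K test_L2(1)[OF \<psi>]]
      by (simp add: left_diff_distrib)
  qed
  then have "AE x in M\<Omega>. \<forall>b\<in>Basis. G x \<bullet> b - K x \<bullet> b = 0"
    by (subst AE_ball_countable) (auto simp: countable_finite)
  then show ?thesis
    by eventually_elim (auto intro: euclidean_eqI)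
qed

lemma weak_gradient_add:
  assumes "weak_gradient \<Omega> u G" "weak_gradient \<Omega> v K" "u \<in> L2_space \<Omega>" "v \<in> L2_space \<Omega>"
  shows "weak_gradient \<Omega> (u + v) (\<lambda>x. G x + K x)"
  unfolding weak_gradient_def
proof (intro conjI ballI)
  fix b :: 'a assume b: "b \<in> Basis"
  note G = weak_gradientD(1)[OF assms(1) b] and K = weak_gradientD(1)[OF assms(2) b]
  show "(\<lambda>x. (G x + K x) \<bullet> b) \<in> L2_space \<Omega>"
    using L2.mem_add[OF G K] by (simp add: plus_fun_def inner_add_left)
  fix \<psi> assume \<psi>: "\<psi> \<in> test_functions \<Omega>"
  show "(LINT x|M\<Omega>. (u + v) x * frechet_derivative \<psi> (at x) b) = - (LINT x|M\<Omega>. ((G x + K x) \<bullet> b) * \<psi> x)"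
    using weak_gradientD(2)[OF assms(1) \<psi> b] weak_gradientD(2)[OF assms(2) \<psi> b]
      L2_mult_integrable[OF G test_L2(1)[OF \<psi>]] L2_mult_integrable[OF K test_L2(1)[OF \<psi>]]
      L2_mult_integrable[OF assms(3) test_L2(2)[OF \<psi> b]] L2_mult_integrable[OF assms(4) test_L2(2)[OF \<psi> b]]
    by (simp add: distrib_right inner_add_left)
qed

lemma weak_gradient_scale:
  assumes "weak_gradient \<Omega> u G"
  shows "weak_gradient \<Omega> (c *\<^sub>R u) (\<lambda>x. c *\<^sub>R G x)"
  unfolding weak_gradient_def
proof (intro conjI ballI)
  fix b :: 'a assume b: "b \<in> Basis"
  show "(\<lambda>x. (c *\<^sub>R G x) \<bullet> b) \<in> L2_space \<Omega>"
    using L2.mem_scale[OF weak_gradientD(1)[OF assms b], of c] by (simp add: scaleR_fun_def)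
  fix \<psi> assume \<psi>: "\<psi> \<in> test_functions \<Omega>"
  show "(LINT x|M\<Omega>. (c *\<^sub>R u) x * frechet_derivative \<psi> (at x) b) = - (LINT x|M\<Omega>. ((c *\<^sub>R G x) \<bullet> b) * \<psi> x)"
    using weak_gradientD(2)[OF assms \<psi> b] by (simp add: mult.assoc)
qed

lemma H1_L2 [simp]: "v \<in> H1_space \<Omega> \<Longrightarrow> v \<in> L2_space \<Omega>"
  by (simp add: H1_space_def)

lemma H1I: "v \<in> L2_space \<Omega> \<Longrightarrow> weak_gradient \<Omega> v G \<Longrightarrow> v \<in> H1_space \<Omega>"
  unfolding H1_space_def by blast

lemma grad: "v \<in> H1_space \<Omega> \<Longrightarrow> weak_gradient \<Omega> v (grad \<Omega> v)"
  unfolding grad_def by (rule someI_ex[of "weak_gradient \<Omega> v"]) (unfold H1_space_def, blast)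

lemma grad_AE: "v \<in> H1_space \<Omega> \<Longrightarrow> weak_gradient \<Omega> v G \<Longrightarrow> AE x in M\<Omega>. grad \<Omega> v x = G x"
  by (rule weak_gradient_unique[OF grad])

lemma H1_subspace: "subspace (H1_space \<Omega>)"
proof (rule subspaceI)
  have "weak_gradient \<Omega> 0 (\<lambda>x. 0)"
    using L2.mem_zero by (simp add: weak_gradient_def zero_fun_def)
  then show "0 \<in> H1_space \<Omega>" by (rule H1I[OF L2.mem_zero])
  show "u + v \<in> H1_space \<Omega>" if "u \<in> H1_space \<Omega>" "v \<in> H1_space \<Omega>" for u v
    by (rule H1I[OF _ weak_gradient_add[OF grad grad]]) (use that in auto)
  show "c *\<^sub>R u \<in> H1_space \<Omega>" if "u \<in> H1_space \<Omega>" for c u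
    by (rule H1I[OF _ weak_gradient_scale[OF grad]]) (use that in auto)
qed

lemma grad_add: "\<lbrakk>u \<in> H1_space \<Omega>; v \<in> H1_space \<Omega>\<rbrakk> \<Longrightarrow> AE x in M\<Omega>. grad \<Omega> (u + v) x = grad \<Omega> u x + grad \<Omega> v x"
  by (intro grad_AE weak_gradient_add grad subspace_add[OF H1_subspace]) auto

lemma grad_scale: "u \<in> H1_space \<Omega> \<Longrightarrow> AE x in M\<Omega>. grad \<Omega> (c *\<^sub>R u) x = c *\<^sub>R grad \<Omega> u x"
  by (intro grad_AE weak_gradient_scale grad subspace_scale[OF H1_subspace]) auto

lemma grad_measurable [measurable]: "u \<in> H1_space \<Omega> \<Longrightarrow> grad \<Omega> u \<in> borel_measurable M\<Omega>"
  by (subst borel_measurable_euclidean_space) (auto intro: L2_measurable weak_gradientD(1)[OF grad])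

section \<open>Diffusion forms with bounded coefficients and the scalar product of H1\<close>

definition ngrad :: "('a \<Rightarrow> real) \<Rightarrow> 'a \<Rightarrow> real" where "ngrad u x = norm (grad \<Omega> u x)"

lemma ngrad_L2: assumes u: "u \<in> H1_space \<Omega>" shows "ngrad u \<in> L2_space \<Omega>"
proof -
  have [measurable]: "grad \<Omega> u \<in> borel_measurable M\<Omega>" by (rule grad_measurable[OF u])
  have "(\<lambda>x. (ngrad u x)\<^sup>2) = (\<lambda>x. \<Sum>b\<in>Basis. (grad \<Omega> u x \<bullet> b)\<^sup>2)"
    unfolding ngrad_def power2_norm_eq_inner by (rule ext, subst euclidean_inner) (simp add: power2_eq_square)
  moreover have "integrable M\<Omega> (\<lambda>x. \<Sum>b\<in>Basis. (grad \<Omega> u x \<bullet> b)\<^sup>2)"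
    by (intro Bochner_Integration.integrable_sum L2_square_integrable weak_gradientD(1)[OF grad[OF u]])
  moreover have "ngrad u \<in> borel_measurable M\<Omega>" unfolding ngrad_def by measurable
  ultimately show ?thesis by (simp add: L2_space_def)
qed

definition dform :: "('a \<Rightarrow> real) \<Rightarrow> ('a \<Rightarrow> real) \<Rightarrow> ('a \<Rightarrow> real) \<Rightarrow> real" where
  "dform \<alpha> u v = (LINT x|M\<Omega>. \<alpha> x * (grad \<Omega> u x \<bullet> grad \<Omega> v x))"

text \<open>The bound is demanded at every point and not almost everywhere; coefficients are values
  of the bounded function \<open>a\<close> or differences of such, so this costs nothing.\<close>

definition coeff_fun :: "real \<Rightarrow> ('a \<Rightarrow> real) \<Rightarrow> bool" where
  "coeff_fun C \<alpha> \<longleftrightarrow> \<alpha> \<in> borel_measurable M\<Omega> \<and> (\<forall>x. \<bar>\<alpha> x\<bar> \<le> C)"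

lemma coeff_L2:
  assumes "coeff_fun C \<alpha>" "v \<in> L2_space \<Omega>" shows "(\<lambda>x. \<bar>\<alpha> x\<bar> * v x) \<in> L2_space \<Omega>"
proof -
  have [measurable]: "\<alpha> \<in> borel_measurable M\<Omega>" "v \<in> borel_measurable M\<Omega>"
    using assms L2_measurable by (auto simp: coeff_fun_def)
  have "integrable M\<Omega> (\<lambda>x. (\<bar>\<alpha> x\<bar> * v x)\<^sup>2)"
  proof (rule Bochner_Integration.integrable_bound)
    show "integrable M\<Omega> (\<lambda>x. C\<^sup>2 * (v x)\<^sup>2)" using L2_square_integrable[OF assms(2)] by simp
    show "AE x in M\<Omega>. norm ((\<bar>\<alpha> x\<bar> * v x)\<^sup>2) \<le> norm (C\<^sup>2 * (v x)\<^sup>2)"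
      using assms(1) by (intro always_eventually allI)
        (auto simp: coeff_fun_def power_mult_distrib intro!: mult_right_mono abs_le_square_iff[THEN iffD1] order_trans[OF _ abs_ge_self])
  qed measurable
  then show ?thesis by (simp add: L2_space_def)
qed

lemma dform_integrable:
  assumes \<alpha>: "coeff_fun C \<alpha>" and u: "u \<in> H1_space \<Omega>" and v: "v \<in> H1_space \<Omega>"
  shows "integrable M\<Omega> (\<lambda>x. \<alpha> x * (grad \<Omega> u x \<bullet> grad \<Omega> v x))"
proof (rule Bochner_Integration.integrable_bound)
  show "integrable M\<Omega> (\<lambda>x. \<bar>\<alpha> x\<bar> * ngrad v x * ngrad u x)"
    by (rule L2_mult_integrable[OF coeff_L2[OF \<alpha> ngrad_L2[OF v]] ngrad_L2[OF u]])
  have "\<bar>\<alpha> x\<bar> * \<bar>grad \<Omega> u x \<bullet> grad \<Omega> v x\<bar> \<le> \<bar>\<alpha> x\<bar> * (ngrad u x * ngrad v x)" for x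
    unfolding ngrad_def by (intro mult_left_mono Cauchy_Schwarz_ineq2) auto
  then show "AE x in M\<Omega>. norm (\<alpha> x * (grad \<Omega> u x \<bullet> grad \<Omega> v x)) \<le> norm (\<bar>\<alpha> x\<bar> * ngrad v x * ngrad u x)"
    by (intro always_eventually allI) (simp add: abs_mult ngrad_def mult_ac)
  have [measurable]: "grad \<Omega> u \<in> borel_measurable M\<Omega>" "grad \<Omega> v \<in> borel_measurable M\<Omega>"
    "\<alpha> \<in> borel_measurable M\<Omega>" using u v \<alpha> by (auto simp: coeff_fun_def)
  show "(\<lambda>x. \<alpha> x * (grad \<Omega> u x \<bullet> grad \<Omega> v x)) \<in> borel_measurable M\<Omega>" by measurable
qed

text \<open>The coefficient stays inside the norm together with one gradient. For a coefficient that
  tends to zero pointwise this bound still tends to zero, whereas a bound through its supremum would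
  not.\<close>

lemma dform_bound':
  assumes \<alpha>: "coeff_fun C \<alpha>" and u: "u \<in> H1_space \<Omega>" and v: "v \<in> H1_space \<Omega>"
  shows "\<bar>dform \<alpha> u v\<bar> \<le> L2_norm \<Omega> (\<lambda>x. \<bar>\<alpha> x\<bar> * ngrad v x) * L2_norm \<Omega> (ngrad u)"
proof -
  have "\<bar>dform \<alpha> u v\<bar> \<le> (LINT x|M\<Omega>. \<bar>\<alpha> x\<bar> * ngrad v x * ngrad u x)"
    unfolding dform_def
  proof (rule order_trans[OF integral_abs_bound], rule integral_mono)
    show "integrable M\<Omega> (\<lambda>x. \<bar>\<alpha> x * (grad \<Omega> u x \<bullet> grad \<Omega> v x)\<bar>)"
      using dform_integrable[OF \<alpha> u v] by simp
    show "integrable M\<Omega> (\<lambda>x. \<bar>\<alpha> x\<bar> * ngrad v x * ngrad u x)"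
      by (rule L2_mult_integrable[OF coeff_L2[OF \<alpha> ngrad_L2[OF v]] ngrad_L2[OF u]])
    have "\<bar>\<alpha> x\<bar> * \<bar>grad \<Omega> u x \<bullet> grad \<Omega> v x\<bar> \<le> \<bar>\<alpha> x\<bar> * (ngrad u x * ngrad v x)" for x
      unfolding ngrad_def by (intro mult_left_mono Cauchy_Schwarz_ineq2) auto
    then show "\<bar>\<alpha> x * (grad \<Omega> u x \<bullet> grad \<Omega> v x)\<bar> \<le> \<bar>\<alpha> x\<bar> * ngrad v x * ngrad u x" for x
      by (simp add: abs_mult mult_ac)
  qed
  also have "\<dots> = L2_inner \<Omega> (\<lambda>x. \<bar>\<alpha> x\<bar> * ngrad v x) (ngrad u)" by (simp add: L2_inner_def)
  also have "\<dots> \<le> L2_norm \<Omega> (\<lambda>x. \<bar>\<alpha> x\<bar> * ngrad v x) * L2_norm \<Omega> (ngrad u)"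
    using L2.Cauchy_Schwarz[OF coeff_L2[OF \<alpha> ngrad_L2[OF v]] ngrad_L2[OF u]] by linarith
  finally show ?thesis .
qed

lemma dform_sym: "dform \<alpha> u v = dform \<alpha> v u"
  by (simp add: dform_def inner_commute)

lemma dform_add_left:
  assumes \<alpha>: "coeff_fun C \<alpha>" and uvw: "u \<in> H1_space \<Omega>" "v \<in> H1_space \<Omega>" "w \<in> H1_space \<Omega>"
  shows "dform \<alpha> (u + v) w = dform \<alpha> u w + dform \<alpha> v w"
proof -
  have s: "u + v \<in> H1_space \<Omega>" using uvw subspace_add[OF H1_subspace] by auto
  have "dform \<alpha> (u + v) w = (LINT x|M\<Omega>. \<alpha> x * (grad \<Omega> u x \<bullet> grad \<Omega> w x) + \<alpha> x * (grad \<Omega> v x \<bullet> grad \<Omega> w x))"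
    unfolding dform_def
  proof (rule integral_cong_AE)
    show "AE x in M\<Omega>. \<alpha> x * (grad \<Omega> (u + v) x \<bullet> grad \<Omega> w x) =
        \<alpha> x * (grad \<Omega> u x \<bullet> grad \<Omega> w x) + \<alpha> x * (grad \<Omega> v x \<bullet> grad \<Omega> w x)"
      using grad_add[OF uvw(1,2)] by eventually_elim (simp add: inner_add_left distrib_left)
  qed (use dform_integrable[OF \<alpha>] s uvw in \<open>auto intro!: borel_measurable_add intro: borel_measurable_integrable\<close>)
  then show ?thesis using dform_integrable[OF \<alpha>] uvw by (simp add: dform_def)
qed

lemma dform_scale_left:
  assumes \<alpha>: "coeff_fun C \<alpha>" and uw: "u \<in> H1_space \<Omega>" "w \<in> H1_space \<Omega>"
  shows "dform \<alpha> (c *\<^sub>R u) w = c * dform \<alpha> u w"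
proof -
  have s: "c *\<^sub>R u \<in> H1_space \<Omega>" using uw subspace_scale[OF H1_subspace] by auto
  have "dform \<alpha> (c *\<^sub>R u) w = (LINT x|M\<Omega>. c * (\<alpha> x * (grad \<Omega> u x \<bullet> grad \<Omega> w x)))"
    unfolding dform_def
  proof (rule integral_cong_AE)
    show "AE x in M\<Omega>. \<alpha> x * (grad \<Omega> (c *\<^sub>R u) x \<bullet> grad \<Omega> w x) = c * (\<alpha> x * (grad \<Omega> u x \<bullet> grad \<Omega> w x))"
      using grad_scale[OF uw(1), of c] by eventually_elim simp
    have "integrable M\<Omega> (\<lambda>x. c * (\<alpha> x * (grad \<Omega> u x \<bullet> grad \<Omega> w x)))"
      by (rule integrable_mult_right[OF dform_integrable[OF \<alpha> uw]])
    then show "(\<lambda>x. c * (\<alpha> x * (grad \<Omega> u x \<bullet> grad \<Omega> w x))) \<in> borel_measurable M\<Omega>"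
      by (rule borel_measurable_integrable)
    show "(\<lambda>x. \<alpha> x * (grad \<Omega> (c *\<^sub>R u) x \<bullet> grad \<Omega> w x)) \<in> borel_measurable M\<Omega>"
      using dform_integrable[OF \<alpha> s uw(2)] by simp
  qed
  then show ?thesis by (simp add: dform_def)
qed

definition H1_inner :: "('a \<Rightarrow> real) \<Rightarrow> ('a \<Rightarrow> real) \<Rightarrow> real" where
  "H1_inner u v = L2_inner \<Omega> u v + dform (\<lambda>x. 1) u v"

lemma coeff_const: "coeff_fun \<bar>c\<bar> (\<lambda>x. c)"
  by (simp add: coeff_fun_def)

lemma dform_self: "u \<in> H1_space \<Omega> \<Longrightarrow> dform (\<lambda>x. 1) u u = (L2_norm \<Omega> (ngrad u))\<^sup>2"
  by (simp add: L2_norm_sq ngrad_L2 dform_def ngrad_def power2_norm_eq_inner)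

lemma H1_semi_inner: "semi_inner (H1_space \<Omega>) H1_inner"
proof
  show "subspace (H1_space \<Omega>)" by (rule H1_subspace)
next
  fix x y z assume "x \<in> H1_space \<Omega>" "y \<in> H1_space \<Omega>" "z \<in> H1_space \<Omega>"
  then show "H1_inner (x + y) z = H1_inner x z + H1_inner y z"
    by (simp add: H1_inner_def L2.add_left dform_add_left[OF coeff_const])
next
  fix c x z assume "x \<in> H1_space \<Omega>" "z \<in> H1_space \<Omega>"
  then show "H1_inner (c *\<^sub>R x) z = c * H1_inner x z"
    by (simp add: H1_inner_def L2.scale_left dform_scale_left[OF coeff_const] distrib_left)
next
  fix x y assume "x \<in> H1_space \<Omega>" "y \<in> H1_space \<Omega>"
  then show "H1_inner x y = H1_inner y x"
    by (simp add: H1_inner_def L2.sym[of x y] dform_sym[of _ x y])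
next
  fix x assume "x \<in> H1_space \<Omega>"
  then show "0 \<le> H1_inner x x"
    by (simp add: H1_inner_def L2.pos dform_self)
qed

lemma H1_norm_alt: "H1_norm \<Omega> v = sqrt (H1_inner v v)"
  by (simp add: H1_norm_def H1_inner_def L2_inner_def dform_def power2_eq_square[symmetric] power2_norm_eq_inner)

end

sublocale bounded_domain \<subseteq> H1: semi_inner "H1_space \<Omega>" H1_inner
  rewrites "semi_inner.nrm H1_inner = H1_norm \<Omega>"
proof -
  show "semi_inner (H1_space \<Omega>) H1_inner" by (rule H1_semi_inner)
  then show "semi_inner.nrm H1_inner = H1_norm \<Omega>"
    by (intro ext) (simp add: semi_inner.nrm_def H1_norm_alt)
qed

context bounded_domain begin

lemma H1_norm_sq: "u \<in> H1_space \<Omega> \<Longrightarrow> (H1_norm \<Omega> u)\<^sup>2 = (L2_norm \<Omega> u)\<^sup>2 + (L2_norm \<Omega> (ngrad u))\<^sup>2"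
  using H1.nrm_sq[of u] L2.nrm_sq[of u] by (simp add: H1_inner_def dform_self)

lemma L2_le_H1: "u \<in> H1_space \<Omega> \<Longrightarrow> L2_norm \<Omega> u \<le> H1_norm \<Omega> u"
  and ngrad_le_H1: "u \<in> H1_space \<Omega> \<Longrightarrow> L2_norm \<Omega> (ngrad u) \<le> H1_norm \<Omega> u"
  by (rule power2_le_imp_le; simp add: H1_norm_sq)+

text \<open>The functions and each component of their gradients converge separately in L2; the
  limits belong together because the defining identity of the weak gradient is continuous for L2
  convergence.\<close>

lemma H1_complete:
  assumes s: "\<And>n. s n \<in> H1_space \<Omega>"
    and cau: "\<And>e. e > 0 \<Longrightarrow> \<exists>N. \<forall>m\<ge>N. \<forall>n\<ge>N. H1_norm \<Omega> (s m - s n) < e"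
  shows "\<exists>x\<in>H1_space \<Omega>. (\<lambda>n. H1_norm \<Omega> (s n - x)) \<longlonglongrightarrow> 0"
proof -
  let ?G = "\<lambda>n b x. grad \<Omega> (s n) x \<bullet> b"
  have G: "?G n b \<in> L2_space \<Omega>" if "b \<in> Basis" for n b
    by (rule weak_gradientD(1)[OF grad[OF s] that])
  have gdiff: "AE x in M\<Omega>. grad \<Omega> (u - v) x = grad \<Omega> u x - grad \<Omega> v x"
    if "u \<in> H1_space \<Omega>" "v \<in> H1_space \<Omega>" for u v
  proof -
    have "AE x in M\<Omega>. grad \<Omega> ((u - v) + v) x = grad \<Omega> (u - v) x + grad \<Omega> v x"
      by (rule grad_add) (use that in auto)
    then show ?thesis by eventually_elim simp
  qed
  have le: "L2_norm \<Omega> (?G m b - ?G n b) \<le> H1_norm \<Omega> (s m - s n)" if b: "b \<in> Basis" for m n b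
  proof (rule order_trans[OF _ ngrad_le_H1])
    have sm: "s m - s n \<in> H1_space \<Omega>" using s by simp
    show "L2_norm \<Omega> (?G m b - ?G n b) \<le> L2_norm \<Omega> (ngrad (s m - s n))"
    proof (rule power2_le_imp_le)
      have "(LINT x|M\<Omega>. ((?G m b - ?G n b) x)\<^sup>2) \<le> (LINT x|M\<Omega>. (ngrad (s m - s n) x)\<^sup>2)"
      proof (rule integral_mono_AE)
        show "AE x in M\<Omega>. ((?G m b - ?G n b) x)\<^sup>2 \<le> (ngrad (s m - s n) x)\<^sup>2"
          using gdiff[OF s s, of m n]
        proof eventually_elim
          case (elim x)
          have "\<bar>grad \<Omega> (s m - s n) x \<bullet> b\<bar> \<le> norm (grad \<Omega> (s m - s n) x)"
            by (rule Basis_le_norm[OF b])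
          then show ?case
            unfolding elim ngrad_def by (simp add: inner_diff_left[symmetric] abs_le_square_iff[symmetric])
        qed
      qed (use L2_square_integrable[OF L2.mem_diff[OF G[OF b] G[OF b]]] L2_square_integrable[OF ngrad_L2[OF sm]] in simp_all)
      then show "(L2_norm \<Omega> (?G m b - ?G n b))\<^sup>2 \<le> (L2_norm \<Omega> (ngrad (s m - s n)))\<^sup>2"
        using L2_norm_sq[OF L2.mem_diff[OF G[OF b] G[OF b]]] L2_norm_sq[OF ngrad_L2[OF sm]] by simp
    qed (use ngrad_L2[OF sm] in simp)
  qed (use s in simp)
  have "\<exists>v\<in>L2_space \<Omega>. (\<lambda>n. L2_norm \<Omega> (s n - v)) \<longlonglongrightarrow> 0"
  proof (rule L2.complete)
    fix e :: real assume "e > 0"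
    then show "\<exists>N. \<forall>m\<ge>N. \<forall>n\<ge>N. L2_norm \<Omega> (s m - s n) < e"
      using cau L2_le_H1[OF H1.mem_diff[OF s s]] by (meson le_less_trans)
  qed (use s in simp)
  then obtain v where v: "v \<in> L2_space \<Omega>" "(\<lambda>n. L2_norm \<Omega> (s n - v)) \<longlonglongrightarrow> 0" by blast
  have "\<exists>g\<in>L2_space \<Omega>. (\<lambda>n. L2_norm \<Omega> (?G n b - g)) \<longlonglongrightarrow> 0" if b: "b \<in> Basis" for b
  proof (rule L2.complete)
    fix e :: real assume "e > 0"
    then show "\<exists>N. \<forall>m\<ge>N. \<forall>n\<ge>N. L2_norm \<Omega> (?G m b - ?G n b) < e"
      using cau le[OF b] by (meson le_less_trans)
  qed (rule G[OF b])
  then obtain g where g: "\<And>b. b \<in> Basis \<Longrightarrow> g b \<in> L2_space \<Omega>"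
    "\<And>b. b \<in> Basis \<Longrightarrow> (\<lambda>n. L2_norm \<Omega> (?G n b - g b)) \<longlonglongrightarrow> 0" by metis
  define K where "K x = (\<Sum>b\<in>Basis. g b x *\<^sub>R b)" for x
  have Kb: "K x \<bullet> b = g b x" if "b \<in> Basis" for x b
    using that by (simp add: K_def inner_sum_left inner_Basis if_distrib cong: if_cong)
  have wg: "weak_gradient \<Omega> v K"
    unfolding weak_gradient_def
  proof (intro conjI ballI)
    fix b :: 'a assume b: "b \<in> Basis"
    show "(\<lambda>x. K x \<bullet> b) \<in> L2_space \<Omega>" using g(1)[OF b] by (simp add: Kb[OF b])
    fix \<psi> assume \<psi>: "\<psi> \<in> test_functions \<Omega>"
    have "(\<lambda>n. L2_inner \<Omega> (s n) (\<lambda>x. frechet_derivative \<psi> (at x) b)) \<longlonglongrightarrow> L2_inner \<Omega> v (\<lambda>x. frechet_derivative \<psi> (at x) b)"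
      by (rule L2.tendsto_ip_left[OF v(2) _ v(1) test_L2(2)[OF \<psi> b]]) (use s in simp)
    moreover have "(\<lambda>n. - L2_inner \<Omega> (?G n b) \<psi>) \<longlonglongrightarrow> - L2_inner \<Omega> (g b) \<psi>"
      by (intro tendsto_minus L2.tendsto_ip_left[OF g(2)[OF b] G[OF b] g(1)[OF b] test_L2(1)[OF \<psi>]])
    moreover have "L2_inner \<Omega> (s n) (\<lambda>x. frechet_derivative \<psi> (at x) b) = - L2_inner \<Omega> (?G n b) \<psi>" for n
      unfolding L2_inner_def by (rule weak_gradientD(2)[OF grad[OF s] \<psi> b])
    ultimately have "L2_inner \<Omega> v (\<lambda>x. frechet_derivative \<psi> (at x) b) = - L2_inner \<Omega> (g b) \<psi>"
      using LIMSEQ_unique by auto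
    then show "(LINT x|M\<Omega>. v x * frechet_derivative \<psi> (at x) b) = - (LINT x|M\<Omega>. (K x \<bullet> b) * \<psi> x)"
      by (simp add: L2_inner_def Kb[OF b])
  qed
  have vH1: "v \<in> H1_space \<Omega>" by (rule H1I[OF v(1) wg])
  have sq: "(H1_norm \<Omega> (s n - v))\<^sup>2 = (L2_norm \<Omega> (s n - v))\<^sup>2 + (\<Sum>b\<in>Basis. (L2_norm \<Omega> (?G n b - g b))\<^sup>2)" for n
  proof -
    have sv: "s n - v \<in> H1_space \<Omega>" using s vH1 by simp
    have "(L2_norm \<Omega> (ngrad (s n - v)))\<^sup>2 = (LINT x|M\<Omega>. (ngrad (s n - v) x)\<^sup>2)"
      by (rule L2_norm_sq[OF ngrad_L2[OF sv]])
    also have "\<dots> = (LINT x|M\<Omega>. (\<Sum>b\<in>Basis. ((?G n b - g b) x)\<^sup>2))"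
    proof (rule integral_cong_AE)
      show "AE x in M\<Omega>. (ngrad (s n - v) x)\<^sup>2 = (\<Sum>b\<in>Basis. ((?G n b - g b) x)\<^sup>2)"
        using gdiff[OF s vH1, of n] grad_AE[OF vH1 wg]
      proof eventually_elim
        case (elim x)
        have "(ngrad (s n - v) x)\<^sup>2 = (\<Sum>b\<in>Basis. (grad \<Omega> (s n - v) x \<bullet> b)\<^sup>2)"
          unfolding ngrad_def power2_norm_eq_inner by (subst euclidean_inner) (simp add: power2_eq_square)
        then show ?case using elim by (simp add: inner_diff_left Kb)
      qed
      show "(\<lambda>x. (ngrad (s n - v) x)\<^sup>2) \<in> borel_measurable M\<Omega>"
        using L2_square_integrable[OF ngrad_L2[OF sv]] by simp
      have "integrable M\<Omega> (\<lambda>x. \<Sum>b\<in>Basis. ((?G n b - g b) x)\<^sup>2)"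
        by (intro Bochner_Integration.integrable_sum L2_square_integrable L2.mem_diff G g)
      then show "(\<lambda>x. \<Sum>b\<in>Basis. ((?G n b - g b) x)\<^sup>2) \<in> borel_measurable M\<Omega>" by simp
    qed
    also have "\<dots> = (\<Sum>b\<in>Basis. LINT x|M\<Omega>. ((?G n b - g b) x)\<^sup>2)"
      by (intro Bochner_Integration.integral_sum L2_square_integrable L2.mem_diff G g)
    also have "\<dots> = (\<Sum>b\<in>Basis. (L2_norm \<Omega> (?G n b - g b))\<^sup>2)"
      by (intro sum.cong refl L2_norm_sq[symmetric] L2.mem_diff G g)
    finally show ?thesis using H1_norm_sq[OF sv] by simp
  qed
  have "(\<lambda>n. (H1_norm \<Omega> (s n - v))\<^sup>2) \<longlonglongrightarrow> 0\<^sup>2 + (\<Sum>b\<in>(Basis::'a set). 0\<^sup>2)"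
    unfolding sq by (intro tendsto_intros v(2) g(2))
  then have "(\<lambda>n. sqrt ((H1_norm \<Omega> (s n - v))\<^sup>2)) \<longlonglongrightarrow> sqrt 0"
    by (intro tendsto_intros) simp
  then have "(\<lambda>n. H1_norm \<Omega> (s n - v)) \<longlonglongrightarrow> 0"
    using s vH1 by simp
  with vH1 show ?thesis by blast
qed

lemma test_H1: assumes \<psi>: "\<psi> \<in> test_functions \<Omega>" shows "\<psi> \<in> H1_space \<Omega>"
proof (rule H1I[OF test_L2(1)[OF \<psi>]])
  define G where "G x = (\<Sum>b\<in>Basis. frechet_derivative \<psi> (at x) b *\<^sub>R b)" for x
  have Gb: "G x \<bullet> b = frechet_derivative \<psi> (at x) b" if "b \<in> Basis" for x b
    using that by (simp add: G_def inner_sum_left inner_Basis if_distrib cong: if_cong)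
  show "weak_gradient \<Omega> \<psi> G"
    unfolding weak_gradient_def
    using test_L2(2)[OF \<psi>] test_functions_parts[OF open_domain bounded_domain \<psi>] by (simp add: Gb)
qed

section \<open>The space \<open>H10_space\<close> and its Gelfand triple\<close>

lemma H10_H1 [simp]: "v \<in> H10_space \<Omega> \<Longrightarrow> v \<in> H1_space \<Omega>"
  by (simp add: H10_space_def)

lemma H10_approx:
  assumes "v \<in> H10_space \<Omega>" "e > 0"
  obtains \<psi> where "\<psi> \<in> test_functions \<Omega>" "H1_norm \<Omega> (v - \<psi>) < e"
  using assms unfolding H10_space_def fun_diff_def by blast

lemma H10I:
  assumes "v \<in> H1_space \<Omega>" "\<And>e. e > 0 \<Longrightarrow> \<exists>\<psi>\<in>test_functions \<Omega>. H1_norm \<Omega> (v - \<psi>) < e"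
  shows "v \<in> H10_space \<Omega>"
  using assms unfolding H10_space_def fun_diff_def by blast

lemma H1_norm_zero: "H1_norm \<Omega> 0 = 0"
  using H1.nrm_0 .

lemma test_H10: "\<psi> \<in> test_functions \<Omega> \<Longrightarrow> \<psi> \<in> H10_space \<Omega>"
  by (rule H10I[OF test_H1]) (auto intro!: bexI[of _ \<psi>] simp: H1_norm_zero)

lemma H10_subspace: "subspace (H10_space \<Omega>)"
proof (rule subspaceI)
  show "0 \<in> H10_space \<Omega>" using test_H10[OF test_functions_zero] by (simp add: zero_fun_def)
next
  fix u v assume uv: "u \<in> H10_space \<Omega>" "v \<in> H10_space \<Omega>"
  show "u + v \<in> H10_space \<Omega>"
  proof (rule H10I)
    fix e :: real assume "e > 0"
    then have e2: "e / 2 > 0" by simp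
    obtain \<phi> where \<phi>: "\<phi> \<in> test_functions \<Omega>" "H1_norm \<Omega> (u - \<phi>) < e / 2" using H10_approx[OF uv(1) e2] by metis
    obtain \<psi> where \<psi>: "\<psi> \<in> test_functions \<Omega>" "H1_norm \<Omega> (v - \<psi>) < e / 2" using H10_approx[OF uv(2) e2] by metis
    have eq: "u + v - (\<phi> + \<psi>) = (u - \<phi>) + (v - \<psi>)" by simp
    have "H1_norm \<Omega> (u + v - (\<phi> + \<psi>)) < e"
      unfolding eq using H1.nrm_triangle[of "u - \<phi>" "v - \<psi>"] uv \<phi> \<psi> test_H1 by simp
    moreover have "\<phi> + \<psi> \<in> test_functions \<Omega>"
      using test_functions_add[OF \<phi>(1) \<psi>(1)] by (simp add: plus_fun_def)
    ultimately show "\<exists>\<psi>\<in>test_functions \<Omega>. H1_norm \<Omega> (u + v - \<psi>) < e" by blast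
  qed (use uv in simp)
next
  fix c :: real and v assume v: "v \<in> H10_space \<Omega>"
  show "c *\<^sub>R v \<in> H10_space \<Omega>"
  proof (rule H10I)
    fix e :: real assume "e > 0"
    \<comment> \<open>The added 1 covers the case \<open>c = 0\<close>.\<close>
    then have e': "e / (\<bar>c\<bar> + 1) > 0" by (simp add: add_nonneg_pos)
    obtain \<psi> where \<psi>: "\<psi> \<in> test_functions \<Omega>" "H1_norm \<Omega> (v - \<psi>) < e / (\<bar>c\<bar> + 1)" using H10_approx[OF v e'] by metis
    have "H1_norm \<Omega> (c *\<^sub>R v - c *\<^sub>R \<psi>) = \<bar>c\<bar> * H1_norm \<Omega> (v - \<psi>)"
      using H1.nrm_scale[of "v - \<psi>" c] v test_H1[OF \<psi>(1)] by (simp add: scaleR_diff_right)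
    also have "\<dots> \<le> (\<bar>c\<bar> + 1) * H1_norm \<Omega> (v - \<psi>)"
      using v test_H1[OF \<psi>(1)] by (intro mult_right_mono) auto
    also have "\<dots> < e" using \<psi>(2) by (simp add: field_simps add_nonneg_pos)
    finally have "H1_norm \<Omega> (c *\<^sub>R v - c *\<^sub>R \<psi>) < e" .
    moreover have "c *\<^sub>R \<psi> \<in> test_functions \<Omega>"
      using test_functions_cmult[OF \<psi>(1), of c] by (simp add: scaleR_fun_def)
    ultimately show "\<exists>\<psi>\<in>test_functions \<Omega>. H1_norm \<Omega> (c *\<^sub>R v - \<psi>) < e" by blast
  qed (use v in simp)
qed

lemma H10_semi_inner: "semi_inner (H10_space \<Omega>) H1_inner"
  by unfold_locales (auto simp: H10_subspace H1.ip_simps H1.sym H1.pos)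

lemma H10_hilbert: "semi_hilbert (H10_space \<Omega>) H1_inner"
proof -
  interpret V: semi_inner "H10_space \<Omega>" H1_inner
    rewrites "semi_inner.nrm H1_inner = H1_norm \<Omega>"
    using H10_semi_inner by (auto simp: semi_inner.nrm_def[OF H1_semi_inner] H1_norm_alt)
  show ?thesis
  proof
    fix s :: "nat \<Rightarrow> 'a \<Rightarrow> real"
    assume s: "\<And>n. s n \<in> H10_space \<Omega>"
      and cau: "\<And>e. e > 0 \<Longrightarrow> \<exists>N. \<forall>m\<ge>N. \<forall>n\<ge>N. semi_inner.nrm H1_inner (s m - s n) < e"
    have nrm: "semi_inner.nrm H1_inner = H1_norm \<Omega>"
      by (rule ext) (simp add: semi_inner.nrm_def[OF H1_semi_inner] H1_norm_alt)
    obtain x where x: "x \<in> H1_space \<Omega>" "(\<lambda>n. H1_norm \<Omega> (s n - x)) \<longlonglongrightarrow> 0"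
      using H1_complete[of s] s cau unfolding nrm by auto
    have "x \<in> H10_space \<Omega>"
    proof (rule H10I[OF x(1)])
      fix e :: real assume "e > 0"
      then have e2: "e / 2 > 0" by simp
      have "\<forall>\<^sub>F n in sequentially. H1_norm \<Omega> (s n - x) < e / 2" by (rule order_tendstoD(2)[OF x(2) e2])
      then obtain n where n: "H1_norm \<Omega> (s n - x) < e / 2" by (auto simp: eventually_sequentially)
      obtain \<psi> where \<psi>: "\<psi> \<in> test_functions \<Omega>" "H1_norm \<Omega> (s n - \<psi>) < e / 2" using H10_approx[OF s e2] by metis
      have "H1_norm \<Omega> (x - \<psi>) < e"
        using H1.nrm_triangle_diff[of x "s n" \<psi>] H1.nrm_diff_commute[of x "s n"] n \<psi> x s test_H1 by simp
      then show "\<exists>\<psi>\<in>test_functions \<Omega>. H1_norm \<Omega> (x - \<psi>) < e" using \<psi> by blast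
    qed
    then show "\<exists>x\<in>H10_space \<Omega>. (\<lambda>n. semi_inner.nrm H1_inner (s n - x)) \<longlonglongrightarrow> 0"
      using x(2) unfolding nrm by blast
  qed
qed

text \<open>Test functions belong to \<open>H10_space\<close>, so orthogonality to it is the
  hypothesis of the fundamental lemma. A function that vanishes almost everywhere has weak gradient
  zero, which gives \<open>null_V\<close>.\<close>

lemma gelfand_triple: "gelfand (L2_space \<Omega>) (H10_space \<Omega>) (L2_inner \<Omega>) H1_inner"
proof -
  interpret V: semi_hilbert "H10_space \<Omega>" H1_inner by (rule H10_hilbert)
  show ?thesis
  proof
    show "H10_space \<Omega> \<subseteq> L2_space \<Omega>" by auto
    show "L2_inner \<Omega> v v \<le> H1_inner v v" if "v \<in> H10_space \<Omega>" for v
      using that by (simp add: H1_inner_def dform_self)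
    show "L2_inner \<Omega> h h = 0" if "h \<in> L2_space \<Omega>" "\<And>\<phi>. \<phi> \<in> H10_space \<Omega> \<Longrightarrow> L2_inner \<Omega> h \<phi> = 0" for h
      unfolding L2_null_iff[OF that(1)]
      by (rule L2_eqI_test[OF that(1)]) (use that(2) test_H10 in \<open>simp add: L2_inner_def\<close>)
    fix v assume v: "v \<in> H10_space \<Omega>" and 0: "L2_inner \<Omega> v v = 0"
    have v0: "AE x in M\<Omega>. v x = 0" using 0 v by (simp add: L2_null_iff)
    have "weak_gradient \<Omega> v (\<lambda>x. 0)"
      unfolding weak_gradient_def
    proof (intro conjI ballI)
      fix \<psi> b assume "\<psi> \<in> test_functions \<Omega>" "b \<in> (Basis::'a set)"
      have "AE x in M\<Omega>. v x * frechet_derivative \<psi> (at x) b = 0" using v0 by eventually_elim simp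
      then show "(LINT x|M\<Omega>. v x * frechet_derivative \<psi> (at x) b) = - (LINT x|M\<Omega>. 0 \<bullet> b * \<psi> x)"
        by (simp add: integral_eq_zero_AE)
    qed (use L2_const[of 0] in simp)
    then have "AE x in M\<Omega>. grad \<Omega> v x = 0" using grad_AE v by auto
    then have "AE x in M\<Omega>. 1 * (grad \<Omega> v x \<bullet> grad \<Omega> v x) = 0" by eventually_elim simp
    then have "dform (\<lambda>x. 1) v v = 0" unfolding dform_def by (rule integral_eq_zero_AE)
    then show "H1_inner v v = 0" using 0 by (simp add: H1_inner_def)
  qed
qed

end

sublocale bounded_domain \<subseteq> G: gelfand "L2_space \<Omega>" "H10_space \<Omega>" "L2_inner \<Omega>" H1_inner
  rewrites "semi_inner.nrm (L2_inner \<Omega>) = L2_norm \<Omega>" and "semi_inner.nrm H1_inner = H1_norm \<Omega>"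
proof -
  show "gelfand (L2_space \<Omega>) (H10_space \<Omega>) (L2_inner \<Omega>) H1_inner" by (rule gelfand_triple)
  show "semi_inner.nrm (L2_inner \<Omega>) = L2_norm \<Omega>" by (rule L2_nrm)
  show "semi_inner.nrm H1_inner = H1_norm \<Omega>"
    by (intro ext) (simp add: semi_inner.nrm_def[OF H1_semi_inner] H1_norm_alt)
qed

context bounded_domain begin

lemma dform_bound:
  assumes \<alpha>: "coeff_fun C \<alpha>" and u: "u \<in> H1_space \<Omega>" and v: "v \<in> H1_space \<Omega>"
  shows "\<bar>dform \<alpha> u v\<bar> \<le> C * L2_norm \<Omega> (ngrad u) * L2_norm \<Omega> (ngrad v)"
    and "\<bar>dform \<alpha> u v\<bar> \<le> C * H1_norm \<Omega> u * H1_norm \<Omega> v"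
proof -
  have C: "0 \<le> C" using \<alpha> by (auto simp: coeff_fun_def intro: order_trans[OF abs_ge_zero])
  have "L2_norm \<Omega> (\<lambda>x. \<bar>\<alpha> x\<bar> * ngrad v x) \<le> C * L2_norm \<Omega> (ngrad v)"
  proof (rule power2_le_imp_le)
    have "(LINT x|M\<Omega>. (\<bar>\<alpha> x\<bar> * ngrad v x)\<^sup>2) \<le> (LINT x|M\<Omega>. C\<^sup>2 * (ngrad v x)\<^sup>2)"
    proof (rule integral_mono)
      fix x
      have "(\<bar>\<alpha> x\<bar>)\<^sup>2 \<le> C\<^sup>2" using \<alpha> by (intro power_mono) (auto simp: coeff_fun_def)
      then show "(\<bar>\<alpha> x\<bar> * ngrad v x)\<^sup>2 \<le> C\<^sup>2 * (ngrad v x)\<^sup>2"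
        unfolding power_mult_distrib by (intro mult_right_mono) auto
    qed (use L2_square_integrable[OF coeff_L2[OF \<alpha> ngrad_L2[OF v]]] L2_square_integrable[OF ngrad_L2[OF v]] in simp_all)
    then show "(L2_norm \<Omega> (\<lambda>x. \<bar>\<alpha> x\<bar> * ngrad v x))\<^sup>2 \<le> (C * L2_norm \<Omega> (ngrad v))\<^sup>2"
      using L2_norm_sq[OF coeff_L2[OF \<alpha> ngrad_L2[OF v]]] L2_norm_sq[OF ngrad_L2[OF v]]
      by (simp add: power_mult_distrib)
  qed (use C ngrad_L2[OF v] in simp)
  then have "L2_norm \<Omega> (\<lambda>x. \<bar>\<alpha> x\<bar> * ngrad v x) * L2_norm \<Omega> (ngrad u) \<le> C * L2_norm \<Omega> (ngrad v) * L2_norm \<Omega> (ngrad u)"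
    using ngrad_L2[OF u] by (intro mult_right_mono) auto
  then show 1: "\<bar>dform \<alpha> u v\<bar> \<le> C * L2_norm \<Omega> (ngrad u) * L2_norm \<Omega> (ngrad v)"
    using dform_bound'[OF \<alpha> u v] by (simp add: mult_ac)
  have "C * L2_norm \<Omega> (ngrad u) * L2_norm \<Omega> (ngrad v) \<le> C * H1_norm \<Omega> u * H1_norm \<Omega> v"
    using C u v ngrad_L2 ngrad_le_H1 by (intro mult_mono mult_nonneg_nonneg) auto
  with 1 show "\<bar>dform \<alpha> u v\<bar> \<le> C * H1_norm \<Omega> u * H1_norm \<Omega> v" by linarith
qed

lemma dform_coercive:
  assumes \<alpha>: "coeff_fun C \<alpha>" and m: "\<And>x. m \<le> \<alpha> x" and u: "u \<in> H1_space \<Omega>"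
  shows "m * (L2_norm \<Omega> (ngrad u))\<^sup>2 \<le> dform \<alpha> u u"
proof -
  have "(LINT x|M\<Omega>. m * (1 * (grad \<Omega> u x \<bullet> grad \<Omega> u x))) \<le> dform \<alpha> u u"
    unfolding dform_def
  proof (rule integral_mono)
    show "integrable M\<Omega> (\<lambda>x. m * (1 * (grad \<Omega> u x \<bullet> grad \<Omega> u x)))"
      by (rule integrable_mult_right[OF dform_integrable[OF coeff_const u u]])
    show "integrable M\<Omega> (\<lambda>x. \<alpha> x * (grad \<Omega> u x \<bullet> grad \<Omega> u x))" by (rule dform_integrable[OF \<alpha> u u])
    show "m * (1 * (grad \<Omega> u x \<bullet> grad \<Omega> u x)) \<le> \<alpha> x * (grad \<Omega> u x \<bullet> grad \<Omega> u x)" for x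
      using m[of x] by (simp add: mult_right_mono)
  qed
  moreover have "(LINT x|M\<Omega>. m * (1 * (grad \<Omega> u x \<bullet> grad \<Omega> u x))) = m * dform (\<lambda>x. 1) u u"
    unfolding dform_def by (rule integral_mult_right_zero)
  ultimately show ?thesis unfolding dform_self[OF u] by argo
qed

lemma coeff_diff: "coeff_fun C \<alpha> \<Longrightarrow> coeff_fun D \<alpha>' \<Longrightarrow> coeff_fun (C + D) (\<lambda>x. \<alpha> x - \<alpha>' x)"
  unfolding coeff_fun_def by (auto intro!: borel_measurable_diff order_trans[OF abs_triangle_ineq4] add_mono)

lemma dform_coeff_diff:
  assumes "coeff_fun C \<alpha>" "coeff_fun D \<alpha>'" "u \<in> H1_space \<Omega>" "v \<in> H1_space \<Omega>"
  shows "dform \<alpha> u v - dform \<alpha>' u v = dform (\<lambda>x. \<alpha> x - \<alpha>' x) u v"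
  using dform_integrable[OF assms(1,3,4)] dform_integrable[OF assms(2,3,4)]
  by (simp add: dform_def left_diff_distrib)

text \<open>Size of the change of the form when the coefficient is replaced while one argument
  \<open>v\<close> is fixed.\<close>

definition coeff_dist :: "('a \<Rightarrow> real) \<Rightarrow> ('a \<Rightarrow> real) \<Rightarrow> ('a \<Rightarrow> real) \<Rightarrow> real" where
  "coeff_dist \<alpha> \<alpha>' v = L2_norm \<Omega> (\<lambda>x. \<bar>\<alpha> x - \<alpha>' x\<bar> * ngrad v x)"

lemma dform_coeff_dist:
  assumes "coeff_fun C \<alpha>" "coeff_fun C \<alpha>'" "u \<in> H1_space \<Omega>" "v \<in> H1_space \<Omega>"
  shows "\<bar>dform \<alpha> u v - dform \<alpha>' u v\<bar> \<le> coeff_dist \<alpha> \<alpha>' v * H1_norm \<Omega> u"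
proof -
  note d = coeff_diff[OF assms(1,2)]
  have "\<bar>dform \<alpha> u v - dform \<alpha>' u v\<bar> \<le> coeff_dist \<alpha> \<alpha>' v * L2_norm \<Omega> (ngrad u)"
    unfolding dform_coeff_diff[OF assms] coeff_dist_def by (rule dform_bound'[OF d assms(3,4)])
  also have "\<dots> \<le> coeff_dist \<alpha> \<alpha>' v * H1_norm \<Omega> u"
    unfolding coeff_dist_def
    using ngrad_le_H1[OF assms(3)] coeff_L2[OF d ngrad_L2[OF assms(4)]] by (intro mult_left_mono) auto
  finally show ?thesis .
qed

lemma coeff_dist_nonneg:
  assumes "coeff_fun C \<alpha>" "coeff_fun C \<alpha>'" "v \<in> H1_space \<Omega>"
  shows "0 \<le> coeff_dist \<alpha> \<alpha>' v"
  unfolding coeff_dist_def by (rule L2.nrm_ge_0[OF coeff_L2[OF coeff_diff[OF assms(1,2)] ngrad_L2[OF assms(3)]]])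

lemma coeff_dist_le:
  assumes "coeff_fun C \<alpha>" "coeff_fun C \<alpha>'" "v \<in> H1_space \<Omega>"
  shows "(coeff_dist \<alpha> \<alpha>' v)\<^sup>2 \<le> (2 * C)\<^sup>2 * (H1_norm \<Omega> v)\<^sup>2"
proof -
  note d = coeff_diff[OF assms(1,2)]
  have "(LINT x|M\<Omega>. (\<bar>\<alpha> x - \<alpha>' x\<bar> * ngrad v x)\<^sup>2) \<le> (LINT x|M\<Omega>. (2 * C)\<^sup>2 * (ngrad v x)\<^sup>2)"
  proof (rule integral_mono)
    fix x
    have "(\<bar>\<alpha> x - \<alpha>' x\<bar>)\<^sup>2 \<le> (2 * C)\<^sup>2"
      using d by (intro power_mono) (auto simp: coeff_fun_def)
    then show "(\<bar>\<alpha> x - \<alpha>' x\<bar> * ngrad v x)\<^sup>2 \<le> (2 * C)\<^sup>2 * (ngrad v x)\<^sup>2"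
      unfolding power_mult_distrib by (intro mult_right_mono) auto
  qed (use L2_square_integrable[OF coeff_L2[OF d ngrad_L2[OF assms(3)]]] L2_square_integrable[OF ngrad_L2[OF assms(3)]] in simp_all)
  then have "(coeff_dist \<alpha> \<alpha>' v)\<^sup>2 \<le> (2 * C)\<^sup>2 * (L2_norm \<Omega> (ngrad v))\<^sup>2"
    unfolding coeff_dist_def
    using L2_norm_sq[OF coeff_L2[OF d ngrad_L2[OF assms(3)]]] L2_norm_sq[OF ngrad_L2[OF assms(3)]] by simp
  also have "\<dots> \<le> (2 * C)\<^sup>2 * (H1_norm \<Omega> v)\<^sup>2"
    using ngrad_le_H1[OF assms(3)] ngrad_L2[OF assms(3)] by (intro mult_left_mono power_mono) auto
  finally show ?thesis .
qed

lemma coeff_dist_tendsto: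
  assumes \<alpha>: "\<And>n. coeff_fun C (\<alpha> n)" "coeff_fun C \<alpha>'" and lim: "\<And>x. x \<in> \<Omega> \<Longrightarrow> (\<lambda>n. \<alpha> n x) \<longlonglongrightarrow> \<alpha>' x"
    and v: "v \<in> H1_space \<Omega>"
  shows "(\<lambda>n. coeff_dist (\<alpha> n) \<alpha>' v) \<longlonglongrightarrow> 0"
proof -
  note d = coeff_diff[OF \<alpha>(1) \<alpha>(2)]
  have "(\<lambda>n. LINT x|M\<Omega>. (\<bar>\<alpha> n x - \<alpha>' x\<bar> * ngrad v x)\<^sup>2) \<longlonglongrightarrow> (LINT x|M\<Omega>. 0)"
  proof (rule integral_dominated_convergence[where w="\<lambda>x. (2 * C)\<^sup>2 * (ngrad v x)\<^sup>2"])
    show "(\<lambda>x. (\<bar>\<alpha> n x - \<alpha>' x\<bar> * ngrad v x)\<^sup>2) \<in> borel_measurable M\<Omega>" for n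
      using L2_square_integrable[OF coeff_L2[OF d ngrad_L2[OF v]]] by simp
    show "integrable M\<Omega> (\<lambda>x. (2 * C)\<^sup>2 * (ngrad v x)\<^sup>2)"
      using L2_square_integrable[OF ngrad_L2[OF v]] by simp
    show "AE x in M\<Omega>. (\<lambda>n. (\<bar>\<alpha> n x - \<alpha>' x\<bar> * ngrad v x)\<^sup>2) \<longlonglongrightarrow> 0"
    proof (rule AE_I2)
      fix x assume "x \<in> space M\<Omega>"
      then have "(\<lambda>n. (\<bar>\<alpha> n x - \<alpha>' x\<bar> * ngrad v x)\<^sup>2) \<longlonglongrightarrow> (\<bar>\<alpha>' x - \<alpha>' x\<bar> * ngrad v x)\<^sup>2"
        by (intro tendsto_intros lim) simp
      then show "(\<lambda>n. (\<bar>\<alpha> n x - \<alpha>' x\<bar> * ngrad v x)\<^sup>2) \<longlonglongrightarrow> 0" by simp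
    qed
    show "AE x in M\<Omega>. norm ((\<bar>\<alpha> n x - \<alpha>' x\<bar> * ngrad v x)\<^sup>2) \<le> (2 * C)\<^sup>2 * (ngrad v x)\<^sup>2" for n
    proof (rule AE_I2)
      fix x
      have "(\<bar>\<alpha> n x - \<alpha>' x\<bar>)\<^sup>2 \<le> (2 * C)\<^sup>2"
        using d[of n] by (intro power_mono) (auto simp: coeff_fun_def)
      then show "norm ((\<bar>\<alpha> n x - \<alpha>' x\<bar> * ngrad v x)\<^sup>2) \<le> (2 * C)\<^sup>2 * (ngrad v x)\<^sup>2"
        unfolding power_mult_distrib real_norm_def by (simp add: mult_right_mono)
    qed
  qed simp
  then have "(\<lambda>n. (coeff_dist (\<alpha> n) \<alpha>' v)\<^sup>2) \<longlonglongrightarrow> 0"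
    unfolding coeff_dist_def using L2_norm_sq[OF coeff_L2[OF d ngrad_L2[OF v]]] by simp
  then have "(\<lambda>n. sqrt ((coeff_dist (\<alpha> n) \<alpha>' v)\<^sup>2)) \<longlonglongrightarrow> sqrt 0" by (intro tendsto_intros)
  then show ?thesis using coeff_dist_nonneg[OF \<alpha>(1) \<alpha>(2) v] by simp
qed

end

section \<open>Distributional derivatives in time\<close>

lemma test_deriv:
  fixes \<psi> :: "real \<Rightarrow> real"
  assumes "\<psi> \<in> test_functions S"
  shows "(\<psi> has_real_derivative deriv \<psi> t) (at t)" "continuous_on UNIV (deriv \<psi>)"
proof -
  have "Ck (Suc 0) \<psi>" using test_functionsD(1)[OF assms] .
  then obtain F' where F': "\<And>y. (\<psi> has_real_derivative F' y) (at y)" "Ck 0 F'" "deriv \<psi> = F'"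
    by (rule Ck_real_SucE) (rule that)
  show "(\<psi> has_real_derivative deriv \<psi> t) (at t)" "continuous_on UNIV (deriv \<psi>)"
    using F' by auto
qed

lemma continuous_integrable_MT:
  fixes h :: "real \<Rightarrow> real"
  assumes "continuous_on {0..T} h"
  shows "integrable (MT T) h" "\<exists>C. \<forall>t\<in>{0..T}. \<bar>h t\<bar> \<le> C"
proof -
  have "bounded (h ` {0..T})"
    by (intro compact_imp_bounded compact_continuous_image assms) simp
  then obtain C where "\<forall>x\<in>h ` {0..T}. norm x \<le> C" unfolding bounded_iff by blast
  then have C: "\<And>t. t \<in> {0..T} \<Longrightarrow> \<bar>h t\<bar> \<le> C" by simp
  then show "\<exists>C. \<forall>t\<in>{0..T}. \<bar>h t\<bar> \<le> C" by blast
  interpret finite_measure "MT T" by (rule finite_measure_MT)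
  show "integrable (MT T) h"
  proof (rule integrable_const_bound[where B=C])
    show "AE t in MT T. norm (h t) \<le> C" by (rule AE_I2) (use C in auto)
    show "h \<in> borel_measurable (MT T)"
      by (rule continuous_imp_measurable_on_sets_lebesgue) (auto intro: continuous_on_subset[OF assms])
  qed
qed

lemma integrable_mult_bounded:
  fixes b h :: "'a \<Rightarrow> real"
  assumes "integrable M b" "h \<in> borel_measurable M" "AE t in M. \<bar>h t\<bar> \<le> C"
  shows "integrable M (\<lambda>t. b t * h t)"
proof (rule Bochner_Integration.integrable_bound[of _ "\<lambda>t. C * b t"])
  show "AE t in M. norm (b t * h t) \<le> norm (C * b t)"
    using assms(3)
  proof eventually_elim
    case (elim t)
    have "\<bar>h t\<bar> * \<bar>b t\<bar> \<le> \<bar>C\<bar> * \<bar>b t\<bar>" using elim by (intro mult_right_mono) auto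
    then show ?case by (simp add: abs_mult mult.commute)
  qed
qed (use assms in auto)

text \<open>Fundamental theorem of calculus up to \<open>T\<close>; a test function vanishes at both
  ends because it vanishes outside the open interval.\<close>

lemma test_integrals:
  assumes \<psi>: "\<psi> \<in> test_functions {0<..<T}" and \<sigma>: "\<sigma> \<in> {0<..<T}"
  shows "(LINT t|MT T. (if \<sigma> \<le> t then deriv \<psi> t else 0)) = - \<psi> \<sigma>"
    and "(LINT t|MT T. deriv \<psi> t) = 0"
proof -
  have *: "(LINT t|MT T. (if s \<le> t then deriv \<psi> t else 0)) = - \<psi> s" if s: "0 \<le> s" "s < T" for s
  proof -
    have "(deriv \<psi> has_integral (\<psi> T - \<psi> s)) {s..T}"
      by (rule fundamental_theorem_of_calculus)
        (use s test_deriv(1)[OF \<psi>] in \<open>auto simp: has_real_derivative_iff_has_vector_derivative[symmetric] intro: has_field_derivative_at_within\<close>)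
    then have "((\<lambda>t. if t \<in> {s..T} then deriv \<psi> t else 0) has_integral (- \<psi> s)) UNIV"
      using test_functionsD(5)[OF \<psi>, of T] by (simp only: has_integral_restrict_UNIV) simp
    moreover have "negligible {s, T}" by simp
    ultimately have "((\<lambda>t. if t \<in> {0<..<T} then (if s \<le> t then deriv \<psi> t else 0) else 0) has_integral (- \<psi> s)) UNIV"
      by (rule has_integral_spike[rotated -1]) (use s in auto)
    then have hi: "((\<lambda>t. if s \<le> t then deriv \<psi> t else 0) has_integral (- \<psi> s)) {0<..<T}"
      by (simp only: has_integral_restrict_UNIV)
    have "integrable (MT T) (\<lambda>t. deriv \<psi> t * (if s \<le> t then 1 else 0))"
      by (rule integrable_mult_bounded[where C=1])
        (auto intro: continuous_integrable_MT(1) continuous_on_subset[OF test_deriv(2)[OF \<psi>]])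
    moreover have "(\<lambda>t. deriv \<psi> t * (if s \<le> t then 1 else 0)) = (\<lambda>t. if s \<le> t then deriv \<psi> t else 0)"
      by auto
    ultimately have int: "integrable (MT T) (\<lambda>t. if s \<le> t then deriv \<psi> t else 0)" by simp
    show ?thesis
      using lebesgue_integral_eq_integral[OF int] integral_unique[OF hi] by simp
  qed
  show "(LINT t|MT T. (if \<sigma> \<le> t then deriv \<psi> t else 0)) = - \<psi> \<sigma>" by (rule *) (use \<sigma> in auto)
  have "(LINT t|MT T. deriv \<psi> t) = (LINT t|MT T. (if 0 \<le> t then deriv \<psi> t else 0))"
    by (rule Bochner_Integration.integral_cong) auto
  also have "\<dots> = 0" using *[of 0] \<sigma> test_functionsD(5)[OF \<psi>, of 0] by simp
  finally show "(LINT t|MT T. deriv \<psi> t) = 0" .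
qed

text \<open>Fubini on the triangle of all pairs with \<open>\<sigma> \<le> t\<close>: the inner
  integral of \<open>deriv \<psi>\<close> from \<open>\<sigma>\<close> to \<open>T\<close> is
  \<open>- \<psi> \<sigma>\<close>.\<close>

lemma parts_in_time:
  assumes b: "integrable (MT T) b" and \<psi>: "\<psi> \<in> test_functions {0<..<T}" and T: "T > 0"
    and p: "\<And>t. t \<in> {0<..<T} \<Longrightarrow> p t = c + iint T b 0 t"
  shows "(LINT t|MT T. p t * deriv \<psi> t) = - (LINT t|MT T. b t * \<psi> t)"
proof -
  let ?f = "\<lambda>\<sigma> t. b \<sigma> * (if \<sigma> \<le> t then deriv \<psi> t else 0)"
  interpret P: pair_sigma_finite "MT T" "MT T"
    unfolding pair_sigma_finite_def using finite_measure.axioms(1)[OF finite_measure_MT] by blast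
  note cont = continuous_on_subset[OF test_deriv(2)[OF \<psi>], of "{0..T}"]
  have [measurable]: "b \<in> borel_measurable (MT T)" "deriv \<psi> \<in> borel_measurable (MT T)"
    using b continuous_integrable_MT(1)[OF cont] by auto
  obtain C where C: "\<And>t. t \<in> {0..T} \<Longrightarrow> \<bar>deriv \<psi> t\<bar> \<le> C"
    using continuous_integrable_MT(2)[OF cont] by blast
  have meas: "case_prod ?f \<in> borel_measurable (MT T \<Otimes>\<^sub>M MT T)" by measurable
  have "integrable (MT T \<Otimes>\<^sub>M MT T) (\<lambda>(\<sigma>, t). b \<sigma> * C)"
  proof (rule P.Fubini_integrable)
    interpret finite_measure "MT T" by (rule finite_measure_MT)
    show "integrable (MT T) (\<lambda>x. LINT y|MT T. norm (case (x, y) of (\<sigma>, t) \<Rightarrow> b \<sigma> * C))"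
      using b by (auto intro!: integrable_mult_right integrable_mult_left integrable_abs simp: abs_mult)
    show "AE x in MT T. integrable (MT T) (\<lambda>y. case (x, y) of (\<sigma>, t) \<Rightarrow> b \<sigma> * C)" by simp
    show "(\<lambda>(\<sigma>, t). b \<sigma> * C) \<in> borel_measurable (MT T \<Otimes>\<^sub>M MT T)" by measurable
  qed
  then have int: "integrable (MT T \<Otimes>\<^sub>M MT T) (case_prod ?f)"
  proof (rule Bochner_Integration.integrable_bound[OF _ meas])
    show "AE x in MT T \<Otimes>\<^sub>M MT T. norm (case_prod ?f x) \<le> norm (case x of (\<sigma>, t) \<Rightarrow> b \<sigma> * C)"
    proof (rule AE_I2)
      fix x assume "x \<in> space (MT T \<Otimes>\<^sub>M MT T)"
      then obtain \<sigma> t where x: "x = (\<sigma>, t)" and t: "t \<in> {0..T}" by (auto simp: space_pair_measure)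
      have "\<bar>if \<sigma> \<le> t then deriv \<psi> t else 0\<bar> \<le> \<bar>C\<bar>" using C[OF t] by auto
      then show "norm (case_prod ?f x) \<le> norm (case x of (\<sigma>, t) \<Rightarrow> b \<sigma> * C)"
        by (simp add: x abs_mult mult_left_mono)
    qed
  qed
  have "(LINT t|MT T. p t * deriv \<psi> t) = (LINT t|MT T. c * deriv \<psi> t + (LINT \<sigma>|MT T. ?f \<sigma> t))"
  proof (rule Bochner_Integration.integral_cong[OF refl])
    fix t assume t: "t \<in> space (MT T)"
    have "(LINT \<sigma>|MT T. ?f \<sigma> t) = (LINT \<sigma>|MT T. (if 0 < \<sigma> \<and> \<sigma> \<le> t then b \<sigma> else 0) * deriv \<psi> t)"
      by (rule Bochner_Integration.integral_cong) auto
    also have "\<dots> = iint T b 0 t * deriv \<psi> t" by (simp add: iint_def)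
    finally show "p t * deriv \<psi> t = c * deriv \<psi> t + (LINT \<sigma>|MT T. ?f \<sigma> t)"
      using p t by (simp add: distrib_right)
  qed
  also have "\<dots> = (LINT t|MT T. c * deriv \<psi> t) + (LINT t|MT T. LINT \<sigma>|MT T. ?f \<sigma> t)"
    by (rule Bochner_Integration.integral_add)
      (use continuous_integrable_MT(1)[OF cont] P.integrable_snd[OF int] in auto)
  also have "(LINT t|MT T. c * deriv \<psi> t) = 0" using test_integrals(2)[OF \<psi>, of "T/2"] T by simp
  also have "(LINT t|MT T. LINT \<sigma>|MT T. ?f \<sigma> t) = (LINT \<sigma>|MT T. LINT t|MT T. ?f \<sigma> t)"
    by (rule P.Fubini_integral[OF int])
  also have "\<dots> = (LINT \<sigma>|MT T. - (b \<sigma> * \<psi> \<sigma>))"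
    by (rule Bochner_Integration.integral_cong) (use test_integrals(1)[OF \<psi>] in auto)
  finally show ?thesis by simp
qed

text \<open>\<open>R\<close> is a smooth step, constant on either side of the support of
  \<open>\<rho>\<close>. The difference of two translated steps has compact support, and its
  derivative is a difference of two bumps.\<close>

lemma interval_bump:
  fixes \<delta> :: real
  assumes \<delta>: "\<delta> > 0"
  obtains \<rho> R where "\<And>k. Ck k \<rho>" "\<And>x. (R has_real_derivative \<rho> x) (at x)" "\<And>x. 0 \<le> \<rho> x" "\<And>x. \<rho> x > 0 \<longleftrightarrow> \<bar>x\<bar> < \<delta>"
    "\<And>x. x \<le> - \<delta> \<Longrightarrow> R x = 0" "\<And>x. x \<ge> \<delta> \<Longrightarrow> R x = R \<delta>"
proof -
  define \<rho> where "\<rho> = box_bump (- \<delta>) \<delta> 1"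
  \<comment> \<open>The lower limit is one unit to the left of the support, so that the one-sided
    fundamental theorem covers a neighbourhood of its left end; further left \<open>R\<close>
    vanishes.\<close>
  define R where "R x = integral {- \<delta> - 1..x} \<rho>" for x
  have C: "Ck k \<rho>" for k unfolding \<rho>_def by (rule box_bump_Ck)
  have cont: "continuous_on S \<rho>" for S using C[of 0] by (auto intro: continuous_on_subset)
  have \<rho>0: "0 \<le> \<rho> x" for x unfolding \<rho>_def by (rule box_bump_range)
  have nz: "\<rho> x \<noteq> 0 \<longleftrightarrow> \<bar>x\<bar> < \<delta>" for x unfolding \<rho>_def by (subst box_bump_pos_iff) auto
  have R0: "R x = 0" if "x \<le> - \<delta>" for x
  proof -
    have "R x = integral {- \<delta> - 1..x} (\<lambda>x. 0)"
      unfolding R_def by (rule integral_cong) (use nz that in force)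
    then show ?thesis by simp
  qed
  have R1: "R x = R \<delta>" if "x \<ge> \<delta>" for x
  proof -
    have "R x = R \<delta> + integral {\<delta>..x} \<rho>"
      unfolding R_def by (rule Henstock_Kurzweil_Integration.integral_combine[symmetric])
        (use that \<delta> in \<open>auto intro!: integrable_continuous_real cont\<close>)
    also have "integral {\<delta>..x} \<rho> = integral {\<delta>..x} (\<lambda>x. 0)"
      by (rule integral_cong) (use nz in force)
    finally show ?thesis by simp
  qed
  have "(R has_real_derivative \<rho> x) (at x)" for x
  proof (cases "x > - \<delta> - 1")
    case True
    have "(R has_real_derivative \<rho> x) (at x within {- \<delta> - 1..x + 1})"
      unfolding R_def by (rule integral_has_real_derivative[OF cont]) (use True in auto)
    then have "(R has_real_derivative \<rho> x) (at x within {- \<delta> - 1<..<x + 1})"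
      by (rule has_field_derivative_subset) auto
    then show ?thesis using True by (simp add: at_within_open[of x "{- \<delta> - 1<..<x + 1}"])
  next
    case False
    then have x: "x < - \<delta>" by simp
    have "\<forall>\<^sub>F y in nhds x. y < - \<delta>" using x by (rule eventually_nhds_in_open[of "{..< - \<delta>}" x, simplified])
    then have "\<forall>\<^sub>F y in nhds x. R y = 0" by eventually_elim (simp add: R0)
    moreover have "\<rho> x = 0" using nz[of x] x \<delta> by auto
    ultimately show ?thesis
      by (subst DERIV_cong_ev[OF refl _ refl, where g="\<lambda>x. 0"]) auto
  qed
  moreover have "\<rho> x > 0 \<longleftrightarrow> \<bar>x\<bar> < \<delta>" for x using nz[of x] \<rho>0[of x] by linarith
  ultimately show ?thesis using that[of \<rho> R] C \<rho>0 R0 R1 by blast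
qed

text \<open>Testing with the difference of two steps, centred at \<open>s\<close> and
  \<open>t\<close>, shows that the averages of \<open>q\<close> against equal bumps there coincide,
  and by continuity these averages are close to \<open>q s\<close> and \<open>q t\<close>. The
  inequality suffices because the roles of \<open>s\<close> and \<open>t\<close> can be
  exchanged.\<close>

lemma constant_of_weak_deriv_zero:
  assumes q: "continuous_on {0..T} q"
    and zero: "\<And>\<psi>. \<psi> \<in> test_functions {0<..<T} \<Longrightarrow> (LINT t|MT T. q t * deriv \<psi> t) = 0"
    and s: "s \<in> {0<..<T}" and t: "t \<in> {0<..<T}"
  shows "q t \<le> q s"
proof (rule field_le_epsilon)
  fix e :: real assume e: "e > 0"
  define \<eta> where "\<eta> = e / 2"
  have \<eta>: "\<eta> > 0" using e by (simp add: \<eta>_def)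
  have near: "\<exists>\<delta>>0. \<forall>x. \<bar>x - s\<bar> < \<delta> \<longrightarrow> x \<in> {0<..<T} \<and> \<bar>q x - q s\<bar> < \<eta>" if s: "s \<in> {0<..<T}" for s
  proof -
    have "isCont q s" using q s by (auto intro: continuous_on_interior)
    then obtain d where d: "d > 0" "\<And>x. dist x s < d \<Longrightarrow> dist (q x) (q s) < \<eta>"
      using \<eta> by (auto simp: continuous_at_eps_delta)
    show ?thesis
      using d s by (intro exI[of _ "min d (min s (T - s))"]) (auto simp: dist_real_def)
  qed
  obtain d1 where d1: "d1 > 0" "\<And>x. \<bar>x - s\<bar> < d1 \<Longrightarrow> x \<in> {0<..<T} \<and> \<bar>q x - q s\<bar> < \<eta>" using near[OF s] by blast
  obtain d2 where d2: "d2 > 0" "\<And>x. \<bar>x - t\<bar> < d2 \<Longrightarrow> x \<in> {0<..<T} \<and> \<bar>q x - q t\<bar> < \<eta>" using near[OF t] by blast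
  define \<delta> where "\<delta> = min d1 d2 / 2"
  have \<delta>: "\<delta> > 0" "\<delta> < d1" "\<delta> < d2" using d1(1) d2(1) by (auto simp: \<delta>_def min_def)
  obtain \<rho> R where \<rho>: "\<And>k. Ck k \<rho>" and R: "\<And>x. (R has_real_derivative \<rho> x) (at x)"
    and \<rho>0: "\<And>x. 0 \<le> \<rho> x" and \<rho>_pos: "\<And>x. \<rho> x > 0 \<longleftrightarrow> \<bar>x\<bar> < \<delta>"
    and R0: "\<And>x. x \<le> - \<delta> \<Longrightarrow> R x = 0" and R1: "\<And>x. x \<ge> \<delta> \<Longrightarrow> R x = R \<delta>"
    by (rule interval_bump[OF \<delta>(1)], rule that)
  define \<psi> where "\<psi> x = R (x - s) - R (x - t)" for x
  have der: "(\<psi> has_real_derivative (\<rho> (x - s) - \<rho> (x - t))) (at x)" for x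
  proof -
    have "((\<lambda>x. R (x - c)) has_real_derivative \<rho> (x - c)) (at x)" for c
    proof -
      have "((\<lambda>x. x - c) has_real_derivative 1) (at x)" by (auto intro!: derivative_eq_intros)
      from DERIV_chain'[OF this R] show ?thesis by simp
    qed
    then show ?thesis unfolding \<psi>_def by (intro DERIV_diff)
  qed
  have Ck\<rho>: "Ck k (\<lambda>x. \<rho> (x - c))" for k c
    using Ck_affine_comp[OF \<rho>, of k "1::real" "- c"] by simp
  have Ck\<psi>: "Ck k \<psi>" for k
  proof -
    have "Ck k (\<lambda>x. \<rho> (x - s) - \<rho> (x - t))" for k
      using Ck_add[OF Ck\<rho>[of k s] Ck_cmult[OF Ck\<rho>[of k t], of "-1"]] by simp
    then have "Ck (Suc k) \<psi>" by (rule Ck_real_SucI[OF der])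
    then show ?thesis by (rule Ck_Suc_D)
  qed
  have edge: "{c - \<delta>..c + \<delta>} \<subseteq> {0<..<T}" if "c = s \<or> c = t" for c
    using that d1(2) d2(2) \<delta> by (auto simp: abs_less_iff subset_iff)
  have \<psi>T: "\<psi> \<in> test_functions {0<..<T}"
  proof (rule test_functionsI[where K="{min s t - \<delta>..max s t + \<delta>}", OF Ck\<psi>])
    fix x assume x: "\<psi> x \<noteq> 0"
    show "x \<in> {min s t - \<delta>..max s t + \<delta>}"
    proof (rule ccontr)
      assume "x \<notin> {min s t - \<delta>..max s t + \<delta>}"
      then consider "x \<le> s - \<delta>" "x \<le> t - \<delta>" | "x \<ge> s + \<delta>" "x \<ge> t + \<delta>" by (auto simp: min_def max_def split: if_splits)
      then show False
      proof cases
        case 1 then show ?thesis using x R0[of "x - s"] R0[of "x - t"] by (simp add: \<psi>_def)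
      next
        case 2 then show ?thesis using x R1[of "x - s"] R1[of "x - t"] by (simp add: \<psi>_def)
      qed
    qed
  next
    have "min s t - \<delta> \<in> {0<..<T}" "max s t + \<delta> \<in> {0<..<T}"
      using edge[of s] edge[of t] \<delta> by (auto simp: min_def max_def subset_iff)
    then show "{min s t - \<delta>..max s t + \<delta>} \<subseteq> {0<..<T}" by auto
  qed auto
  have deriv\<psi>: "deriv \<psi> = (\<lambda>x. \<rho> (x - s) - \<rho> (x - t))" using DERIV_imp_deriv[OF der] by (rule ext)
  have \<rho>c: "continuous_on S (\<lambda>x. \<rho> (x - c))" for S c
    using Ck\<rho>[of 0 c] by (auto intro: continuous_on_subset)
  have int: "integrable (MT T) (\<lambda>x. q x * \<rho> (x - c))" "integrable (MT T) (\<lambda>x. \<rho> (x - c))" for c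
    by (intro continuous_integrable_MT(1) continuous_intros q \<rho>c)+
  define m where "m = (LINT x|lborel. \<rho> x)"
  have mass: "(LINT x|MT T. \<rho> (x - c)) = m" if c: "c = s \<or> c = t" for c
  proof -
    have "(LINT x|MT T. \<rho> (x - c)) = (LINT x|lborel. \<rho> (x - c))"
    proof (rule lebesgue_on_eq_lborel)
      fix x assume "x \<notin> {0<..<T}"
      then have "\<not> \<bar>x - c\<bar> < \<delta>" using edge[OF c] by (auto simp: abs_less_iff subset_iff)
      then show "\<rho> (x - c) = 0" using \<rho>_pos[of "x - c"] \<rho>0[of "x - c"] by linarith
    qed (auto intro!: borel_measurable_continuous_onI \<rho>c)
    also have "\<dots> = m"
      unfolding m_def using lborel_integral_real_affine[of 1 "\<lambda>x. \<rho> (x - c)" c] by simp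
    finally show ?thesis .
  qed
  have m: "m > 0"
  proof -
    have "m \<ge> 0" unfolding m_def by (rule Bochner_Integration.integral_nonneg) (rule \<rho>0)
    moreover have "m \<noteq> 0"
    proof
      assume m0: "m = 0"
      have "AE x in MT T. \<rho> (x - s) = 0"
        using integral_nonneg_eq_0_iff_AE[OF int(2)[of s]] \<rho>0 mass[of s] m0 by simp
      then have "AE x in lebesgue. x \<in> {0<..<T} \<longrightarrow> \<rho> (x - s) = 0" by (simp add: AE_restrict_space_iff)
      then have "AE x in lebesgue. x \<notin> {s - \<delta><..<s + \<delta>}"
      proof eventually_elim
        case (elim x)
        show ?case
        proof
          assume x: "x \<in> {s - \<delta><..<s + \<delta>}"
          then have "x \<in> {0<..<T}" using edge[of s] by (auto simp: subset_iff)
          then have "\<rho> (x - s) = 0" using elim by simp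
          then show False using \<rho>_pos[of "x - s"] x by (auto simp: abs_less_iff)
        qed
      qed
      then have "{s - \<delta><..<s + \<delta>} \<in> null_sets lebesgue"
        by (subst AE_iff_null_sets) simp_all
      then have "emeasure lborel {s - \<delta><..<s + \<delta>} = 0" by (simp add: null_sets_def)
      then show False using \<delta>(1) by (simp add: emeasure_lborel_Ioo)
    qed
    ultimately show ?thesis by simp
  qed
  have "(LINT x|MT T. q x * \<rho> (x - s) - q x * \<rho> (x - t)) = 0"
    using zero[OF \<psi>T] unfolding deriv\<psi> by (simp add: right_diff_distrib)
  then have eq: "(LINT x|MT T. q x * \<rho> (x - s)) = (LINT x|MT T. q x * \<rho> (x - t))"
    using int by simp
  have "(LINT x|MT T. q x * \<rho> (x - s)) \<le> (LINT x|MT T. (q s + \<eta>) * \<rho> (x - s))"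
  proof (rule integral_mono)
    fix x
    show "q x * \<rho> (x - s) \<le> (q s + \<eta>) * \<rho> (x - s)"
    proof (cases "\<bar>x - s\<bar> < \<delta>")
      case True
      then have "q x \<le> q s + \<eta>" using d1(2)[of x] \<delta> by (auto simp: abs_less_iff)
      then show ?thesis by (rule mult_right_mono[OF _ \<rho>0])
    next
      case False
      then have "\<rho> (x - s) = 0" using \<rho>_pos[of "x - s"] \<rho>0[of "x - s"] by linarith
      then show ?thesis by simp
    qed
  qed (use int in auto)
  moreover have "(LINT x|MT T. (q t - \<eta>) * \<rho> (x - t)) \<le> (LINT x|MT T. q x * \<rho> (x - t))"
  proof (rule integral_mono)
    fix x
    show "(q t - \<eta>) * \<rho> (x - t) \<le> q x * \<rho> (x - t)"
    proof (cases "\<bar>x - t\<bar> < \<delta>")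
      case True
      then have "q t - \<eta> \<le> q x" using d2(2)[of x] \<delta> by (auto simp: abs_less_iff)
      then show ?thesis by (rule mult_right_mono[OF _ \<rho>0])
    next
      case False
      then have "\<rho> (x - t) = 0" using \<rho>_pos[of "x - t"] \<rho>0[of "x - t"] by linarith
      then show ?thesis by simp
    qed
  qed (use int in auto)
  ultimately have "(q t - \<eta>) * m \<le> (q s + \<eta>) * m"
    using eq mass[of s] mass[of t] by simp
  then have "q t - \<eta> \<le> q s + \<eta>" using m by simp
  then show "q t \<le> q s + e" by (simp add: \<eta>_def)
qed

text \<open>Subtracting the primitive of \<open>b\<close> leaves a continuous function with weak
  derivative zero; it is constant inside, and continuity includes the endpoints.\<close>

theorem weak_deriv_primitive:
  assumes T: "T > 0" and p: "continuous_on {0..T} p" and b: "integrable (MT T) b"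
    and weak: "\<And>\<psi>. \<psi> \<in> test_functions {0<..<T} \<Longrightarrow> - (LINT t|MT T. p t * deriv \<psi> t) = (LINT t|MT T. b t * \<psi> t)"
    and st: "0 \<le> s" "s \<le> t" "t \<le> T"
  shows "p t - p s = iint T b s t"
proof -
  define q where "q t = p t - iint T b 0 t" for t
  have ib: "continuous_on {0..T} (\<lambda>t. iint T b 0 t)"
    by (rule continuous_on_subset[OF iint_continuous[OF b]]) auto
  have q: "continuous_on {0..T} q"
    unfolding q_def by (intro continuous_on_diff p ib)
  have zero: "(LINT t|MT T. q t * deriv \<psi> t) = 0" if \<psi>: "\<psi> \<in> test_functions {0<..<T}" for \<psi>
  proof -
    note cont = continuous_on_subset[OF test_deriv(2)[OF \<psi>], of "{0..T}"]
    have "(LINT t|MT T. q t * deriv \<psi> t) = (LINT t|MT T. p t * deriv \<psi> t) - (LINT t|MT T. iint T b 0 t * deriv \<psi> t)"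
      unfolding q_def left_diff_distrib
      by (rule Bochner_Integration.integral_diff) (intro continuous_integrable_MT(1) continuous_intros p ib cont; simp)+
    then show ?thesis
      using weak[OF \<psi>] parts_in_time[OF b \<psi> T, of "\<lambda>t. iint T b 0 t" 0] by simp
  qed
  have const: "q x = q (T / 2)" if "x \<in> {0<..<T}" for x
  proof (rule order_antisym)
    have T2: "T / 2 \<in> {0<..<T}" using T by simp
    show "q x \<le> q (T / 2)" by (rule constant_of_weak_deriv_zero[OF q zero T2 that])
    show "q (T / 2) \<le> q x" by (rule constant_of_weak_deriv_zero[OF q zero that T2])
  qed
  have all: "q x = q (T / 2)" if x: "x \<in> {0..T}" for x
  proof (rule continuous_constant_on_closure[of "{0<..<T}" q])
    show "continuous_on (closure {0<..<T}) q" using q T by simp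
    show "x \<in> closure {0<..<T}" using x T by simp
  qed (rule const)
  have "q t = q s" using all[of t] all[of s] st by simp
  then show ?thesis using iint_split[OF b, of 0 s t] st by (simp add: q_def)
qed

section \<open>Bochner spaces and the nonlocal coefficient\<close>

lemma integrable_mult_squares:
  fixes h k :: "'a \<Rightarrow> real"
  assumes "h \<in> borel_measurable M" "k \<in> borel_measurable M"
    and "integrable M (\<lambda>t. (h t)\<^sup>2)" "integrable M (\<lambda>t. (k t)\<^sup>2)"
  shows "integrable M (\<lambda>t. h t * k t)"
proof (rule Bochner_Integration.integrable_bound)
  show "integrable M (\<lambda>t. (h t)\<^sup>2 + (k t)\<^sup>2)" using assms by simp
  have "\<bar>h t\<bar> * \<bar>k t\<bar> \<le> (h t)\<^sup>2 + (k t)\<^sup>2" for t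
  proof -
    have "0 \<le> \<bar>h t\<bar> * \<bar>k t\<bar>" by simp
    then show ?thesis
      using sum_squares_bound[of "\<bar>h t\<bar>" "\<bar>k t\<bar>"] unfolding power2_abs by linarith
  qed
  then show "AE t in M. norm (h t * k t) \<le> norm ((h t)\<^sup>2 + (k t)\<^sup>2)"
    by (intro always_eventually allI) (simp add: abs_mult)
qed (use assms in auto)

lemma integrable_of_square:
  fixes h :: "real \<Rightarrow> real"
  assumes "h \<in> borel_measurable (MT T)" "integrable (MT T) (\<lambda>t. (h t)\<^sup>2)"
  shows "integrable (MT T) h"
proof -
  interpret finite_measure "MT T" by (rule finite_measure_MT)
  show ?thesis
  proof (rule Bochner_Integration.integrable_bound[OF _ assms(1)])
    show "integrable (MT T) (\<lambda>t. 1 + (h t)\<^sup>2)"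
      by (intro Bochner_Integration.integrable_add integrable_const assms(2))
    have "\<bar>h t\<bar> \<le> 1 + (h t)\<^sup>2" for t
      using zero_le_power2[of "\<bar>h t\<bar> - 1/2"] by (simp add: power2_diff power2_eq_square[of "1/2::real"])
    then show "AE t in MT T. norm (h t) \<le> norm (1 + (h t)\<^sup>2)"
      by (intro always_eventually allI) simp
  qed
qed

text \<open>A simple function has finitely many values, so any function of it is measurable. Norms,
  pairings and nonlinear expressions of Bochner functions thus become measurable without a
  sigma-algebra on the function spaces.\<close>

lemma simple_limit_measurable:
  fixes h :: "real \<Rightarrow> real"
  assumes "\<And>k. simple_function (MT T) (s k)" "AE t in MT T. (\<lambda>k. \<Phi> k (s k t)) \<longlonglongrightarrow> h t"
  shows "h \<in> borel_measurable (MT T)"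
proof (rule measurable_AE_limit[OF _ _ assms(2)])
  show "(\<lambda>t. \<Phi> k (s k t)) \<in> borel_measurable (MT T)" for k
    by (rule borel_measurable_simple_function[OF simple_function_compose1[OF assms(1)]])
qed simp

context bounded_domain begin

lemma H1_norm_nonneg [simp]: "0 \<le> H1_norm \<Omega> v"
  by (simp add: H1_norm_def)

section \<open>Functionals on V and the Bochner spaces\<close>

lemma dualD:
  assumes "F \<in> H10_dual \<Omega>" "v \<in> H10_space \<Omega>" "w \<in> H10_space \<Omega>"
  shows "F (v + w) = F v + F w" "F (c *\<^sub>R v) = c * F v" "F (v - w) = F v - F w"
proof -
  have add: "F (v + w) = F v + F w" if "v \<in> H10_space \<Omega>" "w \<in> H10_space \<Omega>" for v w
    using assms(1) that by (simp add: H10_dual_def plus_fun_def)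
  have sc: "F (c *\<^sub>R v) = c * F v" if "v \<in> H10_space \<Omega>" for c v
    using assms(1) that by (simp add: H10_dual_def scaleR_fun_def)
  show "F (v + w) = F v + F w" "F (c *\<^sub>R v) = c * F v" using add sc assms by auto
  show "F (v - w) = F v - F w"
    using add[OF assms(2) G.V.mem_scale[OF assms(3), of "-1"]] sc[OF assms(3), of "-1"] by simp
qed

lemma dualI:
  assumes "\<And>v w. \<lbrakk>v \<in> H10_space \<Omega>; w \<in> H10_space \<Omega>\<rbrakk> \<Longrightarrow> F (v + w) = F v + F w"
    "\<And>c v. v \<in> H10_space \<Omega> \<Longrightarrow> F (c *\<^sub>R v) = c * F v"
    "\<And>v. v \<in> H10_space \<Omega> \<Longrightarrow> \<bar>F v\<bar> \<le> C * H1_norm \<Omega> v"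
  shows "F \<in> H10_dual \<Omega>"
  unfolding H10_dual_def
proof (intro CollectI conjI exI[of _ C] ballI allI)
  show "F (\<lambda>x. v x + w x) = F v + F w" if "v \<in> H10_space \<Omega>" "w \<in> H10_space \<Omega>" for v w
    using assms(1)[OF that] by (simp add: plus_fun_def)
  show "F (\<lambda>x. c * v x) = c * F v" if "v \<in> H10_space \<Omega>" for c v
    using assms(2)[OF that] by (simp add: scaleR_fun_def)
qed (rule assms(3))

lemma dual_bdd:
  assumes "F \<in> H10_dual \<Omega>"
  obtains C where "C \<ge> 0" "\<And>v. v \<in> H10_space \<Omega> \<Longrightarrow> \<bar>F v\<bar> \<le> C * H1_norm \<Omega> v"
proof -
  obtain C where "\<forall>v\<in>H10_space \<Omega>. \<bar>F v\<bar> \<le> C * H1_norm \<Omega> v"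
    using assms unfolding H10_dual_def by blast
  then have "\<bar>F v\<bar> \<le> \<bar>C\<bar> * H1_norm \<Omega> v" if "v \<in> H10_space \<Omega>" for v
    using that by (meson H1_norm_nonneg abs_ge_self mult_right_mono order_trans)
  then show ?thesis using that[of "\<bar>C\<bar>"] by simp
qed

lemma dual_diff:
  assumes F: "F \<in> H10_dual \<Omega>" and G: "G \<in> H10_dual \<Omega>" shows "(\<lambda>z. F z - G z) \<in> H10_dual \<Omega>"
proof -
  obtain C where C: "C \<ge> 0" "\<And>v. v \<in> H10_space \<Omega> \<Longrightarrow> \<bar>F v\<bar> \<le> C * H1_norm \<Omega> v" by (rule dual_bdd[OF F], rule that)
  obtain D where D: "D \<ge> 0" "\<And>v. v \<in> H10_space \<Omega> \<Longrightarrow> \<bar>G v\<bar> \<le> D * H1_norm \<Omega> v" by (rule dual_bdd[OF G], rule that)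
  show ?thesis
  proof (rule dualI[where C="C + D"])
    show "\<bar>F v - G v\<bar> \<le> (C + D) * H1_norm \<Omega> v" if "v \<in> H10_space \<Omega>" for v
      using C(2)[OF that] D(2)[OF that] by (simp add: distrib_right)
  qed (use dualD[OF F] dualD[OF G] in \<open>simp_all add: right_diff_distrib\<close>)
qed

lemma dual_norm_set_bdd:
  assumes "F \<in> H10_dual \<Omega>"
  shows "bdd_above {\<bar>F v\<bar> | v. v \<in> H10_space \<Omega> \<and> H1_norm \<Omega> v \<le> 1}"
proof -
  obtain C where C: "C \<ge> 0" "\<And>v. v \<in> H10_space \<Omega> \<Longrightarrow> \<bar>F v\<bar> \<le> C * H1_norm \<Omega> v" by (rule dual_bdd[OF assms], rule that)
  have "\<bar>F v\<bar> \<le> C" if "v \<in> H10_space \<Omega>" "H1_norm \<Omega> v \<le> 1" for v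
    using C(2)[OF that(1)] mult_left_mono[OF that(2) C(1)] by simp
  then show ?thesis by (intro bdd_aboveI[of _ C]) auto
qed

lemma dual_norm_nonneg: assumes F: "F \<in> H10_dual \<Omega>" shows "0 \<le> H10_dual_norm \<Omega> F"
proof -
  have "\<bar>F 0\<bar> \<le> H10_dual_norm \<Omega> F"
    unfolding H10_dual_norm_def
    by (rule cSup_upper[OF _ dual_norm_set_bdd[OF F]]) (use G.V.mem_zero H1_norm_zero in \<open>auto intro!: exI[of _ 0]\<close>)
  then show ?thesis by linarith
qed

lemma dual_bound:
  assumes F: "F \<in> H10_dual \<Omega>" and v: "v \<in> H10_space \<Omega>"
  shows "\<bar>F v\<bar> \<le> H10_dual_norm \<Omega> F * H1_norm \<Omega> v"
proof (cases "H1_norm \<Omega> v = 0")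
  case True
  obtain C where "C \<ge> 0" "\<And>v. v \<in> H10_space \<Omega> \<Longrightarrow> \<bar>F v\<bar> \<le> C * H1_norm \<Omega> v" by (rule dual_bdd[OF F], rule that)
  then have "\<bar>F v\<bar> \<le> C * H1_norm \<Omega> v" using v by blast
  then show ?thesis using True by simp
next
  case False
  then have pos: "H1_norm \<Omega> v > 0" using H1_norm_nonneg[of v] by linarith
  define c where "c = 1 / H1_norm \<Omega> v"
  have "H1_norm \<Omega> (c *\<^sub>R v) = 1" using G.V.nrm_scale[OF v, of c] pos by (simp add: c_def)
  then have "\<bar>F (c *\<^sub>R v)\<bar> \<le> H10_dual_norm \<Omega> F"
    unfolding H10_dual_norm_def
    by (intro cSup_upper[OF _ dual_norm_set_bdd[OF F]]) (use v G.V.mem_scale in force)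
  then have "c * \<bar>F v\<bar> \<le> H10_dual_norm \<Omega> F" using dualD(2)[OF F v v, of c] pos by (simp add: abs_mult c_def)
  then show ?thesis using pos by (simp add: c_def field_simps)
qed

lemma dual_norm_le:
  assumes "0 \<le> C" "\<And>v. v \<in> H10_space \<Omega> \<Longrightarrow> \<bar>F v\<bar> \<le> C * H1_norm \<Omega> v"
  shows "H10_dual_norm \<Omega> F \<le> C"
  unfolding H10_dual_norm_def
proof (rule cSup_least)
  show "{\<bar>F v\<bar> |v. v \<in> H10_space \<Omega> \<and> H1_norm \<Omega> v \<le> 1} \<noteq> {}"
    using G.V.mem_zero H1_norm_zero by (auto intro!: exI[of _ 0])
  fix y assume "y \<in> {\<bar>F v\<bar> |v. v \<in> H10_space \<Omega> \<and> H1_norm \<Omega> v \<le> 1}"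
  then obtain v where v: "y = \<bar>F v\<bar>" "v \<in> H10_space \<Omega>" "H1_norm \<Omega> v \<le> 1" by blast
  show "y \<le> C" using assms(2)[OF v(2)] mult_left_mono[OF v(3) assms(1)] v(1) by simp
qed

lemma dual_norm_triangle:
  assumes F: "F \<in> H10_dual \<Omega>" and G: "G \<in> H10_dual \<Omega>"
  shows "H10_dual_norm \<Omega> F \<le> H10_dual_norm \<Omega> (\<lambda>z. F z - G z) + H10_dual_norm \<Omega> G"
    "\<bar>H10_dual_norm \<Omega> F - H10_dual_norm \<Omega> G\<bar> \<le> H10_dual_norm \<Omega> (\<lambda>z. F z - G z)"
    "H10_dual_norm \<Omega> (\<lambda>z. F z - G z) \<le> H10_dual_norm \<Omega> F + H10_dual_norm \<Omega> G"
proof -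
  have 1: "H10_dual_norm \<Omega> F \<le> H10_dual_norm \<Omega> (\<lambda>z. F z - G z) + H10_dual_norm \<Omega> G"
    if F: "F \<in> H10_dual \<Omega>" and G: "G \<in> H10_dual \<Omega>" for F G
  proof (rule dual_norm_le)
    show "0 \<le> H10_dual_norm \<Omega> (\<lambda>z. F z - G z) + H10_dual_norm \<Omega> G"
      by (intro add_nonneg_nonneg dual_norm_nonneg dual_diff F G)
    show "\<bar>F v\<bar> \<le> (H10_dual_norm \<Omega> (\<lambda>z. F z - G z) + H10_dual_norm \<Omega> G) * H1_norm \<Omega> v" if "v \<in> H10_space \<Omega>" for v
      using dual_bound[OF dual_diff[OF F G] that] dual_bound[OF G that] by (simp add: distrib_right)
  qed
  have 2: "H10_dual_norm \<Omega> (\<lambda>z. G z - F z) = H10_dual_norm \<Omega> (\<lambda>z. F z - G z)"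
    unfolding H10_dual_norm_def by (simp add: abs_minus_commute)
  show "H10_dual_norm \<Omega> F \<le> H10_dual_norm \<Omega> (\<lambda>z. F z - G z) + H10_dual_norm \<Omega> G" by (rule 1[OF F G])
  show "\<bar>H10_dual_norm \<Omega> F - H10_dual_norm \<Omega> G\<bar> \<le> H10_dual_norm \<Omega> (\<lambda>z. F z - G z)"
    using 1[OF F G] 1[OF G F] 2 by linarith
  show "H10_dual_norm \<Omega> (\<lambda>z. F z - G z) \<le> H10_dual_norm \<Omega> F + H10_dual_norm \<Omega> G"
  proof (rule dual_norm_le)
    show "0 \<le> H10_dual_norm \<Omega> F + H10_dual_norm \<Omega> G"
      by (intro add_nonneg_nonneg dual_norm_nonneg F G)
    show "\<bar>F v - G v\<bar> \<le> (H10_dual_norm \<Omega> F + H10_dual_norm \<Omega> G) * H1_norm \<Omega> v" if "v \<in> H10_space \<Omega>" for v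
      using dual_bound[OF F that] dual_bound[OF G that] by (simp add: distrib_right)
  qed
qed

lemma L2_V_E:
  assumes "u \<in> L2_V T \<Omega>"
  obtains s where "\<And>k. simple_function (MT T) (s k)" "\<And>k t. t \<in> {0<..<T} \<Longrightarrow> s k t \<in> H10_space \<Omega>"
    "AE t in MT T. u t \<in> H10_space \<Omega>" "AE t in MT T. (\<lambda>k. H1_norm \<Omega> (s k t - u t)) \<longlonglongrightarrow> 0"
    "integrable (MT T) (\<lambda>t. (H1_norm \<Omega> (u t))\<^sup>2)"
  using assms unfolding bochner_L2_def fun_diff_def by blast

lemma L2_V_I:
  assumes "\<And>k. simple_function (MT T) (s k)" "\<And>k t. t \<in> {0<..<T} \<Longrightarrow> s k t \<in> H10_space \<Omega>"
    "AE t in MT T. u t \<in> H10_space \<Omega>" "AE t in MT T. (\<lambda>k. H1_norm \<Omega> (s k t - u t)) \<longlonglongrightarrow> 0"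
    "integrable (MT T) (\<lambda>t. (H1_norm \<Omega> (u t))\<^sup>2)"
  shows "u \<in> L2_V T \<Omega>"
  using assms unfolding bochner_L2_def fun_diff_def by blast

lemma H1_norm_measurable:
  assumes "integrable (MT T) (\<lambda>t. (H1_norm \<Omega> (u t))\<^sup>2)"
  shows "(\<lambda>t. H1_norm \<Omega> (u t)) \<in> borel_measurable (MT T)"
proof -
  have [measurable]: "(\<lambda>t. (H1_norm \<Omega> (u t))\<^sup>2) \<in> borel_measurable (MT T)" using assms by simp
  have "(\<lambda>t. sqrt ((H1_norm \<Omega> (u t))\<^sup>2)) \<in> borel_measurable (MT T)" by measurable
  then show ?thesis by simp
qed

lemma L2_V'_E:
  assumes "f \<in> L2_V' T \<Omega>"
  obtains s where "\<And>k. simple_function (MT T) (s k)" "\<And>k t. t \<in> {0<..<T} \<Longrightarrow> s k t \<in> H10_dual \<Omega>"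
    "AE t in MT T. f t \<in> H10_dual \<Omega>" "AE t in MT T. (\<lambda>k. H10_dual_norm \<Omega> (\<lambda>z. s k t z - f t z)) \<longlonglongrightarrow> 0"
    "integrable (MT T) (\<lambda>t. (H10_dual_norm \<Omega> (f t))\<^sup>2)"
  using assms unfolding bochner_L2_def by blast

text \<open>A majorant replaces the integrability clause of the definition: measurability of the
  dual norm already follows from the simple approximations.\<close>

lemma L2_V'_I:
  assumes s: "\<And>k. simple_function (MT T) (s k)" "\<And>k t. t \<in> {0<..<T} \<Longrightarrow> s k t \<in> H10_dual \<Omega>"
    and f: "AE t in MT T. f t \<in> H10_dual \<Omega>"
    and lim: "AE t in MT T. (\<lambda>k. H10_dual_norm \<Omega> (\<lambda>z. s k t z - f t z)) \<longlonglongrightarrow> 0"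
    and c: "integrable (MT T) c" "AE t in MT T. (H10_dual_norm \<Omega> (f t))\<^sup>2 \<le> c t"
  shows "f \<in> L2_V' T \<Omega>"
proof -
  have "AE t in MT T. t \<in> {0<..<T}" by (rule AE_I2) simp
  with f lim have "AE t in MT T. (\<lambda>k. (H10_dual_norm \<Omega> (s k t))\<^sup>2) \<longlonglongrightarrow> (H10_dual_norm \<Omega> (f t))\<^sup>2"
  proof eventually_elim
    case (elim t)
    have "(\<lambda>k. H10_dual_norm \<Omega> (s k t) - H10_dual_norm \<Omega> (f t)) \<longlonglongrightarrow> 0"
    proof (rule tendsto_0_le[OF elim(2), where K=1], intro always_eventually allI)
      fix k
      show "norm (H10_dual_norm \<Omega> (s k t) - H10_dual_norm \<Omega> (f t)) \<le> norm (H10_dual_norm \<Omega> (\<lambda>z. s k t z - f t z)) * 1"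
        using dual_norm_triangle(2)[OF s(2)[OF elim(3), of k] elim(1)] by simp
    qed
    then show ?case by (intro tendsto_power) (simp add: LIM_zero_iff)
  qed
  then have meas: "(\<lambda>t. (H10_dual_norm \<Omega> (f t))\<^sup>2) \<in> borel_measurable (MT T)"
    by (rule simple_limit_measurable[OF s(1), where \<Phi>="\<lambda>k F. (H10_dual_norm \<Omega> F)\<^sup>2"])
  have "integrable (MT T) (\<lambda>t. (H10_dual_norm \<Omega> (f t))\<^sup>2)"
    by (rule Bochner_Integration.integrable_bound[OF c(1) meas], use c(2) in eventually_elim) auto
  then show ?thesis
    using s f lim unfolding bochner_L2_def by blast
qed

text \<open>At the exceptional times where the functional is not in the dual, the supremum in
  \<open>H10_dual_norm\<close> may be any real number; the absolute value makes the majorant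
  nonnegative at all times.\<close>

definition dnorm :: "(('a \<Rightarrow> real) \<Rightarrow> real) \<Rightarrow> real" where "dnorm F = \<bar>H10_dual_norm \<Omega> F\<bar>"

lemma L2_V'_D:
  assumes f: "f \<in> L2_V' T \<Omega>"
  shows "\<phi> \<in> H10_space \<Omega> \<Longrightarrow> (\<lambda>t. f t \<phi>) \<in> borel_measurable (MT T)"
    "(\<lambda>t. dnorm (f t)) \<in> borel_measurable (MT T)"
    "integrable (MT T) (\<lambda>t. (dnorm (f t))\<^sup>2)" "integrable (MT T) (\<lambda>t. dnorm (f t))"
    "AE t in MT T. f t \<in> H10_dual \<Omega> \<and> (\<forall>\<phi>\<in>H10_space \<Omega>. \<bar>f t \<phi>\<bar> \<le> dnorm (f t) * H1_norm \<Omega> \<phi>)"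
    "\<phi> \<in> H10_space \<Omega> \<Longrightarrow> integrable (MT T) (\<lambda>t. f t \<phi>)"
proof -
  obtain s where s: "\<And>k. simple_function (MT T) (s k)" "\<And>k t. t \<in> {0<..<T} \<Longrightarrow> s k t \<in> H10_dual \<Omega>"
    and fd: "AE t in MT T. f t \<in> H10_dual \<Omega>" and lim: "AE t in MT T. (\<lambda>k. H10_dual_norm \<Omega> (\<lambda>z. s k t z - f t z)) \<longlonglongrightarrow> 0"
    and int: "integrable (MT T) (\<lambda>t. (H10_dual_norm \<Omega> (f t))\<^sup>2)"
    by (rule L2_V'_E[OF f], rule that)
  show meas: "(\<lambda>t. f t \<phi>) \<in> borel_measurable (MT T)" if \<phi>: "\<phi> \<in> H10_space \<Omega>" for \<phi>
  proof (rule simple_limit_measurable[OF s(1), where \<Phi>="\<lambda>k F. F \<phi>"])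
    have "AE t in MT T. t \<in> {0<..<T}" by (rule AE_I2) simp
    with fd lim show "AE t in MT T. (\<lambda>k. s k t \<phi>) \<longlonglongrightarrow> f t \<phi>"
    proof eventually_elim
      case (elim t)
      have "(\<lambda>k. s k t \<phi> - f t \<phi>) \<longlonglongrightarrow> 0"
      proof (rule tendsto_0_le[OF elim(2), where K="H1_norm \<Omega> \<phi>"], intro always_eventually allI)
        fix k
        show "norm (s k t \<phi> - f t \<phi>) \<le> norm (H10_dual_norm \<Omega> (\<lambda>z. s k t z - f t z)) * H1_norm \<Omega> \<phi>"
          using dual_bound[OF dual_diff[OF s(2)[OF elim(3), of k] elim(1)] \<phi>]
            mult_right_mono[OF abs_ge_self[of "H10_dual_norm \<Omega> (\<lambda>z. s k t z - f t z)"], of "H1_norm \<Omega> \<phi>"]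
          by simp
      qed
      then show ?case by (simp add: LIM_zero_iff)
    qed
  qed
  show sq: "integrable (MT T) (\<lambda>t. (dnorm (f t))\<^sup>2)" using int by (simp add: dnorm_def)
  have [measurable]: "(\<lambda>t. (H10_dual_norm \<Omega> (f t))\<^sup>2) \<in> borel_measurable (MT T)" using int by simp
  have "(\<lambda>t. sqrt ((H10_dual_norm \<Omega> (f t))\<^sup>2)) \<in> borel_measurable (MT T)" by measurable
  then show m: "(\<lambda>t. dnorm (f t)) \<in> borel_measurable (MT T)" by (simp add: dnorm_def)
  show di: "integrable (MT T) (\<lambda>t. dnorm (f t))" by (rule integrable_of_square[OF m sq])
  show ae: "AE t in MT T. f t \<in> H10_dual \<Omega> \<and> (\<forall>\<phi>\<in>H10_space \<Omega>. \<bar>f t \<phi>\<bar> \<le> dnorm (f t) * H1_norm \<Omega> \<phi>)"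
    using fd by eventually_elim (auto simp: dnorm_def dual_norm_nonneg intro: dual_bound)
  show "integrable (MT T) (\<lambda>t. f t \<phi>)" if \<phi>: "\<phi> \<in> H10_space \<Omega>" for \<phi>
  proof (rule Bochner_Integration.integrable_bound[OF _ meas[OF \<phi>]])
    show "integrable (MT T) (\<lambda>t. dnorm (f t) * H1_norm \<Omega> \<phi>)" using di by simp
    show "AE t in MT T. norm (f t \<phi>) \<le> norm (dnorm (f t) * H1_norm \<Omega> \<phi>)"
      using ae by eventually_elim (use \<phi> in \<open>auto simp: dnorm_def abs_mult\<close>)
  qed
qed

lemma L2_V'_diff:
  assumes f: "f \<in> L2_V' T \<Omega>" and h: "h \<in> L2_V' T \<Omega>"
  shows "(\<lambda>t z. f t z - h t z) \<in> L2_V' T \<Omega>"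
proof -
  obtain s where s: "\<And>k. simple_function (MT T) (s k)" "\<And>k t. t \<in> {0<..<T} \<Longrightarrow> s k t \<in> H10_dual \<Omega>"
    and fd: "AE t in MT T. f t \<in> H10_dual \<Omega>" and lim: "AE t in MT T. (\<lambda>k. H10_dual_norm \<Omega> (\<lambda>z. s k t z - f t z)) \<longlonglongrightarrow> 0"
    and int: "integrable (MT T) (\<lambda>t. (H10_dual_norm \<Omega> (f t))\<^sup>2)"
    by (rule L2_V'_E[OF f], rule that)
  obtain s' where s': "\<And>k. simple_function (MT T) (s' k)" "\<And>k t. t \<in> {0<..<T} \<Longrightarrow> s' k t \<in> H10_dual \<Omega>"
    and hd: "AE t in MT T. h t \<in> H10_dual \<Omega>" and lim': "AE t in MT T. (\<lambda>k. H10_dual_norm \<Omega> (\<lambda>z. s' k t z - h t z)) \<longlonglongrightarrow> 0"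
    and int': "integrable (MT T) (\<lambda>t. (H10_dual_norm \<Omega> (h t))\<^sup>2)"
    by (rule L2_V'_E[OF h], rule that)
  show ?thesis
  proof (rule L2_V'_I[where s="\<lambda>k t z. s k t z - s' k t z"])
    show "simple_function (MT T) (\<lambda>t z. s k t z - s' k t z)" for k
      by (rule simple_function_compose2[OF s(1) s'(1)])
    show "(\<lambda>z. s k t z - s' k t z) \<in> H10_dual \<Omega>" if "t \<in> {0<..<T}" for k t
      by (rule dual_diff[OF s(2)[OF that] s'(2)[OF that]])
    show "AE t in MT T. (\<lambda>z. f t z - h t z) \<in> H10_dual \<Omega>"
      using fd hd by eventually_elim (rule dual_diff)
    show "integrable (MT T) (\<lambda>t. 2 * (H10_dual_norm \<Omega> (f t))\<^sup>2 + 2 * (H10_dual_norm \<Omega> (h t))\<^sup>2)"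
      using int int' by simp
    show "AE t in MT T. (H10_dual_norm \<Omega> (\<lambda>z. f t z - h t z))\<^sup>2 \<le> 2 * (H10_dual_norm \<Omega> (f t))\<^sup>2 + 2 * (H10_dual_norm \<Omega> (h t))\<^sup>2"
      using fd hd
    proof eventually_elim
      case (elim t)
      have "(H10_dual_norm \<Omega> (\<lambda>z. f t z - h t z))\<^sup>2 \<le> (H10_dual_norm \<Omega> (f t) + H10_dual_norm \<Omega> (h t))\<^sup>2"
        by (rule power_mono[OF dual_norm_triangle(3)[OF elim] dual_norm_nonneg[OF dual_diff[OF elim]]])
      also have "\<dots> \<le> 2 * (H10_dual_norm \<Omega> (f t))\<^sup>2 + 2 * (H10_dual_norm \<Omega> (h t))\<^sup>2"
        using sum_squares_bound[of "H10_dual_norm \<Omega> (f t)" "H10_dual_norm \<Omega> (h t)"] by (simp add: power2_sum)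
      finally show ?case .
    qed
    have "AE t in MT T. t \<in> {0<..<T}" by (rule AE_I2) simp
    with fd hd lim lim' show "AE t in MT T. (\<lambda>k. H10_dual_norm \<Omega> (\<lambda>z. (s k t z - s' k t z) - (f t z - h t z))) \<longlonglongrightarrow> 0"
    proof eventually_elim
      case (elim t)
      note d = dual_diff[OF s(2)[OF elim(5)] elim(1)] and d' = dual_diff[OF s'(2)[OF elim(5)] elim(2)]
      have eq: "(\<lambda>z. (s k t z - s' k t z) - (f t z - h t z)) = (\<lambda>z. (s k t z - f t z) - (s' k t z - h t z))" for k
        by auto
      have "(\<lambda>k. H10_dual_norm \<Omega> (\<lambda>z. s k t z - f t z) + H10_dual_norm \<Omega> (\<lambda>z. s' k t z - h t z)) \<longlonglongrightarrow> 0 + 0"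
        by (rule tendsto_add[OF elim(3,4)])
      then have "(\<lambda>k. H10_dual_norm \<Omega> (\<lambda>z. s k t z - f t z) + H10_dual_norm \<Omega> (\<lambda>z. s' k t z - h t z)) \<longlonglongrightarrow> 0" by simp
      then show ?case
        unfolding eq
        by (rule tendsto_sandwich[OF _ _ tendsto_const, rotated 2])
          (intro always_eventually allI dual_norm_nonneg dual_norm_triangle(3) dual_diff d d')+
    qed
  qed
qed

end

section \<open>The nonlocal coefficient and the flux\<close>

locale nonlocal = bounded_domain \<Omega> for \<Omega> :: "'a::euclidean_space set" +
  fixes g :: "'a \<Rightarrow> real" and a :: "real \<Rightarrow> real" and r m M :: real
  assumes g: "g \<in> L2_space \<Omega>" and a_cont: "continuous_on UNIV a" and m: "0 < m"
    and a_bounds: "\<And>x. m \<le> a x \<and> a x \<le> M"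
begin

definition gx :: "'a \<Rightarrow> 'a \<Rightarrow> real" where "gx x y = indicator (cball x r) y * g y"

lemma gx_measurable: "gx x \<in> borel_measurable M\<Omega>"
proof -
  have [measurable]: "g \<in> borel_measurable M\<Omega>" using L2_measurable[OF g] .
  have "(indicator (cball x r) :: 'a \<Rightarrow> real) \<in> borel_measurable lebesgue"
    by (rule borel_measurable_indicator) (rule fmeasurableD[OF lmeasurable_cball])
  then have [measurable]: "(indicator (cball x r) :: 'a \<Rightarrow> real) \<in> borel_measurable M\<Omega>"
    by (rule measurable_restrict_space1)
  show ?thesis unfolding gx_def by measurable
qed

lemma gx_L2: "gx x \<in> L2_space \<Omega>"
proof -
  have "integrable M\<Omega> (\<lambda>y. (gx x y)\<^sup>2)"
  proof (rule Bochner_Integration.integrable_bound[OF L2_square_integrable[OF g]])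
    show "(\<lambda>y. (gx x y)\<^sup>2) \<in> borel_measurable M\<Omega>"
      by (rule borel_measurable_power[OF gx_measurable])
  qed (auto intro!: always_eventually simp: gx_def indicator_def)
  then show ?thesis using gx_measurable by (simp add: L2_space_def)
qed

lemma gx_norm: "L2_norm \<Omega> (gx x) \<le> L2_norm \<Omega> g"
proof (rule power2_le_imp_le)
  have "(LINT y|M\<Omega>. (gx x y)\<^sup>2) \<le> (LINT y|M\<Omega>. (g y)\<^sup>2)"
    by (rule integral_mono) (use L2_square_integrable[OF gx_L2] L2_square_integrable[OF g] in \<open>auto simp: gx_def indicator_def\<close>)
  then show "(L2_norm \<Omega> (gx x))\<^sup>2 \<le> (L2_norm \<Omega> g)\<^sup>2" using L2_norm_sq[OF gx_L2] L2_norm_sq[OF g] by simp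
qed (use g in simp)

lemma l_op_eq: "l_op \<Omega> g r v x = L2_inner \<Omega> (gx x) v"
proof -
  have "L2_inner \<Omega> (gx x) v = (LINT y|lebesgue. indicator \<Omega> y *\<^sub>R (gx x y * v y))"
    unfolding L2_inner_def by (rule integral_restrict_space) simp
  also have "\<dots> = (LINT y|lebesgue. indicator (\<Omega> \<inter> cball x r) y *\<^sub>R (g y * v y))"
    by (rule Bochner_Integration.integral_cong) (auto simp: gx_def indicator_def)
  finally show ?thesis by (simp add: l_op_def set_lebesgue_integral_def)
qed

text \<open>For moving centres the indicators of the balls converge off the sphere of radius
  \<open>r\<close> around the limit centre, which is a null set, and the square of \<open>g\<close>
  dominates.\<close>

lemma gx_continuous:
  assumes "x \<longlonglongrightarrow> x0" shows "(\<lambda>n. L2_norm \<Omega> (gx (x n) - gx x0)) \<longlonglongrightarrow> 0"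
proof -
  have d: "gx (x n) - gx x0 \<in> L2_space \<Omega>" for n by (intro L2.mem_diff gx_L2)
  have "(\<lambda>n. LINT y|M\<Omega>. ((gx (x n) - gx x0) y)\<^sup>2) \<longlonglongrightarrow> (LINT y|M\<Omega>. 0)"
  proof (rule integral_dominated_convergence[where w="\<lambda>y. (g y)\<^sup>2"])
    show "(\<lambda>y. ((gx (x n) - gx x0) y)\<^sup>2) \<in> borel_measurable M\<Omega>" for n
      using borel_measurable_integrable[OF L2_square_integrable[OF d]] .
    show "integrable M\<Omega> (\<lambda>y. (g y)\<^sup>2)" by (rule L2_square_integrable[OF g])
    show "AE y in M\<Omega>. norm (((gx (x n) - gx x0) y)\<^sup>2) \<le> (g y)\<^sup>2" for n
      by (intro always_eventually allI) (simp add: gx_def indicator_def)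
    have "AE y in lebesgue. y \<notin> sphere x0 r"
      by (rule AE_not_in) (simp only: negligible_iff_null_sets[symmetric] negligible_sphere)
    then have "AE y in lebesgue. y \<in> \<Omega> \<longrightarrow> y \<notin> sphere x0 r" by (rule eventually_mono) simp
    then have "AE y in M\<Omega>. y \<notin> sphere x0 r" by (simp add: AE_restrict_space_iff)
    then show "AE y in M\<Omega>. (\<lambda>n. ((gx (x n) - gx x0) y)\<^sup>2) \<longlonglongrightarrow> 0"
    proof eventually_elim
      case (elim y)
      have dl: "(\<lambda>n. dist (x n) y) \<longlonglongrightarrow> dist x0 y" by (intro tendsto_intros assms)
      have "\<forall>\<^sub>F n in sequentially. (y \<in> cball (x n) r) = (y \<in> cball x0 r)"
      proof (cases "dist x0 y < r")
        case True
        from order_tendstoD(2)[OF dl True] show ?thesis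
          by eventually_elim (use True in auto)
      next
        case False
        then have gt: "dist x0 y > r" using elim by auto
        from order_tendstoD(1)[OF dl gt] show ?thesis
          by eventually_elim (use gt in auto)
      qed
      then have "\<forall>\<^sub>F n in sequentially. ((gx (x n) - gx x0) y)\<^sup>2 = 0"
        by eventually_elim (simp add: gx_def indicator_def)
      then show ?case by (rule tendsto_eventually)
    qed
  qed simp
  then have "(\<lambda>n. (L2_norm \<Omega> (gx (x n) - gx x0))\<^sup>2) \<longlonglongrightarrow> 0"
    using L2_norm_sq[OF d] by simp
  then have "(\<lambda>n. sqrt ((L2_norm \<Omega> (gx (x n) - gx x0))\<^sup>2)) \<longlonglongrightarrow> sqrt 0" by (intro tendsto_intros)
  then show ?thesis using d by simp
qed

definition acoef :: "('a \<Rightarrow> real) \<Rightarrow> 'a \<Rightarrow> real" where "acoef v x = a (l_op \<Omega> g r v x)"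

lemma a_tendsto: "x \<longlonglongrightarrow> l \<Longrightarrow> (\<lambda>n. a (x n)) \<longlonglongrightarrow> a l"
  using a_cont by (auto simp: continuous_on_eq_continuous_at intro: isCont_tendsto_compose)

lemma coeff_aI:
  assumes "\<alpha> \<in> borel_measurable M\<Omega>" "\<And>x. \<exists>y. \<alpha> x = a y"
  shows "coeff_fun M \<alpha>"
proof -
  have "\<bar>\<alpha> x\<bar> \<le> M" for x
  proof -
    obtain y where "\<alpha> x = a y" using assms(2) by blast
    then show ?thesis using a_bounds[of y] m by simp
  qed
  then show ?thesis using assms(1) by (simp add: coeff_fun_def)
qed

lemma acoef:
  assumes v: "v \<in> L2_space \<Omega>" shows "coeff_fun M (acoef v)" "m \<le> acoef v x"
proof -
  have "continuous_on UNIV (acoef v)"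
  proof (rule continuous_on_sequentiallyI)
    fix x x0 assume x: "x \<longlonglongrightarrow> (x0::'a)"
    have "(\<lambda>n. L2_inner \<Omega> (gx (x n)) v) \<longlonglongrightarrow> L2_inner \<Omega> (gx x0) v"
      by (rule L2.tendsto_ip_left[OF gx_continuous[OF x] gx_L2 gx_L2 v])
    then show "(\<lambda>n. acoef v (x n)) \<longlonglongrightarrow> acoef v x0"
      unfolding acoef_def l_op_eq by (rule a_tendsto)
  qed
  then have "acoef v \<in> borel_measurable M\<Omega>"
    by (intro continuous_imp_measurable_on_sets_lebesgue) (auto intro: continuous_on_subset)
  then show "coeff_fun M (acoef v)" by (rule coeff_aI) (auto simp: acoef_def)
  show "m \<le> acoef v x" using a_bounds by (simp add: acoef_def)
qed

lemma M_nonneg: "0 \<le> M"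
  using a_bounds[of 0] m by linarith

lemma acoef_tendsto:
  assumes "(\<lambda>n. L2_norm \<Omega> (s n - v)) \<longlonglongrightarrow> 0" "\<And>n. s n \<in> L2_space \<Omega>" "v \<in> L2_space \<Omega>"
  shows "(\<lambda>n. acoef (s n) x) \<longlonglongrightarrow> acoef v x"
proof -
  have "(\<lambda>n. L2_inner \<Omega> (s n) (gx x)) \<longlonglongrightarrow> L2_inner \<Omega> v (gx x)"
    by (rule L2.tendsto_ip_left[OF assms gx_L2])
  then show ?thesis
    unfolding acoef_def l_op_eq
    using L2.sym[OF gx_L2 assms(2)] L2.sym[OF gx_L2 assms(3)] by (intro a_tendsto) simp
qed

lemma dform_diff_left:
  assumes "coeff_fun C \<alpha>" "u \<in> H1_space \<Omega>" "v \<in> H1_space \<Omega>" "w \<in> H1_space \<Omega>"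
  shows "dform \<alpha> (u - v) w = dform \<alpha> u w - dform \<alpha> v w"
  using dform_add_left[OF assms(1), of "u - v" v w] assms by simp

text \<open>The change of the argument is paired with the coefficient of \<open>v\<close>, the
  change of the coefficient with \<open>v'\<close>. In this order the coefficient distance is taken
  at \<open>v'\<close>, the fixed limit in the application.\<close>

lemma flux_diff:
  assumes v: "v \<in> H10_space \<Omega>" and v': "v' \<in> H10_space \<Omega>" and \<phi>: "\<phi> \<in> H10_space \<Omega>"
  shows "\<bar>dform (acoef v) v \<phi> - dform (acoef v') v' \<phi>\<bar> \<le>
    (M * H1_norm \<Omega> (v - v') + coeff_dist (acoef v) (acoef v') v') * H1_norm \<Omega> \<phi>"
proof -
  have A: "coeff_fun M (acoef v)" "coeff_fun M (acoef v')" using v v' acoef by auto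
  have "dform (acoef v) v \<phi> - dform (acoef v') v' \<phi> =
      dform (acoef v) (v - v') \<phi> + (dform (acoef v) \<phi> v' - dform (acoef v') \<phi> v')"
    using dform_diff_left[OF A(1), of v v' \<phi>] v v' \<phi> by (simp add: dform_sym[of _ v' \<phi>])
  moreover have "\<bar>dform (acoef v) (v - v') \<phi>\<bar> \<le> M * H1_norm \<Omega> (v - v') * H1_norm \<Omega> \<phi>"
    by (rule dform_bound(2)[OF A(1)]) (use v v' \<phi> in auto)
  moreover have "\<bar>dform (acoef v) \<phi> v' - dform (acoef v') \<phi> v'\<bar> \<le> coeff_dist (acoef v) (acoef v') v' * H1_norm \<Omega> \<phi>"
    by (rule dform_coeff_dist[OF A]) (use v' \<phi> in auto)
  ultimately show ?thesis by (simp add: distrib_right)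
qed

lemma flux_modulus_tendsto:
  assumes s: "(\<lambda>n. H1_norm \<Omega> (s n - v)) \<longlonglongrightarrow> 0" "\<And>n. s n \<in> H10_space \<Omega>" and v: "v \<in> H10_space \<Omega>"
  shows "(\<lambda>n. M * H1_norm \<Omega> (s n - v) + coeff_dist (acoef (s n)) (acoef v) v) \<longlonglongrightarrow> 0"
proof -
  have "(\<lambda>n. L2_norm \<Omega> (s n - v)) \<longlonglongrightarrow> 0"
    by (rule tendsto_sandwich[OF _ _ tendsto_const s(1)])
      (use s(2) v L2_le_H1 in \<open>auto intro!: always_eventually\<close>)
  then have "(\<lambda>n. acoef (s n) x) \<longlonglongrightarrow> acoef v x" for x
    by (rule acoef_tendsto) (use s(2) v in auto)
  then have "(\<lambda>n. coeff_dist (acoef (s n)) (acoef v) v) \<longlonglongrightarrow> 0"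
    by (intro coeff_dist_tendsto[where C=M] acoef) (use s(2) v in auto)
  then have "(\<lambda>n. M * H1_norm \<Omega> (s n - v) + coeff_dist (acoef (s n)) (acoef v) v) \<longlonglongrightarrow> M * 0 + 0"
    by (intro tendsto_intros s(1))
  then show ?thesis by simp
qed

lemma flux_dual:
  assumes v: "v \<in> H10_space \<Omega>" shows "dform (acoef v) v \<in> H10_dual \<Omega>"
proof (rule dualI)
  have A: "coeff_fun M (acoef v)" using v acoef by auto
  show "dform (acoef v) v (x + y) = dform (acoef v) v x + dform (acoef v) v y"
    if "x \<in> H10_space \<Omega>" "y \<in> H10_space \<Omega>" for x y
    using dform_add_left[OF A, of x y v] that v by (simp add: dform_sym[of _ v])
  show "dform (acoef v) v (c *\<^sub>R x) = c * dform (acoef v) v x" if "x \<in> H10_space \<Omega>" for c x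
    using dform_scale_left[OF A, of x v c] that v by (simp add: dform_sym[of _ v])
  show "\<bar>dform (acoef v) v x\<bar> \<le> (M * H1_norm \<Omega> v) * H1_norm \<Omega> x" if "x \<in> H10_space \<Omega>" for x
    using dform_bound(2)[OF A, of v x] that v by simp
qed

text \<open>The flux of a simple function is simple, and \<open>flux_diff\<close> shows that it
  tends to the flux of \<open>u\<close> in the dual norm; this is the strong measurability.\<close>

lemma flux_L2_V':
  assumes u: "u \<in> L2_V T \<Omega>"
  shows "(\<lambda>t. dform (acoef (u t)) (u t)) \<in> L2_V' T \<Omega>"
proof -
  obtain s where s: "\<And>k. simple_function (MT T) (s k)" "\<And>k t. t \<in> {0<..<T} \<Longrightarrow> s k t \<in> H10_space \<Omega>"
    and uV: "AE t in MT T. u t \<in> H10_space \<Omega>" and lim: "AE t in MT T. (\<lambda>k. H1_norm \<Omega> (s k t - u t)) \<longlonglongrightarrow> 0"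
    and int: "integrable (MT T) (\<lambda>t. (H1_norm \<Omega> (u t))\<^sup>2)"
    by (rule L2_V_E[OF u], rule that)
  show ?thesis
  proof (rule L2_V'_I[where s="\<lambda>k t. dform (acoef (s k t)) (s k t)"])
    show "simple_function (MT T) (\<lambda>t. dform (acoef (s k t)) (s k t))" for k
      by (rule simple_function_compose1[OF s(1)])
    show "dform (acoef (s k t)) (s k t) \<in> H10_dual \<Omega>" if "t \<in> {0<..<T}" for k t
      by (rule flux_dual[OF s(2)[OF that]])
    show "AE t in MT T. dform (acoef (u t)) (u t) \<in> H10_dual \<Omega>"
      using uV by eventually_elim (rule flux_dual)
    show "integrable (MT T) (\<lambda>t. M\<^sup>2 * (H1_norm \<Omega> (u t))\<^sup>2)" using int by simp
    show "AE t in MT T. (H10_dual_norm \<Omega> (dform (acoef (u t)) (u t)))\<^sup>2 \<le> M\<^sup>2 * (H1_norm \<Omega> (u t))\<^sup>2"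
      using uV
    proof eventually_elim
      case (elim t)
      have "H10_dual_norm \<Omega> (dform (acoef (u t)) (u t)) \<le> M * H1_norm \<Omega> (u t)"
        by (rule dual_norm_le) (use M_nonneg dform_bound(2)[OF acoef(1)] elim in auto)
      then have "(H10_dual_norm \<Omega> (dform (acoef (u t)) (u t)))\<^sup>2 \<le> (M * H1_norm \<Omega> (u t))\<^sup>2"
        by (rule power_mono[OF _ dual_norm_nonneg[OF flux_dual[OF elim]]])
      then show ?case by (simp add: power_mult_distrib)
    qed
    have "AE t in MT T. t \<in> {0<..<T}" by (rule AE_I2) simp
    with uV lim show "AE t in MT T. (\<lambda>k. H10_dual_norm \<Omega> (\<lambda>z. dform (acoef (s k t)) (s k t) z - dform (acoef (u t)) (u t) z)) \<longlonglongrightarrow> 0"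
    proof eventually_elim
      case (elim t)
      note sV = s(2)[OF elim(3)]
      show ?case
      proof (rule tendsto_sandwich[OF _ _ tendsto_const flux_modulus_tendsto[OF elim(2) sV elim(1)]]; intro always_eventually allI)
        show "0 \<le> H10_dual_norm \<Omega> (\<lambda>z. dform (acoef (s k t)) (s k t) z - dform (acoef (u t)) (u t) z)" for k
          by (intro dual_norm_nonneg dual_diff flux_dual sV elim)
        show "H10_dual_norm \<Omega> (\<lambda>z. dform (acoef (s k t)) (s k t) z - dform (acoef (u t)) (u t) z) \<le>
            M * H1_norm \<Omega> (s k t - u t) + coeff_dist (acoef (s k t)) (acoef (u t)) (u t)" for k
        proof (rule dual_norm_le)
          show "0 \<le> M * H1_norm \<Omega> (s k t - u t) + coeff_dist (acoef (s k t)) (acoef (u t)) (u t)"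
            using M_nonneg coeff_dist_nonneg[OF acoef(1) acoef(1), of "s k t" "u t" "u t"] sV elim by simp
        qed (rule flux_diff[OF sV elim(1)])
      qed
    qed
  qed
qed

end

section \<open>Uniqueness\<close>

text \<open>On a piece where the integral of \<open>k\<close> is below 1/2, and up to whose start
  \<open>N\<close> vanishes, the maximum of \<open>N\<close> is at most half of itself. Finitely
  many such pieces cover the interval because the primitive of \<open>k\<close> is uniformly
  continuous.\<close>

lemma gronwall_zero:
  assumes T: "T > 0" and N: "continuous_on {0..T} N" and N0: "\<And>t. t \<in> {0..T} \<Longrightarrow> 0 \<le> N t"
    and k: "integrable (MT T) k" "\<And>t. t \<in> {0<..<T} \<Longrightarrow> 0 \<le> k t"
    and le: "\<And>t. t \<in> {0..T} \<Longrightarrow> N t \<le> iint T (\<lambda>\<sigma>. k \<sigma> * N \<sigma>) 0 t"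
    and t: "t \<in> {0..T}"
  shows "N t = 0"
proof -
  obtain C where C: "\<forall>t\<in>{0..T}. \<bar>N t\<bar> \<le> C" using continuous_integrable_MT(2)[OF N] by blast
  have kN: "integrable (MT T) (\<lambda>\<sigma>. k \<sigma> * N \<sigma>)"
  proof (rule integrable_mult_bounded[OF k(1)])
    show "N \<in> borel_measurable (MT T)" using continuous_integrable_MT(1)[OF N] by simp
    show "AE t in MT T. \<bar>N t\<bar> \<le> C" by (rule AE_I2) (use C in auto)
  qed
  define K where "K t = iint T k 0 t" for t
  have "uniformly_continuous_on {0..T} K"
    unfolding K_def by (intro compact_uniformly_continuous continuous_on_subset[OF iint_continuous[OF k(1)]]) auto
  then obtain d where d: "d > 0" "\<And>x y. \<lbrakk>x \<in> {0..T}; y \<in> {0..T}; \<bar>y - x\<bar> < d\<rbrakk> \<Longrightarrow> \<bar>K y - K x\<bar> < 1/2"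
    unfolding uniformly_continuous_on_def dist_real_def by (metis half_gt_zero zero_less_one)
  obtain n :: nat where n: "n > 0" "T / real n < d"
  proof -
    obtain n :: nat where "T / d < real n" using reals_Archimedean2 by blast
    then have "T < real n * d" "n > 0" using d(1) T by (auto simp: field_simps intro: gr0I)
    then show ?thesis using that[of n] by (simp add: field_simps)
  qed
  define h where "h = T / real n"
  have h: "h > 0" "h < d" "real n * h = T" using n T by (auto simp: h_def)
  have step: "\<forall>s\<in>{0..real i * h}. N s = 0" if "i \<le> n" for i
    using that
  proof (induction i)
    case 0
    have "N 0 = 0" using le[of 0] N0[of 0] T by simp
    then show ?case by simp
  next
    case (Suc i)
    define p where "p = real i * h"
    define q where "q = p + h"
    have qT: "q \<le> T"
    proof -
      have "real (Suc i) * h \<le> real n * h" using Suc.prems h by (intro mult_right_mono) auto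
      then show ?thesis using h by (simp add: q_def p_def algebra_simps)
    qed
    have p0: "0 \<le> p" "p \<le> q" using h by (auto simp: p_def q_def)
    \<comment> \<open>The argument is run at a maximum point of \<open>N\<close> on the
      piece.\<close>
    have "\<exists>x\<in>{p..q}. \<forall>y\<in>{p..q}. N y \<le> N x"
      by (rule continuous_attains_sup) (use p0 qT in \<open>auto intro: continuous_on_subset[OF N]\<close>)
    then obtain x where x: "x \<in> {p..q}" "\<And>y. y \<in> {p..q} \<Longrightarrow> N y \<le> N x" by blast
    have IH: "N s = 0" if "s \<in> {0..p}" for s using Suc that by (simp add: p_def)
    have "N x \<le> iint T (\<lambda>\<sigma>. k \<sigma> * N \<sigma>) 0 p + iint T (\<lambda>\<sigma>. k \<sigma> * N \<sigma>) p x"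
      using le[of x] iint_split[OF kN, of 0 p x] x(1) p0 qT by simp
    also have "iint T (\<lambda>\<sigma>. k \<sigma> * N \<sigma>) 0 p = iint T (\<lambda>\<sigma>. 0) 0 p"
      by (rule iint_cong_AE) (use IH kN in auto)
    also have "iint T (\<lambda>\<sigma>. 0) 0 p = 0" by (simp add: iint_def cong: if_cong)
    also have "iint T (\<lambda>\<sigma>. k \<sigma> * N \<sigma>) p x \<le> iint T (\<lambda>\<sigma>. N x * k \<sigma>) p x"
    proof (rule iint_mono_AE[OF kN])
      show "AE \<sigma> in MT T. p < \<sigma> \<and> \<sigma> \<le> x \<longrightarrow> k \<sigma> * N \<sigma> \<le> N x * k \<sigma>"
      proof (rule AE_I2, rule impI)
        fix \<sigma> assume \<sigma>: "\<sigma> \<in> space (MT T)" "p < \<sigma> \<and> \<sigma> \<le> x"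
        then have "N \<sigma> \<le> N x" using x by auto
        moreover have "0 \<le> k \<sigma>" using k(2)[of \<sigma>] \<sigma> by simp
        ultimately have "N \<sigma> * k \<sigma> \<le> N x * k \<sigma>" by (rule mult_right_mono)
        then show "k \<sigma> * N \<sigma> \<le> N x * k \<sigma>" by (simp add: mult.commute)
      qed
    qed (use k in simp)
    also have "\<dots> = N x * (K x - K p)"
      unfolding iint_cmult K_def using iint_split[OF k(1), of 0 p x] x(1) p0 by simp
    also have "\<dots> \<le> N x * (1/2)"
    proof (rule mult_left_mono)
      have "\<bar>K x - K p\<bar> < 1/2" by (rule d(2)) (use x(1) p0 qT h in \<open>auto simp: q_def\<close>)
      then show "K x - K p \<le> 1/2" by linarith
      show "0 \<le> N x" using N0[of x] x(1) p0 qT by auto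
    qed
    finally have "N x \<le> 0" by simp
    have "N s = 0" if "s \<in> {0..real (Suc i) * h}" for s
    proof (cases "s \<le> p")
      case True then show ?thesis using IH that by simp
    next
      case False
      then have "s \<in> {p..q}" using that by (auto simp: q_def p_def algebra_simps)
      then show ?thesis using x(2)[of s] \<open>N x \<le> 0\<close> N0[of s] p0 qT by auto
    qed
    then show ?case by blast
  qed
  show ?thesis using step[of n] t h by simp
qed

lemma L2_norm_diff_eq: "L2_norm \<Omega> (\<lambda>x. v x - w x) = L2_norm \<Omega> (v - w)"
  by (simp add: fun_diff_def)

context bounded_domain begin

lemma nrm_eqs: "semi_inner.nrm (L2_inner \<Omega>) = L2_norm \<Omega>" "semi_inner.nrm H1_inner = H1_norm \<Omega>"
  by (rule L2_nrm) (intro ext, simp add: semi_inner.nrm_def[OF H1_semi_inner] H1_norm_alt)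

lemma L2_inner_AE_left:
  assumes "v \<in> L2_space \<Omega>" "w \<in> L2_space \<Omega>" "\<phi> \<in> L2_space \<Omega>" "AE x in M\<Omega>. v x = w x"
  shows "L2_inner \<Omega> v \<phi> = L2_inner \<Omega> w \<phi>"
  unfolding L2_inner_def
proof (rule integral_cong_AE)
  show "AE x in M\<Omega>. v x * \<phi> x = w x * \<phi> x" using assms(4) by eventually_elim simp
qed (use L2_mult_integrable[OF assms(1,3)] L2_mult_integrable[OF assms(2,3)] in simp_all)

lemma C_L2_continuous:
  assumes w: "w \<in> C_L2 T \<Omega>" and \<phi>: "\<phi> \<in> L2_space \<Omega>"
  shows "continuous_on {0..T} (\<lambda>t. L2_inner \<Omega> (w t) \<phi>)"
  unfolding continuous_on_def
proof
  fix t assume t: "t \<in> {0..T}"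
  have wL: "w s \<in> L2_space \<Omega>" if "s \<in> {0..T}" for s using w that by (simp add: C_L2_def)
  have "((\<lambda>s. L2_norm \<Omega> (w s - w t)) \<longlongrightarrow> 0) (at t within {0..T})"
    using w t unfolding C_L2_def L2_norm_diff_eq by blast
  then have 0: "((\<lambda>s. L2_norm \<Omega> (w s - w t) * L2_norm \<Omega> \<phi>) \<longlongrightarrow> 0) (at t within {0..T})"
    by (rule tendsto_mult_left_zero)
  have "((\<lambda>s. L2_inner \<Omega> (w s) \<phi> - L2_inner \<Omega> (w t) \<phi>) \<longlongrightarrow> 0) (at t within {0..T})"
  proof (rule tendsto_0_le[OF 0, where K=1])
    have "\<forall>\<^sub>F s in at t within {0..T}. s \<in> {0..T}" by (simp add: eventually_at_filter)
    then show "\<forall>\<^sub>F s in at t within {0..T}. norm (L2_inner \<Omega> (w s) \<phi> - L2_inner \<Omega> (w t) \<phi>)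
        \<le> norm (L2_norm \<Omega> (w s - w t) * L2_norm \<Omega> \<phi>) * 1"
    proof eventually_elim
      case (elim s)
      have "\<bar>L2_inner \<Omega> (w s - w t) \<phi>\<bar> \<le> L2_norm \<Omega> (w s - w t) * L2_norm \<Omega> \<phi>"
        by (rule L2.Cauchy_Schwarz) (use wL elim t \<phi> in auto)
      then show ?case using wL elim t \<phi> by (simp add: L2.diff_left)
    qed
  qed
  then show "((\<lambda>s. L2_inner \<Omega> (w s) \<phi>) \<longlongrightarrow> L2_inner \<Omega> (w t) \<phi>) (at t within {0..T})"
    by (simp add: LIM_zero_iff)
qed

end

section \<open>The weak equation and its integrated form\<close>

context nonlocal begin

text \<open>The derivative of \<open>u\<close> in time as a functional on V, prescribed by the
  equation.\<close>

definition rhs :: "(real \<Rightarrow> ('a \<Rightarrow> real) \<Rightarrow> real) \<Rightarrow> (real \<Rightarrow> 'a \<Rightarrow> real) \<Rightarrow> real \<Rightarrow> ('a \<Rightarrow> real) \<Rightarrow> real" where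
  "rhs f u t \<phi> = f t \<phi> - dform (acoef (u t)) (u t) \<phi>"

lemma rhs_L2_V': "f \<in> L2_V' T \<Omega> \<Longrightarrow> u \<in> L2_V T \<Omega> \<Longrightarrow> rhs f u \<in> L2_V' T \<Omega>"
  using L2_V'_diff[OF _ flux_L2_V'] by (simp add: rhs_def[abs_def])

lemma is_solution_iff:
  "is_solution \<Omega> T a g r f u0 u \<longleftrightarrow>
    u \<in> L2_V T \<Omega> \<and> (\<exists>w\<in>L2_V' T \<Omega>. weak_time_deriv T \<Omega> u w) \<and> initial_value T \<Omega> u u0 \<and>
    (\<forall>\<phi>\<in>H10_space \<Omega>. \<forall>\<psi>\<in>test_functions {0<..<T}.
      - (LINT t|MT T. L2_inner \<Omega> (u t) \<phi> * deriv \<psi> t) + (LINT t|MT T. dform (acoef (u t)) (u t) \<phi> * \<psi> t) =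
      (LINT t|MT T. f t \<phi> * \<psi> t))"
  by (simp add: is_solution_def distr_deriv_def regular_distr_def dform_def acoef_def)

lemma test_mult_integrable:
  assumes \<psi>: "\<psi> \<in> test_functions {0<..<T}" and b: "integrable (MT T) b"
  shows "integrable (MT T) (\<lambda>t. b t * \<psi> t)"
proof -
  have c: "continuous_on {0..T} \<psi>" using test_functionsD(2)[OF \<psi>] by (rule continuous_on_subset) simp
  obtain C where C: "\<forall>t\<in>{0..T}. \<bar>\<psi> t\<bar> \<le> C" using continuous_integrable_MT(2)[OF c] by blast
  show ?thesis
  proof (rule integrable_mult_bounded[OF b])
    show "\<psi> \<in> borel_measurable (MT T)" using continuous_integrable_MT(1)[OF c] by simp
    show "AE t in MT T. \<bar>\<psi> t\<bar> \<le> C" by (rule AE_I2) (use C in auto)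
  qed
qed

lemma inner_AE_representative:
  assumes w: "\<And>t. t \<in> {0..T} \<Longrightarrow> w t \<in> L2_space \<Omega>" and u: "u \<in> L2_V T \<Omega>"
    and eq: "AE t in MT T. AE x in M\<Omega>. w t x = u t x" and \<phi>: "\<phi> \<in> L2_space \<Omega>"
  shows "AE t in MT T. L2_inner \<Omega> (w t) \<phi> = L2_inner \<Omega> (u t) \<phi>"
proof -
  have uV: "AE t in MT T. u t \<in> H10_space \<Omega>" by (rule L2_V_E[OF u])
  have "AE t in MT T. t \<in> {0<..<T}" by (rule AE_I2) simp
  with uV eq show ?thesis
    by eventually_elim (rule L2_inner_AE_left, use w \<phi> in auto)
qed

lemma weak_pairing_eq:
  assumes p: "continuous_on {0..T} p" and eq: "AE t in MT T. p t = q t" and \<psi>: "\<psi> \<in> test_functions {0<..<T}"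
  shows "(LINT t|MT T. q t * deriv \<psi> t) = (LINT t|MT T. p t * deriv \<psi> t)"
proof -
  have i: "integrable (MT T) (\<lambda>t. p t * deriv \<psi> t)"
    by (intro continuous_integrable_MT(1) continuous_intros p continuous_on_subset[OF test_deriv(2)[OF \<psi>]]) simp
  have ae: "AE t in MT T. p t * deriv \<psi> t = q t * deriv \<psi> t" using eq by eventually_elim simp
  have "(\<lambda>t. q t * deriv \<psi> t) \<in> borel_measurable (MT T)"
    by (rule measurable_AE_eq[OF _ borel_measurable_integrable[OF i] ae]) simp
  from integral_cong_AE[OF borel_measurable_integrable[OF i] this ae] show ?thesis by simp
qed

text \<open>Tested with a fixed \<open>\<phi>\<close>, the continuous representative of the solution
  is a continuous scalar function with an integrable weak derivative, hence its primitive. This form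
  holds at all times, including the initial one.\<close>

lemma solution_path:
  assumes T: "T > 0" and f: "f \<in> L2_V' T \<Omega>" and sol: "is_solution \<Omega> T a g r f u0 u"
  obtains w where "w \<in> C_L2 T \<Omega>" "AE t in MT T. AE x in M\<Omega>. w t x = u t x" "AE x in M\<Omega>. w 0 x = u0 x"
    "\<And>s t \<phi>. \<lbrakk>0 \<le> s; s \<le> t; t \<le> T; \<phi> \<in> H10_space \<Omega>\<rbrakk> \<Longrightarrow>
      L2_inner \<Omega> (w t - w s) \<phi> = iint T (\<lambda>\<sigma>. rhs f u \<sigma> \<phi>) s t"
proof -
  have u: "u \<in> L2_V T \<Omega>" and init: "initial_value T \<Omega> u u0" using sol by (auto simp: is_solution_iff)
  obtain w where w: "w \<in> C_L2 T \<Omega>" "AE t in MT T. AE x in M\<Omega>. w t x = u t x" "AE x in M\<Omega>. w 0 x = u0 x"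
    using init unfolding initial_value_def by blast
  have wL: "w t \<in> L2_space \<Omega>" if "t \<in> {0..T}" for t using w(1) that by (simp add: C_L2_def)
  have "L2_inner \<Omega> (w t - w s) \<phi> = iint T (\<lambda>\<sigma>. rhs f u \<sigma> \<phi>) s t"
    if st: "0 \<le> s" "s \<le> t" "t \<le> T" and \<phi>: "\<phi> \<in> H10_space \<Omega>" for s t \<phi>
  proof -
    have \<phi>L: "\<phi> \<in> L2_space \<Omega>" using \<phi> by simp
    note p = C_L2_continuous[OF w(1) \<phi>L]
    note ae = inner_AE_representative[OF wL u w(2) \<phi>L]
    have "L2_inner \<Omega> (w t) \<phi> - L2_inner \<Omega> (w s) \<phi> = iint T (\<lambda>\<sigma>. rhs f u \<sigma> \<phi>) s t"
    proof (rule weak_deriv_primitive[OF T p L2_V'_D(6)[OF rhs_L2_V'[OF f u] \<phi>] _ st])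
      fix \<psi> assume \<psi>: "\<psi> \<in> test_functions {0<..<T}"
      have "(LINT t|MT T. rhs f u t \<phi> * \<psi> t) =
        (LINT t|MT T. f t \<phi> * \<psi> t) - (LINT t|MT T. dform (acoef (u t)) (u t) \<phi> * \<psi> t)"
        unfolding rhs_def left_diff_distrib
        by (rule Bochner_Integration.integral_diff)
          (rule test_mult_integrable[OF \<psi>], rule L2_V'_D(6)[OF _ \<phi>], rule f flux_L2_V'[OF u])+
      moreover have "- (LINT t|MT T. L2_inner \<Omega> (u t) \<phi> * deriv \<psi> t) + (LINT t|MT T. dform (acoef (u t)) (u t) \<phi> * \<psi> t) =
          (LINT t|MT T. f t \<phi> * \<psi> t)"
        using sol \<phi> \<psi> unfolding is_solution_iff by blast
      ultimately show "- (LINT t|MT T. L2_inner \<Omega> (w t) \<phi> * deriv \<psi> t) = (LINT t|MT T. rhs f u t \<phi> * \<psi> t)"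
        using weak_pairing_eq[OF p ae \<psi>] by linarith
    qed
    then show ?thesis using wL st \<phi>L by (simp add: L2.diff_left)
  qed
  then show ?thesis using that[of w] w by blast
qed

text \<open>Converse of \<open>solution_path\<close>: no continuity of \<open>w\<close> in L2 is
  supplied, it comes from \<open>path_continuous\<close> by way of the energy identity.\<close>

lemma solution_of_path:
  assumes T: "T > 0" and f: "f \<in> L2_V' T \<Omega>" and u: "u \<in> L2_V T \<Omega>"
    and wL: "\<And>t. t \<in> {0..T} \<Longrightarrow> w t \<in> L2_space \<Omega>"
    and wu: "AE t in MT T. AE x in M\<Omega>. w t x = u t x" and w0: "AE x in M\<Omega>. w 0 x = u0 x"
    and path: "\<And>s t \<phi>. \<lbrakk>0 \<le> s; s \<le> t; t \<le> T; \<phi> \<in> H10_space \<Omega>\<rbrakk> \<Longrightarrow>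
      L2_inner \<Omega> (w t - w s) \<phi> = iint T (\<lambda>\<sigma>. rhs f u \<sigma> \<phi>) s t"
  shows "is_solution \<Omega> T a g r f u0 u"
proof -
  note R = rhs_L2_V'[OF f u]
  have uV: "AE t in MT T. u t \<in> H10_space \<Omega>" and usq: "integrable (MT T) (\<lambda>t. (H1_norm \<Omega> (u t))\<^sup>2)"
    by (rule L2_V_E[OF u], assumption)+
  have "gelfand_path (L2_space \<Omega>) (H10_space \<Omega>) (L2_inner \<Omega>) H1_inner T w u (rhs f u) (\<lambda>t. dnorm (rhs f u t))"
  proof (rule gelfand_path.intro[OF gelfand_triple], rule gelfand_path_axioms.intro, unfold nrm_eqs)
    show "AE t in MT T. u t \<in> H10_space \<Omega> \<and> L2_inner \<Omega> (w t - u t) (w t - u t) = 0"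
    proof -
      have "AE t in MT T. t \<in> {0<..<T}" by (rule AE_I2) simp
      with uV wu show ?thesis
      proof eventually_elim
        case (elim t)
        have "w t - u t \<in> L2_space \<Omega>" using wL[of t] elim by auto
        moreover have "AE x in M\<Omega>. (w t - u t) x = 0" using elim(2) by eventually_elim simp
        ultimately show ?case using elim(1) L2_null_iff by blast
      qed
    qed
    show "AE t in MT T. \<forall>x\<in>H10_space \<Omega>. \<forall>y\<in>H10_space \<Omega>.
        rhs f u t (x + y) = rhs f u t x + rhs f u t y \<and> rhs f u t (x - y) = rhs f u t x - rhs f u t y"
      using L2_V'_D(5)[OF R] by eventually_elim (use dualD in blast)
    show "AE t in MT T. \<forall>x\<in>H10_space \<Omega>. \<bar>rhs f u t x\<bar> \<le> dnorm (rhs f u t) * H1_norm \<Omega> x"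
      using L2_V'_D(5)[OF R] by eventually_elim blast
    show "integrable (MT T) (\<lambda>t. dnorm (rhs f u t) * H1_norm \<Omega> (u t))"
      by (rule integrable_mult_squares[OF L2_V'_D(2)[OF R] H1_norm_measurable[OF usq] L2_V'_D(3)[OF R] usq])
  qed (use T wL path L2_V'_D(1,4)[OF R] in \<open>auto simp: dnorm_def\<close>)
  then interpret P: gelfand_path "L2_space \<Omega>" "H10_space \<Omega>" "L2_inner \<Omega>" H1_inner T w u "rhs f u" "\<lambda>t. dnorm (rhs f u t)" .
  have wC: "w \<in> C_L2 T \<Omega>"
    using wL P.path_continuous unfolding C_L2_def L2_norm_diff_eq nrm_eqs by blast
  have weak: "- (LINT t|MT T. L2_inner \<Omega> (u t) \<phi> * deriv \<psi> t) = (LINT t|MT T. rhs f u t \<phi> * \<psi> t)"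
    if \<phi>: "\<phi> \<in> H10_space \<Omega>" and \<psi>: "\<psi> \<in> test_functions {0<..<T}" for \<phi> \<psi>
  proof -
    have \<phi>L: "\<phi> \<in> L2_space \<Omega>" using \<phi> by simp
    have "(LINT t|MT T. L2_inner \<Omega> (u t) \<phi> * deriv \<psi> t) = (LINT t|MT T. L2_inner \<Omega> (w t) \<phi> * deriv \<psi> t)"
      by (rule weak_pairing_eq[OF C_L2_continuous[OF wC \<phi>L] inner_AE_representative[OF wL u wu \<phi>L] \<psi>])
    also have "\<dots> = - (LINT t|MT T. rhs f u t \<phi> * \<psi> t)"
    proof (rule parts_in_time[OF L2_V'_D(6)[OF R \<phi>] \<psi> T])
      show "L2_inner \<Omega> (w t) \<phi> = L2_inner \<Omega> (w 0) \<phi> + iint T (\<lambda>t. rhs f u t \<phi>) 0 t" if "t \<in> {0<..<T}" for t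
        using path[of 0 t \<phi>] that \<phi> wL[of t] wL[of 0] T by (simp add: L2.diff_left)
    qed
    finally show ?thesis by simp
  qed
  show ?thesis
    unfolding is_solution_iff
  proof (intro conjI ballI)
    show "\<exists>w\<in>L2_V' T \<Omega>. weak_time_deriv T \<Omega> u w"
      using R weak by (auto simp: weak_time_deriv_def distr_deriv_def regular_distr_def)
    show "initial_value T \<Omega> u u0" unfolding initial_value_def using wC wu w0 by blast
    fix \<phi> \<psi> assume \<phi>: "\<phi> \<in> H10_space \<Omega>" and \<psi>: "\<psi> \<in> test_functions {0<..<T}"
    have "(LINT t|MT T. rhs f u t \<phi> * \<psi> t) =
      (LINT t|MT T. f t \<phi> * \<psi> t) - (LINT t|MT T. dform (acoef (u t)) (u t) \<phi> * \<psi> t)"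
      unfolding rhs_def left_diff_distrib
      by (rule Bochner_Integration.integral_diff)
        (rule test_mult_integrable[OF \<psi>], rule L2_V'_D(6)[OF _ \<phi>], rule f flux_L2_V'[OF u])+
    then show "- (LINT t|MT T. L2_inner \<Omega> (u t) \<phi> * deriv \<psi> t) + (LINT t|MT T. dform (acoef (u t)) (u t) \<phi> * \<psi> t) =
        (LINT t|MT T. f t \<phi> * \<psi> t)"
      using weak[OF \<phi> \<psi>] by linarith
  qed (rule u)
qed

text \<open>The bound is uniform in the point because every \<open>gx x\<close> has norm at most
  that of \<open>g\<close>; the same fact keeps the arguments of \<open>a\<close> in
  \<open>[-c, c]\<close>.\<close>

lemma acoef_lipschitz:
  assumes \<gamma>: "\<And>x y. \<lbrakk>\<bar>x\<bar> \<le> c; \<bar>y\<bar> \<le> c\<rbrakk> \<Longrightarrow> \<bar>a x - a y\<bar> \<le> \<gamma> * \<bar>x - y\<bar>" and \<gamma>0: "0 \<le> \<gamma>"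
    and v: "v \<in> L2_space \<Omega>" "L2_norm \<Omega> g * L2_norm \<Omega> v \<le> c"
    and v': "v' \<in> L2_space \<Omega>" "L2_norm \<Omega> g * L2_norm \<Omega> v' \<le> c"
  shows "coeff_fun (\<gamma> * (L2_norm \<Omega> g * L2_norm \<Omega> (v - v'))) (\<lambda>x. acoef v x - acoef v' x)"
proof -
  have le: "\<bar>L2_inner \<Omega> (gx x) v\<bar> \<le> L2_norm \<Omega> g * L2_norm \<Omega> v" if "v \<in> L2_space \<Omega>" for v x
    using L2.Cauchy_Schwarz[OF gx_L2 that] mult_right_mono[OF gx_norm L2.nrm_ge_0[OF that]] by (rule order_trans)
  have "\<bar>acoef v x - acoef v' x\<bar> \<le> \<gamma> * (L2_norm \<Omega> g * L2_norm \<Omega> (v - v'))" for x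
  proof -
    have "\<bar>acoef v x - acoef v' x\<bar> \<le> \<gamma> * \<bar>L2_inner \<Omega> (gx x) v - L2_inner \<Omega> (gx x) v'\<bar>"
      unfolding acoef_def l_op_eq
      by (rule \<gamma>) (use le[OF v(1), of x] le[OF v'(1), of x] v(2) v'(2) in linarith)+
    also have "L2_inner \<Omega> (gx x) v - L2_inner \<Omega> (gx x) v' = L2_inner \<Omega> (gx x) (v - v')"
      using L2.diff_right[OF v(1) v'(1) gx_L2] by simp
    also have "\<gamma> * \<bar>L2_inner \<Omega> (gx x) (v - v')\<bar> \<le> \<gamma> * (L2_norm \<Omega> g * L2_norm \<Omega> (v - v'))"
      by (intro mult_left_mono le \<gamma>0 L2.mem_diff v v')
    finally show ?thesis .
  qed
  then show ?thesis
    using coeff_diff[OF acoef(1)[OF v(1)] acoef(1)[OF v'(1)]] by (simp add: coeff_fun_def)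
qed

text \<open>Coercivity at the difference absorbs the term from the change of coefficients:
  \<open>- m * X^2 + P * Y * X\<close> is at most \<open>(P * Y)^2 / (4 * m)\<close>.\<close>

lemma flux_monotone:
  assumes L: "coeff_fun P (\<lambda>x. acoef u x - acoef v x)"
    and u: "u \<in> H10_space \<Omega>" and v: "v \<in> H10_space \<Omega>"
  shows "dform (acoef v) v (u - v) - dform (acoef u) u (u - v) \<le> P\<^sup>2 / (4 * m) * (H1_norm \<Omega> v)\<^sup>2"
proof -
  have d: "u - v \<in> H1_space \<Omega>" using u v by simp
  have A: "coeff_fun M (acoef u)" "coeff_fun M (acoef v)" using u v acoef by auto
  define X Y where "X = L2_norm \<Omega> (ngrad (u - v))" and "Y = L2_norm \<Omega> (ngrad v)"
  have "dform (acoef v) v (u - v) - dform (acoef u) u (u - v) =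
      - dform (acoef u) (u - v) (u - v) - (dform (acoef u) v (u - v) - dform (acoef v) v (u - v))"
    using dform_diff_left[OF A(1) H10_H1[OF u] H10_H1[OF v] d] by simp
  also have "\<dots> = - dform (acoef u) (u - v) (u - v) - dform (\<lambda>x. acoef u x - acoef v x) v (u - v)"
    using dform_coeff_diff[OF A H10_H1[OF v] d] by simp
  also have "\<dots> \<le> - m * X\<^sup>2 + P * Y * X"
  proof -
    have "m * X\<^sup>2 \<le> dform (acoef u) (u - v) (u - v)"
      unfolding X_def by (rule dform_coercive[OF A(1) acoef(2) d]) (use u in simp)
    moreover have "\<bar>dform (\<lambda>x. acoef u x - acoef v x) v (u - v)\<bar> \<le> P * Y * X"
      unfolding X_def Y_def by (rule dform_bound(1)[OF L _ d]) (use v in simp)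
    ultimately show ?thesis by linarith
  qed
  also have "\<dots> \<le> (P * Y)\<^sup>2 / (4 * m)"
  proof -
    have "0 \<le> (2 * m * X - P * Y)\<^sup>2" by simp
    then show ?thesis using m by (simp add: field_simps power2_eq_square)
  qed
  also have "\<dots> \<le> P\<^sup>2 / (4 * m) * (H1_norm \<Omega> v)\<^sup>2"
  proof -
    have "Y\<^sup>2 \<le> (H1_norm \<Omega> v)\<^sup>2"
      unfolding Y_def using v ngrad_le_H1 ngrad_L2 by (intro power_mono) auto
    then have "P\<^sup>2 / (4 * m) * Y\<^sup>2 \<le> P\<^sup>2 / (4 * m) * (H1_norm \<Omega> v)\<^sup>2"
      using m by (intro mult_left_mono) auto
    then show ?thesis by (simp add: power_mult_distrib)
  qed
  finally show ?thesis .
qed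

text \<open>The difference of the continuous representatives is a path driven by the difference of
  the two right-hand sides, in which \<open>f\<close> cancels. Its squared norm \<open>N\<close>
  vanishes initially and grows at a rate at most \<open>k * N\<close>, where \<open>k\<close> is
  integrable since it contains just the squared norm of \<open>v t\<close> in V.\<close>

theorem uniqueness:
  assumes T: "T > 0" and f: "f \<in> L2_V' T \<Omega>"
    and lip: "\<And>c. \<exists>\<gamma>. \<forall>x\<in>{-c..c}. \<forall>y\<in>{-c..c}. \<bar>a x - a y\<bar> \<le> \<gamma> * \<bar>x - y\<bar>"
    and su: "is_solution \<Omega> T a g r f u0 u" and sv: "is_solution \<Omega> T a g r f u0 v"
  shows "AE t in MT T. AE x in M\<Omega>. u t x = v t x"
proof -
  have u: "u \<in> L2_V T \<Omega>" and v: "v \<in> L2_V T \<Omega>" using su sv by (auto simp: is_solution_iff)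
  obtain w1 where w1: "w1 \<in> C_L2 T \<Omega>" "AE t in MT T. AE x in M\<Omega>. w1 t x = u t x" "AE x in M\<Omega>. w1 0 x = u0 x"
    and p1: "\<And>s t \<phi>. \<lbrakk>0 \<le> s; s \<le> t; t \<le> T; \<phi> \<in> H10_space \<Omega>\<rbrakk> \<Longrightarrow>
      L2_inner \<Omega> (w1 t - w1 s) \<phi> = iint T (\<lambda>\<sigma>. rhs f u \<sigma> \<phi>) s t"
    by (rule solution_path[OF T f su], rule that)
  obtain w2 where w2: "w2 \<in> C_L2 T \<Omega>" "AE t in MT T. AE x in M\<Omega>. w2 t x = v t x" "AE x in M\<Omega>. w2 0 x = u0 x"
    and p2: "\<And>s t \<phi>. \<lbrakk>0 \<le> s; s \<le> t; t \<le> T; \<phi> \<in> H10_space \<Omega>\<rbrakk> \<Longrightarrow>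
      L2_inner \<Omega> (w2 t - w2 s) \<phi> = iint T (\<lambda>\<sigma>. rhs f v \<sigma> \<phi>) s t"
    by (rule solution_path[OF T f sv], rule that)
  have uV: "AE t in MT T. u t \<in> H10_space \<Omega>" and usq: "integrable (MT T) (\<lambda>t. (H1_norm \<Omega> (u t))\<^sup>2)"
    by (rule L2_V_E[OF u], assumption)+
  have vV: "AE t in MT T. v t \<in> H10_space \<Omega>" and vsq: "integrable (MT T) (\<lambda>t. (H1_norm \<Omega> (v t))\<^sup>2)"
    by (rule L2_V_E[OF v], assumption)+
  have wL: "w1 t \<in> L2_space \<Omega>" "w2 t \<in> L2_space \<Omega>" if "t \<in> {0..T}" for t
    using w1(1) w2(1) that by (auto simp: C_L2_def)
  define w where "w t = w1 t - w2 t" for t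
  define B where "B t \<phi> = rhs f u t \<phi> - rhs f v t \<phi>" for t \<phi>
  have BV: "B \<in> L2_V' T \<Omega>"
    unfolding B_def[abs_def] by (rule L2_V'_diff[OF rhs_L2_V'[OF f u] rhs_L2_V'[OF f v]])
  have inT: "AE t in MT T. t \<in> {0<..<T}" by (rule AE_I2) simp
  have unorm: "AE t in MT T. L2_norm \<Omega> (u t) = L2_norm \<Omega> (w1 t) \<and> L2_norm \<Omega> (v t) = L2_norm \<Omega> (w2 t)
      \<and> u t - v t \<in> H10_space \<Omega> \<and> L2_inner \<Omega> (w t - (u t - v t)) (w t - (u t - v t)) = 0
      \<and> L2_norm \<Omega> (u t - v t) = L2_norm \<Omega> (w t)"
    using inT uV vV w1(2) w2(2)
  proof eventually_elim
    case (elim t)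
    have t: "t \<in> {0..T}" using elim by auto
    have nrm: "L2_norm \<Omega> y = L2_norm \<Omega> x" if "AE z in M\<Omega>. x z = y z" "x \<in> L2_space \<Omega>" "y \<in> L2_space \<Omega>" for x y
    proof -
      have "AE z in M\<Omega>. (x - y) z = 0" using that(1) by eventually_elim simp
      then have 0: "L2_norm \<Omega> (x - y) = 0" using L2_null_iff[OF L2.mem_diff[OF that(2,3)]] by (simp add: L2_norm_def)
      then show ?thesis using L2.nrm_triangle_sub[OF that(2,3)] by simp
    qed
    have d: "AE z in M\<Omega>. w t z = (u t - v t) z" using elim(4,5) by eventually_elim (simp add: w_def)
    have dL: "w t \<in> L2_space \<Omega>" "u t - v t \<in> L2_space \<Omega>" using wL[OF t] elim by (auto simp: w_def)
    have "AE z in M\<Omega>. (w t - (u t - v t)) z = 0" using d by eventually_elim simp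
    then have "L2_inner \<Omega> (w t - (u t - v t)) (w t - (u t - v t)) = 0"
      using L2_null_iff[OF L2.mem_diff[OF dL]] by blast
    then show ?case
      using nrm[OF elim(4)] nrm[OF elim(5)] nrm[OF d dL] wL[OF t] elim by simp
  qed
  \<comment> \<open>Needed for the integrability of the dual norm of \<open>B\<close> times the norm
    of \<open>u t - v t\<close>; measurability has to be derived from simple approximations of both
    functions.\<close>
  have dsq: "(\<lambda>t. H1_norm \<Omega> (u t - v t)) \<in> borel_measurable (MT T) \<and> integrable (MT T) (\<lambda>t. (H1_norm \<Omega> (u t - v t))\<^sup>2)"
  proof -
    obtain s where s: "\<And>k. simple_function (MT T) (s k)" "\<And>k t. t \<in> {0<..<T} \<Longrightarrow> s k t \<in> H10_space \<Omega>"
      "AE t in MT T. (\<lambda>k. H1_norm \<Omega> (s k t - u t)) \<longlonglongrightarrow> 0"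
      by (rule L2_V_E[OF u], rule that)
    obtain s' where s': "\<And>k. simple_function (MT T) (s' k)" "\<And>k t. t \<in> {0<..<T} \<Longrightarrow> s' k t \<in> H10_space \<Omega>"
      "AE t in MT T. (\<lambda>k. H1_norm \<Omega> (s' k t - v t)) \<longlonglongrightarrow> 0"
      by (rule L2_V_E[OF v], rule that)
    have sd: "simple_function (MT T) (\<lambda>t. s k t - s' k t)" for k
      by (rule simple_function_compose2[OF s(1) s'(1)])
    have meas: "(\<lambda>t. H1_norm \<Omega> (u t - v t)) \<in> borel_measurable (MT T)"
    proof (rule simple_limit_measurable[OF sd, where \<Phi>="\<lambda>k. H1_norm \<Omega>"])
      show "AE t in MT T. (\<lambda>k. H1_norm \<Omega> (s k t - s' k t)) \<longlonglongrightarrow> H1_norm \<Omega> (u t - v t)"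
        using inT uV vV s(3) s'(3)
      proof eventually_elim
        case (elim t)
        note sV = s(2)[OF elim(1)] s'(2)[OF elim(1)]
        have "(\<lambda>k. H1_norm \<Omega> (s k t - u t) + H1_norm \<Omega> (s' k t - v t)) \<longlonglongrightarrow> 0 + 0"
          by (rule tendsto_add[OF elim(4,5)])
        then have 0: "(\<lambda>k. H1_norm \<Omega> (s k t - u t) + H1_norm \<Omega> (s' k t - v t)) \<longlonglongrightarrow> 0" by simp
        have "(\<lambda>k. H1_norm \<Omega> ((s k t - s' k t) - (u t - v t))) \<longlonglongrightarrow> 0"
        proof (rule tendsto_0_le[OF 0, where K=1], intro always_eventually allI)
          fix k
          have eq: "(s k t - s' k t) - (u t - v t) = (s k t - u t) - (s' k t - v t)" by simp
          have "H1_norm \<Omega> ((s k t - s' k t) - (u t - v t)) \<le> H1_norm \<Omega> (s k t - u t) + H1_norm \<Omega> (s' k t - v t)"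
            unfolding eq by (rule H1.nrm_diff_le) (use sV[of k] elim in simp_all)
          then show "norm (H1_norm \<Omega> ((s k t - s' k t) - (u t - v t))) \<le> norm (H1_norm \<Omega> (s k t - u t) + H1_norm \<Omega> (s' k t - v t)) * 1"
            by simp
        qed
        then show ?case by (rule H1.tendsto_nrm) (use sV elim in auto)
      qed
    qed
    have "integrable (MT T) (\<lambda>t. (H1_norm \<Omega> (u t - v t))\<^sup>2)"
    proof (rule Bochner_Integration.integrable_bound)
      show "integrable (MT T) (\<lambda>t. 2 * (H1_norm \<Omega> (u t))\<^sup>2 + 2 * (H1_norm \<Omega> (v t))\<^sup>2)" using usq vsq by simp
      show "(\<lambda>t. (H1_norm \<Omega> (u t - v t))\<^sup>2) \<in> borel_measurable (MT T)" by (rule borel_measurable_power[OF meas])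
      show "AE t in MT T. norm ((H1_norm \<Omega> (u t - v t))\<^sup>2) \<le> norm (2 * (H1_norm \<Omega> (u t))\<^sup>2 + 2 * (H1_norm \<Omega> (v t))\<^sup>2)"
        using uV vV
      proof eventually_elim
        case (elim t)
        have "(H1_norm \<Omega> (u t - v t))\<^sup>2 \<le> (H1_norm \<Omega> (u t) + H1_norm \<Omega> (v t))\<^sup>2"
          by (rule power_mono[OF H1.nrm_diff_le]) (use elim in auto)
        also have "\<dots> \<le> 2 * (H1_norm \<Omega> (u t))\<^sup>2 + 2 * (H1_norm \<Omega> (v t))\<^sup>2"
          using sum_squares_bound[of "H1_norm \<Omega> (u t)" "H1_norm \<Omega> (v t)"] by (simp add: power2_sum)
        finally show ?case by simp
      qed
    qed
    with meas show ?thesis by blast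
  qed
  have "gelfand_path (L2_space \<Omega>) (H10_space \<Omega>) (L2_inner \<Omega>) H1_inner T w (\<lambda>t. u t - v t) B (\<lambda>t. dnorm (B t))"
  proof (rule gelfand_path.intro[OF gelfand_triple], rule gelfand_path_axioms.intro, unfold nrm_eqs)
    show "AE t in MT T. u t - v t \<in> H10_space \<Omega> \<and> L2_inner \<Omega> (w t - (u t - v t)) (w t - (u t - v t)) = 0"
      using unorm by eventually_elim blast
    show "AE t in MT T. \<forall>x\<in>H10_space \<Omega>. \<forall>y\<in>H10_space \<Omega>. B t (x + y) = B t x + B t y \<and> B t (x - y) = B t x - B t y"
      using L2_V'_D(5)[OF BV] by eventually_elim (use dualD in blast)
    show "AE t in MT T. \<forall>x\<in>H10_space \<Omega>. \<bar>B t x\<bar> \<le> dnorm (B t) * H1_norm \<Omega> x"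
      using L2_V'_D(5)[OF BV] by eventually_elim blast
    show "integrable (MT T) (\<lambda>t. dnorm (B t) * H1_norm \<Omega> (u t - v t))"
      by (rule integrable_mult_squares[OF L2_V'_D(2)[OF BV] _ L2_V'_D(3)[OF BV]]) (use dsq in auto)
    show "L2_inner \<Omega> (w t - w s) \<phi> = iint T (\<lambda>\<sigma>. B \<sigma> \<phi>) s t"
      if "0 \<le> s" "s \<le> t" "t \<le> T" "\<phi> \<in> H10_space \<Omega>" for s t \<phi>
    proof -
      have eq: "w t - w s = (w1 t - w1 s) - (w2 t - w2 s)" by (simp add: w_def)
      have "L2_inner \<Omega> (w t - w s) \<phi> = L2_inner \<Omega> (w1 t - w1 s) \<phi> - L2_inner \<Omega> (w2 t - w2 s) \<phi>"
        unfolding eq by (rule L2.diff_left) (use wL that in auto)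
      then show ?thesis
        unfolding B_def p1[OF that] p2[OF that]
        by (subst iint_diff) (use L2_V'_D(6)[OF rhs_L2_V'[OF f u]] L2_V'_D(6)[OF rhs_L2_V'[OF f v]] that in auto)
    qed
    show "w t \<in> L2_space \<Omega>" if "t \<in> {0..T}" for t using wL[OF that] by (simp add: w_def)
  qed (use T L2_V'_D(1,4)[OF BV] in \<open>auto simp: dnorm_def\<close>)
  then interpret P: gelfand_path "L2_space \<Omega>" "H10_space \<Omega>" "L2_inner \<Omega>" H1_inner T w "\<lambda>t. u t - v t" B "\<lambda>t. dnorm (B t)" .
  define N where "N t = L2_inner \<Omega> (w t) (w t)" for t
  have Nsq: "N t = (L2_norm \<Omega> (w t))\<^sup>2" if "t \<in> {0..T}" for t
    using L2.nrm_sq[of "w t"] P.wH[OF that] by (simp add: N_def)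
  have N_cont: "continuous_on {0..T} N" unfolding N_def by (rule P.energy_continuous)
  have bdd: "\<exists>K. \<forall>t\<in>{0..T}. L2_norm \<Omega> (w' t) \<le> K" if w': "w' \<in> C_L2 T \<Omega>" for w'
  proof -
    have w'L: "w' t \<in> L2_space \<Omega>" if "t \<in> {0..T}" for t using w' that by (simp add: C_L2_def)
    have "continuous_on {0..T} (\<lambda>t. L2_norm \<Omega> (w' t))"
      unfolding continuous_on_def
    proof
      fix t assume t: "t \<in> {0..T}"
      have 0: "((\<lambda>s. L2_norm \<Omega> (w' s - w' t)) \<longlongrightarrow> 0) (at t within {0..T})"
        using w' t unfolding C_L2_def L2_norm_diff_eq by blast
      have "((\<lambda>s. L2_norm \<Omega> (w' s) - L2_norm \<Omega> (w' t)) \<longlongrightarrow> 0) (at t within {0..T})"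
      proof (rule tendsto_0_le[OF 0, where K=1])
        have "\<forall>\<^sub>F s in at t within {0..T}. s \<in> {0..T}" by (simp add: eventually_at_filter)
        then show "\<forall>\<^sub>F s in at t within {0..T}. norm (L2_norm \<Omega> (w' s) - L2_norm \<Omega> (w' t)) \<le> norm (L2_norm \<Omega> (w' s - w' t)) * 1"
        proof eventually_elim
          case (elim s)
          show ?case using L2.nrm_triangle_sub[OF w'L[OF elim] w'L[OF t]] by simp
        qed
      qed
      then show "((\<lambda>s. L2_norm \<Omega> (w' s)) \<longlongrightarrow> L2_norm \<Omega> (w' t)) (at t within {0..T})" by (simp add: LIM_zero_iff)
    qed
    then obtain C where "\<forall>t\<in>{0..T}. \<bar>L2_norm \<Omega> (w' t)\<bar> \<le> C" using continuous_integrable_MT(2) by blast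
    then show ?thesis by (intro exI[of _ C]) auto
  qed
  obtain K1 where K1: "\<forall>t\<in>{0..T}. L2_norm \<Omega> (w1 t) \<le> K1" using bdd[OF w1(1)] by blast
  obtain K2 where K2: "\<forall>t\<in>{0..T}. L2_norm \<Omega> (w2 t) \<le> K2" using bdd[OF w2(1)] by blast
  \<comment> \<open>By Cauchy-Schwarz this bounds the nonlocal quantity of both solutions at all
    points, so a single local Lipschitz constant serves.\<close>
  define c where "c = L2_norm \<Omega> g * max K1 K2"
  obtain \<gamma>0 where "\<forall>x\<in>{-c..c}. \<forall>y\<in>{-c..c}. \<bar>a x - a y\<bar> \<le> \<gamma>0 * \<bar>x - y\<bar>" using lip by blast
  then have \<gamma>: "\<bar>a x - a y\<bar> \<le> \<bar>\<gamma>0\<bar> * \<bar>x - y\<bar>" if "\<bar>x\<bar> \<le> c" "\<bar>y\<bar> \<le> c" for x y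
  proof -
    have "\<bar>a x - a y\<bar> \<le> \<gamma>0 * \<bar>x - y\<bar>" using \<open>\<forall>x\<in>{-c..c}. _\<close> that by (simp add: abs_le_iff)
    also have "\<dots> \<le> \<bar>\<gamma>0\<bar> * \<bar>x - y\<bar>" by (intro mult_right_mono) auto
    finally show ?thesis .
  qed
  \<comment> \<open>The constant of \<open>flux_monotone\<close> with the squared norm of the
    difference taken out as \<open>N\<close>; the factor 2 in \<open>k\<close> is that of the energy
    identity.\<close>
  define Q where "Q = (\<bar>\<gamma>0\<bar> * L2_norm \<Omega> g)\<^sup>2 / (4 * m)"
  have Q: "0 \<le> Q" using m by (simp add: Q_def)
  define k where "k t = 2 * Q * (H1_norm \<Omega> (v t))\<^sup>2" for t
  have ki: "integrable (MT T) k" unfolding k_def using vsq by simp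
  obtain CN where CN: "\<forall>t\<in>{0..T}. \<bar>N t\<bar> \<le> CN" using continuous_integrable_MT(2)[OF N_cont] by blast
  have kN: "integrable (MT T) (\<lambda>t. k t * N t)"
  proof (rule integrable_mult_bounded[OF ki])
    show "N \<in> borel_measurable (MT T)" using continuous_integrable_MT(1)[OF N_cont] by simp
    show "AE t in MT T. \<bar>N t\<bar> \<le> CN" by (rule AE_I2) (use CN in auto)
  qed
  have key: "AE \<sigma> in MT T. 2 * B \<sigma> (u \<sigma> - v \<sigma>) \<le> k \<sigma> * N \<sigma>"
    using inT uV vV unorm
  proof eventually_elim
    case (elim \<sigma>)
    have \<sigma>: "\<sigma> \<in> {0..T}" using elim by auto
    define P where "P = \<bar>\<gamma>0\<bar> * (L2_norm \<Omega> g * L2_norm \<Omega> (u \<sigma> - v \<sigma>))"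
    have "coeff_fun P (\<lambda>x. acoef (u \<sigma>) x - acoef (v \<sigma>) x)"
      unfolding P_def
    proof (rule acoef_lipschitz[where c=c])
      show "L2_norm \<Omega> g * L2_norm \<Omega> (u \<sigma>) \<le> c" "L2_norm \<Omega> g * L2_norm \<Omega> (v \<sigma>) \<le> c"
        unfolding c_def using K1 K2 \<sigma> elim(4) g by (auto intro!: mult_left_mono simp: le_max_iff_disj)
    qed (use \<gamma> elim in auto)
    from flux_monotone[OF this elim(2,3)]
    have "B \<sigma> (u \<sigma> - v \<sigma>) \<le> P\<^sup>2 / (4 * m) * (H1_norm \<Omega> (v \<sigma>))\<^sup>2"
      by (simp add: B_def rhs_def)
    also have "\<dots> = Q * (H1_norm \<Omega> (v \<sigma>))\<^sup>2 * N \<sigma>"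
      using elim(4) Nsq[OF \<sigma>] by (simp add: P_def Q_def power_mult_distrib)
    finally show ?case by (simp add: k_def)
  qed
  have N0: "N 0 = 0"
  proof -
    have "AE x in M\<Omega>. w 0 x = 0" using w1(3) w2(3) by eventually_elim (simp add: w_def)
    then show ?thesis unfolding N_def using L2_null_iff P.wH[of 0] T by auto
  qed
  have N_zero: "N t = 0" if t: "t \<in> {0..T}" for t
  proof (rule gronwall_zero[OF T N_cont _ ki _ _ t])
    show "0 \<le> N t" if "t \<in> {0..T}" for t using Nsq[OF that] by simp
    show "0 \<le> k t" for t using Q by (simp add: k_def)
    fix t assume t: "t \<in> {0..T}"
    have "N t = 2 * iint T (\<lambda>\<sigma>. B \<sigma> (u \<sigma> - v \<sigma>)) 0 t"
      using P.energy_identity[of 0 t] t N0 by (simp add: N_def)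
    also have "\<dots> = iint T (\<lambda>\<sigma>. 2 * B \<sigma> (u \<sigma> - v \<sigma>)) 0 t" by (rule iint_cmult[symmetric])
    also have "\<dots> \<le> iint T (\<lambda>\<sigma>. k \<sigma> * N \<sigma>) 0 t"
      by (rule iint_mono_AE[OF _ kN]) (use P.B_u_integrable key in \<open>auto elim!: eventually_mono\<close>)
    finally show "N t \<le> iint T (\<lambda>\<sigma>. k \<sigma> * N \<sigma>) 0 t" .
  qed
  show ?thesis
    using inT w1(2) w2(2)
  proof eventually_elim
    case (elim t)
    have t: "t \<in> {0..T}" using elim by auto
    have "AE x in M\<Omega>. w t x = 0"
      using N_zero[OF t] L2_null_iff[OF P.wH[OF t]] by (simp add: N_def)
    with elim(2,3) show ?case by eventually_elim (simp add: w_def)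
  qed
qed

end

section \<open>Time discretization\<close>

lemma simple_integrable_MT:
  fixes h :: "real \<Rightarrow> real"
  assumes "simple_function (MT T) h" shows "integrable (MT T) h"
proof -
  interpret finite_measure "MT T" by (rule finite_measure_MT)
  show ?thesis by (rule integrable_simple_function[OF assms]) simp
qed

lemma iint_one:
  assumes "0 \<le> s" "s \<le> t" "t \<le> T" shows "iint T (\<lambda>\<sigma>. c) s t = c * (t - s)"
proof -
  have "iint T (\<lambda>\<sigma>. 1) s t = (LINT \<sigma>|lebesgue. indicator {0<..<T} \<sigma> *\<^sub>R (if s < \<sigma> \<and> \<sigma> \<le> t then 1 else 0))"
    unfolding iint_def by (rule integral_restrict_space) simp
  also have "\<dots> = (LINT \<sigma>|lebesgue. indicator ({s<..t} - {T}) \<sigma>)"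
    by (rule Bochner_Integration.integral_cong) (use assms in \<open>auto simp: indicator_def\<close>)
  also have "\<dots> = measure lebesgue ({s<..t} - {T})" by simp
  also have "\<dots> = t - s"
  proof (cases "t = T")
    case True
    have "{s<..t} - {T} = {s<..<t}" using True by auto
    then show ?thesis using assms by simp
  next
    case False
    have "{s<..t} - {T} = {s<..t}" using False assms by auto
    then show ?thesis using assms by simp
  qed
  finally have "iint T (\<lambda>\<sigma>. 1) s t = t - s" .
  then show ?thesis using iint_cmult[of T c "\<lambda>_. 1" s t] by simp
qed

text \<open>Source of the square root of the time increment in all moduli of continuity
  below.\<close>

lemma iint_Cauchy_Schwarz:
  assumes b: "b \<in> borel_measurable (MT T)" "integrable (MT T) (\<lambda>t. (b t)\<^sup>2)" and st: "0 \<le> s" "s \<le> t" "t \<le> T"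
    and C: "(LINT t|MT T. (b t)\<^sup>2) \<le> C\<^sup>2" "0 \<le> C"
  shows "iint T b s t \<le> sqrt (t - s) * C"
proof -
  interpret L: semi_inner "L2_space {0<..<T}" "L2_inner {0<..<T}" by (rule L2_semi_inner)
  interpret finite_measure "MT T" by (rule finite_measure_MT)
  let ?o = "\<lambda>\<sigma>. if s < \<sigma> \<and> \<sigma> \<le> t then 1 else (0::real)"
  have bL: "b \<in> L2_space {0<..<T}" using b by (simp add: L2_space_def)
  have sq: "(\<lambda>\<sigma>. (?o \<sigma>)\<^sup>2) = ?o" by auto
  have oi: "integrable (MT T) ?o" by (rule integrable_cut) simp
  then have oL: "?o \<in> L2_space {0<..<T}" unfolding L2_space_def using sq by simp
  have "L2_inner {0<..<T} ?o ?o = t - s"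
    using iint_one[OF st, of 1] sq by (simp add: L2_inner_def iint_def power2_eq_square)
  then have no: "L.nrm ?o = sqrt (t - s)" by (simp add: L.nrm_def)
  have "L2_inner {0<..<T} b b \<le> C\<^sup>2" using C by (simp add: L2_inner_def power2_eq_square)
  then have nb: "L.nrm b \<le> C" unfolding L.nrm_def using C(2) by (simp add: real_le_lsqrt)
  have "iint T b s t = L2_inner {0<..<T} ?o b"
    unfolding iint_def L2_inner_def by (rule Bochner_Integration.integral_cong) auto
  also have "\<dots> \<le> L.nrm ?o * L.nrm b" using L.Cauchy_Schwarz[OF oL bL] by linarith
  also have "\<dots> \<le> sqrt (t - s) * C" unfolding no using nb st by (intro mult_left_mono) auto
  finally show ?thesis .
qed

section \<open>The implicit step and its a priori bounds\<close>

context nonlocal begin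

text \<open>The coefficient is given, so the form is bilinear and symmetric; boundedness and
  coercivity make it equivalent to the H1 scalar product with constants
  \<open>min 1 (\<tau> * m)\<close> and \<open>1 + \<tau> * M\<close>.\<close>

lemma implicit_step:
  assumes U: "U \<in> L2_space \<Omega>" and \<alpha>: "coeff_fun M \<alpha>" "\<And>x. m \<le> \<alpha> x" and \<tau>: "\<tau> > 0"
    and F: "\<And>x y. \<lbrakk>x \<in> H10_space \<Omega>; y \<in> H10_space \<Omega>\<rbrakk> \<Longrightarrow> F (x + y) = F x + F y"
      "\<And>c x. x \<in> H10_space \<Omega> \<Longrightarrow> F (c *\<^sub>R x) = c * F x"
      "\<And>x. x \<in> H10_space \<Omega> \<Longrightarrow> \<bar>F x\<bar> \<le> C * H1_norm \<Omega> x"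
  shows "\<exists>y\<in>H10_space \<Omega>. \<forall>\<phi>\<in>H10_space \<Omega>. L2_inner \<Omega> y \<phi> + \<tau> * dform \<alpha> y \<phi> = L2_inner \<Omega> U \<phi> + F \<phi>"
proof -
  define b where "b x y = L2_inner \<Omega> x y + \<tau> * dform \<alpha> x y" for x y
  define c where "c = min 1 (\<tau> * m)"
  have c: "c > 0" "c \<le> 1" "c \<le> \<tau> * m" using \<tau> m by (auto simp: c_def)
  have lower: "c * (H1_norm \<Omega> x)\<^sup>2 \<le> b x x" if x: "x \<in> H10_space \<Omega>" for x
  proof -
    have x1: "x \<in> H1_space \<Omega>" using x by simp
    have "c * (L2_norm \<Omega> x)\<^sup>2 \<le> 1 * (L2_norm \<Omega> x)\<^sup>2" using c by (intro mult_right_mono) auto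
    moreover have "c * (L2_norm \<Omega> (ngrad x))\<^sup>2 \<le> \<tau> * m * (L2_norm \<Omega> (ngrad x))\<^sup>2" using c by (intro mult_right_mono) auto
    moreover have "\<tau> * (m * (L2_norm \<Omega> (ngrad x))\<^sup>2) \<le> \<tau> * dform \<alpha> x x"
      using dform_coercive[OF \<alpha> x1] \<tau> by (intro mult_left_mono) auto
    ultimately show ?thesis
      using L2.nrm_sq[of x] x by (simp add: H1_norm_sq[OF x1] b_def distrib_left)
  qed
  have upper: "b x x \<le> (1 + \<tau> * M) * (H1_norm \<Omega> x)\<^sup>2" if x: "x \<in> H10_space \<Omega>" for x
  proof -
    have x1: "x \<in> H1_space \<Omega>" using x by simp
    have "\<tau> * dform \<alpha> x x \<le> \<tau> * (M * (H1_norm \<Omega> x)\<^sup>2)"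
      using dform_bound(2)[OF \<alpha>(1) x1 x1] \<tau> by (intro mult_left_mono) (auto simp: power2_eq_square)
    moreover have "L2_inner \<Omega> x x \<le> (H1_norm \<Omega> x)\<^sup>2"
      using L2.nrm_sq[of x] x H1_norm_sq[OF x1] by simp
    ultimately show ?thesis by (simp add: b_def distrib_right)
  qed
  have si: "semi_inner (H10_space \<Omega>) b"
  proof
    show "0 \<le> b x x" if "x \<in> H10_space \<Omega>" for x
      using lower[OF that] c(1) by (meson mult_nonneg_nonneg less_imp_le order_trans zero_le_power2)
    fix x y z assume xyz: "x \<in> H10_space \<Omega>" "y \<in> H10_space \<Omega>" "z \<in> H10_space \<Omega>"
    show "b (x + y) z = b x z + b y z"
      using xyz by (simp add: b_def L2.add_left dform_add_left[OF \<alpha>(1)] distrib_left)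
  next
    fix c x z assume xz: "x \<in> H10_space \<Omega>" "z \<in> H10_space \<Omega>"
    show "b (c *\<^sub>R x) z = c * b x z"
      using xz by (simp add: b_def L2.scale_left dform_scale_left[OF \<alpha>(1)] distrib_left)
  next
    fix x y assume xy: "x \<in> H10_space \<Omega>" "y \<in> H10_space \<Omega>"
    show "b x y = b y x" using xy by (simp add: b_def L2.sym[of x y] dform_sym[of \<alpha> x y])
  qed (rule H10_subspace)
  have "semi_hilbert (H10_space \<Omega>) b"
  proof (rule semi_hilbert.equivalent_form[OF H10_hilbert si c(1)])
    show "c * H1_inner x x \<le> b x x" "b x x \<le> (1 + \<tau> * M) * H1_inner x x" if "x \<in> H10_space \<Omega>" for x
      using lower[OF that] upper[OF that] H1.nrm_sq[of x] that by auto
  qed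
  then interpret B: semi_hilbert "H10_space \<Omega>" b .
  have bnd: "\<bar>L2_inner \<Omega> U x + F x\<bar> \<le> ((L2_norm \<Omega> U + \<bar>C\<bar>) / sqrt c) * B.nrm x" if x: "x \<in> H10_space \<Omega>" for x
  proof -
    have x1: "x \<in> H1_space \<Omega>" using x by simp
    have "sqrt c * H1_norm \<Omega> x = sqrt (c * (H1_norm \<Omega> x)\<^sup>2)" by (simp add: real_sqrt_mult)
    also have "\<dots> \<le> B.nrm x" unfolding B.nrm_def by (rule real_sqrt_le_mono[OF lower[OF x]])
    finally have le: "H1_norm \<Omega> x \<le> B.nrm x / sqrt c" using c(1) by (simp add: field_simps)
    have "\<bar>L2_inner \<Omega> U x\<bar> \<le> L2_norm \<Omega> U * H1_norm \<Omega> x"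
      using L2.Cauchy_Schwarz[OF U, of x] mult_left_mono[OF L2_le_H1[OF x1] L2.nrm_ge_0[OF U]] x by simp
    moreover have "\<bar>F x\<bar> \<le> \<bar>C\<bar> * H1_norm \<Omega> x"
      using F(3)[OF x] mult_right_mono[OF abs_ge_self[of C] H1_norm_nonneg[of x]] by linarith
    ultimately have "\<bar>L2_inner \<Omega> U x + F x\<bar> \<le> (L2_norm \<Omega> U + \<bar>C\<bar>) * H1_norm \<Omega> x"
      by (simp add: distrib_right)
    also have "\<dots> \<le> (L2_norm \<Omega> U + \<bar>C\<bar>) * (B.nrm x / sqrt c)"
      using U by (intro mult_left_mono le) simp
    finally show ?thesis by simp
  qed
  obtain y where "y \<in> H10_space \<Omega>" "\<And>x. x \<in> H10_space \<Omega> \<Longrightarrow> b y x = L2_inner \<Omega> U x + F x"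
  proof -
    have add: "L2_inner \<Omega> U (x + y) + F (x + y) = (L2_inner \<Omega> U x + F x) + (L2_inner \<Omega> U y + F y)"
      if "x \<in> H10_space \<Omega>" "y \<in> H10_space \<Omega>" for x y
      using F(1)[OF that] that U by (simp add: L2.add_right)
    have scale: "L2_inner \<Omega> U (c *\<^sub>R x) + F (c *\<^sub>R x) = c * (L2_inner \<Omega> U x + F x)" if "x \<in> H10_space \<Omega>" for c x
      using F(2)[OF that] that U by (simp add: L2.scale_right distrib_left)
    show thesis by (rule B.Riesz[of "\<lambda>x. L2_inner \<Omega> U x + F x", OF add scale bnd], assumption+, rule that)
  qed
  then show ?thesis by (auto simp: b_def)
qed

context
  fixes T :: real and f :: "real \<Rightarrow> ('a \<Rightarrow> real) \<Rightarrow> real" and u0 :: "'a \<Rightarrow> real"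
  assumes T: "T > 0" and f: "f \<in> L2_V' T \<Omega>" and u0: "u0 \<in> L2_space \<Omega>"
begin

lemma f_average:
  "\<lbrakk>x \<in> H10_space \<Omega>; y \<in> H10_space \<Omega>\<rbrakk> \<Longrightarrow> iint T (\<lambda>\<sigma>. f \<sigma> (x + y)) s t = iint T (\<lambda>\<sigma>. f \<sigma> x) s t + iint T (\<lambda>\<sigma>. f \<sigma> y) s t"
  "x \<in> H10_space \<Omega> \<Longrightarrow> iint T (\<lambda>\<sigma>. f \<sigma> (c *\<^sub>R x)) s t = c * iint T (\<lambda>\<sigma>. f \<sigma> x) s t"
  "x \<in> H10_space \<Omega> \<Longrightarrow> \<bar>iint T (\<lambda>\<sigma>. f \<sigma> x) s t\<bar> \<le> iint T (\<lambda>\<sigma>. dnorm (f \<sigma>)) s t * H1_norm \<Omega> x"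
proof -
  note D = L2_V'_D[OF f]
  show "iint T (\<lambda>\<sigma>. f \<sigma> (x + y)) s t = iint T (\<lambda>\<sigma>. f \<sigma> x) s t + iint T (\<lambda>\<sigma>. f \<sigma> y) s t"
    if xy: "x \<in> H10_space \<Omega>" "y \<in> H10_space \<Omega>"
  proof -
    have "iint T (\<lambda>\<sigma>. f \<sigma> (x + y)) s t = iint T (\<lambda>\<sigma>. f \<sigma> x + f \<sigma> y) s t"
    proof (rule iint_cong_AE)
      show "AE \<sigma> in MT T. s < \<sigma> \<and> \<sigma> \<le> t \<longrightarrow> f \<sigma> (x + y) = f \<sigma> x + f \<sigma> y"
        using D(5) by eventually_elim (use dualD(1) xy in blast)
    qed (use D(1) xy in auto)
    then show ?thesis using iint_add D(6) xy by simp
  qed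
  show "iint T (\<lambda>\<sigma>. f \<sigma> (c *\<^sub>R x)) s t = c * iint T (\<lambda>\<sigma>. f \<sigma> x) s t" if x: "x \<in> H10_space \<Omega>"
  proof -
    have "iint T (\<lambda>\<sigma>. f \<sigma> (c *\<^sub>R x)) s t = iint T (\<lambda>\<sigma>. c * f \<sigma> x) s t"
    proof (rule iint_cong_AE)
      show "AE \<sigma> in MT T. s < \<sigma> \<and> \<sigma> \<le> t \<longrightarrow> f \<sigma> (c *\<^sub>R x) = c * f \<sigma> x"
        using D(5) by eventually_elim (use dualD(2) x in blast)
    qed (use D(1) x in auto)
    then show ?thesis by (simp add: iint_cmult)
  qed
  show "\<bar>iint T (\<lambda>\<sigma>. f \<sigma> x) s t\<bar> \<le> iint T (\<lambda>\<sigma>. dnorm (f \<sigma>)) s t * H1_norm \<Omega> x" if x: "x \<in> H10_space \<Omega>"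
  proof -
    have "\<bar>iint T (\<lambda>\<sigma>. f \<sigma> x) s t\<bar> \<le> iint T (\<lambda>\<sigma>. H1_norm \<Omega> x * dnorm (f \<sigma>)) s t"
    proof (rule iint_abs_le)
      show "AE \<sigma> in MT T. s < \<sigma> \<and> \<sigma> \<le> t \<longrightarrow> \<bar>f \<sigma> x\<bar> \<le> H1_norm \<Omega> x * dnorm (f \<sigma>)"
        using D(5) by eventually_elim (use x in \<open>auto simp: mult.commute\<close>)
    qed (use D x in auto)
    then show ?thesis unfolding iint_cmult by (simp only: mult.commute)
  qed
qed

definition fsq :: real where "fsq = (LINT t|MT T. (dnorm (f t))\<^sup>2)"

text \<open>Bound for the squared L2 norm plus m times the time integral of the squared gradient.
  The exponential comes from a discrete Gronwall argument, \<open>fsq / m\<close> from Young's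
  inequality with weight m.\<close>

definition C0 :: real where "C0 = exp (2 * m * T) * ((L2_norm \<Omega> u0)\<^sup>2 + fsq / m)"

lemma fsq_nonneg: "0 \<le> fsq"
  unfolding fsq_def by (rule Bochner_Integration.integral_nonneg) simp

lemma C0_nonneg: "0 \<le> C0"
  unfolding C0_def using fsq_nonneg m by simp

text \<open>Bound in L2 over time for the dual norm of the data minus the flux: a sum of two terms
  is squared, the second being M times the H1 norm.\<close>

definition C1 :: real where "C1 = sqrt (2 * fsq + 2 * M\<^sup>2 * (C0 * (T + 1 / m)))"

lemma C1_nonneg: "0 \<le> C1"
proof -
  have "0 \<le> 2 * fsq + 2 * M\<^sup>2 * (C0 * (T + 1 / m))"
    using fsq_nonneg C0_nonneg T m by simp
  then show ?thesis unfolding C1_def by simp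
qed

context
  fixes n :: nat and \<tau> :: real and U :: "nat \<Rightarrow> 'a \<Rightarrow> real"
  assumes n: "n > 0" and \<tau>: "\<tau> = T / real n" and m\<tau>: "m * \<tau> \<le> 1 / 2"
    and U0: "U 0 = u0" and UL: "\<And>i. U i \<in> L2_space \<Omega>" and UV: "\<And>i. U (Suc i) \<in> H10_space \<Omega>"
    and step: "\<And>i \<phi>. \<phi> \<in> H10_space \<Omega> \<Longrightarrow>
      L2_inner \<Omega> (U (Suc i)) \<phi> + \<tau> * dform (acoef (U i)) (U (Suc i)) \<phi> =
      L2_inner \<Omega> (U i) \<phi> + iint T (\<lambda>\<sigma>. f \<sigma> \<phi>) (real i * \<tau>) (real (Suc i) * \<tau>)"
begin

lemma \<tau>_pos: "\<tau> > 0" and n\<tau>: "real n * \<tau> = T"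
  using T n by (auto simp: \<tau>)

lemma node_le: "i \<le> n \<Longrightarrow> real i * \<tau> \<le> T"
  using mult_right_mono[of "real i" "real n" \<tau>] \<tau>_pos n\<tau> by simp

text \<open>The equation of the step is tested with its solution. Young's inequality with weight m
  lets the data use half of the coercivity; because it involves the full H1 norm, the factor
  \<open>1 - m * \<tau>\<close> appears in front of the L2 part.\<close>

lemma step_energy:
  assumes i: "Suc i \<le> n"
  shows "(1 - m * \<tau>) * (L2_norm \<Omega> (U (Suc i)))\<^sup>2 + m * \<tau> * (L2_norm \<Omega> (ngrad (U (Suc i))))\<^sup>2 \<le>
    (L2_norm \<Omega> (U i))\<^sup>2 + iint T (\<lambda>\<sigma>. (dnorm (f \<sigma>))\<^sup>2) (real i * \<tau>) (real (Suc i) * \<tau>) / m"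
proof -
  let ?v = "U (Suc i)" and ?s = "real i * \<tau>" and ?t = "real (Suc i) * \<tau>"
  have v1: "?v \<in> H1_space \<Omega>" using UV by simp
  define h where "h = H1_norm \<Omega> ?v"
  have st: "0 \<le> ?s" "?s \<le> ?t" "?t \<le> T" using \<tau>_pos node_le[OF i] by (auto simp: mult_right_mono)
  have "iint T (\<lambda>\<sigma>. f \<sigma> ?v) ?s ?t \<le> iint T (\<lambda>\<sigma>. (1 / (2 * m)) * (dnorm (f \<sigma>))\<^sup>2 + m * h\<^sup>2 / 2) ?s ?t"
  proof (rule iint_mono_AE)
    interpret finite_measure "MT T" by (rule finite_measure_MT)
    show "integrable (MT T) (\<lambda>\<sigma>. (1 / (2 * m)) * (dnorm (f \<sigma>))\<^sup>2 + m * h\<^sup>2 / 2)"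
      by (intro Bochner_Integration.integrable_add integrable_mult_right L2_V'_D(3)[OF f] integrable_const)
    show "AE \<sigma> in MT T. ?s < \<sigma> \<and> \<sigma> \<le> ?t \<longrightarrow> f \<sigma> ?v \<le> (1 / (2 * m)) * (dnorm (f \<sigma>))\<^sup>2 + m * h\<^sup>2 / 2"
      using L2_V'_D(5)[OF f]
    proof eventually_elim
      case (elim \<sigma>)
      have "f \<sigma> ?v \<le> dnorm (f \<sigma>) * h" using elim UV[of i] unfolding h_def by (auto simp: abs_le_iff)
      also have "\<dots> \<le> (1 / (2 * m)) * (dnorm (f \<sigma>))\<^sup>2 + m * h\<^sup>2 / 2"
      proof -
        have "0 \<le> (dnorm (f \<sigma>) - m * h)\<^sup>2" by simp
        then show ?thesis using m by (simp add: field_simps power2_eq_square)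
      qed
      finally show ?case by simp
    qed
  qed (rule L2_V'_D(6)[OF f UV])
  also have "\<dots> = (1 / (2 * m)) * iint T (\<lambda>\<sigma>. (dnorm (f \<sigma>))\<^sup>2) ?s ?t + m * h\<^sup>2 / 2 * (?t - ?s)"
  proof -
    interpret finite_measure "MT T" by (rule finite_measure_MT)
    show ?thesis
      using iint_add[OF integrable_mult_right[OF L2_V'_D(3)[OF f]] integrable_const, of "1 / (2 * m)" "m * h\<^sup>2 / 2" ?s ?t]
        iint_cmult[of T "1 / (2 * m)" "\<lambda>\<sigma>. (dnorm (f \<sigma>))\<^sup>2"] iint_one[OF st, of "m * h\<^sup>2 / 2"]
      by simp
  qed
  also have "?t - ?s = \<tau>" by (simp add: algebra_simps)
  finally have F: "iint T (\<lambda>\<sigma>. f \<sigma> ?v) ?s ?t \<le> (1 / (2 * m)) * iint T (\<lambda>\<sigma>. (dnorm (f \<sigma>))\<^sup>2) ?s ?t + m * h\<^sup>2 / 2 * \<tau>" .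
  have "L2_inner \<Omega> (U i) ?v \<le> L2_norm \<Omega> (U i) * L2_norm \<Omega> ?v"
    using L2.Cauchy_Schwarz[OF UL UL, of i "Suc i"] by linarith
  then have I: "2 * L2_inner \<Omega> (U i) ?v \<le> (L2_norm \<Omega> (U i))\<^sup>2 + (L2_norm \<Omega> ?v)\<^sup>2"
    using sum_squares_bound[of "L2_norm \<Omega> (U i)" "L2_norm \<Omega> ?v"] by linarith
  have D: "\<tau> * (m * (L2_norm \<Omega> (ngrad ?v))\<^sup>2) \<le> \<tau> * dform (acoef (U i)) ?v ?v"
    using dform_coercive[OF acoef(1)[OF UL] acoef(2)[OF UL] v1] \<tau>_pos by (intro mult_left_mono) auto
  have h2: "m * h\<^sup>2 / 2 * \<tau> = m * \<tau> * (L2_norm \<Omega> ?v)\<^sup>2 / 2 + m * \<tau> * (L2_norm \<Omega> (ngrad ?v))\<^sup>2 / 2"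
    unfolding h_def H1_norm_sq[OF v1] by (simp add: field_simps)
  have "(L2_norm \<Omega> ?v)\<^sup>2 + \<tau> * dform (acoef (U i)) ?v ?v = L2_inner \<Omega> (U i) ?v + iint T (\<lambda>\<sigma>. f \<sigma> ?v) ?s ?t"
    using step[OF UV, of i i] L2.nrm_sq[OF UL, of "Suc i"] by simp
  moreover define e where "e = iint T (\<lambda>\<sigma>. (dnorm (f \<sigma>))\<^sup>2) ?s ?t / m"
  moreover have "(1 / (2 * m)) * iint T (\<lambda>\<sigma>. (dnorm (f \<sigma>))\<^sup>2) ?s ?t = e / 2" unfolding e_def by simp
  moreover have "\<tau> * (m * (L2_norm \<Omega> (ngrad ?v))\<^sup>2) = m * \<tau> * (L2_norm \<Omega> (ngrad ?v))\<^sup>2"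
    "(1 - m * \<tau>) * (L2_norm \<Omega> ?v)\<^sup>2 = (L2_norm \<Omega> ?v)\<^sup>2 - m * \<tau> * (L2_norm \<Omega> ?v)\<^sup>2"
    by (simp_all add: left_diff_distrib)
  ultimately show ?thesis using F I D h2 by linarith
qed

text \<open>Discrete Gronwall: for \<open>m * \<tau> \<le> 1/2\<close> the factor
  \<open>1 - m * \<tau>\<close> is inverted at the cost of \<open>1 + 2 * m * \<tau>\<close>, which
  is at most \<open>exp (2 * m * \<tau>)\<close>.\<close>

lemma energy_bound:
  assumes "k \<le> n"
  shows "(L2_norm \<Omega> (U k))\<^sup>2 + m * \<tau> * (\<Sum>j<k. (L2_norm \<Omega> (ngrad (U (Suc j))))\<^sup>2) \<le>
    exp (2 * m * (real k * \<tau>)) * ((L2_norm \<Omega> u0)\<^sup>2 + iint T (\<lambda>\<sigma>. (dnorm (f \<sigma>))\<^sup>2) 0 (real k * \<tau>) / m)"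
  using assms
proof (induction k)
  case 0
  then show ?case by (simp add: U0)
next
  case (Suc k)
  define x where "x i = (L2_norm \<Omega> (U i))\<^sup>2" for i
  define y where "y i = (L2_norm \<Omega> (ngrad (U (Suc i))))\<^sup>2" for i
  define S where "S = m * \<tau> * (\<Sum>j<k. y j)"
  define I where "I k = (L2_norm \<Omega> u0)\<^sup>2 + iint T (\<lambda>\<sigma>. (dnorm (f \<sigma>))\<^sup>2) 0 (real k * \<tau>) / m" for k :: nat
  define \<eta> where "\<eta> = iint T (\<lambda>\<sigma>. (dnorm (f \<sigma>))\<^sup>2) (real k * \<tau>) (real (Suc k) * \<tau>) / m"
  have IS: "I (Suc k) = I k + \<eta>"
    unfolding I_def \<eta>_def using iint_split[OF L2_V'_D(3)[OF f], of 0 "real k * \<tau>" "real (Suc k) * \<tau>"] \<tau>_pos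
    by (simp add: add_divide_distrib mult_right_mono)
  have \<eta>0: "0 \<le> \<eta>" unfolding \<eta>_def using m by (intro divide_nonneg_pos iint_nonneg) auto
  have x0: "0 \<le> x (Suc k)" "0 \<le> y k" "0 \<le> S"
    unfolding x_def y_def S_def using m \<tau>_pos by (simp, simp, intro mult_nonneg_nonneg sum_nonneg, auto)
  define E where "E = x (Suc k) + (S + m * \<tau> * y k)"
  have IH: "x k + S \<le> exp (2 * m * (real k * \<tau>)) * I k"
    using Suc by (simp add: x_def S_def y_def I_def)
  have "(1 - m * \<tau>) * x (Suc k) + m * \<tau> * y k \<le> x k + \<eta>"
    using step_energy[of k] Suc.prems by (simp add: x_def y_def \<eta>_def)
  then have "(1 - m * \<tau>) * E \<le> x k + S + \<eta>"
  proof -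
    have "0 \<le> m * \<tau> * (S + m * \<tau> * y k)" using m \<tau>_pos x0 by simp
    then show ?thesis
      using \<open>(1 - m * \<tau>) * x (Suc k) + m * \<tau> * y k \<le> x k + \<eta>\<close> by (simp add: E_def algebra_simps)
  qed
  moreover have "E \<le> (1 + 2 * (m * \<tau>)) * ((1 - m * \<tau>) * E)"
  proof -
    have "1 \<le> (1 + 2 * (m * \<tau>)) * (1 - m * \<tau>)"
    proof -
      have "0 \<le> m * \<tau> * (1 - 2 * (m * \<tau>))" using m \<tau>_pos m\<tau> by simp
      then show ?thesis by (simp add: algebra_simps)
    qed
    moreover have "0 \<le> E" using x0 m \<tau>_pos by (simp add: E_def)
    ultimately have "1 * E \<le> (1 + 2 * (m * \<tau>)) * (1 - m * \<tau>) * E" by (rule mult_right_mono)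
    then show ?thesis by (simp only: mult.assoc mult_1)
  qed
  moreover have "(1 + 2 * (m * \<tau>)) * ((1 - m * \<tau>) * E) \<le> exp (2 * (m * \<tau>)) * (exp (2 * m * (real k * \<tau>)) * (I k + \<eta>))"
  proof (rule mult_mono)
    show "1 + 2 * (m * \<tau>) \<le> exp (2 * (m * \<tau>))" by (rule exp_ge_add_one_self)
    have "1 \<le> exp (2 * m * (real k * \<tau>))" using m \<tau>_pos by simp
    then have "\<eta> \<le> exp (2 * m * (real k * \<tau>)) * \<eta>" using mult_right_mono[OF _ \<eta>0, of 1 "exp (2 * m * (real k * \<tau>))"] by simp
    then show "(1 - m * \<tau>) * E \<le> exp (2 * m * (real k * \<tau>)) * (I k + \<eta>)"
      using calculation(1) IH by (simp add: distrib_left)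
    have "0 \<le> E" unfolding E_def using x0 m \<tau>_pos by (intro add_nonneg_nonneg mult_nonneg_nonneg) auto
    then show "0 \<le> (1 - m * \<tau>) * E" using m\<tau> by (intro mult_nonneg_nonneg) auto
  qed simp
  moreover have "exp (2 * (m * \<tau>)) * (exp (2 * m * (real k * \<tau>)) * (I k + \<eta>)) = exp (2 * m * (real (Suc k) * \<tau>)) * I (Suc k)"
  proof -
    have "2 * m * (real (Suc k) * \<tau>) = 2 * (m * \<tau>) + 2 * m * (real k * \<tau>)" by (simp add: algebra_simps)
    then show ?thesis unfolding IS by (simp only: exp_add mult.assoc)
  qed
  ultimately have "E \<le> exp (2 * m * (real (Suc k) * \<tau>)) * I (Suc k)" by linarith
  moreover have "E = (L2_norm \<Omega> (U (Suc k)))\<^sup>2 + m * \<tau> * (\<Sum>j<Suc k. (L2_norm \<Omega> (ngrad (U (Suc j))))\<^sup>2)"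
    by (simp add: E_def x_def y_def S_def algebra_simps)
  ultimately show ?case by (simp add: I_def)
qed

lemma energy_bound':
  assumes k: "k \<le> n"
  shows "(L2_norm \<Omega> (U k))\<^sup>2 + m * \<tau> * (\<Sum>j<k. (L2_norm \<Omega> (ngrad (U (Suc j))))\<^sup>2) \<le> C0"
proof -
  have "iint T (\<lambda>\<sigma>. (dnorm (f \<sigma>))\<^sup>2) 0 (real k * \<tau>) \<le> iint T (\<lambda>\<sigma>. (dnorm (f \<sigma>))\<^sup>2) 0 T"
    by (rule iint_mono_interval[OF L2_V'_D(3)[OF f]]) (use node_le[OF k] in auto)
  then have I: "iint T (\<lambda>\<sigma>. (dnorm (f \<sigma>))\<^sup>2) 0 (real k * \<tau>) \<le> fsq" unfolding iint_full fsq_def .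
  have "exp (2 * m * (real k * \<tau>)) * ((L2_norm \<Omega> u0)\<^sup>2 + iint T (\<lambda>\<sigma>. (dnorm (f \<sigma>))\<^sup>2) 0 (real k * \<tau>) / m) \<le> C0"
    unfolding C0_def
  proof (rule mult_mono)
    show "exp (2 * m * (real k * \<tau>)) \<le> exp (2 * m * T)" using node_le[OF k] m by simp
    show "(L2_norm \<Omega> u0)\<^sup>2 + iint T (\<lambda>\<sigma>. (dnorm (f \<sigma>))\<^sup>2) 0 (real k * \<tau>) / m \<le> (L2_norm \<Omega> u0)\<^sup>2 + fsq / m"
      using I m by (simp add: divide_right_mono)
    show "0 \<le> (L2_norm \<Omega> u0)\<^sup>2 + iint T (\<lambda>\<sigma>. (dnorm (f \<sigma>))\<^sup>2) 0 (real k * \<tau>) / m"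
      using m by (intro add_nonneg_nonneg divide_nonneg_pos iint_nonneg) auto
  qed simp
  with energy_bound[OF k] show ?thesis by linarith
qed

lemma U_bound: "k \<le> n \<Longrightarrow> (L2_norm \<Omega> (U k))\<^sup>2 \<le> C0"
  using energy_bound'[of k] m \<tau>_pos
  by (smt (verit, best) mult_nonneg_nonneg sum_nonneg zero_le_power2)

lemma U_H1_bound: "(\<Sum>j<n. \<tau> * (H1_norm \<Omega> (U (Suc j)))\<^sup>2) \<le> C0 * (T + 1 / m)"
proof -
  have "(\<Sum>j<n. \<tau> * (H1_norm \<Omega> (U (Suc j)))\<^sup>2) = (\<Sum>j<n. \<tau> * (L2_norm \<Omega> (U (Suc j)))\<^sup>2) + \<tau> * (\<Sum>j<n. (L2_norm \<Omega> (ngrad (U (Suc j))))\<^sup>2)"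
    using UV by (simp add: H1_norm_sq distrib_left sum.distrib sum_distrib_left)
  moreover have "(\<Sum>j<n. \<tau> * (L2_norm \<Omega> (U (Suc j)))\<^sup>2) \<le> (\<Sum>j<n. \<tau> * C0)"
    using U_bound \<tau>_pos by (intro sum_mono mult_left_mono) auto
  moreover have "(\<Sum>j<n. \<tau> * C0) = C0 * T" using n\<tau> by (simp add: mult.assoc[symmetric] mult.commute)
  moreover have "\<tau> * (\<Sum>j<n. (L2_norm \<Omega> (ngrad (U (Suc j))))\<^sup>2) \<le> C0 / m"
  proof -
    have "m * \<tau> * (\<Sum>j<n. (L2_norm \<Omega> (ngrad (U (Suc j))))\<^sup>2) \<le> C0"
      using energy_bound'[of n] zero_le_power2[of "L2_norm \<Omega> (U n)"] by linarith
    then show ?thesis using m by (simp add: field_simps)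
  qed
  moreover have "C0 * (T + 1 / m) = C0 * T + C0 / m" by (simp add: distrib_left)
  ultimately show ?thesis by linarith
qed

section \<open>Piecewise constant interpolants\<close>

definition idx :: "real \<Rightarrow> nat" where "idx t = nat \<lceil>t / \<tau>\<rceil>"

text \<open>Each step interval contains its right node and not its left one, in agreement with the
  half-open intervals of \<open>iint\<close>.\<close>

lemma idx_eq: "\<lbrakk>real j * \<tau> < t; t \<le> real (Suc j) * \<tau>\<rbrakk> \<Longrightarrow> idx t = Suc j"
proof -
  assume t: "real j * \<tau> < t" "t \<le> real (Suc j) * \<tau>"
  have "\<lceil>t / \<tau>\<rceil> = int (Suc j)"
    by (rule ceiling_unique) (use t \<tau>_pos in \<open>auto simp: field_simps\<close>)
  then show ?thesis unfolding idx_def by simp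
qed

lemma idx_bounds:
  assumes "t \<in> {0<..T}"
  obtains j where "idx t = Suc j" "Suc j \<le> n" "real j * \<tau> < t" "t \<le> real (Suc j) * \<tau>"
proof -
  define i where "i = idx t"
  have q: "0 < t / \<tau>" using assms \<tau>_pos by simp
  then have pos: "0 < \<lceil>t / \<tau>\<rceil>" by simp
  have i: "real i = of_int \<lceil>t / \<tau>\<rceil>" using pos by (simp add: i_def idx_def)
  have "i \<noteq> 0" using pos by (simp add: i_def idx_def)
  then obtain j where j: "i = Suc j" using not0_implies_Suc by blast
  have "t / \<tau> \<le> real i" "real i < t / \<tau> + 1" unfolding i by linarith+
  then have b: "t \<le> real i * \<tau>" "real i * \<tau> < t + \<tau>" using \<tau>_pos by (auto simp: field_simps)
  have "i \<le> n"
  proof -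
    have "real i * \<tau> < (real n + 1) * \<tau>" using b(2) assms n\<tau> by (simp add: distrib_right)
    then have "real i < real n + 1" using \<tau>_pos by simp
    then show ?thesis by linarith
  qed
  then show ?thesis using that[of j] b by (simp add: j i_def[symmetric] algebra_simps)
qed

lemma simple_idx: "simple_function (MT T) idx"
  unfolding simple_function_def
proof (intro conjI ballI)
  have "idx ` space (MT T) \<subseteq> {..n}"
  proof
    fix i assume "i \<in> idx ` space (MT T)"
    then obtain t where "t \<in> {0<..<T}" "i = idx t" by auto
    then have t: "t \<in> {0<..T}" "i = idx t" by auto
    show "i \<in> {..n}" by (rule idx_bounds[OF t(1)]) (use t in simp)
  qed
  then show "finite (idx ` space (MT T))" by (rule finite_subset) simp
  have "idx \<in> measurable (MT T) (count_space UNIV)" unfolding idx_def by measurable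
  then show "idx -` {x} \<inter> space (MT T) \<in> sets (MT T)" for x by (rule measurable_sets) simp
qed

lemma iint_pieces:
  assumes G: "\<And>i. i \<le> n \<Longrightarrow> integrable (MT T) (G i)" and h: "integrable (MT T) h"
    and eq: "\<And>j \<sigma>. \<lbrakk>j < n; real j * \<tau> < \<sigma>; \<sigma> \<le> real (Suc j) * \<tau>\<rbrakk> \<Longrightarrow> h \<sigma> = G (Suc j) \<sigma>"
    and k: "k \<le> n"
  shows "iint T h 0 (real k * \<tau>) = (\<Sum>j<k. iint T (G (Suc j)) (real j * \<tau>) (real (Suc j) * \<tau>))"
  using k
proof (induction k)
  case (Suc k)
  have "iint T h 0 (real (Suc k) * \<tau>) = iint T h 0 (real k * \<tau>) + iint T h (real k * \<tau>) (real (Suc k) * \<tau>)"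
    by (rule iint_split[OF h]) (use \<tau>_pos in \<open>auto intro: mult_right_mono\<close>)
  also have "iint T h (real k * \<tau>) (real (Suc k) * \<tau>) = iint T (G (Suc k)) (real k * \<tau>) (real (Suc k) * \<tau>)"
    by (rule iint_cong_AE) (use eq[of k] Suc.prems h G[of "Suc k"] in auto)
  finally show ?case using Suc by simp
qed simp

text \<open>\<open>V\<close> carries the new value throughout a step and \<open>W\<close> the
  previous one, so that the lagged coefficient of the scheme is \<open>acoef (W t)\<close>.\<close>

definition V :: "real \<Rightarrow> 'a \<Rightarrow> real" where "V t = U (idx t)"
definition W :: "real \<Rightarrow> 'a \<Rightarrow> real" where "W t = U (idx t - 1)"

lemma VW_simple: "simple_function (MT T) V" "simple_function (MT T) W"
  unfolding V_def[abs_def] W_def[abs_def] by (rule simple_function_compose1[OF simple_idx])+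

lemma VW_mem:
  assumes "t \<in> {0<..T}"
  shows "V t \<in> H10_space \<Omega>" "W t \<in> L2_space \<Omega>" "(L2_norm \<Omega> (V t))\<^sup>2 \<le> C0" "(L2_norm \<Omega> (W t))\<^sup>2 \<le> C0"
  by (rule idx_bounds[OF assms], use UV UL U_bound in \<open>auto simp: V_def W_def\<close>)+

lemma V_H1_int: "integrable (MT T) (\<lambda>t. (H1_norm \<Omega> (V t))\<^sup>2)"
  by (rule simple_integrable_MT[OF simple_function_compose1[OF VW_simple(1)]])

lemma V_H1: "(LINT t|MT T. (H1_norm \<Omega> (V t))\<^sup>2) \<le> C0 * (T + 1 / m)"
proof -
  interpret finite_measure "MT T" by (rule finite_measure_MT)
  have "(LINT t|MT T. (H1_norm \<Omega> (V t))\<^sup>2) = iint T (\<lambda>t. (H1_norm \<Omega> (V t))\<^sup>2) 0 (real n * \<tau>)"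
    unfolding n\<tau> iint_full ..
  also have "\<dots> = (\<Sum>j<n. iint T (\<lambda>_. (H1_norm \<Omega> (U (Suc j)))\<^sup>2) (real j * \<tau>) (real (Suc j) * \<tau>))"
    by (rule iint_pieces[where G="\<lambda>i _. (H1_norm \<Omega> (U i))\<^sup>2", OF _ V_H1_int]) (auto simp: V_def idx_eq)
  also have "\<dots> = (\<Sum>j<n. \<tau> * (H1_norm \<Omega> (U (Suc j)))\<^sup>2)"
  proof (rule sum.cong[OF refl])
    fix j assume "j \<in> {..<n}"
    then have "real (Suc j) * \<tau> \<le> T" using node_le[of "Suc j"] by simp
    then show "iint T (\<lambda>_. (H1_norm \<Omega> (U (Suc j)))\<^sup>2) (real j * \<tau>) (real (Suc j) * \<tau>) = \<tau> * (H1_norm \<Omega> (U (Suc j)))\<^sup>2"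
      using \<tau>_pos by (subst iint_one) (auto simp: algebra_simps)
  qed
  finally show ?thesis using U_H1_bound by simp
qed

definition R :: "real \<Rightarrow> ('a \<Rightarrow> real) \<Rightarrow> real" where "R \<sigma> \<phi> = f \<sigma> \<phi> - dform (acoef (W \<sigma>)) (V \<sigma>) \<phi>"

lemma dform_simple: "simple_function (MT T) (\<lambda>\<sigma>. dform (acoef (W \<sigma>)) (V \<sigma>) \<phi>)"
  by (rule simple_function_compose2[OF VW_simple(2,1)])

lemma R_integrable: "\<phi> \<in> H10_space \<Omega> \<Longrightarrow> integrable (MT T) (\<lambda>\<sigma>. R \<sigma> \<phi>)"
  unfolding R_def by (intro Bochner_Integration.integrable_diff L2_V'_D(6)[OF f] simple_integrable_MT dform_simple)

lemma node_path:
  assumes \<phi>: "\<phi> \<in> H10_space \<Omega>" and k: "k \<le> n"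
  shows "L2_inner \<Omega> (U k) \<phi> = L2_inner \<Omega> u0 \<phi> + iint T (\<lambda>\<sigma>. R \<sigma> \<phi>) 0 (real k * \<tau>)"
proof -
  interpret finite_measure "MT T" by (rule finite_measure_MT)
  let ?G = "\<lambda>i \<sigma>. f \<sigma> \<phi> - dform (acoef (U (i - 1))) (U i) \<phi>"
  have "iint T (\<lambda>\<sigma>. R \<sigma> \<phi>) 0 (real k * \<tau>) = (\<Sum>j<k. iint T (?G (Suc j)) (real j * \<tau>) (real (Suc j) * \<tau>))"
    by (rule iint_pieces[OF _ R_integrable[OF \<phi>] _ k])
      (auto simp: R_def V_def W_def idx_eq L2_V'_D(6)[OF f \<phi>])
  also have "\<dots> = (\<Sum>j<k. L2_inner \<Omega> (U (Suc j)) \<phi> - L2_inner \<Omega> (U j) \<phi>)"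
  proof (rule sum.cong[OF refl])
    fix j assume "j \<in> {..<k}"
    then have le: "real (Suc j) * \<tau> \<le> T" using node_le[of "Suc j"] k by simp
    have "iint T (?G (Suc j)) (real j * \<tau>) (real (Suc j) * \<tau>) =
        iint T (\<lambda>\<sigma>. f \<sigma> \<phi>) (real j * \<tau>) (real (Suc j) * \<tau>) - dform (acoef (U j)) (U (Suc j)) \<phi> * (real (Suc j) * \<tau> - real j * \<tau>)"
      using iint_diff[OF L2_V'_D(6)[OF f \<phi>] integrable_const, of "dform (acoef (U j)) (U (Suc j)) \<phi>" "real j * \<tau>" "real (Suc j) * \<tau>"]
        iint_one[of "real j * \<tau>" "real (Suc j) * \<tau>" T "dform (acoef (U j)) (U (Suc j)) \<phi>"] le \<tau>_pos
      by (simp add: mult_right_mono)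
    also have "real (Suc j) * \<tau> - real j * \<tau> = \<tau>" by (simp add: algebra_simps)
    finally show "iint T (?G (Suc j)) (real j * \<tau>) (real (Suc j) * \<tau>) = L2_inner \<Omega> (U (Suc j)) \<phi> - L2_inner \<Omega> (U j) \<phi>"
      using step[OF \<phi>, of j] by (simp add: mult.commute)
  qed
  also have "\<dots> = L2_inner \<Omega> (U k) \<phi> - L2_inner \<Omega> u0 \<phi>"
    using sum_lessThan_telescope[of "\<lambda>j. L2_inner \<Omega> (U j) \<phi>" k] by (simp add: U0)
  finally show ?thesis by simp
qed

lemma R_iint_bound:
  assumes \<phi>: "\<phi> \<in> H10_space \<Omega>" and st: "0 \<le> s" "s \<le> t" "t \<le> T"
  shows "\<bar>iint T (\<lambda>\<sigma>. R \<sigma> \<phi>) s t\<bar> \<le> sqrt (t - s) * C1 * H1_norm \<Omega> \<phi>"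
proof -
  define \<beta> where "\<beta> \<sigma> = dnorm (f \<sigma>) + M * H1_norm \<Omega> (V \<sigma>)" for \<sigma>
  have hm: "(\<lambda>\<sigma>. H1_norm \<Omega> (V \<sigma>)) \<in> borel_measurable (MT T)"
    by (rule H1_norm_measurable[OF V_H1_int])
  have \<beta>m: "\<beta> \<in> borel_measurable (MT T)"
    unfolding \<beta>_def[abs_def] using L2_V'_D(2)[OF f] hm by measurable
  have le: "(\<beta> \<sigma>)\<^sup>2 \<le> 2 * (dnorm (f \<sigma>))\<^sup>2 + 2 * M\<^sup>2 * (H1_norm \<Omega> (V \<sigma>))\<^sup>2" for \<sigma>
    using sum_squares_bound[of "dnorm (f \<sigma>)" "M * H1_norm \<Omega> (V \<sigma>)"]
    by (simp add: \<beta>_def power2_sum power_mult_distrib)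
  have ri: "integrable (MT T) (\<lambda>\<sigma>. 2 * (dnorm (f \<sigma>))\<^sup>2 + 2 * M\<^sup>2 * (H1_norm \<Omega> (V \<sigma>))\<^sup>2)"
    using L2_V'_D(3)[OF f] V_H1_int by simp
  have \<beta>sq: "integrable (MT T) (\<lambda>\<sigma>. (\<beta> \<sigma>)\<^sup>2)"
  proof (rule Bochner_Integration.integrable_bound[OF ri borel_measurable_power[OF \<beta>m]])
    show "AE \<sigma> in MT T. norm ((\<beta> \<sigma>)\<^sup>2) \<le> norm (2 * (dnorm (f \<sigma>))\<^sup>2 + 2 * M\<^sup>2 * (H1_norm \<Omega> (V \<sigma>))\<^sup>2)"
      using le by (intro always_eventually allI) (auto intro: order_trans[OF _ abs_ge_self])
  qed
  have nn: "0 \<le> 2 * fsq + 2 * M\<^sup>2 * (C0 * (T + 1 / m))"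
    using fsq_nonneg C0_nonneg T m by simp
  have "(LINT \<sigma>|MT T. (\<beta> \<sigma>)\<^sup>2) \<le> (LINT \<sigma>|MT T. 2 * (dnorm (f \<sigma>))\<^sup>2 + 2 * M\<^sup>2 * (H1_norm \<Omega> (V \<sigma>))\<^sup>2)"
    by (rule integral_mono[OF \<beta>sq ri le])
  also have "\<dots> = 2 * fsq + 2 * M\<^sup>2 * (LINT \<sigma>|MT T. (H1_norm \<Omega> (V \<sigma>))\<^sup>2)"
    unfolding fsq_def using L2_V'_D(3)[OF f] V_H1_int by simp
  also have "\<dots> \<le> 2 * fsq + 2 * M\<^sup>2 * (C0 * (T + 1 / m))"
    using V_H1 by (intro add_left_mono mult_left_mono) auto
  also have "\<dots> = C1\<^sup>2" unfolding C1_def using nn by simp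
  finally have b2: "(LINT \<sigma>|MT T. (\<beta> \<sigma>)\<^sup>2) \<le> C1\<^sup>2" .
  note C1 = C1_nonneg
  have "\<bar>iint T (\<lambda>\<sigma>. R \<sigma> \<phi>) s t\<bar> \<le> iint T (\<lambda>\<sigma>. H1_norm \<Omega> \<phi> * \<beta> \<sigma>) s t"
  proof (rule iint_abs_le[OF R_integrable[OF \<phi>] integrable_mult_right[OF integrable_of_square[OF \<beta>m \<beta>sq]]])
    have "AE \<sigma> in MT T. \<sigma> \<in> {0<..<T}" by (rule AE_I2) simp
    with L2_V'_D(5)[OF f] show "AE \<sigma> in MT T. s < \<sigma> \<and> \<sigma> \<le> t \<longrightarrow> \<bar>R \<sigma> \<phi>\<bar> \<le> H1_norm \<Omega> \<phi> * \<beta> \<sigma>"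
    proof eventually_elim
      case (elim \<sigma>)
      have \<sigma>: "\<sigma> \<in> {0<..T}" using elim by auto
      have "\<bar>dform (acoef (W \<sigma>)) (V \<sigma>) \<phi>\<bar> \<le> M * H1_norm \<Omega> (V \<sigma>) * H1_norm \<Omega> \<phi>"
        by (rule dform_bound(2)[OF acoef(1)]) (use VW_mem[OF \<sigma>] \<phi> in auto)
      moreover have "\<bar>f \<sigma> \<phi>\<bar> \<le> dnorm (f \<sigma>) * H1_norm \<Omega> \<phi>" using elim \<phi> by blast
      ultimately show ?case by (auto simp: R_def \<beta>_def algebra_simps)
    qed
  qed
  also have "\<dots> = H1_norm \<Omega> \<phi> * iint T \<beta> s t" by (rule iint_cmult)
  also have "\<dots> \<le> H1_norm \<Omega> \<phi> * (sqrt (t - s) * C1)"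
    by (intro mult_left_mono iint_Cauchy_Schwarz[OF \<beta>m \<beta>sq st b2 C1]) simp
  finally show ?thesis by (simp add: mult_ac)
qed

text \<open>At the nodes the integrated equation is exact. Between them \<open>V\<close> already has
  the value of the next node, so the error is an integral over part of one step;
  \<open>V - W\<close> is the integral over a full step.\<close>

lemma piecewise_path:
  assumes \<phi>: "\<phi> \<in> H10_space \<Omega>" and t: "t \<in> {0<..T}"
  shows "\<bar>L2_inner \<Omega> (V t) \<phi> - L2_inner \<Omega> u0 \<phi> - iint T (\<lambda>\<sigma>. R \<sigma> \<phi>) 0 t\<bar> \<le> sqrt \<tau> * C1 * H1_norm \<Omega> \<phi>"
    and "\<bar>L2_inner \<Omega> (V t - W t) \<phi>\<bar> \<le> sqrt \<tau> * C1 * H1_norm \<Omega> \<phi>"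
proof -
  obtain j where j: "idx t = Suc j" "Suc j \<le> n" "real j * \<tau> < t" "t \<le> real (Suc j) * \<tau>"
    by (rule idx_bounds[OF t], rule that)
  have C1: "0 \<le> C1 * H1_norm \<Omega> \<phi>"
    using C1_nonneg by simp
  have le: "real (Suc j) * \<tau> \<le> T" using node_le[OF j(2)] .
  have "L2_inner \<Omega> (V t) \<phi> - L2_inner \<Omega> u0 \<phi> - iint T (\<lambda>\<sigma>. R \<sigma> \<phi>) 0 t = iint T (\<lambda>\<sigma>. R \<sigma> \<phi>) t (real (Suc j) * \<tau>)"
    using node_path[OF \<phi> j(2)] iint_split[OF R_integrable[OF \<phi>], of 0 t "real (Suc j) * \<tau>"] j t by (simp add: V_def)
  then have "\<bar>L2_inner \<Omega> (V t) \<phi> - L2_inner \<Omega> u0 \<phi> - iint T (\<lambda>\<sigma>. R \<sigma> \<phi>) 0 t\<bar> \<le> sqrt (real (Suc j) * \<tau> - t) * (C1 * H1_norm \<Omega> \<phi>)"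
    using R_iint_bound[OF \<phi>, of t "real (Suc j) * \<tau>"] t j le by (simp add: mult.assoc)
  also have "\<dots> \<le> sqrt \<tau> * (C1 * H1_norm \<Omega> \<phi>)"
    by (rule mult_right_mono[OF _ C1]) (use j(3) in \<open>simp add: algebra_simps\<close>)
  finally show "\<bar>L2_inner \<Omega> (V t) \<phi> - L2_inner \<Omega> u0 \<phi> - iint T (\<lambda>\<sigma>. R \<sigma> \<phi>) 0 t\<bar> \<le> sqrt \<tau> * C1 * H1_norm \<Omega> \<phi>"
    by (simp add: mult.assoc)
  have jn: "j \<le> n" using j(2) by simp
  have "L2_inner \<Omega> (V t - W t) \<phi> = L2_inner \<Omega> (U (Suc j)) \<phi> - L2_inner \<Omega> (U j) \<phi>"
    unfolding V_def W_def j(1) using L2.diff_left[OF UL UL, of \<phi> "Suc j" j] \<phi> by simp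
  also have "\<dots> = iint T (\<lambda>\<sigma>. R \<sigma> \<phi>) (real j * \<tau>) (real (Suc j) * \<tau>)"
    using node_path[OF \<phi> j(2)] node_path[OF \<phi> jn]
      iint_split[OF R_integrable[OF \<phi>], of 0 "real j * \<tau>" "real (Suc j) * \<tau>"] \<tau>_pos by (simp add: mult_right_mono)
  finally have "\<bar>L2_inner \<Omega> (V t - W t) \<phi>\<bar> \<le> sqrt (real (Suc j) * \<tau> - real j * \<tau>) * C1 * H1_norm \<Omega> \<phi>"
    using R_iint_bound[OF \<phi>, of "real j * \<tau>" "real (Suc j) * \<tau>"] le \<tau>_pos by (simp add: mult_right_mono)
  also have "real (Suc j) * \<tau> - real j * \<tau> = \<tau>" by (simp add: algebra_simps)
  finally show "\<bar>L2_inner \<Omega> (V t - W t) \<phi>\<bar> \<le> sqrt \<tau> * C1 * H1_norm \<Omega> \<phi>" .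
qed

lemma piecewise_modulus:
  assumes \<phi>: "\<phi> \<in> H10_space \<Omega>" and st: "s \<in> {0<..T}" "t \<in> {0<..T}"
  shows "\<bar>L2_inner \<Omega> (V t) \<phi> - L2_inner \<Omega> (V s) \<phi>\<bar> \<le> (2 * sqrt \<tau> + sqrt \<bar>t - s\<bar>) * C1 * H1_norm \<Omega> \<phi>"
proof -
  have main: "\<bar>L2_inner \<Omega> (V t) \<phi> - L2_inner \<Omega> (V s) \<phi>\<bar> \<le> (2 * sqrt \<tau> + sqrt \<bar>t - s\<bar>) * C1 * H1_norm \<Omega> \<phi>"
    if st: "s \<in> {0<..T}" "t \<in> {0<..T}" "s \<le> t" for s t
  proof -
    have "iint T (\<lambda>\<sigma>. R \<sigma> \<phi>) 0 t = iint T (\<lambda>\<sigma>. R \<sigma> \<phi>) 0 s + iint T (\<lambda>\<sigma>. R \<sigma> \<phi>) s t"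
      by (rule iint_split[OF R_integrable[OF \<phi>]]) (use st in auto)
    moreover have "\<bar>iint T (\<lambda>\<sigma>. R \<sigma> \<phi>) s t\<bar> \<le> sqrt \<bar>t - s\<bar> * C1 * H1_norm \<Omega> \<phi>"
      using R_iint_bound[OF \<phi>, of s t] st by simp
    moreover have "(2 * sqrt \<tau> + sqrt \<bar>t - s\<bar>) * C1 * H1_norm \<Omega> \<phi> =
        sqrt \<tau> * C1 * H1_norm \<Omega> \<phi> + sqrt \<tau> * C1 * H1_norm \<Omega> \<phi> + sqrt \<bar>t - s\<bar> * C1 * H1_norm \<Omega> \<phi>"
      by (simp add: algebra_simps)
    ultimately show ?thesis
      using piecewise_path(1)[OF \<phi> st(1)] piecewise_path(1)[OF \<phi> st(2)] by linarith
  qed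
  show ?thesis
    using main[of s t] main[of t s] st by (cases "s \<le> t") (auto simp: abs_minus_commute)
qed

end

lemma rothe_scheme:
  assumes \<tau>: "\<tau> > 0"
  obtains U where "U 0 = u0" "\<And>i. U i \<in> L2_space \<Omega>" "\<And>i. U (Suc i) \<in> H10_space \<Omega>"
    "\<And>i \<phi>. \<phi> \<in> H10_space \<Omega> \<Longrightarrow>
      L2_inner \<Omega> (U (Suc i)) \<phi> + \<tau> * dform (acoef (U i)) (U (Suc i)) \<phi> =
      L2_inner \<Omega> (U i) \<phi> + iint T (\<lambda>\<sigma>. f \<sigma> \<phi>) (real i * \<tau>) (real (Suc i) * \<tau>)"
proof -
  let ?P = "\<lambda>i x. x \<in> L2_space \<Omega> \<and> (i = 0 \<longrightarrow> x = u0)"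
  let ?Q = "\<lambda>i x y. y \<in> H10_space \<Omega> \<and> (\<forall>\<phi>\<in>H10_space \<Omega>. L2_inner \<Omega> y \<phi> + \<tau> * dform (acoef x) y \<phi> =
      L2_inner \<Omega> x \<phi> + iint T (\<lambda>\<sigma>. f \<sigma> \<phi>) (real i * \<tau>) (real (Suc i) * \<tau>))"
  have "\<exists>U. \<forall>i. ?P i (U i) \<and> ?Q i (U i) (U (Suc i))"
  proof (rule dependent_nat_choice)
    show "\<exists>x. ?P 0 x" using u0 by blast
    fix x and i :: nat assume x: "?P i x"
    have "\<exists>y\<in>H10_space \<Omega>. \<forall>\<phi>\<in>H10_space \<Omega>. L2_inner \<Omega> y \<phi> + \<tau> * dform (acoef x) y \<phi> =
      L2_inner \<Omega> x \<phi> + iint T (\<lambda>\<sigma>. f \<sigma> \<phi>) (real i * \<tau>) (real (Suc i) * \<tau>)"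
      by (rule implicit_step[OF _ acoef(1) acoef(2) \<tau> f_average]) (use x in auto)
    then obtain y where y: "y \<in> H10_space \<Omega>" "?Q i x y" by blast
    then show "\<exists>y. ?P (Suc i) y \<and> ?Q i x y" by (intro exI[of _ y]) auto
  qed
  then obtain U where "\<And>i. ?P i (U i)" "\<And>i. ?Q i (U i) (U (Suc i))" by blast
  then show ?thesis by (intro that[of U]) auto
qed

text \<open>Collects what the limit passage uses, with one constant for all step sizes and
  \<open>\<delta> n\<close> the square root of the n-th step size.\<close>

lemma rothe_approximation:
  obtains C :: real and V W :: "nat \<Rightarrow> real \<Rightarrow> 'a \<Rightarrow> real" and \<delta> :: "nat \<Rightarrow> real"
  where "0 \<le> C" "\<delta> \<longlonglongrightarrow> 0" "\<And>n. 0 \<le> \<delta> n"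
    "\<And>n. simple_function (MT T) (V n)" "\<And>n. simple_function (MT T) (W n)"
    "\<And>n t. t \<in> {0<..T} \<Longrightarrow> V n t \<in> H10_space \<Omega>" "\<And>n t. t \<in> {0<..T} \<Longrightarrow> W n t \<in> L2_space \<Omega>"
    "\<And>n t. t \<in> {0<..T} \<Longrightarrow> L2_norm \<Omega> (V n t) \<le> C" "\<And>n t. t \<in> {0<..T} \<Longrightarrow> L2_norm \<Omega> (W n t) \<le> C"
    "\<And>n. (LINT t|MT T. (H1_norm \<Omega> (V n t))\<^sup>2) \<le> C\<^sup>2"
    "\<And>n t \<phi>. \<lbrakk>t \<in> {0<..T}; \<phi> \<in> H10_space \<Omega>\<rbrakk> \<Longrightarrow>
      \<bar>L2_inner \<Omega> (V n t) \<phi> - L2_inner \<Omega> u0 \<phi> - iint T (\<lambda>\<sigma>. f \<sigma> \<phi> - dform (acoef (W n \<sigma>)) (V n \<sigma>) \<phi>) 0 t\<bar> \<le> \<delta> n * C * H1_norm \<Omega> \<phi>"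
    "\<And>n t \<phi>. \<lbrakk>t \<in> {0<..T}; \<phi> \<in> H10_space \<Omega>\<rbrakk> \<Longrightarrow> \<bar>L2_inner \<Omega> (V n t - W n t) \<phi>\<bar> \<le> \<delta> n * C * H1_norm \<Omega> \<phi>"
    "\<And>n s t \<phi>. \<lbrakk>s \<in> {0<..T}; t \<in> {0<..T}; \<phi> \<in> H10_space \<Omega>\<rbrakk> \<Longrightarrow>
      \<bar>L2_inner \<Omega> (V n t) \<phi> - L2_inner \<Omega> (V n s) \<phi>\<bar> \<le> (2 * \<delta> n + sqrt \<bar>t - s\<bar>) * C * H1_norm \<Omega> \<phi>"
proof -
  \<comment> \<open>Starting with at least \<open>n0\<close> steps guarantees
    \<open>m * \<tau> n \<le> 1 / 2\<close> for every n.\<close>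
  obtain n0 :: nat where n0: "2 * m * T < real n0" using reals_Archimedean2 by blast
  have n0_pos: "n0 > 0" using n0 m T by (cases n0) (auto simp: mult_less_0_iff)
  define \<tau> where "\<tau> n = T / real (n + n0)" for n
  have \<tau>_pos: "\<tau> n > 0" for n using T n0_pos by (simp add: \<tau>_def)
  have m\<tau>: "m * \<tau> n \<le> 1 / 2" for n
    unfolding \<tau>_def using n0 n0_pos m T by (simp add: field_simps)
  have "\<exists>U. U 0 = u0 \<and> (\<forall>i. U i \<in> L2_space \<Omega>) \<and> (\<forall>i. U (Suc i) \<in> H10_space \<Omega>) \<and>
    (\<forall>i. \<forall>\<phi>\<in>H10_space \<Omega>. L2_inner \<Omega> (U (Suc i)) \<phi> + \<tau> n * dform (acoef (U i)) (U (Suc i)) \<phi> =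
      L2_inner \<Omega> (U i) \<phi> + iint T (\<lambda>\<sigma>. f \<sigma> \<phi>) (real i * \<tau> n) (real (Suc i) * \<tau> n))" for n
    by (rule rothe_scheme[OF \<tau>_pos]) blast
  then obtain U where U: "\<And>n. U n 0 = u0" "\<And>n i. U n i \<in> L2_space \<Omega>" "\<And>n i. U n (Suc i) \<in> H10_space \<Omega>"
    "\<And>n i \<phi>. \<phi> \<in> H10_space \<Omega> \<Longrightarrow> L2_inner \<Omega> (U n (Suc i)) \<phi> + \<tau> n * dform (acoef (U n i)) (U n (Suc i)) \<phi> =
      L2_inner \<Omega> (U n i) \<phi> + iint T (\<lambda>\<sigma>. f \<sigma> \<phi>) (real i * \<tau> n) (real (Suc i) * \<tau> n)"
    by metis
  have np: "n + n0 > 0" for n using n0_pos by simp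
  note facts = np \<tau>_def m\<tau> U(1) U(2) U(3) U(4)
  define C where "C = sqrt C0 + sqrt (C0 * (T + 1 / m)) + C1"
  have nn: "0 \<le> sqrt C0" "0 \<le> C0 * (T + 1 / m)" "0 \<le> C1"
    using C0_nonneg T m C1_nonneg by auto
  have C: "0 \<le> C" "sqrt C0 \<le> C" "sqrt (C0 * (T + 1 / m)) \<le> C" "C1 \<le> C" using nn by (auto simp: C_def)
  have sqrtC: "x \<le> C" if "x\<^sup>2 \<le> C0" for x using real_le_rsqrt[OF that] C(2) by linarith
  have mono: "c * C1 * H1_norm \<Omega> \<phi> \<le> c * C * H1_norm \<Omega> \<phi>" if "0 \<le> c" for c \<phi>
    by (intro mult_right_mono mult_left_mono C(4) that) simp
  have r: "R (\<tau> n) (U n) = (\<lambda>\<sigma> \<phi>. f \<sigma> \<phi> - dform (acoef (W (\<tau> n) (U n) \<sigma>)) (V (\<tau> n) (U n) \<sigma>) \<phi>)" for n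
    by (intro ext) (rule R_def[OF facts])
  show ?thesis
  proof (rule that[of C "\<lambda>n. sqrt (\<tau> n)" "\<lambda>n. V (\<tau> n) (U n)" "\<lambda>n. W (\<tau> n) (U n)"])
    show "(\<lambda>n. sqrt (\<tau> n)) \<longlonglongrightarrow> 0"
    proof -
      have "\<tau> \<longlonglongrightarrow> 0"
        unfolding \<tau>_def using LIMSEQ_ignore_initial_segment[OF lim_const_over_n[of T], of n0] by simp
      then have "(\<lambda>n. sqrt (\<tau> n)) \<longlonglongrightarrow> sqrt 0" by (intro tendsto_intros)
      then show ?thesis by simp
    qed
    show "0 \<le> sqrt (\<tau> n)" for n using \<tau>_pos[of n] by simp
    show "simple_function (MT T) (V (\<tau> n) (U n))" for n by (rule VW_simple(1)[OF facts])
    show "simple_function (MT T) (W (\<tau> n) (U n))" for n by (rule VW_simple(2)[OF facts])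
    show "V (\<tau> n) (U n) t \<in> H10_space \<Omega>" if "t \<in> {0<..T}" for n t
      by (rule VW_mem(1)[OF facts that])
    show "W (\<tau> n) (U n) t \<in> L2_space \<Omega>" if "t \<in> {0<..T}" for n t
      by (rule VW_mem(2)[OF facts that])
    show "L2_norm \<Omega> (V (\<tau> n) (U n) t) \<le> C" if "t \<in> {0<..T}" for n t
      by (rule sqrtC[OF VW_mem(3)[OF facts that]])
    show "L2_norm \<Omega> (W (\<tau> n) (U n) t) \<le> C" if "t \<in> {0<..T}" for n t
      by (rule sqrtC[OF VW_mem(4)[OF facts that]])
    show "(LINT t|MT T. (H1_norm \<Omega> (V (\<tau> n) (U n) t))\<^sup>2) \<le> C\<^sup>2" for n
    proof -
      have "(sqrt (C0 * (T + 1 / m)))\<^sup>2 \<le> C\<^sup>2" by (rule power_mono[OF C(3)]) (use nn in simp)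
      then show ?thesis using V_H1[OF facts, of n] nn(2) by simp
    qed
    fix n s t \<phi> assume \<phi>: "\<phi> \<in> H10_space \<Omega>"
    assume t: "t \<in> {0<..T}"
    have sq: "0 \<le> sqrt (\<tau> n)" using \<tau>_pos[of n] by simp
    show "\<bar>L2_inner \<Omega> (V (\<tau> n) (U n) t) \<phi> - L2_inner \<Omega> u0 \<phi> -
        iint T (\<lambda>\<sigma>. f \<sigma> \<phi> - dform (acoef (W (\<tau> n) (U n) \<sigma>)) (V (\<tau> n) (U n) \<sigma>) \<phi>) 0 t\<bar> \<le> sqrt (\<tau> n) * C * H1_norm \<Omega> \<phi>"
      by (rule order_trans[OF piecewise_path(1)[OF facts \<phi> t] mono[OF sq], unfolded r])
    show "\<bar>L2_inner \<Omega> (V (\<tau> n) (U n) t - W (\<tau> n) (U n) t) \<phi>\<bar> \<le> sqrt (\<tau> n) * C * H1_norm \<Omega> \<phi>"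
      by (rule order_trans[OF piecewise_path(2)[OF facts \<phi> t] mono[OF sq]])
    assume s: "s \<in> {0<..T}"
    have sq': "0 \<le> 2 * sqrt (\<tau> n) + sqrt \<bar>t - s\<bar>" using sq by simp
    show "\<bar>L2_inner \<Omega> (V (\<tau> n) (U n) t) \<phi> - L2_inner \<Omega> (V (\<tau> n) (U n) s) \<phi>\<bar> \<le> (2 * sqrt (\<tau> n) + sqrt \<bar>t - s\<bar>) * C * H1_norm \<Omega> \<phi>"
      by (rule order_trans[OF piecewise_modulus[OF facts \<phi> s t] mono[OF sq']])
  qed (rule C(1))
qed

end

end

section \<open>Compactness\<close>

text \<open>A diagonal sequence converges on a countable dense subset. The modulus is required only
  for large n, since each piecewise constant interpolant jumps, and it still gives the Cauchy
  property at every point.\<close>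

lemma asymptotic_equicontinuous_subsequence:
  fixes F :: "nat \<Rightarrow> 'b::{metric_space, second_countable_topology} \<Rightarrow> real"
  assumes bd: "\<And>n z. z \<in> Z \<Longrightarrow> \<bar>F n z\<bar> \<le> K"
    and eq: "\<And>z e. \<lbrakk>z \<in> Z; e > 0\<rbrakk> \<Longrightarrow> \<exists>d>0. \<exists>N. \<forall>n\<ge>N. \<forall>z'\<in>Z. dist z' z < d \<longrightarrow> \<bar>F n z' - F n z\<bar> < e"
  obtains r :: "nat \<Rightarrow> nat" where "strict_mono r" "\<And>z. z \<in> Z \<Longrightarrow> convergent (\<lambda>n. F (r n) z)"
proof -
  obtain S where S: "countable S" "S \<subseteq> Z" "Z \<subseteq> closure S" using separable[of Z] .
  obtain r where r: "strict_mono r" "\<And>x. x \<in> S \<Longrightarrow> \<exists>l. (\<lambda>n. F (r n) x) \<longlonglongrightarrow> l"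
    by (rule function_convergent_subsequence[OF S(1), of F K]) (use bd S(2) in auto)
  have "convergent (\<lambda>n. F (r n) z)" if z: "z \<in> Z" for z
  proof (rule Cauchy_convergent, rule metric_CauchyI)
    fix e :: real assume "e > 0"
    then have e3: "e / 3 > 0" by simp
    obtain d N where d: "d > 0" and N: "\<And>n z'. \<lbrakk>n \<ge> N; z' \<in> Z; dist z' z < d\<rbrakk> \<Longrightarrow> \<bar>F n z' - F n z\<bar> < e / 3"
      using eq[OF z e3] by blast
    have "z \<in> closure S" using S(3) z by blast
    then obtain x where x: "x \<in> S" "dist x z < d" using d unfolding closure_approachable by blast
    have "Cauchy (\<lambda>n. F (r n) x)" using r(2)[OF x(1)] by (auto intro: LIMSEQ_imp_Cauchy)
    then obtain N' where N': "\<And>i j. \<lbrakk>i \<ge> N'; j \<ge> N'\<rbrakk> \<Longrightarrow> dist (F (r i) x) (F (r j) x) < e / 3"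
      using metric_CauchyD[OF _ e3] by blast
    show "\<exists>N. \<forall>i\<ge>N. \<forall>j\<ge>N. dist (F (r i) z) (F (r j) z) < e"
    proof (intro exI[of _ "max N N'"] allI impI)
      fix i j assume ij: "i \<ge> max N N'" "j \<ge> max N N'"
      have "r i \<ge> N" "r j \<ge> N" using ij seq_suble[OF r(1), of i] seq_suble[OF r(1), of j] by auto
      then have "\<bar>F (r i) x - F (r i) z\<bar> < e / 3" "\<bar>F (r j) x - F (r j) z\<bar> < e / 3"
        using N x S(2) by blast+
      moreover have "\<bar>F (r i) x - F (r j) x\<bar> < e / 3" using N'[of i j] ij by (simp add: dist_real_def)
      ultimately show "dist (F (r i) z) (F (r j) z) < e" unfolding dist_real_def by linarith
    qed
  qed
  then show ?thesis using that r(1) by blast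
qed

lemma (in semi_inner) Cauchy_of_summable:
  assumes s: "\<And>n. s n \<in> X" and sum: "summable (\<lambda>k. nrm (s (Suc k) - s k))" and e: "e > 0"
  shows "\<exists>N. \<forall>i\<ge>N. \<forall>j\<ge>N. nrm (s i - s j) < e"
proof -
  have tel: "nrm (s (k + p) - s k) \<le> (\<Sum>i=k..<k + p. nrm (s (Suc i) - s i))" for k p
  proof (induction p)
    case (Suc p)
    have "nrm (s (k + Suc p) - s k) \<le> nrm (s (Suc (k + p)) - s (k + p)) + nrm (s (k + p) - s k)"
      using nrm_triangle_diff[of "s (Suc (k + p))" "s (k + p)" "s k"] s by simp
    then show ?case using Suc by simp
  qed simp
  have e2: "e / 2 > 0" using e by simp
  obtain N where N: "\<And>k l. k \<ge> N \<Longrightarrow> norm (\<Sum>i=k..<l. nrm (s (Suc i) - s i)) < e / 2"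
    using sum[unfolded summable_Cauchy] e2 by blast
  have near: "nrm (s k - s N) < e / 2" if "k \<ge> N" for k
    using tel[of N "k - N"] N[of N k] that by simp
  show ?thesis
  proof (intro exI[of _ N] allI impI)
    fix i j assume "i \<ge> N" "j \<ge> N"
    then show "nrm (s i - s j) < e"
      using near[of i] near[of j] nrm_triangle_diff[of "s i" "s N" "s j"] nrm_diff_commute[of "s N" "s j"] s by simp
  qed
qed

section \<open>Density of V, coefficient distances and V-valued step functions\<close>

context bounded_domain begin

text \<open>The resolvents of \<open>h\<close> lie in V and tend to \<open>h\<close>.\<close>

lemma H10_dense:
  assumes h: "h \<in> L2_space \<Omega>" and e: "e > 0"
  obtains \<phi> where "\<phi> \<in> H10_space \<Omega>" "L2_norm \<Omega> (\<phi> - h) < e"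
proof -
  have "\<exists>y. \<forall>n. G.res (1 / real (Suc n)) h (y n)" by (intro choice allI G.res_exists G.inv_Suc(2) h)
  then obtain y where y: "\<And>n. G.res (1 / real (Suc n)) h (y n)" by blast
  have "\<forall>\<^sub>F n in sequentially. L2_norm \<Omega> (y n - h) < e"
    by (rule order_tendstoD(2)[OF G.res_tendsto_H[OF y h] e])
  then obtain n where "L2_norm \<Omega> (y n - h) < e" by (auto simp: eventually_sequentially)
  then show ?thesis using that[of "y n"] G.resV[OF y] by blast
qed

lemma weakly_null_of_dense:
  assumes v: "\<And>n. v n \<in> L2_space \<Omega>" "\<And>n. L2_norm \<Omega> (v n) \<le> C" and h: "h \<in> L2_space \<Omega>"
    and lim: "\<And>\<phi>. \<phi> \<in> H10_space \<Omega> \<Longrightarrow> (\<lambda>n. L2_inner \<Omega> (v n) \<phi>) \<longlonglongrightarrow> 0"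
  shows "(\<lambda>n. L2_inner \<Omega> (v n) h) \<longlonglongrightarrow> 0"
proof (rule LIMSEQ_I)
  fix e :: real assume e: "e > 0"
  have C: "0 \<le> C" using L2.nrm_ge_0[OF v(1)[of 0]] v(2)[of 0] by linarith
  have e': "e / (2 * (C + 1)) > 0" using e C by simp
  obtain \<phi> where \<phi>: "\<phi> \<in> H10_space \<Omega>" "L2_norm \<Omega> (\<phi> - h) < e / (2 * (C + 1))"
    by (rule H10_dense[OF h e'])
  have e2: "e / 2 > 0" using e by simp
  obtain N where N: "\<And>n. n \<ge> N \<Longrightarrow> \<bar>L2_inner \<Omega> (v n) \<phi>\<bar> < e / 2"
    using LIMSEQ_D[OF lim[OF \<phi>(1)] e2] by auto
  have "\<bar>L2_inner \<Omega> (v n) h\<bar> < e" if "n \<ge> N" for n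
  proof -
    have \<phi>L: "\<phi> \<in> L2_space \<Omega>" using \<phi> by simp
    have "\<bar>L2_inner \<Omega> (v n) (\<phi> - h)\<bar> \<le> L2_norm \<Omega> (v n) * L2_norm \<Omega> (\<phi> - h)"
      by (rule L2.Cauchy_Schwarz[OF v(1) L2.mem_diff[OF \<phi>L h]])
    also have "\<dots> \<le> (C + 1) * (e / (2 * (C + 1)))"
      using v(2)[of n] \<phi> C \<phi>L h e' by (intro mult_mono) auto
    also have "\<dots> = e / 2" using C by (simp add: field_simps)
    finally show ?thesis using N[OF that] L2.diff_right[OF \<phi>L h v(1)[of n]] by linarith
  qed
  then show "\<exists>N. \<forall>n\<ge>N. norm (L2_inner \<Omega> (v n) h - 0) < e" by auto
qed

text \<open>Without the absolute value the weighted gradients depend linearly on the coefficient, so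
  the triangle inequality of the L2 norm applies to them.\<close>

lemma coeff_dist_alt:
  assumes "coeff_fun C \<alpha>" "coeff_fun C \<beta>" "v \<in> H1_space \<Omega>"
  shows "coeff_dist \<alpha> \<beta> v = L2_norm \<Omega> (\<lambda>x. (\<alpha> x - \<beta> x) * ngrad v x)"
    "(\<lambda>x. (\<alpha> x - \<beta> x) * ngrad v x) \<in> L2_space \<Omega>"
proof -
  have sq: "(\<bar>z\<bar> * p) * (\<bar>z\<bar> * p) = (z * p) * (z * p)" for z p :: real
    by (simp add: abs_if)
  show "coeff_dist \<alpha> \<beta> v = L2_norm \<Omega> (\<lambda>x. (\<alpha> x - \<beta> x) * ngrad v x)"
    unfolding coeff_dist_def L2_norm_def L2_inner_def sq ..
  note d = coeff_diff[OF assms(1,2)]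
  have [measurable]: "(\<lambda>x. \<alpha> x - \<beta> x) \<in> borel_measurable M\<Omega>" "ngrad v \<in> borel_measurable M\<Omega>"
    using d L2_measurable[OF ngrad_L2[OF assms(3)]] by (auto simp: coeff_fun_def)
  show "(\<lambda>x. (\<alpha> x - \<beta> x) * ngrad v x) \<in> L2_space \<Omega>"
    using L2_square_integrable[OF coeff_L2[OF d ngrad_L2[OF assms(3)]]]
    unfolding L2_space_def by (simp add: power_mult_distrib)
qed

lemma coeff_dist_triangle:
  assumes "coeff_fun C \<alpha>" "coeff_fun C \<beta>" "coeff_fun C \<gamma>" "v \<in> H1_space \<Omega>"
  shows "\<bar>coeff_dist \<alpha> \<beta> v - coeff_dist \<alpha> \<gamma> v\<bar> \<le> coeff_dist \<gamma> \<beta> v"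
proof -
  have "(\<lambda>x. (\<alpha> x - \<beta> x) * ngrad v x) - (\<lambda>x. (\<alpha> x - \<gamma> x) * ngrad v x) = (\<lambda>x. (\<gamma> x - \<beta> x) * ngrad v x)"
    by (intro ext) (simp add: algebra_simps)
  with L2.nrm_triangle_sub[OF coeff_dist_alt(2)[OF assms(1,2,4)] coeff_dist_alt(2)[OF assms(1,3,4)]]
  show ?thesis
    by (simp add: coeff_dist_alt(1)[OF assms(1,2,4)] coeff_dist_alt(1)[OF assms(1,3,4)] coeff_dist_alt(1)[OF assms(3,2,4)])
qed

text \<open>A space of V-valued simple functions on which integrals over time are finite sums; it is
  not complete, so limits are taken pointwise. The time \<open>T\<close>, unseen by the measure, is
  included because the interpolants are evaluated there.\<close>

definition step_space :: "real \<Rightarrow> (real \<Rightarrow> 'a \<Rightarrow> real) set" where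
  "step_space T = {s. simple_function (MT T) s \<and> (\<forall>t\<in>{0<..T}. s t \<in> H10_space \<Omega>)}"

definition step_inner :: "real \<Rightarrow> (real \<Rightarrow> 'a \<Rightarrow> real) \<Rightarrow> (real \<Rightarrow> 'a \<Rightarrow> real) \<Rightarrow> real" where
  "step_inner T s s' = (LINT t|MT T. H1_inner (s t) (s' t))"

lemma step_spaceD:
  "s \<in> step_space T \<Longrightarrow> simple_function (MT T) s"
  "s \<in> step_space T \<Longrightarrow> t \<in> {0<..T} \<Longrightarrow> s t \<in> H10_space \<Omega>"
  by (auto simp: step_space_def)

lemma step_integrable:
  "\<lbrakk>s \<in> step_space T; s' \<in> step_space T\<rbrakk> \<Longrightarrow> integrable (MT T) (\<lambda>t. H1_inner (s t) (s' t))"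
  by (rule simple_integrable_MT[OF simple_function_compose2[OF step_spaceD(1) step_spaceD(1)]])

lemma step_H1_integrable: "s \<in> step_space T \<Longrightarrow> integrable (MT T) (\<lambda>t. (H1_norm \<Omega> (s t))\<^sup>2)"
  by (rule simple_integrable_MT[OF simple_function_compose1[OF step_spaceD(1)]])

lemma step_space_subspace: "subspace (step_space T)"
proof (rule subspaceI)
  note H = H10_subspace
  show "0 \<in> step_space T"
    using subspace_0[OF H] by (auto simp: step_space_def zero_fun_def simple_function_const[unfolded zero_fun_def])
  show "s + s' \<in> step_space T" if "s \<in> step_space T" "s' \<in> step_space T" for s s'
  proof -
    have "simple_function (MT T) (\<lambda>t. s t + s' t)"
      by (rule simple_function_compose2[OF step_spaceD(1)[OF that(1)] step_spaceD(1)[OF that(2)]])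
    moreover have "(\<lambda>t. s t + s' t) = s + s'" by (simp add: fun_eq_iff)
    ultimately show ?thesis
      using subspace_add[OF H step_spaceD(2)[OF that(1)] step_spaceD(2)[OF that(2)]] by (simp add: step_space_def)
  qed
  show "c *\<^sub>R s \<in> step_space T" if "s \<in> step_space T" for c s
  proof -
    have "simple_function (MT T) (\<lambda>t. c *\<^sub>R s t)"
      by (rule simple_function_compose1[OF step_spaceD(1)[OF that]])
    moreover have "(\<lambda>t. c *\<^sub>R s t) = c *\<^sub>R s" by (simp add: fun_eq_iff)
    ultimately show ?thesis
      using subspace_scale[OF H step_spaceD(2)[OF that]] by (simp add: step_space_def)
  qed
qed

lemma step_semi_inner: "semi_inner (step_space T) (step_inner T)"
proof
  show "subspace (step_space T)" by (rule step_space_subspace)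
  show "step_inner T (x + y) z = step_inner T x z + step_inner T y z"
    if "x \<in> step_space T" "y \<in> step_space T" "z \<in> step_space T" for x y z
  proof -
    have "step_inner T (x + y) z = (LINT t|MT T. H1_inner (x t) (z t) + H1_inner (y t) (z t))"
      unfolding step_inner_def
    proof (rule Bochner_Integration.integral_cong[OF refl])
      fix t assume "t \<in> space (MT T)"
      then have "t \<in> {0<..T}" by auto
      then have "x t \<in> H10_space \<Omega>" "y t \<in> H10_space \<Omega>" "z t \<in> H10_space \<Omega>" using that step_spaceD(2) by blast+
      then show "H1_inner ((x + y) t) (z t) = H1_inner (x t) (z t) + H1_inner (y t) (z t)"
        by (simp add: H1.add_left)
    qed
    then show ?thesis using step_integrable that by (simp add: step_inner_def)
  qed
  show "step_inner T (c *\<^sub>R x) z = c * step_inner T x z" if "x \<in> step_space T" "z \<in> step_space T" for c x z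
  proof -
    have "step_inner T (c *\<^sub>R x) z = (LINT t|MT T. c * H1_inner (x t) (z t))"
      unfolding step_inner_def
    proof (rule Bochner_Integration.integral_cong[OF refl])
      fix t assume "t \<in> space (MT T)"
      then have "t \<in> {0<..T}" by auto
      then have "x t \<in> H10_space \<Omega>" "z t \<in> H10_space \<Omega>" using that step_spaceD(2) by blast+
      then show "H1_inner ((c *\<^sub>R x) t) (z t) = c * H1_inner (x t) (z t)"
        by (simp add: H1.scale_left)
    qed
    then show ?thesis by (simp add: step_inner_def)
  qed
  show "step_inner T x y = step_inner T y x" if "x \<in> step_space T" "y \<in> step_space T" for x y
    unfolding step_inner_def
  proof (rule Bochner_Integration.integral_cong[OF refl])
    fix t assume "t \<in> space (MT T)"
    then have "t \<in> {0<..T}" by auto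
    then have "x t \<in> H10_space \<Omega>" "y t \<in> H10_space \<Omega>" using that step_spaceD(2) by blast+
    then show "H1_inner (x t) (y t) = H1_inner (y t) (x t)" by (intro H1.sym) auto
  qed
  show "0 \<le> step_inner T x x" if "x \<in> step_space T" for x
    unfolding step_inner_def
  proof (rule Bochner_Integration.integral_nonneg)
    fix t assume "t \<in> space (MT T)"
    then have "t \<in> {0<..T}" by auto
    then have "x t \<in> H10_space \<Omega>" using that step_spaceD(2) by blast
    then show "0 \<le> H1_inner (x t) (x t)" by (intro H1.pos) auto
  qed
qed

lemma step_nrm:
  assumes "s \<in> step_space T" shows "semi_inner.nrm (step_inner T) s = sqrt (LINT t|MT T. (H1_norm \<Omega> (s t))\<^sup>2)"
proof -
  have "step_inner T s s = (LINT t|MT T. (H1_norm \<Omega> (s t))\<^sup>2)"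
    unfolding step_inner_def
  proof (rule Bochner_Integration.integral_cong[OF refl])
    fix t assume "t \<in> space (MT T)"
    then have "t \<in> {0<..T}" by auto
    then have "s t \<in> H1_space \<Omega>" using assms step_spaceD(2) by auto
    then show "H1_inner (s t) (s t) = (H1_norm \<Omega> (s t))\<^sup>2" by (simp add: H1.nrm_sq)
  qed
  then show ?thesis by (simp add: semi_inner.nrm_def[OF step_semi_inner])
qed

text \<open>
  Convex combinations of the tails of a sequence bounded in \<open>L\<^sup>2(0,T;V)\<close> converge strongly; this replaces
  weak compactness, since linear quantities keep their limits under convex combinations.
\<close>

lemma strong_convex_limit:
  assumes V: "\<And>n. V n \<in> step_space T" and bd: "\<And>n. (LINT t|MT T. (H1_norm \<Omega> (V n t))\<^sup>2) \<le> C\<^sup>2" and C: "0 \<le> C"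
  obtains y u where "\<And>k. y k \<in> convex hull (V ` {k..})" "u \<in> L2_V T \<Omega>"
    "AE t in MT T. u t \<in> H10_space \<Omega> \<and> (\<lambda>k. H1_norm \<Omega> (y k t - u t)) \<longlonglongrightarrow> 0"
    "\<And>k. (\<lambda>t. H1_norm \<Omega> (y k t - u t)) \<in> borel_measurable (MT T)"
    "\<And>k. integrable (MT T) (\<lambda>t. (H1_norm \<Omega> (y k t - u t))\<^sup>2)"
    "\<And>k. (LINT t|MT T. (H1_norm \<Omega> (y k t - u t))\<^sup>2) \<le> (1/8)^k"
proof -
  interpret S: semi_inner "step_space T" "step_inner T" by (rule step_semi_inner)
  have Vn: "S.nrm (V n) \<le> C" for n
    unfolding step_nrm[OF V] using bd[of n] C by (simp add: real_le_lsqrt)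
  obtain v where v: "\<And>n. v n \<in> convex hull (V ` {n..})"
    and vC: "\<And>e. e > 0 \<Longrightarrow> \<exists>N. \<forall>m\<ge>N. \<forall>n\<ge>N. S.nrm (v m - v n) < e"
    by (rule S.mazur_Cauchy[where xs=V, OF V Vn], rule that)
  have vX: "v n \<in> step_space T" for n by (rule S.hull_tail_mem[OF V v])
  define d where "d i j = (LINT t|MT T. (H1_norm \<Omega> (v i t - v j t))\<^sup>2)" for i j
  have dn: "S.nrm (v i - v j) = sqrt (d i j)" for i j
    using step_nrm[OF S.mem_diff[OF vX vX], of i j] by (simp add: d_def)
  have dC: "\<exists>N. \<forall>m\<ge>N. \<forall>n\<ge>N. d m n < e" if "e > 0" for e
    using vC[of "sqrt e"] that unfolding dn by simp
  \<comment> \<open>At this rate the increments are summable in the V norm at almost every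
    time.\<close>
  obtain \<rho> where \<rho>: "strict_mono \<rho>" "\<And>k m n. \<lbrakk>m \<ge> \<rho> k; n \<ge> \<rho> k\<rbrakk> \<Longrightarrow> d m n < (1/8)^k"
    by (rule fast_subsequence[of d, OF dC], assumption, rule that)
  define y where "y k = v (\<rho> k)" for k
  have yX: "y k \<in> step_space T" for k using vX by (simp add: y_def)
  have yh: "y k \<in> convex hull (V ` {k..})" for k
  proof -
    have "convex hull (V ` {\<rho> k..}) \<subseteq> convex hull (V ` {k..})"
      using seq_suble[OF \<rho>(1), of k] by (intro hull_mono) auto
    then show ?thesis using v[of "\<rho> k"] by (auto simp: y_def)
  qed
  have yd: "(LINT t|MT T. (H1_norm \<Omega> (y i t - y j t))\<^sup>2) \<le> (1/8)^k" if "i \<ge> k" "j \<ge> k" for i j k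
    using \<rho>(2)[of k "\<rho> i" "\<rho> j"] that strict_mono_less_eq[OF \<rho>(1)] by (simp add: d_def y_def)
  have yi: "integrable (MT T) (\<lambda>t. (H1_norm \<Omega> (y i t - y j t))\<^sup>2)" for i j
    using step_H1_integrable[OF S.mem_diff[OF yX yX], of i j] by simp
  have yV: "y k t \<in> H10_space \<Omega>" if "t \<in> {0<..<T}" for k t using step_spaceD(2)[OF yX, of t] that by auto
  have sum: "AE t in MT T. summable (\<lambda>k. \<bar>H1_norm \<Omega> (y (Suc k) t - y k t)\<bar>)"
    by (rule AE_summable_of_fast[OF yi]) (rule yd, auto)
  define u where "u t = (SOME x. x \<in> H10_space \<Omega> \<and> (\<lambda>k. H1_norm \<Omega> (y k t - x)) \<longlonglongrightarrow> 0)" for t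
  have AET: "AE t in MT T. t \<in> {0<..<T}" by (rule AE_I2) simp
  from sum AET have lim: "AE t in MT T. u t \<in> H10_space \<Omega> \<and> (\<lambda>k. H1_norm \<Omega> (y k t - u t)) \<longlonglongrightarrow> 0"
  proof eventually_elim
    case (elim t)
    have "\<exists>x\<in>H10_space \<Omega>. (\<lambda>k. H1_norm \<Omega> (y k t - x)) \<longlonglongrightarrow> 0"
    proof (rule G.V.complete)
      show "\<exists>N. \<forall>m\<ge>N. \<forall>n\<ge>N. H1_norm \<Omega> (y m t - y n t) < e" if "e > 0" for e
        by (rule H1.Cauchy_of_summable[OF _ _ that]) (use yV elim in auto)
    qed (rule yV[OF elim(2)])
    then have "\<exists>x. x \<in> H10_space \<Omega> \<and> (\<lambda>k. H1_norm \<Omega> (y k t - x)) \<longlonglongrightarrow> 0" by blast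
    from someI_ex[OF this] show ?case unfolding u_def .
  qed
  have simple: "simple_function (MT T) (y k)" for k by (rule step_spaceD(1)[OF yX])
  from lim AET have sqlim: "AE t in MT T. (\<lambda>k. (H1_norm \<Omega> (y k t))\<^sup>2) \<longlonglongrightarrow> (H1_norm \<Omega> (u t))\<^sup>2"
  proof eventually_elim
    case (elim t)
    show ?case by (intro tendsto_power H1.tendsto_nrm) (use elim yV in auto)
  qed
  have usq: "integrable (MT T) (\<lambda>t. (H1_norm \<Omega> (u t))\<^sup>2)"
  proof (rule Fatou_bound(1)[OF step_H1_integrable[OF yX] _ _ _ sqlim])
    show "(LINT t|MT T. (H1_norm \<Omega> (y k t))\<^sup>2) \<le> C\<^sup>2" for k
    proof -
      have "S.nrm (y k) \<le> C" by (rule S.hull_bounded[OF _ yh[of k]]) (use V Vn in auto)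
      then show ?thesis unfolding step_nrm[OF yX] using C by (simp add: sqrt_le_D)
    qed
    show "(\<lambda>t. (H1_norm \<Omega> (u t))\<^sup>2) \<in> borel_measurable (MT T)"
      by (rule simple_limit_measurable[OF simple, where \<Phi>="\<lambda>k x. (H1_norm \<Omega> x)\<^sup>2", OF sqlim])
  qed simp
  have uL: "u \<in> L2_V T \<Omega>"
    by (rule L2_V_I[OF simple yV _ _ usq]) (use lim in \<open>auto elim: eventually_mono\<close>)
  have diff: "integrable (MT T) (\<lambda>t. (H1_norm \<Omega> (y k t - u t))\<^sup>2) \<and> (LINT t|MT T. (H1_norm \<Omega> (y k t - u t))\<^sup>2) \<le> (1/8)^k" for k
  proof -
    \<comment> \<open>Fatou in \<open>j\<close> for fixed \<open>k\<close>: the later elements stay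
      within \<open>(1/8)^k\<close> of \<open>y k\<close> in the squared norm.\<close>
    from lim AET have l: "AE t in MT T. (\<lambda>j. (H1_norm \<Omega> (y k t - y (k + j) t))\<^sup>2) \<longlonglongrightarrow> (H1_norm \<Omega> (y k t - u t))\<^sup>2"
    proof eventually_elim
      case (elim t)
      have "(\<lambda>j. H1_norm \<Omega> (y (j + k) t - u t)) \<longlonglongrightarrow> 0" using elim by (intro LIMSEQ_ignore_initial_segment) blast
      moreover have "H1_norm \<Omega> ((y k t - y (k + j) t) - (y k t - u t)) = H1_norm \<Omega> (y (j + k) t - u t)" for j
        using H1.nrm_diff_commute[of "u t" "y (k + j) t"] elim yV by (simp add: add.commute[of k j])
      ultimately have "(\<lambda>j. H1_norm \<Omega> ((y k t - y (k + j) t) - (y k t - u t))) \<longlonglongrightarrow> 0" by simp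
      then show ?case by (intro tendsto_power H1.tendsto_nrm) (use elim yV in auto)
    qed
    have meas: "(\<lambda>t. (H1_norm \<Omega> (y k t - u t))\<^sup>2) \<in> borel_measurable (MT T)"
      by (rule measurable_AE_limit[OF _ _ l]) (use yi in auto)
    show ?thesis
      using Fatou_bound[OF yi[of k] _ yd meas l, of k] by simp
  qed
  show ?thesis
    by (rule that[OF yh uL lim]) (use diff H1_norm_measurable[of T "\<lambda>t. y _ t - u t"] in auto)
qed

end

section \<open>Passage to the limit\<close>

context nonlocal begin

lemma gx_tendsto_at:
  assumes "e > 0"
  obtains d where "d > 0" "\<And>x'. dist x' x < d \<Longrightarrow> L2_norm \<Omega> (gx x' - gx x) < e"
proof -
  have "((\<lambda>x'. L2_norm \<Omega> (gx x' - gx x)) \<longlongrightarrow> 0) (at x)"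
    unfolding tendsto_at_iff_sequentially comp_def using gx_continuous by blast
  from tendstoD[OF this assms] obtain d where d: "d > 0"
    "\<And>x'. \<lbrakk>x' \<noteq> x; dist x' x < d\<rbrakk> \<Longrightarrow> dist (L2_norm \<Omega> (gx x' - gx x)) 0 < e"
    unfolding eventually_at by blast
  have "L2_norm \<Omega> (gx x' - gx x) < e" if "dist x' x < d" for x'
    using d(2)[of x'] that assms L2.nrm_0 by (cases "x' = x") auto
  then show ?thesis using that d(1) by blast
qed

text \<open>The modulus in time is known only against elements of V, so \<open>gx x\<close> is
  replaced by a nearby \<open>\<phi>\<close> in V; the errors of this and of moving \<open>x\<close>
  are controlled by the uniform L2 bound.\<close>

lemma nonlocal_equicontinuous:
  fixes V :: "nat \<Rightarrow> real \<Rightarrow> 'a \<Rightarrow> real"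
  assumes V: "\<And>n t. t \<in> I \<Longrightarrow> V n t \<in> L2_space \<Omega>" "\<And>n t. t \<in> I \<Longrightarrow> L2_norm \<Omega> (V n t) \<le> C"
    and \<delta>: "\<delta> \<longlonglongrightarrow> 0"
    and mod: "\<And>n s t \<phi>. \<lbrakk>s \<in> I; t \<in> I; \<phi> \<in> H10_space \<Omega>\<rbrakk> \<Longrightarrow>
      \<bar>L2_inner \<Omega> (V n t) \<phi> - L2_inner \<Omega> (V n s) \<phi>\<bar> \<le> (2 * \<delta> n + sqrt \<bar>t - s\<bar>) * C * H1_norm \<Omega> \<phi>"
    and C: "0 \<le> C" and e: "e > 0" and s: "s \<in> I"
  shows "\<exists>d>0. \<exists>N. \<forall>n\<ge>N. \<forall>z'\<in>I \<times> UNIV. dist z' (s, x) < d \<longrightarrow>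
    \<bar>L2_inner \<Omega> (gx (snd z')) (V n (fst z')) - L2_inner \<Omega> (gx x) (V n s)\<bar> < e"
proof -
  \<comment> \<open>Three L2 errors are kept below \<open>e / 8\<close> each by this choice, and the
    increment in time below \<open>e / 4\<close> by that of \<open>\<kappa>\<close>; the added 1
    keeps the denominators positive.\<close>
  define \<eta> where "\<eta> = e / (8 * (C + 1))"
  have \<eta>: "\<eta> > 0" using e C by (simp add: \<eta>_def)
  have C\<eta>: "C * \<eta> < e / 8"
  proof -
    have "C * \<eta> < (C + 1) * \<eta>" using \<eta> by (intro mult_strict_right_mono) auto
    also have "\<dots> = e / 8" using C by (simp add: \<eta>_def field_simps)
    finally show ?thesis .
  qed
  obtain \<phi> where \<phi>: "\<phi> \<in> H10_space \<Omega>" "L2_norm \<Omega> (\<phi> - gx x) < \<eta>" by (rule H10_dense[OF gx_L2 \<eta>])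
  obtain d1 where d1: "d1 > 0" "\<And>x'. dist x' x < d1 \<Longrightarrow> L2_norm \<Omega> (gx x' - gx x) < \<eta>"
    by (rule gx_tendsto_at[OF \<eta>], rule that)
  define B where "B = C * H1_norm \<Omega> \<phi>"
  have B: "0 \<le> B" using C by (simp add: B_def)
  define \<kappa> where "\<kappa> = e / (8 * (B + 1))"
  have \<kappa>: "\<kappa> > 0" using e B by (simp add: \<kappa>_def)
  have B\<kappa>: "\<kappa> * B < e / 8"
  proof -
    have "\<kappa> * B < \<kappa> * (B + 1)" using \<kappa> by simp
    also have "\<dots> = e / 8" using B by (simp add: \<kappa>_def field_simps)
    finally show ?thesis .
  qed
  have "\<kappa> / 2 > 0" using \<kappa> by simp
  from order_tendstoD(2)[OF \<delta> this] obtain N where N: "\<And>n. n \<ge> N \<Longrightarrow> \<delta> n < \<kappa> / 2"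
    unfolding eventually_sequentially by blast
  show ?thesis
  proof (intro exI[of _ "min d1 (\<kappa>\<^sup>2)"] conjI exI[of _ N] allI impI ballI)
    show "0 < min d1 (\<kappa>\<^sup>2)" using d1(1) \<kappa> by simp
    fix n z' assume n: "n \<ge> N" and z': "z' \<in> I \<times> UNIV" and dz: "dist z' (s, x) < min d1 (\<kappa>\<^sup>2)"
    obtain t x' where z: "z' = (t, x')" by (cases z')
    have t: "t \<in> I" using z' z by simp
    have dx: "dist x' x < d1" using dist_snd_le[of z' "(s, x)"] dz z by simp
    have "\<bar>t - s\<bar> < \<kappa>\<^sup>2" using dist_fst_le[of z' "(s, x)"] dz z by (simp add: dist_real_def)
    then have "sqrt \<bar>t - s\<bar> < sqrt (\<kappa>\<^sup>2)" by (rule real_sqrt_less_mono)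
    then have sq: "sqrt \<bar>t - s\<bar> \<le> \<kappa>" using \<kappa> by simp
    have L: "gx x \<in> L2_space \<Omega>" "gx x' \<in> L2_space \<Omega>" "\<phi> \<in> L2_space \<Omega>" "V n t \<in> L2_space \<Omega>" "V n s \<in> L2_space \<Omega>"
      using gx_L2 \<phi>(1) V(1) s t by auto
    have p: "\<bar>L2_inner \<Omega> (V n t') h\<bar> \<le> C * \<eta>" if "t' \<in> I" "h \<in> L2_space \<Omega>" "L2_norm \<Omega> h < \<eta>" for t' h
    proof -
      have "\<bar>L2_inner \<Omega> (V n t') h\<bar> \<le> L2_norm \<Omega> (V n t') * L2_norm \<Omega> h"
        by (rule L2.Cauchy_Schwarz[OF V(1)[OF that(1)] that(2)])
      also have "\<dots> \<le> C * \<eta>" using that V C by (intro mult_mono) auto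
      finally show ?thesis .
    qed
    have 1: "\<bar>L2_inner \<Omega> (V n t) (gx x' - gx x)\<bar> \<le> C * \<eta>"
      by (rule p[OF t L2.mem_diff[OF L(2,1)] d1(2)[OF dx]])
    have 2: "\<bar>L2_inner \<Omega> (V n t) (\<phi> - gx x)\<bar> \<le> C * \<eta>" "\<bar>L2_inner \<Omega> (V n s) (\<phi> - gx x)\<bar> \<le> C * \<eta>"
      by (rule p[OF _ L2.mem_diff[OF L(3,1)] \<phi>(2)], rule t, rule p[OF _ L2.mem_diff[OF L(3,1)] \<phi>(2)], rule s)
    have "\<bar>L2_inner \<Omega> (V n t) \<phi> - L2_inner \<Omega> (V n s) \<phi>\<bar> \<le> (2 * \<delta> n + sqrt \<bar>t - s\<bar>) * B"
      using mod[OF s t \<phi>(1), of n] by (simp add: B_def mult.assoc)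
    also have "\<dots> \<le> (2 * \<kappa>) * B" using N[OF n] sq B by (intro mult_right_mono) auto
    finally have 3: "\<bar>L2_inner \<Omega> (V n t) \<phi> - L2_inner \<Omega> (V n s) \<phi>\<bar> < e / 4" using B\<kappa> by linarith
    have "L2_inner \<Omega> (gx (snd z')) (V n (fst z')) = L2_inner \<Omega> (V n t) (gx x')"
      "L2_inner \<Omega> (gx x) (V n s) = L2_inner \<Omega> (V n s) (gx x)"
      using L2.sym[OF L(2,4)] L2.sym[OF L(1,5)] by (simp_all add: z)
    then show "\<bar>L2_inner \<Omega> (gx (snd z')) (V n (fst z')) - L2_inner \<Omega> (gx x) (V n s)\<bar> < e"
      using 1 2 3 C\<eta> L2.diff_right[OF L(2,1,4)] L2.diff_right[OF L(3,1,4)] L2.diff_right[OF L(3,1,5)]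
      by linarith
  qed
qed

context
  fixes T :: real and f :: "real \<Rightarrow> ('a \<Rightarrow> real) \<Rightarrow> real" and u0 :: "'a \<Rightarrow> real"
    and C :: real and V W :: "nat \<Rightarrow> real \<Rightarrow> 'a \<Rightarrow> real" and \<delta> :: "nat \<Rightarrow> real" and L :: "real \<Rightarrow> 'a \<Rightarrow> real"
  assumes T: "T > 0" and f: "f \<in> L2_V' T \<Omega>" and u0: "u0 \<in> L2_space \<Omega>"
    and C: "0 \<le> C" and \<delta>: "\<delta> \<longlonglongrightarrow> 0"
    and V: "\<And>n. V n \<in> step_space T" and Ws: "\<And>n. simple_function (MT T) (W n)"
    and WL: "\<And>n t. t \<in> {0<..T} \<Longrightarrow> W n t \<in> L2_space \<Omega>"
    and VC: "\<And>n t. t \<in> {0<..T} \<Longrightarrow> L2_norm \<Omega> (V n t) \<le> C" and WC: "\<And>n t. t \<in> {0<..T} \<Longrightarrow> L2_norm \<Omega> (W n t) \<le> C"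
    and VH1: "\<And>n. (LINT t|MT T. (H1_norm \<Omega> (V n t))\<^sup>2) \<le> C\<^sup>2"
    and path: "\<And>n t \<phi>. \<lbrakk>t \<in> {0<..T}; \<phi> \<in> H10_space \<Omega>\<rbrakk> \<Longrightarrow>
      \<bar>L2_inner \<Omega> (V n t) \<phi> - L2_inner \<Omega> u0 \<phi> - iint T (\<lambda>\<sigma>. f \<sigma> \<phi> - dform (acoef (W n \<sigma>)) (V n \<sigma>) \<phi>) 0 t\<bar> \<le> \<delta> n * C * H1_norm \<Omega> \<phi>"
    and VW: "\<And>n t \<phi>. \<lbrakk>t \<in> {0<..T}; \<phi> \<in> H10_space \<Omega>\<rbrakk> \<Longrightarrow> \<bar>L2_inner \<Omega> (V n t - W n t) \<phi>\<bar> \<le> \<delta> n * C * H1_norm \<Omega> \<phi>"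
    and L: "\<And>t x. t \<in> {0<..T} \<Longrightarrow> (\<lambda>n. L2_inner \<Omega> (gx x) (V n t)) \<longlonglongrightarrow> L t x"
begin

lemma VH: "t \<in> {0<..T} \<Longrightarrow> V n t \<in> H10_space \<Omega>"
  using step_spaceD(2)[OF V] .

lemma error_tendsto: "(\<lambda>n. \<delta> n * C * H1_norm \<Omega> \<phi>) \<longlonglongrightarrow> 0"
  using tendsto_mult_left_zero[OF \<delta>, of "C * H1_norm \<Omega> \<phi>"] by (simp add: mult.assoc)

definition A :: "real \<Rightarrow> 'a \<Rightarrow> real" where "A t x = a (L t x)"

text \<open>\<open>V - W\<close> is bounded and tends to zero against V, hence against every
  \<open>gx x\<close>; so the lagged values give the same limit as \<open>V\<close>.\<close>

lemma A_limit:
  assumes t: "t \<in> {0<..T}" shows "(\<lambda>n. acoef (W n t) x) \<longlonglongrightarrow> A t x"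
proof -
  have VL: "V n t \<in> L2_space \<Omega>" for n using VH[OF t] by simp
  have "(\<lambda>n. L2_inner \<Omega> (V n t - W n t) (gx x)) \<longlonglongrightarrow> 0"
  proof (rule weakly_null_of_dense[where C="C + C"])
    show "V n t - W n t \<in> L2_space \<Omega>" for n by (rule L2.mem_diff[OF VL WL[OF t]])
    show "L2_norm \<Omega> (V n t - W n t) \<le> C + C" for n
      using L2.nrm_diff_le[OF VL WL[OF t], of n n] VC[OF t, of n] WC[OF t, of n] by linarith
    show "(\<lambda>n. L2_inner \<Omega> (V n t - W n t) \<phi>) \<longlonglongrightarrow> 0" if \<phi>: "\<phi> \<in> H10_space \<Omega>" for \<phi>
      by (rule Lim_null_comparison[OF _ error_tendsto[of \<phi>]]) (use VW[OF t \<phi>] in auto)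
  qed (rule gx_L2)
  from tendsto_diff[OF L[OF t, of x] this]
  have "(\<lambda>n. L2_inner \<Omega> (gx x) (V n t) - L2_inner \<Omega> (V n t - W n t) (gx x)) \<longlonglongrightarrow> L t x" by simp
  moreover have "L2_inner \<Omega> (gx x) (V n t) - L2_inner \<Omega> (V n t - W n t) (gx x) = L2_inner \<Omega> (gx x) (W n t)" for n
    using L2.diff_left[OF VL WL[OF t] gx_L2] L2.sym[OF gx_L2 VL, of x n] L2.sym[OF gx_L2 WL[OF t], of x n] by simp
  ultimately have "(\<lambda>n. L2_inner \<Omega> (gx x) (W n t)) \<longlonglongrightarrow> L t x" by simp
  then show ?thesis unfolding acoef_def l_op_eq A_def by (rule a_tendsto)
qed

lemma W_coeff: "t \<in> {0<..T} \<Longrightarrow> coeff_fun M (acoef (W n t))"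
  by (rule acoef(1)[OF WL])

lemma A_coeff:
  assumes t: "t \<in> {0<..T}" shows "coeff_fun M (A t)"
proof (rule coeff_aI)
  show "A t \<in> borel_measurable M\<Omega>"
    by (rule borel_measurable_LIMSEQ_real[OF A_limit[OF t]]) (use W_coeff[OF t] in \<open>auto simp: coeff_fun_def\<close>)
qed (auto simp: A_def)

lemma A_dist_tendsto:
  assumes t: "t \<in> {0<..T}" and v: "v \<in> H1_space \<Omega>"
  shows "(\<lambda>n. coeff_dist (acoef (W n t)) (A t) v) \<longlonglongrightarrow> 0"
  by (rule coeff_dist_tendsto[OF W_coeff[OF t] A_coeff[OF t] A_limit[OF t] v])

lemma AE_MT: "AE t in MT T. t \<in> {0<..T}"
  by (rule AE_I2) simp

text \<open>\<open>A\<close> is merely a pointwise limit; replacing it by the coefficient of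
  \<open>W j\<close> gives simple functions of time, and the triangle inequality for
  \<open>coeff_dist\<close> lets j tend to infinity.\<close>

lemma A_dist_measurable:
  assumes v: "v \<in> H1_space \<Omega>"
  shows "(\<lambda>t. coeff_dist (acoef (W n t)) (A t) v) \<in> borel_measurable (MT T)"
proof (rule measurable_AE_limit[where f="\<lambda>j t. coeff_dist (acoef (W n t)) (acoef (W j t)) v"])
  show "(\<lambda>t. coeff_dist (acoef (W n t)) (acoef (W j t)) v) \<in> borel_measurable (MT T)" for j
    by (rule borel_measurable_simple_function[OF simple_function_compose2[OF Ws Ws]])
  show "AE t in MT T. (\<lambda>j. coeff_dist (acoef (W n t)) (acoef (W j t)) v) \<longlonglongrightarrow> coeff_dist (acoef (W n t)) (A t) v"
    using AE_MT
  proof eventually_elim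
    case (elim t)
    have "(\<lambda>j. coeff_dist (acoef (W n t)) (acoef (W j t)) v - coeff_dist (acoef (W n t)) (A t) v) \<longlonglongrightarrow> 0"
    proof (rule Lim_null_comparison[OF always_eventually[OF allI] A_dist_tendsto[OF elim v]])
      fix j
      have "coeff_dist (A t) (acoef (W j t)) v = coeff_dist (acoef (W j t)) (A t) v"
        unfolding coeff_dist_def by (simp add: abs_minus_commute)
      then show "norm (coeff_dist (acoef (W n t)) (acoef (W j t)) v - coeff_dist (acoef (W n t)) (A t) v) \<le> coeff_dist (acoef (W j t)) (A t) v"
        using coeff_dist_triangle[OF W_coeff[OF elim] W_coeff[OF elim] A_coeff[OF elim] v, of n j] by simp
    qed
    then show ?case by (simp add: LIM_zero_iff)
  qed
qed simp

lemma A_dist_square: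
  assumes v: "v \<in> H1_space \<Omega>"
  shows "integrable (MT T) (\<lambda>t. (coeff_dist (acoef (W n t)) (A t) v)\<^sup>2)"
    and "(\<lambda>n. LINT t|MT T. (coeff_dist (acoef (W n t)) (A t) v)\<^sup>2) \<longlonglongrightarrow> 0"
proof -
  interpret finite_measure "MT T" by (rule finite_measure_MT)
  have m: "(\<lambda>t. (coeff_dist (acoef (W n t)) (A t) v)\<^sup>2) \<in> borel_measurable (MT T)" for n
    by (rule borel_measurable_power[OF A_dist_measurable[OF v]])
  have b: "AE t in MT T. norm ((coeff_dist (acoef (W n t)) (A t) v)\<^sup>2) \<le> (2 * M)\<^sup>2 * (H1_norm \<Omega> v)\<^sup>2" for n
    using AE_MT by eventually_elim (use coeff_dist_le[OF W_coeff A_coeff v] in simp)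
  show "integrable (MT T) (\<lambda>t. (coeff_dist (acoef (W n t)) (A t) v)\<^sup>2)"
    by (rule integrable_const_bound[OF b m])
  have "(\<lambda>n. LINT t|MT T. (coeff_dist (acoef (W n t)) (A t) v)\<^sup>2) \<longlonglongrightarrow> (LINT t|MT T. 0)"
  proof (rule integral_dominated_convergence[OF _ m _ _ b])
    show "AE t in MT T. (\<lambda>n. (coeff_dist (acoef (W n t)) (A t) v)\<^sup>2) \<longlonglongrightarrow> 0"
      using AE_MT
    proof eventually_elim
      case (elim t)
      show ?case using tendsto_power[OF A_dist_tendsto[OF elim v], of 2] by simp
    qed
  qed simp_all
  then show "(\<lambda>n. LINT t|MT T. (coeff_dist (acoef (W n t)) (A t) v)\<^sup>2) \<longlonglongrightarrow> 0" by simp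
qed

lemma A_form_integrable:
  assumes s: "s \<in> step_space T" and \<phi>: "\<phi> \<in> H10_space \<Omega>"
  shows "integrable (MT T) (\<lambda>\<sigma>. dform (A \<sigma>) (s \<sigma>) \<phi>)"
proof (rule Bochner_Integration.integrable_bound)
  have \<phi>1: "\<phi> \<in> H1_space \<Omega>" using \<phi> by simp
  have s1: "s t \<in> H1_space \<Omega>" if "t \<in> {0<..T}" for t using step_spaceD(2)[OF s that] by simp
  show "integrable (MT T) (\<lambda>\<sigma>. M * H1_norm \<Omega> (s \<sigma>) * H1_norm \<Omega> \<phi>)"
    by (rule simple_integrable_MT[OF simple_function_compose1[OF step_spaceD(1)[OF s]]])
  show "AE \<sigma> in MT T. norm (dform (A \<sigma>) (s \<sigma>) \<phi>) \<le> norm (M * H1_norm \<Omega> (s \<sigma>) * H1_norm \<Omega> \<phi>)"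
    using AE_MT
  proof eventually_elim
    case (elim t)
    show ?case using dform_bound(2)[OF A_coeff[OF elim] s1[OF elim] \<phi>1] by (simp add: M_nonneg)
  qed
  show "(\<lambda>\<sigma>. dform (A \<sigma>) (s \<sigma>) \<phi>) \<in> borel_measurable (MT T)"
  proof (rule measurable_AE_limit[where f="\<lambda>j \<sigma>. dform (acoef (W j \<sigma>)) (s \<sigma>) \<phi>"])
    show "(\<lambda>\<sigma>. dform (acoef (W j \<sigma>)) (s \<sigma>) \<phi>) \<in> borel_measurable (MT T)" for j
      by (rule borel_measurable_simple_function[OF simple_function_compose2[OF Ws step_spaceD(1)[OF s]]])
    show "AE \<sigma> in MT T. (\<lambda>j. dform (acoef (W j \<sigma>)) (s \<sigma>) \<phi>) \<longlonglongrightarrow> dform (A \<sigma>) (s \<sigma>) \<phi>"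
      using AE_MT
    proof eventually_elim
      case (elim t)
      have "(\<lambda>j. coeff_dist (acoef (W j t)) (A t) \<phi> * H1_norm \<Omega> (s t)) \<longlonglongrightarrow> 0"
        by (rule tendsto_mult_left_zero[OF A_dist_tendsto[OF elim \<phi>1]])
      then have "(\<lambda>j. dform (acoef (W j t)) (s t) \<phi> - dform (A t) (s t) \<phi>) \<longlonglongrightarrow> 0"
        by (rule Lim_null_comparison[rotated])
          (use dform_coeff_dist[OF W_coeff[OF elim] A_coeff[OF elim] s1[OF elim] \<phi>1] in auto)
      then show ?case by (simp add: LIM_zero_iff)
    qed
  qed simp
qed

text \<open>Exchanging the lagged coefficient for its limit costs the coefficient distance at the
  fixed \<open>\<phi>\<close>, which tends to zero in L2 over time, times the norm of
  \<open>V n\<close> in V, for which boundedness is enough. What remains on the left is linear in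
  \<open>V n\<close>.\<close>

lemma frozen_path_limit:
  assumes \<phi>: "\<phi> \<in> H10_space \<Omega>" and t: "t \<in> {0<..T}"
  shows "(\<lambda>n. L2_inner \<Omega> (V n t) \<phi> + iint T (\<lambda>\<sigma>. dform (A \<sigma>) (V n \<sigma>) \<phi>) 0 t) \<longlonglongrightarrow>
    L2_inner \<Omega> u0 \<phi> + iint T (\<lambda>\<sigma>. f \<sigma> \<phi>) 0 t"
proof -
  interpret LT: semi_inner "L2_space {0<..<T}" "L2_inner {0<..<T}" by (rule L2_semi_inner)
  have \<phi>1: "\<phi> \<in> H1_space \<Omega>" using \<phi> by simp
  define h where "h n \<sigma> = coeff_dist (acoef (W n \<sigma>)) (A \<sigma>) \<phi>" for n \<sigma>
  define k where "k n \<sigma> = H1_norm \<Omega> (V n \<sigma>)" for n \<sigma>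
  have hL: "h n \<in> L2_space {0<..<T}" for n
    using A_dist_measurable[OF \<phi>1] A_dist_square(1)[OF \<phi>1] by (simp add: h_def[abs_def] L2_space_def)
  have kL: "k n \<in> L2_space {0<..<T}" for n
    using H1_norm_measurable[OF step_H1_integrable[OF V]] step_H1_integrable[OF V]
    by (simp add: k_def[abs_def] L2_space_def)
  have hk: "integrable (MT T) (\<lambda>\<sigma>. h n \<sigma> * k n \<sigma>)" for n by (rule L2_mult_integrable[OF hL kL])
  have nonneg: "0 \<le> h n \<sigma> * k n \<sigma>" if "\<sigma> \<in> {0<..T}" for n \<sigma>
    unfolding h_def k_def using coeff_dist_nonneg[OF W_coeff[OF that] A_coeff[OF that] \<phi>1] by simp
  have Wint: "integrable (MT T) (\<lambda>\<sigma>. dform (acoef (W n \<sigma>)) (V n \<sigma>) \<phi>)" for n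
    by (rule simple_integrable_MT[OF simple_function_compose2[OF Ws step_spaceD(1)[OF V]]])
  define b where "b n = sqrt (LINT \<sigma>|MT T. (h n \<sigma>)\<^sup>2)" for n
  have "(\<lambda>n. sqrt (LINT \<sigma>|MT T. (h n \<sigma>)\<^sup>2)) \<longlonglongrightarrow> sqrt 0"
    unfolding h_def by (intro tendsto_real_sqrt A_dist_square(2)[OF \<phi>1])
  then have b0: "b \<longlonglongrightarrow> 0" by (simp add: b_def[abs_def])
  have est: "\<bar>iint T (\<lambda>\<sigma>. dform (A \<sigma>) (V n \<sigma>) \<phi> - dform (acoef (W n \<sigma>)) (V n \<sigma>) \<phi>) 0 t\<bar> \<le> b n * C" for n
  proof -
    have "\<bar>iint T (\<lambda>\<sigma>. dform (A \<sigma>) (V n \<sigma>) \<phi> - dform (acoef (W n \<sigma>)) (V n \<sigma>) \<phi>) 0 t\<bar> \<le> iint T (\<lambda>\<sigma>. h n \<sigma> * k n \<sigma>) 0 t"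
    proof (rule iint_abs_le[OF Bochner_Integration.integrable_diff[OF A_form_integrable[OF V \<phi>] Wint] hk])
      show "AE \<sigma> in MT T. 0 < \<sigma> \<and> \<sigma> \<le> t \<longrightarrow> \<bar>dform (A \<sigma>) (V n \<sigma>) \<phi> - dform (acoef (W n \<sigma>)) (V n \<sigma>) \<phi>\<bar> \<le> h n \<sigma> * k n \<sigma>"
        using AE_MT
      proof eventually_elim
        case (elim \<sigma>)
        have "V n \<sigma> \<in> H1_space \<Omega>" using VH[OF elim] by simp
        from dform_coeff_dist[OF W_coeff[OF elim] A_coeff[OF elim] this \<phi>1, of n] show ?case
          by (simp add: h_def k_def abs_minus_commute)
      qed
    qed
    also have "\<dots> \<le> iint T (\<lambda>\<sigma>. h n \<sigma> * k n \<sigma>) 0 T"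
      by (rule iint_mono_interval[OF hk]) (use t nonneg in auto)
    also have "\<dots> = L2_inner {0<..<T} (h n) (k n)" by (simp add: iint_full L2_inner_def)
    also have "\<dots> \<le> LT.nrm (h n) * LT.nrm (k n)" using LT.Cauchy_Schwarz[OF hL kL, of n n] by linarith
    also have "LT.nrm (h n) = b n" by (simp add: LT.nrm_def L2_inner_def b_def power2_eq_square)
    also have "b n * LT.nrm (k n) \<le> b n * C"
    proof (rule mult_left_mono)
      have "L2_inner {0<..<T} (k n) (k n) \<le> C\<^sup>2" using VH1[of n] by (simp add: L2_inner_def k_def power2_eq_square)
      then show "LT.nrm (k n) \<le> C" unfolding LT.nrm_def using C by (simp add: real_le_lsqrt)
      show "0 \<le> b n" unfolding b_def by simp
    qed
    finally show ?thesis .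
  qed
  have "(\<lambda>n. (L2_inner \<Omega> (V n t) \<phi> + iint T (\<lambda>\<sigma>. dform (A \<sigma>) (V n \<sigma>) \<phi>) 0 t) -
      (L2_inner \<Omega> u0 \<phi> + iint T (\<lambda>\<sigma>. f \<sigma> \<phi>) 0 t)) \<longlonglongrightarrow> 0"
  proof (rule Lim_null_comparison[OF always_eventually[OF allI]])
    fix n
    show "norm ((L2_inner \<Omega> (V n t) \<phi> + iint T (\<lambda>\<sigma>. dform (A \<sigma>) (V n \<sigma>) \<phi>) 0 t) -
      (L2_inner \<Omega> u0 \<phi> + iint T (\<lambda>\<sigma>. f \<sigma> \<phi>) 0 t)) \<le> \<delta> n * C * H1_norm \<Omega> \<phi> + b n * C"
      using path[OF t \<phi>, of n] est[of n]
        iint_diff[OF A_form_integrable[OF V \<phi>] Wint, of n n 0 t] iint_diff[OF L2_V'_D(6)[OF f \<phi>] Wint, of n 0 t]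
      unfolding real_norm_def by linarith
    have "(\<lambda>n. \<delta> n * C * H1_norm \<Omega> \<phi> + b n * C) \<longlonglongrightarrow> 0 + 0 * C"
      by (intro tendsto_intros error_tendsto b0)
    then show "(\<lambda>n. \<delta> n * C * H1_norm \<Omega> \<phi> + b n * C) \<longlonglongrightarrow> 0" by simp
  qed
  then show ?thesis by (simp add: LIM_zero_iff)
qed

text \<open>Linear quantities keep their limits along the convex combinations \<open>y\<close>,
  whose strong limit \<open>u\<close> then both identifies the coefficient and passes through the
  flux. The resulting integrated equation is realized by a path \<open>w\<close> defined at all
  times, and \<open>solution_of_path\<close> concludes.\<close>

lemma limit_solution: "\<exists>u. is_solution \<Omega> T a g r f u0 u"
proof -
  obtain y u where y: "\<And>k. y k \<in> convex hull (V ` {k..})" and u: "u \<in> L2_V T \<Omega>"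
    and yu: "AE t in MT T. u t \<in> H10_space \<Omega> \<and> (\<lambda>k. H1_norm \<Omega> (y k t - u t)) \<longlonglongrightarrow> 0"
    and dm: "\<And>k. (\<lambda>t. H1_norm \<Omega> (y k t - u t)) \<in> borel_measurable (MT T)"
    and di: "\<And>k. integrable (MT T) (\<lambda>t. (H1_norm \<Omega> (y k t - u t))\<^sup>2)"
    and dl: "\<And>k. (LINT t|MT T. (H1_norm \<Omega> (y k t - u t))\<^sup>2) \<le> (1/8)^k"
    by (rule strong_convex_limit[OF V VH1 C], rule that)
  interpret S: semi_inner "step_space T" "step_inner T" by (rule step_semi_inner)
  have yX: "y k \<in> step_space T" for k by (rule S.hull_tail_mem[OF V y])
  have yV: "y k t \<in> H10_space \<Omega>" if "t \<in> {0<..T}" for k t by (rule step_spaceD(2)[OF yX that])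
  have yL: "y k t \<in> L2_space \<Omega>" if "t \<in> {0<..T}" for k t using yV[OF that] by simp
  \<comment> \<open>Evaluation at a fixed time is linear, so it maps the hull of the functions into
    the hull of their values.\<close>
  have yC: "L2_norm \<Omega> (y k t) \<le> C" if t: "t \<in> {0<..T}" for k t
  proof -
    have lin: "linear (\<lambda>s :: real \<Rightarrow> 'a \<Rightarrow> real. s t)" by (rule linearI) auto
    have "y k t \<in> (\<lambda>s. s t) ` (convex hull (V ` {k..}))" using y by (rule imageI)
    then have "y k t \<in> convex hull ((\<lambda>s. s t) ` V ` {k..})" unfolding convex_hull_linear_image[OF lin] .
    then show ?thesis by (rule L2.hull_bounded[rotated]) (use VH[OF t] VC[OF t] in auto)
  qed
  have strong: "AE t in MT T. t \<in> {0<..T} \<and> u t \<in> H10_space \<Omega> \<and> (\<lambda>k. L2_norm \<Omega> (y k t - u t)) \<longlonglongrightarrow> 0"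
    using yu AE_MT
  proof eventually_elim
    case (elim t)
    have "(\<lambda>k. L2_norm \<Omega> (y k t - u t)) \<longlonglongrightarrow> 0"
    proof (rule Lim_null_comparison[OF always_eventually[OF allI] conjunct2[OF elim(1)]])
      fix k
      have "y k t - u t \<in> H10_space \<Omega>" using yV elim by (intro G.V.mem_diff) auto
      then show "norm (L2_norm \<Omega> (y k t - u t)) \<le> H1_norm \<Omega> (y k t - u t)" using L2_le_H1[of "y k t - u t"] by simp
    qed
    then show ?case using elim by blast
  qed
  \<comment> \<open>At fixed \<open>t\<close> and \<open>x\<close> the nonlocal quantity is linear
    in the function: along \<open>y\<close> it tends to \<open>L t x\<close> as convex combinations
    do, and to its value at \<open>u t\<close> by strong convergence.\<close>
  have coeff: "AE t in MT T. A t = acoef (u t)"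
    using strong
  proof eventually_elim
    case (elim t)
    then have t: "t \<in> {0<..T}" and ut: "u t \<in> L2_space \<Omega>" and st: "(\<lambda>k. L2_norm \<Omega> (y k t - u t)) \<longlonglongrightarrow> 0" by auto
    have "L2_inner \<Omega> (gx x) (u t) = L t x" for x
    proof (rule LIMSEQ_unique)
      show "(\<lambda>k. L2_inner \<Omega> (gx x) (y k t)) \<longlonglongrightarrow> L2_inner \<Omega> (gx x) (u t)"
        using L2.tendsto_ip_left[OF st yL[OF t] ut gx_L2, of x] L2.sym[OF gx_L2 yL[OF t]] L2.sym[OF gx_L2 ut] by simp
      show "(\<lambda>k. L2_inner \<Omega> (gx x) (y k t)) \<longlonglongrightarrow> L t x"
      proof (rule S.convex_combination_limit[where xs=V and p="\<lambda>s. L2_inner \<Omega> (gx x) (s t)", OF V _ _ L[OF t] y])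
        show "L2_inner \<Omega> (gx x) ((s + s') t) = L2_inner \<Omega> (gx x) (s t) + L2_inner \<Omega> (gx x) (s' t)"
          if "s \<in> step_space T" "s' \<in> step_space T" for s s'
          using step_spaceD(2)[OF that(1) t] step_spaceD(2)[OF that(2) t] gx_L2 by (simp add: L2.add_right)
        show "L2_inner \<Omega> (gx x) ((c *\<^sub>R s) t) = c * L2_inner \<Omega> (gx x) (s t)" if "s \<in> step_space T" for c s
          using step_spaceD(2)[OF that t] gx_L2 by (simp add: L2.scale_right)
      qed
    qed
    then show ?case by (intro ext) (simp add: A_def acoef_def l_op_eq)
  qed
  have y_path: "(\<lambda>k. L2_inner \<Omega> (y k t) \<phi> + iint T (\<lambda>\<sigma>. dform (A \<sigma>) (y k \<sigma>) \<phi>) 0 t) \<longlonglongrightarrow>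
      L2_inner \<Omega> u0 \<phi> + iint T (\<lambda>\<sigma>. f \<sigma> \<phi>) 0 t" if t: "t \<in> {0<..T}" and \<phi>: "\<phi> \<in> H10_space \<Omega>" for t \<phi>
  proof (rule S.convex_combination_limit[where xs=V and p="\<lambda>s. L2_inner \<Omega> (s t) \<phi> + iint T (\<lambda>\<sigma>. dform (A \<sigma>) (s \<sigma>) \<phi>) 0 t",
      OF V _ _ frozen_path_limit[OF \<phi> t] y])
    show "L2_inner \<Omega> ((s + s') t) \<phi> + iint T (\<lambda>\<sigma>. dform (A \<sigma>) ((s + s') \<sigma>) \<phi>) 0 t =
        L2_inner \<Omega> (s t) \<phi> + iint T (\<lambda>\<sigma>. dform (A \<sigma>) (s \<sigma>) \<phi>) 0 t + (L2_inner \<Omega> (s' t) \<phi> + iint T (\<lambda>\<sigma>. dform (A \<sigma>) (s' \<sigma>) \<phi>) 0 t)"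
      if ss: "s \<in> step_space T" "s' \<in> step_space T" for s s'
    proof -
      note i = A_form_integrable[OF _ \<phi>]
      have "iint T (\<lambda>\<sigma>. dform (A \<sigma>) ((s + s') \<sigma>) \<phi>) 0 t = iint T (\<lambda>\<sigma>. dform (A \<sigma>) (s \<sigma>) \<phi> + dform (A \<sigma>) (s' \<sigma>) \<phi>) 0 t"
      proof (rule iint_cong_AE)
        show "AE \<sigma> in MT T. 0 < \<sigma> \<and> \<sigma> \<le> t \<longrightarrow> dform (A \<sigma>) ((s + s') \<sigma>) \<phi> = dform (A \<sigma>) (s \<sigma>) \<phi> + dform (A \<sigma>) (s' \<sigma>) \<phi>"
          using AE_MT
        proof eventually_elim
          case (elim \<sigma>)
          show ?case
            using dform_add_left[OF A_coeff[OF elim], of "s \<sigma>" "s' \<sigma>" \<phi>] step_spaceD(2)[OF ss(1) elim] step_spaceD(2)[OF ss(2) elim] \<phi>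
            by simp
        qed
      qed (use i[OF S.mem_add[OF ss]] i[OF ss(1)] i[OF ss(2)] in auto)
      moreover have "L2_inner \<Omega> ((s + s') t) \<phi> = L2_inner \<Omega> (s t) \<phi> + L2_inner \<Omega> (s' t) \<phi>"
        using step_spaceD(2)[OF ss(1) t] step_spaceD(2)[OF ss(2) t] \<phi> by (simp add: L2.add_left)
      ultimately show ?thesis using iint_add[OF i[OF ss(1)] i[OF ss(2)]] by simp
    qed
    show "L2_inner \<Omega> ((c *\<^sub>R s) t) \<phi> + iint T (\<lambda>\<sigma>. dform (A \<sigma>) ((c *\<^sub>R s) \<sigma>) \<phi>) 0 t =
        c * (L2_inner \<Omega> (s t) \<phi> + iint T (\<lambda>\<sigma>. dform (A \<sigma>) (s \<sigma>) \<phi>) 0 t)"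
      if s: "s \<in> step_space T" for c s
    proof -
      note i = A_form_integrable[OF _ \<phi>]
      have "iint T (\<lambda>\<sigma>. dform (A \<sigma>) ((c *\<^sub>R s) \<sigma>) \<phi>) 0 t = iint T (\<lambda>\<sigma>. c * dform (A \<sigma>) (s \<sigma>) \<phi>) 0 t"
      proof (rule iint_cong_AE)
        show "AE \<sigma> in MT T. 0 < \<sigma> \<and> \<sigma> \<le> t \<longrightarrow> dform (A \<sigma>) ((c *\<^sub>R s) \<sigma>) \<phi> = c * dform (A \<sigma>) (s \<sigma>) \<phi>"
          using AE_MT
        proof eventually_elim
          case (elim \<sigma>)
          show ?case using dform_scale_left[OF A_coeff[OF elim], of "s \<sigma>" \<phi> c] step_spaceD(2)[OF s elim] \<phi> by simp
        qed
      qed (use i[OF S.mem_scale[OF s]] i[OF s] in auto)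
      moreover have "L2_inner \<Omega> ((c *\<^sub>R s) t) \<phi> = c * L2_inner \<Omega> (s t) \<phi>"
        using step_spaceD(2)[OF s t] \<phi> by (simp add: L2.scale_left)
      ultimately show ?thesis by (simp add: iint_cmult distrib_left)
    qed
  qed
  have flux_int: "integrable (MT T) (\<lambda>\<sigma>. dform (acoef (u \<sigma>)) (u \<sigma>) \<phi>)" if "\<phi> \<in> H10_space \<Omega>" for \<phi>
    by (rule L2_V'_D(6)[OF flux_L2_V'[OF u] that])
  have flux_lim: "(\<lambda>k. iint T (\<lambda>\<sigma>. dform (A \<sigma>) (y k \<sigma>) \<phi>) 0 t) \<longlonglongrightarrow> iint T (\<lambda>\<sigma>. dform (acoef (u \<sigma>)) (u \<sigma>) \<phi>) 0 t"
    if t: "t \<in> {0<..T}" and \<phi>: "\<phi> \<in> H10_space \<Omega>" for t \<phi>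
  proof -
    have "(\<lambda>k. iint T (\<lambda>\<sigma>. dform (A \<sigma>) (y k \<sigma>) \<phi>) 0 t - iint T (\<lambda>\<sigma>. dform (acoef (u \<sigma>)) (u \<sigma>) \<phi>) 0 t) \<longlonglongrightarrow> 0"
    proof (rule Lim_null_comparison[OF always_eventually[OF allI]])
      fix k
      have "\<bar>iint T (\<lambda>\<sigma>. dform (A \<sigma>) (y k \<sigma>) \<phi> - dform (acoef (u \<sigma>)) (u \<sigma>) \<phi>) 0 t\<bar> \<le>
          iint T (\<lambda>\<sigma>. (M * H1_norm \<Omega> \<phi>) * H1_norm \<Omega> (y k \<sigma> - u \<sigma>)) 0 t"
      proof (rule iint_abs_le[OF Bochner_Integration.integrable_diff[OF A_form_integrable[OF yX \<phi>] flux_int[OF \<phi>]]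
            integrable_mult_right[OF integrable_of_square[OF dm di]]])
        show "AE \<sigma> in MT T. 0 < \<sigma> \<and> \<sigma> \<le> t \<longrightarrow>
            \<bar>dform (A \<sigma>) (y k \<sigma>) \<phi> - dform (acoef (u \<sigma>)) (u \<sigma>) \<phi>\<bar> \<le> (M * H1_norm \<Omega> \<phi>) * H1_norm \<Omega> (y k \<sigma> - u \<sigma>)"
          using strong coeff
        proof eventually_elim
          case (elim \<sigma>)
          have H: "y k \<sigma> \<in> H1_space \<Omega>" "u \<sigma> \<in> H1_space \<Omega>" "\<phi> \<in> H1_space \<Omega>" using elim yV[of \<sigma> k] \<phi> by auto
          have c: "coeff_fun M (acoef (u \<sigma>))" using elim by (intro acoef) auto
          show ?case
            using dform_bound(2)[OF c H1.mem_diff[OF H(1,2)] H(3)] dform_diff_left[OF c H] elim(2)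
            by (simp add: mult_ac)
        qed
      qed
      also have "\<dots> = (M * H1_norm \<Omega> \<phi>) * iint T (\<lambda>\<sigma>. H1_norm \<Omega> (y k \<sigma> - u \<sigma>)) 0 t" by (rule iint_cmult)
      also have "\<dots> \<le> (M * H1_norm \<Omega> \<phi>) * (sqrt (t - 0) * sqrt ((1/8)^k))"
        using dl[of k] t by (intro mult_left_mono iint_Cauchy_Schwarz[OF dm di]) (auto simp: M_nonneg)
      finally show "norm (iint T (\<lambda>\<sigma>. dform (A \<sigma>) (y k \<sigma>) \<phi>) 0 t - iint T (\<lambda>\<sigma>. dform (acoef (u \<sigma>)) (u \<sigma>) \<phi>) 0 t) \<le>
          (M * H1_norm \<Omega> \<phi>) * (sqrt t * sqrt ((1/8)^k))"
        using iint_diff[OF A_form_integrable[OF yX \<phi>] flux_int[OF \<phi>], of k 0 t] by simp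
      have "(\<lambda>k. (1/8::real)^k) \<longlonglongrightarrow> 0" by (rule LIMSEQ_realpow_zero) auto
      then have "(\<lambda>k. (M * H1_norm \<Omega> \<phi>) * (sqrt t * sqrt ((1/8)^k))) \<longlonglongrightarrow> (M * H1_norm \<Omega> \<phi>) * (sqrt t * sqrt 0)"
        by (intro tendsto_mult tendsto_const tendsto_real_sqrt)
      then show "(\<lambda>k. (M * H1_norm \<Omega> \<phi>) * (sqrt t * sqrt ((1/8)^k))) \<longlonglongrightarrow> 0" by simp
    qed
    then show ?thesis by (simp add: LIM_zero_iff)
  qed
  define \<Lambda> where "\<Lambda> t \<phi> = L2_inner \<Omega> u0 \<phi> + iint T (\<lambda>\<sigma>. rhs f u \<sigma> \<phi>) 0 t" for t \<phi>
  have \<Lambda>: "(\<lambda>k. L2_inner \<Omega> (y k t) \<phi>) \<longlonglongrightarrow> \<Lambda> t \<phi>" if t: "t \<in> {0<..T}" and \<phi>: "\<phi> \<in> H10_space \<Omega>" for t \<phi>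
    using tendsto_diff[OF y_path[OF t \<phi>] flux_lim[OF t \<phi>]] iint_diff[OF L2_V'_D(6)[OF f \<phi>] flux_int[OF \<phi>], of 0 t]
    by (simp add: \<Lambda>_def rhs_def add_diff_eq)
  \<comment> \<open>Strong convergence to \<open>u\<close> says nothing at the exceptional times;
    the bound \<open>yC\<close> holds at every positive time and provides a weak limit
    there.\<close>
  have "\<exists>x. x \<in> L2_space \<Omega> \<and> (\<forall>\<phi>\<in>H10_space \<Omega>. L2_inner \<Omega> x \<phi> = \<Lambda> t \<phi>)" if t: "t \<in> {0..T}" for t
  proof (cases "t = 0")
    case True
    then show ?thesis using u0 by (intro exI[of _ u0]) (simp add: \<Lambda>_def)
  next
    case False
    then have t': "t \<in> {0<..T}" using t by auto
    obtain x where x: "x \<in> L2_space \<Omega>" "\<And>\<phi> l. \<lbrakk>\<phi> \<in> L2_space \<Omega>; (\<lambda>k. L2_inner \<Omega> (y k t) \<phi>) \<longlonglongrightarrow> l\<rbrakk> \<Longrightarrow> L2_inner \<Omega> x \<phi> = l"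
      by (rule L2.weak_limit[of "\<lambda>k. y k t", OF yL[OF t'] yC[OF t']], rule that)
    have "L2_inner \<Omega> x \<phi> = \<Lambda> t \<phi>" if "\<phi> \<in> H10_space \<Omega>" for \<phi>
      by (rule x(2)[OF _ \<Lambda>[OF t' that]]) (use that in simp)
    with x(1) show ?thesis by blast
  qed
  then obtain w' where w': "\<And>t. t \<in> {0..T} \<Longrightarrow> w' t \<in> L2_space \<Omega>"
    "\<And>t \<phi>. \<lbrakk>t \<in> {0..T}; \<phi> \<in> H10_space \<Omega>\<rbrakk> \<Longrightarrow> L2_inner \<Omega> (w' t) \<phi> = \<Lambda> t \<phi>"
    by metis
  \<comment> \<open>The pairings determine the value at time 0 only up to a null function;
    \<open>u0\<close> itself is selected.\<close>
  define w where "w t = (if t = 0 then u0 else w' t)" for t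
  have wL: "w t \<in> L2_space \<Omega>" if "t \<in> {0..T}" for t using w'(1)[OF that] u0 by (simp add: w_def)
  have w\<Lambda>: "L2_inner \<Omega> (w t) \<phi> = \<Lambda> t \<phi>" if "t \<in> {0..T}" "\<phi> \<in> H10_space \<Omega>" for t \<phi>
    using w'(2)[OF that] by (simp add: w_def \<Lambda>_def)
  have "is_solution \<Omega> T a g r f u0 u"
  proof (rule solution_of_path[OF T f u wL])
    show "AE t in MT T. AE x in M\<Omega>. w t x = u t x"
      using strong
    proof eventually_elim
      case (elim t)
      then have t: "t \<in> {0<..T}" "t \<in> {0..T}" and ut: "u t \<in> L2_space \<Omega>"
        and st: "(\<lambda>k. L2_norm \<Omega> (y k t - u t)) \<longlonglongrightarrow> 0" by auto
      have d: "w t - u t \<in> L2_space \<Omega>" by (rule L2.mem_diff[OF wL[OF t(2)] ut])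
      have "L2_inner \<Omega> (w t - u t) \<phi> = 0" if \<phi>: "\<phi> \<in> H10_space \<Omega>" for \<phi>
      proof -
        have \<phi>L: "\<phi> \<in> L2_space \<Omega>" using \<phi> by simp
        have "L2_inner \<Omega> (u t) \<phi> = \<Lambda> t \<phi>"
          by (rule LIMSEQ_unique[OF L2.tendsto_ip_left[OF st yL[OF t(1)] ut \<phi>L] \<Lambda>[OF t(1) \<phi>]])
        then show ?thesis using L2.diff_left[OF wL[OF t(2)] ut \<phi>L] w\<Lambda>[OF t(2) \<phi>] by simp
      qed
      then have "AE x in M\<Omega>. (w t - u t) x = 0" using G.separating[OF d] L2_null_iff[OF d] by blast
      then show ?case by eventually_elim simp
    qed
    show "AE x in M\<Omega>. w 0 x = u0 x" by (simp add: w_def)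
    show "L2_inner \<Omega> (w t - w s) \<phi> = iint T (\<lambda>\<sigma>. rhs f u \<sigma> \<phi>) s t"
      if st: "0 \<le> s" "s \<le> t" "t \<le> T" and \<phi>: "\<phi> \<in> H10_space \<Omega>" for s t \<phi>
    proof -
      have mem: "s \<in> {0..T}" "t \<in> {0..T}" and \<phi>L: "\<phi> \<in> L2_space \<Omega>" using st \<phi> by auto
      have "iint T (\<lambda>\<sigma>. rhs f u \<sigma> \<phi>) 0 t = iint T (\<lambda>\<sigma>. rhs f u \<sigma> \<phi>) 0 s + iint T (\<lambda>\<sigma>. rhs f u \<sigma> \<phi>) s t"
        by (rule iint_split[OF L2_V'_D(6)[OF rhs_L2_V'[OF f u] \<phi>] st(1,2)])
      then show ?thesis
        using L2.diff_left[OF wL[OF mem(2)] wL[OF mem(1)] \<phi>L] w\<Lambda>[OF mem(1) \<phi>] w\<Lambda>[OF mem(2) \<phi>] by (simp add: \<Lambda>_def)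
    qed
  qed
  then show ?thesis by blast
qed

end

text \<open>The subsequence is chosen for the scalar products with \<open>gx x\<close> as functions
  of the pair (t, x); this is the only compactness that the nonlinearity calls for.\<close>

theorem existence:
  assumes T: "T > 0" and f: "f \<in> L2_V' T \<Omega>" and u0: "u0 \<in> L2_space \<Omega>"
  shows "\<exists>u. is_solution \<Omega> T a g r f u0 u"
proof -
  obtain C V W \<delta> where C: "0 \<le> C" and \<delta>: "\<delta> \<longlonglongrightarrow> 0" "\<And>n. 0 \<le> \<delta> n"
    and simple: "\<And>n. simple_function (MT T) (V n)" "\<And>n. simple_function (MT T) (W n)"
    and mem: "\<And>n t. t \<in> {0<..T} \<Longrightarrow> V n t \<in> H10_space \<Omega>" "\<And>n t. t \<in> {0<..T} \<Longrightarrow> W n t \<in> L2_space \<Omega>"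
    and bd: "\<And>n t. t \<in> {0<..T} \<Longrightarrow> L2_norm \<Omega> (V n t) \<le> C" "\<And>n t. t \<in> {0<..T} \<Longrightarrow> L2_norm \<Omega> (W n t) \<le> C"
    and VH1: "\<And>n. (LINT t|MT T. (H1_norm \<Omega> (V n t))\<^sup>2) \<le> C\<^sup>2"
    and path: "\<And>n t \<phi>. \<lbrakk>t \<in> {0<..T}; \<phi> \<in> H10_space \<Omega>\<rbrakk> \<Longrightarrow>
      \<bar>L2_inner \<Omega> (V n t) \<phi> - L2_inner \<Omega> u0 \<phi> - iint T (\<lambda>\<sigma>. f \<sigma> \<phi> - dform (acoef (W n \<sigma>)) (V n \<sigma>) \<phi>) 0 t\<bar> \<le> \<delta> n * C * H1_norm \<Omega> \<phi>"
    and VW: "\<And>n t \<phi>. \<lbrakk>t \<in> {0<..T}; \<phi> \<in> H10_space \<Omega>\<rbrakk> \<Longrightarrow> \<bar>L2_inner \<Omega> (V n t - W n t) \<phi>\<bar> \<le> \<delta> n * C * H1_norm \<Omega> \<phi>"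
    and mod: "\<And>n s t \<phi>. \<lbrakk>s \<in> {0<..T}; t \<in> {0<..T}; \<phi> \<in> H10_space \<Omega>\<rbrakk> \<Longrightarrow>
      \<bar>L2_inner \<Omega> (V n t) \<phi> - L2_inner \<Omega> (V n s) \<phi>\<bar> \<le> (2 * \<delta> n + sqrt \<bar>t - s\<bar>) * C * H1_norm \<Omega> \<phi>"
    by (rule rothe_approximation[OF T f u0], rule that)
  have VL: "V n t \<in> L2_space \<Omega>" if "t \<in> {0<..T}" for n t using mem(1)[OF that] by simp
  obtain \<rho> where \<rho>: "strict_mono (\<rho> :: nat \<Rightarrow> nat)"
    and conv: "\<And>z. z \<in> {0<..T} \<times> UNIV \<Longrightarrow> convergent (\<lambda>n. L2_inner \<Omega> (gx (snd z)) (V (\<rho> n) (fst z)))"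
  proof (rule asymptotic_equicontinuous_subsequence[where F="\<lambda>n z. L2_inner \<Omega> (gx (snd z)) (V n (fst z))" and Z="{0<..T} \<times> UNIV"])
    show "\<bar>L2_inner \<Omega> (gx (snd z)) (V n (fst z))\<bar> \<le> L2_norm \<Omega> g * C" if "z \<in> {0<..T} \<times> UNIV" for n z
    proof -
      have t: "fst z \<in> {0<..T}" using that by auto
      have "\<bar>L2_inner \<Omega> (gx (snd z)) (V n (fst z))\<bar> \<le> L2_norm \<Omega> (gx (snd z)) * L2_norm \<Omega> (V n (fst z))"
        by (rule L2.Cauchy_Schwarz[OF gx_L2 VL[OF t]])
      also have "\<dots> \<le> L2_norm \<Omega> g * C"
        by (rule mult_mono[OF gx_norm bd(1)[OF t]]) (use g VL[OF t] in auto)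
      finally show ?thesis .
    qed
    show "\<exists>d>0. \<exists>N. \<forall>n\<ge>N. \<forall>z'\<in>{0<..T} \<times> UNIV. dist z' z < d \<longrightarrow>
        \<bar>L2_inner \<Omega> (gx (snd z')) (V n (fst z')) - L2_inner \<Omega> (gx (snd z)) (V n (fst z))\<bar> < e"
      if z: "z \<in> {0<..T} \<times> UNIV" and e: "e > 0" for z e
    proof -
      have t: "fst z \<in> {0<..T}" using z by auto
      show ?thesis
        using nonlocal_equicontinuous[of "{0<..T}" V C \<delta> e "fst z" "snd z", OF VL bd(1) \<delta>(1) mod C e t] by simp
    qed
  qed (rule that)
  define L where "L t x = lim (\<lambda>n. L2_inner \<Omega> (gx x) (V (\<rho> n) t))" for t x
  have L: "(\<lambda>n. L2_inner \<Omega> (gx x) (V (\<rho> n) t)) \<longlonglongrightarrow> L t x" if "t \<in> {0<..T}" for t x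
    using conv[of "(t, x)"] that by (simp add: L_def convergent_LIMSEQ_iff)
  have \<delta>\<rho>: "(\<lambda>n. \<delta> (\<rho> n)) \<longlonglongrightarrow> 0" using LIMSEQ_subseq_LIMSEQ[OF \<delta>(1) \<rho>] by (simp add: comp_def)
  show ?thesis
    by (rule limit_solution[where V="\<lambda>n. V (\<rho> n)" and W="\<lambda>n. W (\<rho> n)" and \<delta>="\<lambda>n. \<delta> (\<rho> n)" and L=L,
          OF T f u0 C \<delta>\<rho> _ simple(2) mem(2) bd VH1 path VW L])
      (use simple(1) mem(1) in \<open>auto simp: step_space_def\<close>)
qed

end

theorem theorem2p1:
  fixes \<Omega> :: "(real ^ 'n) set"
    and g u0 :: "real ^ 'n \<Rightarrow> real"
    and T m M :: real
    and f :: "real \<Rightarrow> (real ^ 'n \<Rightarrow> real) \<Rightarrow> real"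
    and a :: "real \<Rightarrow> real"
  assumes "open \<Omega>" and "bounded \<Omega>"
    and "g \<in> L2_space \<Omega>"
    and "T > 0"
    and "f \<in> L2_V' T \<Omega>"
    and "u0 \<in> L2_space \<Omega>"
    and "continuous_on UNIV a"
    and "0 < m" and "\<And>\<epsilon>. m \<le> a \<epsilon> \<and> a \<epsilon> \<le> M"
  shows "\<forall>r\<in>{0..diameter \<Omega>}.
     (\<exists>u. is_solution \<Omega> T a g r f u0 u) \<and>
     ((\<forall>c. \<exists>\<gamma>. \<forall>\<epsilon>\<in>{-c..c}. \<forall>\<epsilon>'\<in>{-c..c}. \<bar>a \<epsilon> - a \<epsilon>'\<bar> \<le> \<gamma> * \<bar>\<epsilon> - \<epsilon>'\<bar>) \<longrightarrow>
      (\<forall>u v. is_solution \<Omega> T a g r f u0 u \<and> is_solution \<Omega> T a g r f u0 v \<longrightarrow>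
         (AE t in lebesgue_on {0<..<T}. AE x in lebesgue_on \<Omega>. u t x = v t x)))"
proof
  fix r :: real
  interpret nonlocal \<Omega> g a r m M
    by (intro nonlocal.intro bounded_domain.intro nonlocal_axioms.intro assms)
  show "(\<exists>u. is_solution \<Omega> T a g r f u0 u) \<and>
     ((\<forall>c. \<exists>\<gamma>. \<forall>\<epsilon>\<in>{-c..c}. \<forall>\<epsilon>'\<in>{-c..c}. \<bar>a \<epsilon> - a \<epsilon>'\<bar> \<le> \<gamma> * \<bar>\<epsilon> - \<epsilon>'\<bar>) \<longrightarrow>
      (\<forall>u v. is_solution \<Omega> T a g r f u0 u \<and> is_solution \<Omega> T a g r f u0 v \<longrightarrow>
         (AE t in lebesgue_on {0<..<T}. AE x in lebesgue_on \<Omega>. u t x = v t x)))"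
  proof (intro conjI impI allI)
    show "\<exists>u. is_solution \<Omega> T a g r f u0 u" by (rule existence[OF assms(4-6)])
    fix u v
    assume "\<forall>c. \<exists>\<gamma>. \<forall>\<epsilon>\<in>{-c..c}. \<forall>\<epsilon>'\<in>{-c..c}. \<bar>a \<epsilon> - a \<epsilon>'\<bar> \<le> \<gamma> * \<bar>\<epsilon> - \<epsilon>'\<bar>"
      and "is_solution \<Omega> T a g r f u0 u \<and> is_solution \<Omega> T a g r f u0 v"
    then show "AE t in lebesgue_on {0<..<T}. AE x in lebesgue_on \<Omega>. u t x = v t x"
      using uniqueness[OF assms(4,5)] by blast
  qed
qed

end
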